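(* Suppose that: (1) $((\varepsilon_nB,\hat B^n))_{n\in\mathbb{N}}$ satisfies an LDP on $C_0^p\times C_0^p$ with speed $\varepsilon_n^{-2}$ and good rate function $I_{(B,\hat B)}$; (2) $\mu_i,\sigma_{ij}:\mathbb{R}^p\to\mathbb{R}$ are continuous ($1\le i,j\le d$) and $\det(a(y))\ne0$ for every $y\in\mathbb{R}^p$, where $a=\sigma\sigma^T$; (3) $\tilde\sigma_{i\ell}:\mathbb{R}^p\to\mathbb{R}$ are locally $\omega$-continuous for $1\le i\le d$, $1\le\ell\le p$; (4) there are constants $\alpha,M_1,M_2>0$ such that $|\tilde\sigma_{i\ell}(x)|+|\sigma_{ij}(x)|+|\mu_i(x)|\le M_1+M_2\|x\|^\alpha$ for all $x\in\mathbb{R}^p$, $1\le i,j\le d$, $1\le\ell\le p$. Let $Z^n=(Z^n_1,\dots,Z^n_d)$ be given, for $1\le i\le d$, $0\le t\le T$, by $$Z_i^n(t)=\int_0^t\Big(\mu_i(\hat B^n(s))-\tfrac12\varepsilon_n^2\sum_{j=1}^d\sigma_{ij}(\hat B^n(s))^2-\tfrac12\varepsilon_n^2\sum_{\ell=1}^p\tilde\sigma_{i\ell}(\hat B^n(s))^2\Big)ds+\varepsilon_n\int_0^t\sum_{\ell=1}^p\tilde\sigma_{i\ell}(\hat B^n(s))\,dB_\ell(s)+\varepsilon_n\int_0^t\sum_{j=1}^d\sigma_{ij}(\hat B^n(s))\,dW_j(s).$$ Then the family of random variables $(Z^n(T))_{n\in\mathbb{N}}$ satisfies an LDP on $\mathbb{R}^d$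 with speed $\varepsilon_n^{-2}$ and good rate function $$I_T(z)=\inf_{f\in H_0^{1,p}}\Big\{\tfrac12\|f\|_{H_0^{1,p}}^2+\tfrac12\big(z-\Phi(f,\hat f)(T)-M_{\hat f}\big)^TA_{\hat f}^{-1}\big(z-\Phi(f,\hat f)(T)-M_{\hat f}\big)\Big\},\qquad z\in\mathbb{R}^d,$$ where $A_{\hat f}\in\mathbb{R}^{d\times d}$ has entries $(A_{\hat f})_{ij}=\int_0^Ta_{ij}(\hat f(t))\,dt$, $M_{\hat f}\in\mathbb{R}^d$ has components $(M_{\hat f})_i=\int_0^T\mu_i(\hat f(t))\,dt$, and $\Phi_i(f,\hat f)(t)=\sum_{\ell=1}^p\int_0^t\tilde\sigma_{i\ell}(\hat f(s))\dot f_\ell(s)\,ds$ for $1\le i\le d$.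
   Context: Fix $T>0$ and integers $d,p\ge1$. $C^k$ is the space of continuous functions $[0,T]\to\mathbb{R}^k$ with the norm $\|f\|_\infty=\sup_{0\le t\le T}\|f(t)\|$ ($\|\cdot\|$ Euclidean); $C_0^k$ is the subspace of functions starting at $0$. $H_0^{1,k}$ is the Cameron–Martin space of absolutely continuous $f:[0,T]\to\mathbb{R}^k$ with $f(0)=0$ and $\|f\|_{H_0^{1,k}}^2=\int_0^T\|\dot f(s)\|^2ds<\infty$. A rate function is a lower semicontinuous map $I:E\to[0,+\infty]$; it is good if all sets $\{I\le a\}$, $a\ge0$, are compact. A family of $E$-valued random variables (with laws $\eta_n$) satisfies an LDP with speed $\gamma_n\to+\infty$ and rate function $I$ if $\liminf_n\gamma_n^{-1}\log\eta_n(\Theta)\ge-\inf_\Theta I$ for all open $\Theta$ and $\limsup_n\gamma_n^{-1}\log\eta_n(\Gamma)\le-\inf_\Gamma I$ for all closed $\Gamma$. A Volterra kernel is a measurable square-integrable $K:[0,T]^2\to\mathbb{R}$ with $\sup_{t}\int_0^TK(t,s)^2ds<\infty$ such that (a) $K(0,0)=0$ and $K(t,s)=0$ for $0\le t<s\le T$; (b) there are $c,\alpha>0$ with $\sup_{|t_1-t_2|\le\delta}\int_0^T|K(t_1,s)-K(t_2,s)|^2ds\le c\,\delta^\alpha$ for all $\delta\in[0,T]$. $(\varepsilon_n)$ is a sequence of positive numbers with $\varepsilon_n\to0$; $B$ is a standard $p$-dimensional Brownian motion and $W$ a standard $d$-dimensional Brownian motion independent of $B$. For each $n$, $\hat B^n=(\hat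 B^n_1,\dots,\hat B^n_p)$ is the continuous process $\hat B^n_\ell(t)=\int_0^TK^n_\ell(t,s)\,dB_\ell(s)$ with $K^n_\ell$ Volterra kernels, and there are Volterra kernels $K_\ell$ with $\lim_{n}K^n_\ell(t,s)/\varepsilon_n=K_\ell(t,s)$, $\ell=1,\dots,p$. For $f\in H_0^{1,p}$, $\hat f=(\hat f_1,\dots,\hat f_p)$ with $\hat f_\ell(t)=\int_0^tK_\ell(t,u)\dot f_\ell(u)\,du$. The function $I_{(B,\hat B)}$ on $C_0^p\times C_0^p$ is $I_{(B,\hat B)}(f,g)=\frac12\int_0^T\|\dot f(s)\|^2ds$ if $f\in H_0^{1,p}$ and $g=\hat f$, and $+\infty$ otherwise. $\mu=(\mu_i)$ is $\mathbb{R}^d$-valued, $\sigma=(\sigma_{ij})$ is $\mathbb{R}^{d\times d}$-valued, $\tilde\sigma=(\tilde\sigma_{i\ell})$ is $\mathbb{R}^{d\times p}$-valued. A function $h:\mathbb{R}^p\to\mathbb{R}$ is locally $\omega$-continuous if, for a modulus of continuity $\omega$ (an increasing function $\omega:[0,\infty)\to[0,\infty)$ with $\omega(0)=0$ and $\lim_{r\to0}\omega(r)=0$), for every $\delta>0$ there is $L(\delta)>0$ with $|h(x)-h(y)|\le L(\delta)\,\omega(\|x-y\|)$ for all $\|x\|,\|y\|\le\delta$. *)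

theory Defs
  imports "HOL-Probability.Probability"
begin

section \<open>Path spaces\<close>

text \<open>The library space \<open>cfunspace\<close> of bounded continuous maps carries the supremum metric; its
  elements are extensional, i.e. \<open>undefined\<close> outside \<open>[0,T]\<close>.\<close>

definition C_space :: "real \<Rightarrow> (real \<Rightarrow> real^'k) metric" where
  "C_space T = cfunspace (top_of_set {0..T}) euclidean_metric"

definition C0_space :: "real \<Rightarrow> (real \<Rightarrow> real^'k) metric" where
  "C0_space T = submetric (C_space T) {f. f 0 = 0}"

definition trajectory :: "real \<Rightarrow> (real \<Rightarrow> 'w \<Rightarrow> 'b) \<Rightarrow> 'w \<Rightarrow> real \<Rightarrow> 'b" where
  "trajectory T X \<omega> = (\<lambda>t\<in>{0..T}. X t \<omega>)"

definition abs_continuous_on_interval :: "real \<Rightarrow> real \<Rightarrow> (real \<Rightarrow> 'b::real_normed_vector) \<Rightarrow> bool" where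
  "abs_continuous_on_interval a b f \<longleftrightarrow>
    (\<forall>e>0. \<exists>\<delta>>0. \<forall>(m::nat) u v.
       (\<forall>i<m. a \<le> u i \<and> u i \<le> v i \<and> v i \<le> b) \<longrightarrow>
       disjoint_family_on (\<lambda>i. {u i<..<v i}) {..<m} \<longrightarrow>
       (\<Sum>i<m. v i - u i) < \<delta> \<longrightarrow>
       (\<Sum>i<m. norm (f (v i) - f (u i))) < e)"

text \<open>The a.e. derivative on \<open>[0,T]\<close>. Where \<open>f\<close> is not differentiable the value is an arbitrary
  constant; for absolutely continuous \<open>f\<close> this happens on a Lebesgue null set only. Integrals of
  the derivative are therefore taken with respect to \<open>lebesgue\<close>.\<close>

definition dot :: "real \<Rightarrow> (real \<Rightarrow> real^'k) \<Rightarrow> real \<Rightarrow> real^'k" where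
  "dot T f s = vector_derivative f (at s within {0..T})"

definition cameron_martin :: "real \<Rightarrow> (real \<Rightarrow> real^'k) set" where
  "cameron_martin T = {f \<in> mspace (C0_space T). abs_continuous_on_interval 0 T f \<and>
     set_integrable lebesgue {0..T} (\<lambda>s. (norm (dot T f s))\<^sup>2)}"

definition cm_norm_sq :: "real \<Rightarrow> (real \<Rightarrow> real^'k) \<Rightarrow> real" where
  "cm_norm_sq T f = (LINT s:{0..T}|lebesgue. (norm (dot T f s))\<^sup>2)"


section \<open>Large deviations\<close>

definition rate_function :: "'e topology \<Rightarrow> ('e \<Rightarrow> ereal) \<Rightarrow> bool" where
  "rate_function X I \<longleftrightarrow> (\<forall>x\<in>topspace X. 0 \<le> I x) \<and>
     (\<forall>a. openin X {x\<in>topspace X. a < I x})"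

definition good_rate_function :: "'e topology \<Rightarrow> ('e \<Rightarrow> ereal) \<Rightarrow> bool" where
  "good_rate_function X I \<longleftrightarrow> rate_function X I \<and>
     (\<forall>a::real. 0 \<le> a \<longrightarrow> compactin X {x\<in>topspace X. I x \<le> ereal a})"

text \<open>The real-valued \<open>ln\<close> has \<open>ln 0 = 0\<close>; here the logarithm of 0 must be \<open>-\<infinity>\<close>.\<close>

definition eln :: "real \<Rightarrow> ereal" where
  "eln x = (if x = 0 then -\<infinity> else ereal (ln x))"

definition LDP :: "'e topology \<Rightarrow> (nat \<Rightarrow> real) \<Rightarrow> ('e \<Rightarrow> ereal) \<Rightarrow> (nat \<Rightarrow> 'e measure) \<Rightarrow> bool" where
  "LDP X \<gamma> I \<eta> \<longleftrightarrow> filterlim \<gamma> at_top sequentially \<and> rate_function X I \<and>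
     (\<forall>\<Theta>. openin X \<Theta> \<longrightarrow>
        liminf (\<lambda>n. ereal (1 / \<gamma> n) * eln (measure (\<eta> n) \<Theta>)) \<ge> - (INF x\<in>\<Theta>. I x)) \<and>
     (\<forall>\<Gamma>. closedin X \<Gamma> \<longrightarrow>
        limsup (\<lambda>n. ereal (1 / \<gamma> n) * eln (measure (\<eta> n) \<Gamma>)) \<le> - (INF x\<in>\<Gamma>. I x))"

definition borel_of_top :: "'e topology \<Rightarrow> 'e measure" where
  "borel_of_top X = sigma (topspace X) {U. openin X U}"

definition satisfies_LDP ::
  "'w measure \<Rightarrow> 'e topology \<Rightarrow> (nat \<Rightarrow> real) \<Rightarrow> ('e \<Rightarrow> ereal) \<Rightarrow> (nat \<Rightarrow> 'w \<Rightarrow> 'e) \<Rightarrow> bool" where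
  "satisfies_LDP M X \<gamma> I \<xi> \<longleftrightarrow> (\<forall>n. \<xi> n \<in> M \<rightarrow>\<^sub>M borel_of_top X) \<and>
     LDP X \<gamma> I (\<lambda>n. distr M (borel_of_top X) (\<xi> n))"


section \<open>Brownian motion\<close>

definition brownian_motion1 :: "'w measure \<Rightarrow> real \<Rightarrow> (real \<Rightarrow> 'w \<Rightarrow> real) \<Rightarrow> bool" where
  "brownian_motion1 M T b \<longleftrightarrow>
     (\<forall>t\<in>{0..T}. b t \<in> borel_measurable M) \<and>
     (\<forall>\<omega>\<in>space M. b 0 \<omega> = 0 \<and> continuous_on {0..T} (\<lambda>t. b t \<omega>)) \<and>
     (\<forall>s t. 0 \<le> s \<longrightarrow> s < t \<longrightarrow> t \<le> T \<longrightarrow>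
        distributed M lborel (\<lambda>\<omega>. b t \<omega> - b s \<omega>) (normal_density 0 (sqrt (t - s)))) \<and>
     (\<forall>(m::nat) \<tau>. (\<forall>i\<le>m. \<tau> i \<in> {0..T}) \<longrightarrow> (\<forall>i<m. \<tau> i \<le> \<tau> (Suc i)) \<longrightarrow>
        prob_space.indep_vars M (\<lambda>_. borel) (\<lambda>i \<omega>. b (\<tau> (Suc i)) \<omega> - b (\<tau> i) \<omega>) {..<m})"

definition path_algebra :: "real \<Rightarrow> (real \<Rightarrow> 'b::topological_space) measure" where
  "path_algebra T = PiM {0..T} (\<lambda>_. borel)"

definition brownian_motion :: "'w measure \<Rightarrow> real \<Rightarrow> (real \<Rightarrow> 'w \<Rightarrow> real^'k) \<Rightarrow> bool" where
  "brownian_motion M T B \<longleftrightarrow>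
     (\<forall>l. brownian_motion1 M T (\<lambda>t \<omega>. B t \<omega> $ l)) \<and>
     prob_space.indep_vars M (\<lambda>_. path_algebra T) (\<lambda>l. trajectory T (\<lambda>t \<omega>. B t \<omega> $ l)) UNIV"

definition natural_filtration ::
  "'w measure \<Rightarrow> (real \<Rightarrow> 'w \<Rightarrow> 'b::topological_space) \<Rightarrow> real \<Rightarrow> 'w measure" where
  "natural_filtration M X t = vimage_algebra (space M) (trajectory t X) (path_algebra t)"


definition driving_filtration ::
  "'w measure \<Rightarrow> (real \<Rightarrow> 'w \<Rightarrow> real^'p) \<Rightarrow> (real \<Rightarrow> 'w \<Rightarrow> real^'d) \<Rightarrow> real \<Rightarrow> 'w measure" where
  "driving_filtration M B W = natural_filtration M (\<lambda>t \<omega>. (B t \<omega>, W t \<omega>))"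

text \<open>Expressed through the generated sigma-algebras, since \<open>indep_var\<close> requires both random
  variables to have the same type.\<close>

definition independent_processes ::
  "'w measure \<Rightarrow> real \<Rightarrow> (real \<Rightarrow> 'w \<Rightarrow> 'b::topological_space) \<Rightarrow>
     (real \<Rightarrow> 'w \<Rightarrow> 'c::topological_space) \<Rightarrow> bool" where
  "independent_processes M T X Y \<longleftrightarrow>
     prob_space.indep_set M (sets (natural_filtration M X T)) (sets (natural_filtration M Y T))"


section \<open>Ito integral\<close>

text \<open>A simple adapted integrand on \<open>[0,t]\<close> is \<open>\<Sum>i<m. \<xi> i * indicator {\<tau> i<..\<tau> (Suc i)}\<close> with
  \<open>0 = \<tau> 0 < \<dots> < \<tau> m = t\<close> and \<open>\<xi> i\<close> bounded and measurable with respect to \<open>F (\<tau> i)\<close>.\<close>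

definition simple_integrand ::
  "(real \<Rightarrow> 'w measure) \<Rightarrow> real \<Rightarrow> nat \<Rightarrow> (nat \<Rightarrow> real) \<Rightarrow> (nat \<Rightarrow> 'w \<Rightarrow> real) \<Rightarrow> bool" where
  "simple_integrand F t m \<tau> \<xi> \<longleftrightarrow> \<tau> 0 = 0 \<and> \<tau> m = t \<and> (\<forall>i<m. \<tau> i < \<tau> (Suc i)) \<and>
     (\<forall>i<m. \<xi> i \<in> borel_measurable (F (\<tau> i)) \<and> bounded (\<xi> i ` space (F (\<tau> i))))"

definition simple_process ::
  "nat \<Rightarrow> (nat \<Rightarrow> real) \<Rightarrow> (nat \<Rightarrow> 'w \<Rightarrow> real) \<Rightarrow> real \<Rightarrow> 'w \<Rightarrow> real" where
  "simple_process m \<tau> \<xi> s \<omega> = (\<Sum>i<m. \<xi> i \<omega> * indicator {\<tau> i<..\<tau> (Suc i)} s)"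

definition simple_integral ::
  "(real \<Rightarrow> 'w \<Rightarrow> real) \<Rightarrow> nat \<Rightarrow> (nat \<Rightarrow> real) \<Rightarrow> (nat \<Rightarrow> 'w \<Rightarrow> real) \<Rightarrow> 'w \<Rightarrow> real" where
  "simple_integral b m \<tau> \<xi> \<omega> = (\<Sum>i<m. \<xi> i \<omega> * (b (\<tau> (Suc i)) \<omega> - b (\<tau> i) \<omega>))"

definition null_in_probability :: "'w measure \<Rightarrow> (nat \<Rightarrow> 'w \<Rightarrow> ennreal) \<Rightarrow> bool" where
  "null_in_probability M Y \<longleftrightarrow>
     (\<forall>e>0. (\<lambda>k. measure M {\<omega>\<in>space M. ennreal e < Y k \<omega>}) \<longlonglongrightarrow> 0)"

text \<open>\<open>has_ito_integral M F b t H J\<close>: the random variable \<open>J\<close> is (a version of) \<open>\<integral>\<^sub>0\<^sup>t H dB\<close>, for \<open>b\<close> a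
  Brownian motion relative to the filtration \<open>F\<close>. This is the usual extension of the integral from
  simple integrands to all adapted \<open>H\<close> with \<open>\<integral>\<^sub>0\<^sup>t H\<^sup>2 ds < \<infinity>\<close> almost surely: approximate \<open>H\<close> by simple
  integrands in \<open>L\<^sup>2([0,t])\<close>, in probability, and take the limit in probability of the integrals.
  As with \<open>has_integral\<close>, the relation includes existence, and it determines \<open>J\<close> almost surely.
  A square-integrable deterministic integrand gives the Wiener integral.\<close>

definition has_ito_integral ::
  "'w measure \<Rightarrow> (real \<Rightarrow> 'w measure) \<Rightarrow> (real \<Rightarrow> 'w \<Rightarrow> real) \<Rightarrow> real \<Rightarrow>
     (real \<Rightarrow> 'w \<Rightarrow> real) \<Rightarrow> ('w \<Rightarrow> real) \<Rightarrow> bool" where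
  "has_ito_integral M F b t H J \<longleftrightarrow>
     (\<lambda>(s, \<omega>). H s \<omega>) \<in> borel_measurable (restrict_space borel {0..t} \<Otimes>\<^sub>M M) \<and>
     J \<in> borel_measurable M \<and>
     (\<exists>m \<tau> \<xi>. (\<forall>k. simple_integrand F t (m k) (\<tau> k) (\<xi> k)) \<and>
        null_in_probability M (\<lambda>k \<omega>.
          \<integral>\<^sup>+s\<in>{0..t}. ennreal ((simple_process (m k) (\<tau> k) (\<xi> k) s \<omega> - H s \<omega>)\<^sup>2) \<partial>lborel) \<and>
        null_in_probability M (\<lambda>k \<omega>.
          ennreal \<bar>simple_integral b (m k) (\<tau> k) (\<xi> k) \<omega> - J \<omega>\<bar>))"


section \<open>Volterra kernels\<close>

definition volterra_kernel :: "real \<Rightarrow> (real \<Rightarrow> real \<Rightarrow> real) \<Rightarrow> bool" where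
  "volterra_kernel T K \<longleftrightarrow>
     (\<lambda>(t, s). K t s) \<in> borel_measurable (restrict_space borel ({0..T} \<times> {0..T})) \<and>
     (\<integral>\<^sup>+x\<in>{0..T} \<times> {0..T}. ennreal ((K (fst x) (snd x))\<^sup>2) \<partial>lborel) < \<infinity> \<and>
     (SUP t\<in>{0..T}. \<integral>\<^sup>+s\<in>{0..T}. ennreal ((K t s)\<^sup>2) \<partial>lborel) < \<infinity> \<and>
     K 0 0 = 0 \<and> (\<forall>t s. 0 \<le> t \<longrightarrow> t < s \<longrightarrow> s \<le> T \<longrightarrow> K t s = 0) \<and>
     (\<exists>c>0. \<exists>\<alpha>>0. \<forall>\<delta>\<in>{0..T}. \<forall>t1\<in>{0..T}. \<forall>t2\<in>{0..T}. \<bar>t1 - t2\<bar> \<le> \<delta> \<longrightarrow>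
        (\<integral>\<^sup>+s\<in>{0..T}. ennreal ((K t1 s - K t2 s)\<^sup>2) \<partial>lborel) \<le> ennreal (c * \<delta> powr \<alpha>))"

definition hat :: "real \<Rightarrow> ('p \<Rightarrow> real \<Rightarrow> real \<Rightarrow> real) \<Rightarrow> (real \<Rightarrow> real^'p) \<Rightarrow> real \<Rightarrow> real^'p" where
  "hat T K f = (\<lambda>t\<in>{0..T}. \<chi> l. (LINT u:{0..t}|lebesgue. K l t u * dot T f u $ l))"

definition I_B_hatB :: "real \<Rightarrow> ('p \<Rightarrow> real \<Rightarrow> real \<Rightarrow> real) \<Rightarrow>
    (real \<Rightarrow> real^'p) \<times> (real \<Rightarrow> real^'p) \<Rightarrow> ereal" where
  "I_B_hatB T K = (\<lambda>(f, g). if f \<in> cameron_martin T \<and> g = hat T K f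
     then ereal (1/2 * cm_norm_sq T f) else \<infinity>)"


section \<open>Coefficients and the rate function of the log-price\<close>

definition modulus_of_continuity :: "(real \<Rightarrow> real) \<Rightarrow> bool" where
  "modulus_of_continuity w \<longleftrightarrow> mono_on {0..} w \<and> (\<forall>r\<ge>0. 0 \<le> w r) \<and> w 0 = 0 \<and>
     (w \<longlongrightarrow> 0) (at_right 0)"

definition locally_omega_continuous :: "(real \<Rightarrow> real) \<Rightarrow> (real^'p \<Rightarrow> real) \<Rightarrow> bool" where
  "locally_omega_continuous w h \<longleftrightarrow>
     (\<forall>\<delta>>0. \<exists>L>0. \<forall>x y. norm x \<le> \<delta> \<longrightarrow> norm y \<le> \<delta> \<longrightarrow> \<bar>h x - h y\<bar> \<le> L * w (norm (x - y)))"

definition diffusion_matrix :: "(real^'p \<Rightarrow> real^'d^'d) \<Rightarrow> real^'p \<Rightarrow> real^'d^'d" where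
  "diffusion_matrix \<sigma> y = \<sigma> y ** transpose (\<sigma> y)"

definition A_mat :: "real \<Rightarrow> (real^'p \<Rightarrow> real^'d^'d) \<Rightarrow> (real \<Rightarrow> real^'p) \<Rightarrow> real^'d^'d" where
  "A_mat T \<sigma> g = (\<chi> i j. (LINT t:{0..T}|lborel. diffusion_matrix \<sigma> (g t) $ i $ j))"

definition M_vec :: "real \<Rightarrow> (real^'p \<Rightarrow> real^'d) \<Rightarrow> (real \<Rightarrow> real^'p) \<Rightarrow> real^'d" where
  "M_vec T \<mu> g = (\<chi> i. (LINT t:{0..T}|lborel. \<mu> (g t) $ i))"

definition Phi :: "real \<Rightarrow> (real^'p \<Rightarrow> real^'p^'d) \<Rightarrow> (real \<Rightarrow> real^'p) \<Rightarrow> (real \<Rightarrow> real^'p) \<Rightarrow>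
    real \<Rightarrow> real^'d" where
  "Phi T \<sigma>' f g t = (\<chi> i. \<Sum>l\<in>UNIV. (LINT s:{0..t}|lebesgue. \<sigma>' (g s) $ i $ l * dot T f s $ l))"

definition I_T :: "real \<Rightarrow> (real^'p \<Rightarrow> real^'d) \<Rightarrow> (real^'p \<Rightarrow> real^'d^'d) \<Rightarrow> (real^'p \<Rightarrow> real^'p^'d) \<Rightarrow>
    ('p \<Rightarrow> real \<Rightarrow> real \<Rightarrow> real) \<Rightarrow> real^'d \<Rightarrow> ereal" where
  "I_T T \<mu> \<sigma> \<sigma>' K z = (INF f\<in>cameron_martin T.
     (let v = z - Phi T \<sigma>' f (hat T K f) T - M_vec T \<mu> (hat T K f)
      in ereal (1/2 * cm_norm_sq T f + 1/2 * (v \<bullet> (matrix_inv (A_mat T \<sigma> (hat T K f)) *v v)))))"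

end

theory Submission
  imports Defs
begin

text \<open>Freezing the coefficients of \<open>Z\<^sup>n(T)\<close> on a uniform mesh is exponentially accurate: goodness of the rate
  function of \<open>(\<epsilon>\<^sub>n B, Bh\<^sup>n)\<close> confines the paths, up to exponentially small probability, to finitely many thin tubes, hence
  controls the oscillation of the coefficients, and exponential martingales turn small oscillation into a Gaussian tail for the
  error of the Ito integrals. The frozen variable is a continuous functional of finitely many values of
  \<open>(\<epsilon>\<^sub>n B, Bh\<^sup>n)\<close> and of the increments of \<open>W\<close>, and it is Gaussian given \<open>B\<close>. Near a path
  \<open>(f, hat f)\<close>, put \<open>v = z - \<Phi> - M\<close> and \<open>\<theta> = A\<^sup>-\<^sup>1 v\<close>. The exponential Chebyshev inequality for the linear form \<open>\<theta>\<close> bounds the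
  probability that \<open>Z\<^sup>n(T)\<close> is near \<open>z\<close> while the path is in the tube from above. Steering the increments of \<open>W\<close> along
  \<open>\<sigma>\<^sup>T \<theta> dt\<close>, independently of the tube event, bounds it from below with the same exponent
  \<open>1/2 \<parallel>f\<parallel>\<^sup>2 + 1/2 v\<^sup>T A\<^sup>-\<^sup>1 v\<close>.\<close>

subsection \<open>Absolutely continuous functions\<close>

text \<open>The obstacle throughout is adaptedness. The filtration in
  \<open>has_ito_integral\<close> is not completed, while the Ito relation fixes
  \<open>Bh n t\<close> only up to null sets, so a frozen coefficient need not be measurable for the
  past. Each \<open>Bh n t\<close> therefore gets a version that depends on \<open>B\<close> up to
  time t and not on \<open>W\<close>. The same versions make the coefficients known given
  \<open>B\<close>, so that \<open>W\<close> can be integrated out separately. Exponential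
  martingales are used for step integrands only; the tail bound passes to Ito integrals through
  convergence in probability, at the price of a constant. Its exponent is inversely proportional to
  the squared oscillation of the coefficients, so a fine mesh beats any prescribed exponent.
  Matching them takes Lebesgue's theorem that an absolutely continuous function is the integral of
  its almost everywhere derivative. The quadratic term is the maximum over \<theta> of
  \<open>\<theta> \<bullet> v - 1/2 * (\<theta> \<bullet> (A *v \<theta>))\<close>, and the \<theta>
  of the overview is the maximizer; this is why the two bounds meet.\<close>

definition interval_family :: "real \<Rightarrow> real \<Rightarrow> 'i set \<Rightarrow> ('i \<Rightarrow> real) \<Rightarrow> ('i \<Rightarrow> real) \<Rightarrow> bool" where
  "interval_family a b I u v \<longleftrightarrow> finite I \<and> (\<forall>i\<in>I. a \<le> u i \<and> u i \<le> v i \<and> v i \<le> b) \<and>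
     disjoint_family_on (\<lambda>i. {u i<..<v i}) I"

text \<open>The index type is left free because families indexed by integers (dyadic intervals) and
  by pairs (families inside several intervals, glued together) occur below.\<close>

lemma abs_continuous_on_intervalE:
  assumes "abs_continuous_on_interval a b f" "e > 0"
  obtains d where "d > 0" "\<And>(I :: 'i set) u v. interval_family a b I u v \<Longrightarrow> (\<Sum>i\<in>I. v i - u i) < d
     \<Longrightarrow> (\<Sum>i\<in>I. norm (f (v i) - f (u i))) < e"
proof -
  obtain d where d: "d > 0" and D: "\<And>(m::nat) u v. (\<forall>i<m. a \<le> u i \<and> u i \<le> v i \<and> v i \<le> b) \<Longrightarrow>
       disjoint_family_on (\<lambda>i. {u i<..<v i}) {..<m} \<Longrightarrow>
       (\<Sum>i<m. v i - u i) < d \<Longrightarrow> (\<Sum>i<m. norm (f (v i) - f (u i))) < e"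
    using assms unfolding abs_continuous_on_interval_def by meson
  have "(\<Sum>i\<in>I. norm (f (v i) - f (u i))) < e"
    if F: "interval_family a b I u v" and lt: "(\<Sum>i\<in>I. v i - u i) < d" for I :: "'i set" and u v
  proof -
    have fin: "finite I" using F by (auto simp: interval_family_def)
    obtain h where h: "bij_betw h {..<card I} I"
      using ex_bij_betw_nat_finite[OF fin] by (auto simp: atLeast0LessThan)
    have sums: "sum g I = (\<Sum>j<card I. g (h j))" for g :: "'i \<Rightarrow> real"
      using sum.reindex_bij_betw[OF h, of g] by simp
    have hI: "h j \<in> I" if "j < card I" for j using h that by (auto simp: bij_betw_def)
    have inj: "inj_on h {..<card I}" using h by (auto simp: bij_betw_def)
    have "(\<Sum>j<card I. norm (f (v (h j)) - f (u (h j)))) < e"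
    proof (rule D)
      show "\<forall>i<card I. a \<le> u (h i) \<and> u (h i) \<le> v (h i) \<and> v (h i) \<le> b"
        using F hI by (auto simp: interval_family_def)
      show "disjoint_family_on (\<lambda>i. {u (h i)<..<v (h i)}) {..<card I}"
      proof (unfold disjoint_family_on_def, intro ballI impI)
        fix i j assume ij: "i \<in> {..<card I}" "j \<in> {..<card I}" "i \<noteq> j"
        then have "h i \<noteq> h j" using inj by (auto simp: inj_on_def)
        moreover have "h i \<in> I" "h j \<in> I" using ij hI by auto
        ultimately show "{u (h i)<..<v (h i)} \<inter> {u (h j)<..<v (h j)} = {}"
          using F unfolding interval_family_def disjoint_family_on_def by blast
      qed
      show "(\<Sum>i<card I. v (h i) - u (h i)) < d" using lt sums[of "\<lambda>i. v i - u i"] by simp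
    qed
    then show ?thesis using sums[of "\<lambda>i. norm (f (v i) - f (u i))"] by simp
  qed
  then show ?thesis using that d by blast
qed

lemma interval_family_length:
  assumes "interval_family a b I u v" "a \<le> b"
  shows "(\<Sum>i\<in>I. v i - u i) \<le> b - a"
proof -
  have fin: "finite I" and I: "\<And>i. i \<in> I \<Longrightarrow> a \<le> u i \<and> u i \<le> v i \<and> v i \<le> b"
    and dis: "disjoint_family_on (\<lambda>i. {u i<..<v i}) I" using assms by (auto simp: interval_family_def)
  have "(\<Sum>i\<in>I. v i - u i) = (\<Sum>i\<in>I. measure lborel {u i<..<v i})"
    by (rule sum.cong) (use I in auto)
  also have "\<dots> = measure lborel (\<Union>i\<in>I. {u i<..<v i})"
    by (rule measure_finite_Union[symmetric, OF fin _ dis]) (use I in \<open>auto simp: emeasure_lborel_Ioo\<close>)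
  also have "\<dots> \<le> measure lborel {a..b}"
  proof (rule measure_mono_fmeasurable)
    show "(\<Union>i\<in>I. {u i<..<v i}) \<subseteq> {a..b}" using I by fastforce
    show "(\<Union>i\<in>I. {u i<..<v i}) \<in> sets lborel" using fin by (intro sets.finite_UN) auto
    show "{a..b} \<in> fmeasurable lborel" by (auto simp: fmeasurable_def emeasure_lborel_Icc_eq)
  qed
  finally show ?thesis using assms(2) by simp
qed

text \<open>Clamping the endpoints keeps the index set: an interval on the wrong side of x collapses
  to a point, which the weak inequalities in \<open>interval_family\<close> permit.\<close>

lemma interval_family_cut:
  assumes F: "interval_family a b I u v" and x: "a \<le> x" "x \<le> b"
  shows "interval_family a x I (\<lambda>i. min (u i) x) (\<lambda>i. min (v i) x)"
    and "interval_family x b I (\<lambda>i. max (u i) x) (\<lambda>i. max (v i) x)"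
proof -
  have 1: "{min (u i) x<..<min (v i) x} \<subseteq> {u i<..<v i}" for i by auto
  have 2: "{max (u i) x<..<max (v i) x} \<subseteq> {u i<..<v i}" for i by auto
  show "interval_family a x I (\<lambda>i. min (u i) x) (\<lambda>i. min (v i) x)"
    using F x 1 unfolding interval_family_def disjoint_family_on_def by (fastforce simp: min_def)
  show "interval_family x b I (\<lambda>i. max (u i) x) (\<lambda>i. max (v i) x)"
    using F x 2 unfolding interval_family_def disjoint_family_on_def by (fastforce simp: max_def)
qed

lemma sum_cut:
  fixes f :: "real \<Rightarrow> real"
  shows "(\<Sum>i\<in>I. f (v i) - f (u i)) = (\<Sum>i\<in>I. f (min (v i) x) - f (min (u i) x))
     + (\<Sum>i\<in>I. f (max (v i) x) - f (max (u i) x))"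
proof -
  have "f y = f (min y x) + f (max y x) - f x" for y by (auto simp: min_def max_def)
  then have "f (v i) - f (u i) = (f (min (v i) x) - f (min (u i) x)) + (f (max (v i) x) - f (max (u i) x))" for i
    by (smt (verit, best))
  then show ?thesis by (simp add: sum.distrib)
qed

text \<open>Signed increments, without absolute values: the supremum is the positive variation P,
  and f = P - (P - f) is then a difference of two monotone functions.\<close>

definition increments :: "(real \<Rightarrow> real) \<Rightarrow> real \<Rightarrow> real \<Rightarrow> real set" where
  "increments f a b = {(\<Sum>i\<in>I. f (v i) - f (u i)) | (I :: nat set) u v. interval_family a b I u v}"

lemma incrementsI: "interval_family a b (I :: nat set) u v \<Longrightarrow> (\<Sum>i\<in>I. f (v i) - f (u i)) \<in> increments f a b"
  unfolding increments_def by blast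

text \<open>Absolute continuity bounds the increments inside a window of length d/2 by 1, and
  finitely many such windows exhaust [a, b]; the induction cuts off the last window.\<close>

lemma increments_bdd:
  assumes ac: "abs_continuous_on_interval a b f" and ab: "a \<le> b"
  shows "\<exists>C. \<forall>s\<in>increments f a b. s \<le> C"
proof -
  obtain d where d: "d > 0" and D: "\<And>(I :: nat set) u v. interval_family a b I u v \<Longrightarrow> (\<Sum>i\<in>I. v i - u i) < d
     \<Longrightarrow> (\<Sum>i\<in>I. norm (f (v i) - f (u i))) < 1"
    using abs_continuous_on_intervalE[OF ac zero_less_one] by metis
  have step: "(\<Sum>i\<in>I. f (v i) - f (u i)) \<le> real k"
    if "interval_family a x I u v" "a \<le> x" "x \<le> b" "x \<le> a + real k * (d/2)" for k x and I :: "nat set" and u v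
    using that
  proof (induction k arbitrary: x u v)
    case 0
    then have "u i = v i" if "i \<in> I" for i using that by (force simp: interval_family_def)
    then show ?case by simp
  next
    case (Suc k)
    define y where "y = max a (x - d/2)"
    have y: "a \<le> y" "y \<le> x" using d Suc.prems by (auto simp: y_def)
    note c = interval_family_cut[OF Suc.prems(1) y]
    have A: "(\<Sum>i\<in>I. f (min (v i) y) - f (min (u i) y)) \<le> real k"
    proof (rule Suc.IH[OF c(1)])
      show "y \<le> a + real k * (d/2)" using Suc.prems d by (auto simp: y_def max_def field_simps)
    qed (use y Suc.prems in auto)
    have "(\<Sum>i\<in>I. f (max (v i) y) - f (max (u i) y)) \<le> (\<Sum>i\<in>I. norm (f (max (v i) y) - f (max (u i) y)))"
      by (rule sum_mono) auto
    also have "\<dots> < 1"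
    proof (rule D)
      show "interval_family a b I (\<lambda>i. max (u i) y) (\<lambda>i. max (v i) y)"
        using c(2) y Suc.prems by (force simp: interval_family_def)
      show "(\<Sum>i\<in>I. max (v i) y - max (u i) y) < d"
        using interval_family_length[OF c(2) y(2)] d by (auto simp: y_def)
    qed
    finally have B: "(\<Sum>i\<in>I. f (max (v i) y) - f (max (u i) y)) \<le> 1" by simp
    show ?case unfolding sum_cut[of f v u I y] using A B by simp
  qed
  obtain k where k: "(b - a) / (d/2) \<le> real k" using real_arch_simple by blast
  then have "b \<le> a + real k * (d/2)" using d by (auto simp: field_simps)
  then show ?thesis using step[OF _ ab order_refl] unfolding increments_def by blast
qed

definition pos_variation :: "(real \<Rightarrow> real) \<Rightarrow> real \<Rightarrow> real \<Rightarrow> real" where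
  "pos_variation f a b = Sup (increments f a b)"

lemma increments_mono: "a' \<le> a \<Longrightarrow> b \<le> b' \<Longrightarrow> increments f a b \<subseteq> increments f a' b'"
  unfolding increments_def interval_family_def by fastforce

lemma zero_in_increments: "0 \<in> increments f a b"
  unfolding increments_def interval_family_def disjoint_family_on_def
  by (rule CollectI, rule exI[of _ "{}"]) auto

context
  fixes f :: "real \<Rightarrow> real" and a b :: real
  assumes ac: "abs_continuous_on_interval a b f" and ab: "a \<le> b"
begin

lemma increments_bdd_above: "a \<le> x \<Longrightarrow> y \<le> b \<Longrightarrow> bdd_above (increments f x y)"
  using increments_bdd[OF ac ab] increments_mono[of a x y b f] by (meson bdd_aboveI subsetD)

lemma pos_variation_upper: "a \<le> x \<Longrightarrow> y \<le> b \<Longrightarrow> s \<in> increments f x y \<Longrightarrow> s \<le> pos_variation f x y"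
  unfolding pos_variation_def by (rule cSup_upper) (auto intro: increments_bdd_above)

lemma pos_variation_mono: "x \<le> y \<Longrightarrow> y \<le> b \<Longrightarrow> a \<le> x \<Longrightarrow> pos_variation f a x \<le> pos_variation f a y"
  unfolding pos_variation_def
  using zero_in_increments by (intro cSup_subset_mono increments_bdd_above increments_mono) auto

text \<open>A family in [a, x] can be enlarged by the interval from x to y under a fresh index.
  Consequently \<open>pos_variation f a\<close> minus f is monotone.\<close>

lemma pos_variation_increment:
  assumes "a \<le> x" "x \<le> y" "y \<le> b"
  shows "f y - f x \<le> pos_variation f a y - pos_variation f a x"
proof -
  have "s \<le> pos_variation f a y - (f y - f x)" if mem: "s \<in> increments f a x" for s
  proof -
    obtain I :: "nat set" and u v where F: "interval_family a x I u v" and s: "s = (\<Sum>i\<in>I. f (v i) - f (u i))"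
      using mem unfolding increments_def by blast
    have "finite I" using F by (simp add: interval_family_def)
    then obtain k where k: "k \<notin> I" using ex_new_if_finite infinite_UNIV_nat by blast
    have "interval_family a y (insert k I) (u(k:=x)) (v(k:=y))"
      unfolding interval_family_def
    proof (intro conjI)
      show "finite (insert k I)" using \<open>finite I\<close> by simp
      show "\<forall>i\<in>insert k I. a \<le> (u(k := x)) i \<and> (u(k := x)) i \<le> (v(k := y)) i \<and> (v(k := y)) i \<le> y"
        using F assms by (auto simp: interval_family_def)
      have "{u i<..<v i} \<subseteq> {..<x}" if "i \<in> I" for i using F that by (force simp: interval_family_def)
      then have 1: "{u i<..<v i} \<inter> {x<..<y} = {}" if "i \<in> I" for i using that by fastforce
      have dis: "disjoint_family_on (\<lambda>i. {u i<..<v i}) I" using F by (simp add: interval_family_def)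
      show "disjoint_family_on (\<lambda>i. {(u(k := x)) i<..<(v(k := y)) i}) (insert k I)"
        unfolding disjoint_family_on_def
      proof (intro ballI impI)
        fix i j assume ij: "i \<in> insert k I" "j \<in> insert k I" "i \<noteq> j"
        have "i \<in> I \<Longrightarrow> j \<in> I \<Longrightarrow> {u i<..<v i} \<inter> {u j<..<v j} = {}"
          using dis ij(3) unfolding disjoint_family_on_def by blast
        then show "{(u(k := x)) i<..<(v(k := y)) i} \<inter> {(u(k := x)) j<..<(v(k := y)) j} = {}"
          using ij 1[of i] 1[of j] by (cases "i = k"; cases "j = k") (simp_all add: Int_commute)
      qed
    qed
    moreover have "(\<Sum>i\<in>insert k I. f ((v(k:=y)) i) - f ((u(k:=x)) i)) = s + (f y - f x)"
      using k \<open>finite I\<close> by (subst sum.insert) (auto simp: s intro!: sum.cong)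
    ultimately have "s + (f y - f x) \<in> increments f a y"
      using incrementsI by metis
    then show ?thesis using pos_variation_upper[of a y] assms by fastforce
  qed
  then have "pos_variation f a x \<le> pos_variation f a y - (f y - f x)"
    unfolding pos_variation_def[of f a x] by (intro cSup_least) (use zero_in_increments in blast)+
  then show ?thesis by simp
qed

lemma pos_variation_split:
  assumes "a \<le> x" "x \<le> y" "y \<le> b"
  shows "pos_variation f a y - pos_variation f a x \<le> pos_variation f x y"
proof -
  have "s \<le> pos_variation f a x + pos_variation f x y" if mem: "s \<in> increments f a y" for s
  proof -
    obtain I :: "nat set" and u v where F: "interval_family a y I u v" and s: "s = (\<Sum>i\<in>I. f (v i) - f (u i))"
      using mem unfolding increments_def by blast
    note c = interval_family_cut[OF F assms(1,2)]
    have "(\<Sum>i\<in>I. f (min (v i) x) - f (min (u i) x)) \<le> pos_variation f a x"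
      by (rule pos_variation_upper) (use assms incrementsI[OF c(1)] in auto)
    moreover have "(\<Sum>i\<in>I. f (max (v i) x) - f (max (u i) x)) \<le> pos_variation f x y"
      by (rule pos_variation_upper) (use assms incrementsI[OF c(2)] in auto)
    ultimately show ?thesis unfolding s sum_cut[of f v u I x] by simp
  qed
  then have "pos_variation f a y \<le> pos_variation f a x + pos_variation f x y"
    unfolding pos_variation_def[of f a y] by (intro cSup_least) (use zero_in_increments in blast)+
  then show ?thesis by simp
qed

text \<open>Inside each given interval a family is chosen that nearly attains the positive variation
  there. Glued together these families form one family of no larger total length, to which absolute
  continuity of f applies.\<close>

lemma abs_continuous_pos_variation: "abs_continuous_on_interval a b (pos_variation f a)"
  unfolding abs_continuous_on_interval_def
proof (intro allI impI)
  fix e :: real assume e: "e > 0"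
  obtain d where d: "d > 0" and D: "\<And>(I :: (nat\<times>nat) set) u v. interval_family a b I u v \<Longrightarrow> (\<Sum>i\<in>I. v i - u i) < d
     \<Longrightarrow> (\<Sum>i\<in>I. norm (f (v i) - f (u i))) < e/2"
    by (rule abs_continuous_on_intervalE[OF ac half_gt_zero[OF e]]) blast
  have "(\<Sum>i<m. norm (pos_variation f a (v i) - pos_variation f a (u i))) < e"
    if uv: "\<forall>i<m. a \<le> u i \<and> u i \<le> v i \<and> v i \<le> b" and dis: "disjoint_family_on (\<lambda>i. {u i<..<v i}) {..<m}"
      and lt: "(\<Sum>i<m. v i - u i) < d" for m :: nat and u v
  proof -
    \<comment> \<open>The slack allowed in each interval: m of them cost at most e/4 on top of the
      e/2 obtained from f. The added 1 covers m = 0.\<close>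
    define k where "k = e / 4 / (real m + 1)"
    have k: "k > 0" using e by (simp add: k_def)
    have "\<exists>I U V. interval_family (u i) (v i) (I :: nat set) U V \<and> pos_variation f (u i) (v i) - k < (\<Sum>j\<in>I. f (V j) - f (U j))"
      if "i < m" for i
    proof -
      have "pos_variation f (u i) (v i) - k < Sup (increments f (u i) (v i))"
        using k by (simp add: pos_variation_def)
      then have "\<exists>s\<in>increments f (u i) (v i). pos_variation f (u i) (v i) - k < s"
        using less_cSupD[of "increments f (u i) (v i)"] zero_in_increments by blast
      then show ?thesis by (auto simp: increments_def)
    qed
    then obtain I U V where F: "\<And>i. i < m \<Longrightarrow> interval_family (u i) (v i) (I i :: nat set) (U i) (V i)"
      and S: "\<And>i. i < m \<Longrightarrow> pos_variation f (u i) (v i) - k < (\<Sum>j\<in>I i. f (V i j) - f (U i j))"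
      by metis
    define J where "J = Sigma {..<m} I"
    have fin: "finite (I i)" if "i < m" for i using F[OF that] by (simp add: interval_family_def)
    have FJ: "interval_family a b J (\<lambda>(i,j). U i j) (\<lambda>(i,j). V i j)"
      unfolding interval_family_def
    proof (intro conjI)
      show "finite J" unfolding J_def using fin by auto
      show "\<forall>i\<in>J. a \<le> (case i of (i, j) \<Rightarrow> U i j) \<and> (case i of (i, j) \<Rightarrow> U i j) \<le> (case i of (i, j) \<Rightarrow> V i j) \<and>
           (case i of (i, j) \<Rightarrow> V i j) \<le> b"
        using F uv unfolding J_def interval_family_def by fastforce
      show "disjoint_family_on (\<lambda>i. {case i of (i, j) \<Rightarrow> U i j<..<case i of (i, j) \<Rightarrow> V i j}) J"
      proof (unfold disjoint_family_on_def, intro ballI impI)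
        fix p q assume p: "p \<in> J" and q: "q \<in> J" and pq: "p \<noteq> q"
        obtain i j i' j' where eq: "p = (i,j)" "q = (i',j')" by fastforce
        have mem: "i < m" "i' < m" "j \<in> I i" "j' \<in> I i'" using p q eq by (auto simp: J_def)
        have sub: "{U i j<..<V i j} \<subseteq> {u i<..<v i}" "{U i' j'<..<V i' j'} \<subseteq> {u i'<..<v i'}"
          using F[OF mem(1)] F[OF mem(2)] mem by (fastforce simp: interval_family_def)+
        show "{case p of (i, j) \<Rightarrow> U i j<..<case p of (i, j) \<Rightarrow> V i j} \<inter>
              {case q of (i, j) \<Rightarrow> U i j<..<case q of (i, j) \<Rightarrow> V i j} = {}"
        proof (cases "i = i'")
          case True
          then have "j \<noteq> j'" using pq eq by auto
          then show ?thesis using F[OF mem(1)] mem True unfolding eq interval_family_def disjoint_family_on_def by force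
        next
          case False
          then have "{u i<..<v i} \<inter> {u i'<..<v i'} = {}" using dis mem by (auto simp: disjoint_family_on_def)
          then show ?thesis using sub unfolding eq prod.case by blast
        qed
      qed
    qed
    have sumJ: "sum g J = (\<Sum>i<m. \<Sum>j\<in>I i. g (i,j))" for g :: "nat \<times> nat \<Rightarrow> real"
      unfolding J_def using fin by (subst sum.Sigma) (auto simp: case_prod_beta')
    have "(\<Sum>p\<in>J. (case p of (i,j) \<Rightarrow> V i j) - (case p of (i,j) \<Rightarrow> U i j)) \<le> (\<Sum>i<m. v i - u i)"
      unfolding sumJ by (rule sum_mono) (use F interval_family_length uv in fastforce)
    then have "(\<Sum>p\<in>J. norm (f (case p of (i,j) \<Rightarrow> V i j) - f (case p of (i,j) \<Rightarrow> U i j))) < e/2"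
      using D[OF FJ] lt by simp
    moreover have "(\<Sum>p\<in>J. f (case p of (i,j) \<Rightarrow> V i j) - f (case p of (i,j) \<Rightarrow> U i j)) \<le>
       (\<Sum>p\<in>J. norm (f (case p of (i,j) \<Rightarrow> V i j) - f (case p of (i,j) \<Rightarrow> U i j)))"
      by (rule sum_mono) auto
    ultimately have s: "(\<Sum>i<m. \<Sum>j\<in>I i. f (V i j) - f (U i j)) < e/2" unfolding sumJ by simp
    have "(\<Sum>i<m. norm (pos_variation f a (v i) - pos_variation f a (u i))) \<le> (\<Sum>i<m. (\<Sum>j\<in>I i. f (V i j) - f (U i j)) + k)"
    proof (rule sum_mono)
      fix i assume "i \<in> {..<m}"
      then have i: "i < m" by simp
      have "norm (pos_variation f a (v i) - pos_variation f a (u i)) = pos_variation f a (v i) - pos_variation f a (u i)"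
        using pos_variation_mono uv i by simp
      also have "\<dots> \<le> pos_variation f (u i) (v i)" by (rule pos_variation_split) (use uv i in auto)
      finally show "norm (pos_variation f a (v i) - pos_variation f a (u i)) \<le> (\<Sum>j\<in>I i. f (V i j) - f (U i j)) + k"
        using S[OF i] by simp
    qed
    also have "\<dots> = (\<Sum>i<m. \<Sum>j\<in>I i. f (V i j) - f (U i j)) + real m * k" by (simp add: sum.distrib)
    also have "\<dots> < e"
    proof -
      have "real m * k \<le> e/4" using e by (simp add: k_def field_simps)
      then show ?thesis using s e by linarith
    qed
    finally show ?thesis .
  qed
  then show "\<exists>\<delta>>0. \<forall>(m::nat) u v. (\<forall>i<m. a \<le> u i \<and> u i \<le> v i \<and> v i \<le> b) \<longrightarrow>
       disjoint_family_on (\<lambda>i. {u i<..<v i}) {..<m} \<longrightarrow> (\<Sum>i<m. v i - u i) < \<delta> \<longrightarrow>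
       (\<Sum>i<m. norm (pos_variation f a (v i) - pos_variation f a (u i))) < e"
    using d by blast
qed

end

lemma abs_continuous_diff:
  assumes "abs_continuous_on_interval a b f" "abs_continuous_on_interval a b g"
  shows "abs_continuous_on_interval a b (\<lambda>x. f x - g x)"
  unfolding abs_continuous_on_interval_def
proof (intro allI impI)
  fix e :: real assume e: "e > 0"
  obtain d where d: "d > 0" and D: "\<And>(I :: nat set) u v. interval_family a b I u v \<Longrightarrow> (\<Sum>i\<in>I. v i - u i) < d
     \<Longrightarrow> (\<Sum>i\<in>I. norm (f (v i) - f (u i))) < e/2"
    by (rule abs_continuous_on_intervalE[OF assms(1) half_gt_zero[OF e]]) blast
  obtain d' where d': "d' > 0" and D': "\<And>(I :: nat set) u v. interval_family a b I u v \<Longrightarrow> (\<Sum>i\<in>I. v i - u i) < d'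
     \<Longrightarrow> (\<Sum>i\<in>I. norm (g (v i) - g (u i))) < e/2"
    by (rule abs_continuous_on_intervalE[OF assms(2) half_gt_zero[OF e]]) blast
  have "(\<Sum>i<m. norm (f (v i) - g (v i) - (f (u i) - g (u i)))) < e"
    if uv: "\<forall>i<m. a \<le> u i \<and> u i \<le> v i \<and> v i \<le> b" and dis: "disjoint_family_on (\<lambda>i. {u i<..<v i}) {..<m}"
      and lt: "(\<Sum>i<m. v i - u i) < min d d'" for m :: nat and u v
  proof -
    have F: "interval_family a b {..<m} u v" using uv dis by (auto simp: interval_family_def)
    have "(\<Sum>i<m. norm (f (v i) - g (v i) - (f (u i) - g (u i)))) \<le>
       (\<Sum>i<m. norm (f (v i) - f (u i)) + norm (g (v i) - g (u i)))"
    proof (rule sum_mono)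
      fix i
      have "f (v i) - g (v i) - (f (u i) - g (u i)) = (f (v i) - f (u i)) - (g (v i) - g (u i))" by simp
      then show "norm (f (v i) - g (v i) - (f (u i) - g (u i))) \<le> norm (f (v i) - f (u i)) + norm (g (v i) - g (u i))"
        by (metis norm_triangle_ineq4)
    qed
    also have "\<dots> < e/2 + e/2" unfolding sum.distrib
      by (rule add_strict_mono[OF D[OF F] D'[OF F]]) (use lt in auto)
    finally show ?thesis by simp
  qed
  then show "\<exists>\<delta>>0. \<forall>(m::nat) u v. (\<forall>i<m. a \<le> u i \<and> u i \<le> v i \<and> v i \<le> b) \<longrightarrow>
       disjoint_family_on (\<lambda>i. {u i<..<v i}) {..<m} \<longrightarrow> (\<Sum>i<m. v i - u i) < \<delta> \<longrightarrow>
       (\<Sum>i<m. norm (f (v i) - g (v i) - (f (u i) - g (u i)))) < e"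
    using d d' by (intro exI[of _ "min d d'"]) auto
qed

lemma abs_continuous_imp_continuous:
  assumes "abs_continuous_on_interval a b f"
  shows "continuous_on {a..b} f"
  unfolding continuous_on_iff
proof (intro ballI allI impI)
  fix x e :: real assume x: "x \<in> {a..b}" and e: "e > 0"
  obtain d where d: "d > 0" and D: "\<And>(I :: nat set) u v. interval_family a b I u v \<Longrightarrow> (\<Sum>i\<in>I. v i - u i) < d
     \<Longrightarrow> (\<Sum>i\<in>I. norm (f (v i) - f (u i))) < e"
    by (rule abs_continuous_on_intervalE[OF assms e]) blast
  have "dist (f y) (f x) < e" if y: "y \<in> {a..b}" "dist y x < d" for y
  proof -
    have "interval_family a b {0::nat} (\<lambda>_. min x y) (\<lambda>_. max x y)"
      using x y by (auto simp: interval_family_def disjoint_family_on_def)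
    from D[OF this] show ?thesis using y(2)
      by (cases "x \<le> y") (auto simp: dist_real_def norm_minus_commute dist_norm)
  qed
  then show "\<exists>d>0. \<forall>x'\<in>{a..b}. dist x' x < d \<longrightarrow> dist (f x') (f x) < e" using d by blast
qed

text \<open>The Stieltjes measure of a monotone absolutely continuous function has a density: an open set is
  exhausted by finite unions of dyadic intervals, to which absolute continuity applies.\<close>

lemma monotone_abs_continuous_density:
  fixes F :: "real \<Rightarrow> real"
  assumes ac: "abs_continuous_on_interval a b F" and ab: "a \<le> b"
    and mono: "\<And>x y. a \<le> x \<Longrightarrow> x \<le> y \<Longrightarrow> y \<le> b \<Longrightarrow> F x \<le> F y"
  shows "\<exists>g\<in>borel_measurable borel. (\<forall>x. 0 \<le> g x) \<and> integrable lborel g \<and>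
    (\<forall>x y. a \<le> x \<longrightarrow> x \<le> y \<longrightarrow> y \<le> b \<longrightarrow> (LINT t:{x..y}|lborel. g t) = F y - F x)"
proof -
  \<comment> \<open>Clamping to [a, b] extends F to a monotone continuous function on the whole
    line, as the Stieltjes measure requires.\<close>
  define c where "c x = max a (min b x)" for x
  have c: "a \<le> c x" "c x \<le> b" for x using ab by (auto simp: c_def)
  have c_id: "a \<le> x \<Longrightarrow> x \<le> b \<Longrightarrow> c x = x" for x by (auto simp: c_def)
  have c_mono: "x \<le> y \<Longrightarrow> c x \<le> c y" for x y by (auto simp: c_def)
  have c_lip: "x \<le> y \<Longrightarrow> c y - c x \<le> y - x" for x y using ab by (auto simp: c_def)
  define G where "G x = F (c x)" for x
  have G_mono: "x \<le> y \<Longrightarrow> G x \<le> G y" for x y unfolding G_def by (intro mono c c_mono)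
  have G_cont: "continuous_on UNIV G"
  proof -
    have "continuous_on UNIV (\<lambda>x. F (c x))"
      by (rule continuous_on_compose2[OF abs_continuous_imp_continuous[OF ac]])
        (use c in \<open>auto simp: c_def intro!: continuous_intros\<close>)
    then show ?thesis by (simp add: G_def[abs_def])
  qed
  then have G_right: "continuous (at_right x) G" for x
    by (auto simp: continuous_on_eq_continuous_within intro: continuous_within_subset)
  define N where "N = interval_measure G"
  have N_Ioc: "emeasure N {x<..y} = ennreal (G y - G x)" if "x \<le> y" for x y
    unfolding N_def by (rule emeasure_interval_measure_Ioc[OF that G_mono G_right])
  have sets_N: "sets N = sets borel" by (simp add: N_def)
  \<comment> \<open>Open sets of small Lebesgue measure have small Stieltjes measure; outer
    regularity of Lebesgue measure then transfers this to null sets.\<close>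
  have small: "\<exists>d>0. \<forall>U. open U \<longrightarrow> emeasure lborel U < ennreal d \<longrightarrow> emeasure N U \<le> ennreal e" if e: "e > 0" for e :: real
  proof -
    obtain d where d: "d > 0" and D: "\<And>(I :: int set) u v. interval_family a b I u v \<Longrightarrow> (\<Sum>i\<in>I. v i - u i) < d
     \<Longrightarrow> (\<Sum>i\<in>I. norm (F (v i) - F (u i))) < e"
      by (rule abs_continuous_on_intervalE[OF ac e]) blast
    have "emeasure N U \<le> ennreal e" if U: "open U" "emeasure lborel U < ennreal d" for U
    proof -
      \<comment> \<open>With cells of length 2^-n the bound 4^n on the index reaches from about -2^n
        to 2^n: finitely many cells for each n, and every point is reached eventually. The closed
        cell must lie in U, while \<open>W n\<close> uses half-open cells so that they are
        disjoint.\<close>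
      define I where "I n = {k. - ((4::int)^n) \<le> k \<and> k \<le> (4::int)^n \<and> {real_of_int k/2^n..(real_of_int k+1)/2^n} \<subseteq> U}" for n :: nat
      define W where "W n = (\<Union>k\<in>I n. {real_of_int k/2^n<..(real_of_int k+1)/2^n})" for n :: nat
      have finI: "finite (I n)" for n
        by (rule finite_subset[of _ "{- (4^n)..4^n}"]) (auto simp: I_def)
      have disj0: "k = l" if "x \<in> {real_of_int k/2^n<..(real_of_int k+1)/2^n}" "x \<in> {real_of_int l/2^n<..(real_of_int l+1)/2^n}" for x :: real and k l :: int and n :: nat
      proof -
        have "real_of_int k < x * 2^n" "x * 2^n \<le> k + 1" "real_of_int l < x * 2^n" "x * 2^n \<le> l + 1"
          using that by (auto simp: field_simps)
        then have "real_of_int k < real_of_int (l + 1)" "real_of_int l < real_of_int (k + 1)" by linarith+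
        then show ?thesis by linarith
      qed
      have disj: "disjoint_family_on (\<lambda>k. {real_of_int k/2^n<..(real_of_int k+1)/2^n}) (I n)" for n
        unfolding disjoint_family_on_def using disj0[of _ _ n] by blast
      have WU: "W n \<subseteq> U" for n unfolding W_def I_def by force
      have fam: "interval_family a b (I n) (\<lambda>k. c (real_of_int k/2^n)) (\<lambda>k. c ((real_of_int k+1)/2^n))" for n
        unfolding interval_family_def
      proof (intro conjI)
        show "finite (I n)" by (rule finI)
        show "\<forall>k\<in>I n. a \<le> c (real_of_int k/2^n) \<and> c (real_of_int k/2^n) \<le> c ((real_of_int k+1)/2^n) \<and> c ((real_of_int k+1)/2^n) \<le> b"
          using c by (auto intro!: c_mono simp: field_simps)
        show "disjoint_family_on (\<lambda>k. {c (real_of_int k/2^n)<..<c ((real_of_int k+1)/2^n)}) (I n)"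
          unfolding disjoint_family_on_def
        proof (intro ballI impI)
          fix k l assume "k \<in> I n" "l \<in> I n" "k \<noteq> l"
          then have "{real_of_int k/2^n<..(real_of_int k+1)/2^n} \<inter> {real_of_int l/2^n<..(real_of_int l+1)/2^n} = {}"
            using disj[of n] by (simp add: disjoint_family_on_def)
          moreover have "{c x<..<c y} \<subseteq> {x<..y}" for x y
            by (auto simp: c_def max_def min_def split: if_splits)
          ultimately show "{c (real_of_int k/2^n)<..<c ((real_of_int k+1)/2^n)} \<inter> {c (real_of_int l/2^n)<..<c ((real_of_int l+1)/2^n)} = {}"
            by blast
        qed
      qed
      have W_meas: "W n \<in> sets borel" for n unfolding W_def using finI by (intro sets.finite_UN) auto
      have lenW: "emeasure lborel (W n) = ennreal (\<Sum>k\<in>I n. (real_of_int k+1)/2^n - real_of_int k/2^n)" for n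
      proof -
        have "emeasure lborel (W n) = (\<Sum>k\<in>I n. emeasure lborel {real_of_int k/2^n<..(real_of_int k+1)/2^n})"
          unfolding W_def by (rule sum_emeasure[symmetric]) (use finI disj in auto)
        also have "\<dots> = (\<Sum>k\<in>I n. ennreal ((real_of_int k+1)/2^n - real_of_int k/2^n))"
          by (rule sum.cong) (auto simp: field_simps)
        also have "\<dots> = ennreal (\<Sum>k\<in>I n. (real_of_int k+1)/2^n - real_of_int k/2^n)"
          by (rule sum_ennreal) (auto simp: field_simps)
        finally show ?thesis .
      qed
      have "emeasure N (W n) \<le> ennreal e" for n
      proof -
        have "ennreal (\<Sum>k\<in>I n. (real_of_int k+1)/2^n - real_of_int k/2^n) < ennreal d"
          unfolding lenW[symmetric] using emeasure_mono[OF WU[of n], of lborel] U by (auto intro: le_less_trans)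
        then have "(\<Sum>k\<in>I n. (real_of_int k+1)/2^n - real_of_int k/2^n) < d"
          using d by (simp add: ennreal_less_iff sum_nonneg field_simps)
        moreover have "(\<Sum>k\<in>I n. c ((real_of_int k+1)/2^n) - c (real_of_int k/2^n)) \<le> (\<Sum>k\<in>I n. (real_of_int k+1)/2^n - real_of_int k/2^n)"
          by (intro sum_mono c_lip) (auto simp: field_simps)
        ultimately have less: "(\<Sum>k\<in>I n. norm (F (c ((real_of_int k+1)/2^n)) - F (c (real_of_int k/2^n)))) < e"
          using D[OF fam[of n]] by linarith
        have "emeasure N (W n) = (\<Sum>k\<in>I n. emeasure N {real_of_int k/2^n<..(real_of_int k+1)/2^n})"
          unfolding W_def by (rule sum_emeasure[symmetric]) (use finI disj sets_N in auto)
        also have "\<dots> = (\<Sum>k\<in>I n. ennreal (norm (F (c ((real_of_int k+1)/2^n)) - F (c (real_of_int k/2^n)))))"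
        proof (rule sum.cong[OF refl])
          fix k
          have le: "real_of_int k/2^n \<le> (real_of_int k+1)/2^n" by (auto simp: field_simps)
          show "emeasure N {real_of_int k/2^n<..(real_of_int k+1)/2^n} = ennreal (norm (F (c ((real_of_int k+1)/2^n)) - F (c (real_of_int k/2^n))))"
            using N_Ioc[OF le] G_mono[OF le] by (simp add: G_def)
        qed
        also have "\<dots> = ennreal (\<Sum>k\<in>I n. norm (F (c ((real_of_int k+1)/2^n)) - F (c (real_of_int k/2^n))))"
          by (rule sum_ennreal) auto
        finally show ?thesis using less by (simp add: ennreal_leI)
      qed
      moreover have "incseq W"
      proof (rule incseq_SucI, rule subsetI)
        fix n x assume "x \<in> W n"
        then obtain k where k: "k \<in> I n" "x \<in> {real_of_int k/2^n<..(real_of_int k+1)/2^n}" by (auto simp: W_def)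
        \<comment> \<open>The half of the cell that contains x. Its index is 2k or 2k+1, which stays
          within the bound for \<open>Suc n\<close>, since that bound grows by a factor 4.\<close>
        define l where "l = (if x \<le> (2*k+1)/2^Suc n then 2*k else 2*k+1)"
        have xl: "x \<in> {real_of_int l/2^Suc n<..(real_of_int l+1)/2^Suc n}"
          using k(2) by (auto simp: l_def field_simps)
        have "real_of_int l/2^Suc n \<ge> real_of_int k/2^n" "(real_of_int l+1)/2^Suc n \<le> (real_of_int k+1)/2^n"
          by (auto simp: l_def field_simps)
        then have "{real_of_int l/2^Suc n..(real_of_int l+1)/2^Suc n} \<subseteq> U" using k(1) unfolding I_def by fastforce
        moreover have "- (4^Suc n) \<le> l \<and> l \<le> 4^Suc n"
        proof -
          have "(1::int) \<le> 4^n" by simp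
          moreover have "- (4^n) \<le> k" "k \<le> 4^n" using k(1) by (simp_all add: I_def)
          moreover have "2 * k \<le> l" "l \<le> 2 * k + 1" by (auto simp: l_def)
          ultimately show ?thesis unfolding power_Suc by presburger
        qed
        ultimately have "l \<in> I (Suc n)" by (simp add: I_def)
        then show "x \<in> W (Suc n)" using xl unfolding W_def by blast
      qed
      moreover have "(\<Union>n. W n) = U"
      proof
        show "(\<Union>n. W n) \<subseteq> U" using WU by blast
        show "U \<subseteq> (\<Union>n. W n)"
        proof
          fix x assume "x \<in> U"
          then obtain r where r: "r > 0" "ball x r \<subseteq> U" using U(1) open_contains_ball by blast
          have "(\<lambda>n. (1/2::real)^n) \<longlonglongrightarrow> 0" by (rule LIMSEQ_power_zero) auto
          then have "eventually (\<lambda>n. (1/2::real)^n < r) sequentially"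
            using order_tendstoD(2) r(1) by blast
          moreover obtain n0 where n0: "\<bar>x\<bar> + 1 < 2^n0" using real_arch_pow[of 2 "\<bar>x\<bar> + 1"] by auto
          ultimately obtain n where n: "n \<ge> n0" "(1/2::real)^n < r"
            unfolding eventually_sequentially by (meson nle_le)
          define k where "k = \<lceil>x * 2^n\<rceil> - 1"
          have xk: "real_of_int k < x * 2^n" "x * 2^n \<le> k + 1" unfolding k_def by linarith+
          then have xk': "x \<in> {real_of_int k/2^n<..(real_of_int k+1)/2^n}" by (auto simp: field_simps)
          have "{real_of_int k/2^n..(real_of_int k+1)/2^n} \<subseteq> ball x r"
          proof
            fix y assume y: "y \<in> {real_of_int k/2^n..(real_of_int k+1)/2^n}"
            have "(real_of_int k+1)/2^n = real_of_int k/2^n + (1/2)^n" by (simp add: field_simps power_one_over)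
            then have "\<bar>x - y\<bar> \<le> (1/2)^n" using y xk' by auto
            then show "y \<in> ball x r" using n by (simp add: dist_real_def)
          qed
          moreover have "\<bar>k\<bar> \<le> 4^n"
          proof -
            have "\<bar>x * 2^n\<bar> + 1 \<le> (\<bar>x\<bar> + 1) * 2^n" by (simp add: abs_mult algebra_simps)
            also have "\<dots> \<le> 2^n * 2^n"
            proof (rule mult_right_mono)
              have "(2::real)^n0 \<le> 2^n" using n by simp
              then show "\<bar>x\<bar> + 1 \<le> 2^n" using n0 by linarith
            qed simp
            also have "\<dots> = 4^n" by (simp flip: power_mult_distrib)
            finally have "\<bar>real_of_int k\<bar> \<le> 4^n" using xk by linarith
            then have "real_of_int \<bar>k\<bar> \<le> real_of_int (4^n)" by simp
            then show ?thesis unfolding of_int_le_iff .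
          qed
          ultimately have "k \<in> I n" using r by (auto simp: I_def abs_le_iff)
          then show "x \<in> (\<Union>n. W n)" using xk' unfolding W_def by blast
        qed
      qed
      moreover have "(\<lambda>n. emeasure N (W n)) \<longlonglongrightarrow> emeasure N (\<Union>n. W n)"
        by (rule Lim_emeasure_incseq) (use W_meas sets_N \<open>incseq W\<close> in auto)
      ultimately show ?thesis by (intro LIMSEQ_le_const2[of "\<lambda>n. emeasure N (W n)"]) auto
    qed
    then show ?thesis using d by blast
  qed
  have "absolutely_continuous lborel N"
    unfolding absolutely_continuous_def
  proof
    fix A :: "real set" assume A: "A \<in> null_sets lborel"
    then have [measurable]: "A \<in> sets borel" by auto
    have le: "emeasure N A \<le> ennreal e" if e: "e > 0" for e :: real
    proof -
      obtain d where d: "d > 0" "\<And>U. open U \<Longrightarrow> emeasure lborel U < ennreal d \<Longrightarrow> emeasure N U \<le> ennreal e"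
        using small[OF e] by blast
      obtain U where U: "open U" "A \<subseteq> U" "emeasure lborel (U - A) < ennreal d"
        using outer_regular_lborel[OF _ d(1), of A] by auto
      have "emeasure lborel U = emeasure lborel (U - A)"
        using emeasure_Diff_null_set[OF A, of U] U(1) by simp
      then have "emeasure N U \<le> ennreal e" using d(2) U by simp
      moreover have "emeasure N A \<le> emeasure N U" using U sets_N by (intro emeasure_mono) auto
      ultimately show ?thesis by (rule order_trans[rotated])
    qed
    have "emeasure N A \<le> 0" by (rule ennreal_le_epsilon) (simp add: le)
    then have "emeasure N A = 0" by simp
    then show "A \<in> null_sets N" by (simp add: null_sets_def sets_N)
  qed
  then obtain h where h[measurable]: "h \<in> borel_measurable lborel" and hN: "density lborel h = N"
    using sigma_finite_measure.Radon_Nikodym[OF sigma_finite_lborel _ , of N] sets_N by auto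
  have h_Ioc: "(\<integral>\<^sup>+t. h t * indicator {x<..y} t \<partial>lborel) = ennreal (F y - F x)"
    if "a \<le> x" "x \<le> y" "y \<le> b" for x y
  proof -
    have "ennreal (F y - F x) = emeasure N {x<..y}" using that N_Ioc[of x y] by (simp add: G_def c_id)
    also have "\<dots> = (\<integral>\<^sup>+t. h t * indicator {x<..y} t \<partial>lborel)"
      unfolding hN[symmetric] by (rule emeasure_density) auto
    finally show ?thesis ..
  qed
  \<comment> \<open>Restricted to ]a, b] the density has the finite integral F b - F a; it is
    therefore finite almost everywhere, and \<open>enn2real\<close> changes it only on a null
    set.\<close>
  define h' where "h' t = h t * indicator {a<..b} t" for t
  have h'm[measurable]: "h' \<in> borel_measurable borel" unfolding h'_def using h by simp
  have h'_int: "(\<integral>\<^sup>+t. h' t \<partial>lborel) = ennreal (F b - F a)"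
    unfolding h'_def using h_Ioc[of a b] ab by simp
  have fin: "AE t in lborel. h' t \<noteq> \<infinity>"
    by (rule nn_integral_PInf_AE) (use h'_int in auto)
  define g where "g t = enn2real (h' t)" for t
  have g_h: "AE t in lborel. ennreal (g t) = h' t"
    using fin by eventually_elim (auto simp: g_def less_top)
  have gm[measurable]: "g \<in> borel_measurable borel" unfolding g_def by measurable
  have g0: "0 \<le> g t" for t by (simp add: g_def)
  have "(\<integral>\<^sup>+t. ennreal (g t) \<partial>lborel) = ennreal (F b - F a)"
    using nn_integral_cong_AE[OF g_h] h'_int by simp
  then have gi: "integrable lborel g" by (intro integrableI_nonneg) (auto simp: g0)
  have "(LINT t:{x..y}|lborel. g t) = F y - F x" if xy: "a \<le> x" "x \<le> y" "y \<le> b" for x y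
  proof -
    have "(LINT t:{x..y}|lborel. g t) = enn2real (\<integral>\<^sup>+t. ennreal (indicator {x..y} t *\<^sub>R g t) \<partial>lborel)"
      unfolding set_lebesgue_integral_def by (rule integral_eq_nn_integral) (auto simp: g0)
    also have "(\<integral>\<^sup>+t. ennreal (indicator {x..y} t *\<^sub>R g t) \<partial>lborel) = (\<integral>\<^sup>+t. h t * indicator {x<..y} t \<partial>lborel)"
    proof (rule nn_integral_cong_AE)
      have "AE t in lborel. t \<noteq> x" using AE_lborel_singleton by auto
      then show "AE t in lborel. ennreal (indicator {x..y} t *\<^sub>R g t) = h t * indicator {x<..y} t"
        using g_h by eventually_elim (use xy in \<open>auto simp: h'_def indicator_def split: if_splits\<close>)
    qed
    also have "\<dots> = ennreal (F y - F x)" by (rule h_Ioc[OF xy])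
    finally show ?thesis using mono[OF xy] by simp
  qed
  then show ?thesis using gm g0 gi by blast
qed

text \<open>The difference of the densities of the two monotone functions P and P - f, where P is
  \<open>pos_variation f a\<close>.\<close>

lemma abs_continuous_density:
  fixes f :: "real \<Rightarrow> real"
  assumes ac: "abs_continuous_on_interval a b f" and ab: "a \<le> b"
  shows "\<exists>g\<in>borel_measurable borel. integrable lborel g \<and>
    (\<forall>x y. a \<le> x \<longrightarrow> x \<le> y \<longrightarrow> y \<le> b \<longrightarrow> (LINT t:{x..y}|lborel. g t) = f y - f x)"
proof -
  let ?P = "pos_variation f a"
  note P = abs_continuous_pos_variation[OF ac ab]
  obtain g where g: "g \<in> borel_measurable borel" "integrable lborel g"
    "\<And>x y. a \<le> x \<Longrightarrow> x \<le> y \<Longrightarrow> y \<le> b \<Longrightarrow> (LINT t:{x..y}|lborel. g t) = ?P y - ?P x"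
    using monotone_abs_continuous_density[OF P ab pos_variation_mono[OF ac ab]] by blast
  obtain h where h: "h \<in> borel_measurable borel" "integrable lborel h"
    "\<And>x y. a \<le> x \<Longrightarrow> x \<le> y \<Longrightarrow> y \<le> b \<Longrightarrow> (LINT t:{x..y}|lborel. h t) = (?P y - f y) - (?P x - f x)"
    using monotone_abs_continuous_density[OF abs_continuous_diff[OF P ac] ab] pos_variation_increment[OF ac ab]
    by (smt (verit))
  have "(LINT t:{x..y}|lborel. g t - h t) = f y - f x" if "a \<le> x" "x \<le> y" "y \<le> b" for x y
    using that g(3)[OF that] h(3)[OF that]
    by (subst set_integral_diff) (auto simp: set_integrable_def simp del: real_scaleR_def intro!: integrable_mult_indicator g h)
  then show ?thesis using g h by (intro bexI[of _ "\<lambda>t. g t - h t"]) auto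
qed

text \<open>Henstock's lemma bounds the total error over a tagged family of intervals; Vitali's theorem selects such
  a family that covers the set on which the difference quotients stay away from the density.\<close>

lemma negligible_not_differentiable_integral_aux:
  fixes g :: "real \<Rightarrow> real"
  assumes g: "g integrable_on {a..b}" and eta: "\<eta> > 0"
  shows "negligible {x\<in>{a<..<b}. \<forall>d>0. \<exists>c d'. c \<le> x \<and> x \<le> d' \<and> c < d' \<and> d' - c < d \<and> {c..d'} \<subseteq> {a<..<b} \<and>
            \<eta> * (d' - c) < \<bar>(d' - c) * g x - integral {c..d'} g\<bar>}" (is "negligible ?E")
proof (rule negligible_outer[THEN iffD2], intro allI impI)
  fix e :: real assume e: "e > 0"
  \<comment> \<open>The tolerance carries the factor \<eta> because each selected interval
    contributes an error larger than \<eta> times its length; dividing by \<eta> leaves a bound e/2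
    on the total length.\<close>
  obtain \<gamma> where gauge: "gauge \<gamma>"
    and H: "\<And>p. \<lbrakk>p tagged_partial_division_of (cbox a b); \<gamma> fine p\<rbrakk> \<Longrightarrow>
             sum (\<lambda>(x,k). norm(measure lborel k *\<^sub>R g x - integral k g)) p < \<eta> * (e/2)"
    using Henstock_lemma[of g a b "\<eta> * (e/2)"] g eta e by auto
  define K where "K = {(x,c,d'). c \<le> x \<and> x \<le> d' \<and> c < d' \<and> {c..d'} \<subseteq> {a<..<b} \<and> {c..d'} \<subseteq> \<gamma> x \<and>
            \<eta> * (d' - c) < \<bar>(d' - c) * g x - integral {c..d'} g\<bar>}"
  \<comment> \<open>Centre and radius present [c, d'] as a ball, the form in which Vitali's theorem
    selects; the point x is carried along as the tag for Henstock's lemma.\<close>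
  define m where "m = (\<lambda>(x::real,c,d'). (c + d') / (2::real))"
  define r where "r = (\<lambda>(x::real,c,d'). (d' - c) / (2::real))"
  have cb: "cball (m (x,c,d')) (r (x,c,d')) = {c..d'}" for x c d'
    by (auto simp: m_def r_def cball_eq_atLeastAtMost field_simps)
  have rpos: "\<And>i. i \<in> K \<Longrightarrow> 0 < r i" by (auto simp: K_def r_def)
  have cov: "\<exists>i. i \<in> K \<and> x \<in> cball (m i) (r i) \<and> r i < d" if x: "x \<in> ?E" and d: "d > 0" for x d
  proof -
    obtain \<delta> where \<delta>: "\<delta> > 0" "ball x \<delta> \<subseteq> \<gamma> x"
      using gauge unfolding gauge_def by (meson open_contains_ball)
    have "min d \<delta> > 0" using d \<delta> by simp
    then obtain c d' where cd: "c \<le> x" "x \<le> d'" "c < d'" "d' - c < min d \<delta>" "{c..d'} \<subseteq> {a<..<b}"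
            "\<eta> * (d' - c) < \<bar>(d' - c) * g x - integral {c..d'} g\<bar>" using x by blast
    have "{c..d'} \<subseteq> ball x \<delta>" using cd by (auto simp: dist_real_def)
    then have "(x,c,d') \<in> K" using cd \<delta> by (auto simp: K_def)
    moreover have "x \<in> cball (m (x,c,d')) (r (x,c,d'))" unfolding cb using cd by auto
    moreover have "r (x,c,d') < d" using cd by (auto simp: r_def)
    ultimately show ?thesis by blast
  qed
  obtain C where C: "countable C" "C \<subseteq> K"
     and pw: "pairwise (\<lambda>i j. disjnt (cball (m i) (r i)) (cball (m j) (r j))) C"
     and neg: "negligible (?E - (\<Union>i\<in>C. cball (m i) (r i)))"
    using Vitali_covering_theorem_cballs[of K r ?E m, OF rpos cov] by blast
  have fin_le: "(\<Sum>i\<in>D. measure lebesgue (cball (m i) (r i))) \<le> e/2" if D: "finite D" "D \<subseteq> C" for D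
  proof -
    define p where "p = (\<lambda>(x,c,d'). (x, {c..d'})) ` D"
    have inj: "inj_on (\<lambda>(x,c,d'). (x, {c..d'})) D"
      using D C by (auto simp: inj_on_def K_def)
    have tp: "p tagged_partial_division_of cbox a b"
      unfolding tagged_partial_division_of_def
    proof (intro conjI allI impI)
      show "finite p" using D by (simp add: p_def)
      fix x k assume "(x,k) \<in> p"
      then obtain c d' where cd: "(x,c,d') \<in> K" "k = {c..d'}" using D C by (auto simp: p_def)
      then have "{c..d'} \<subseteq> {a<..<b}" "c \<le> x" "x \<le> d'" by (auto simp: K_def)
      then show "x \<in> k" "k \<subseteq> cbox a b" "\<exists>a b. k = cbox a b" unfolding cd(2) by fastforce+
    next
      fix x1 K1 x2 K2 assume as: "(x1,K1) \<in> p \<and> (x2,K2) \<in> p \<and> (x1,K1) \<noteq> (x2,K2)"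
      then obtain c1 d1 c2 d2 where cd: "(x1,c1,d1) \<in> D" "K1 = {c1..d1}" "(x2,c2,d2) \<in> D" "K2 = {c2..d2}"
        by (auto simp: p_def)
      then have "(x1,c1,d1) \<noteq> (x2,c2,d2)" using as by auto
      then have "disjnt {c1..d1} {c2..d2}"
        using pw cd D unfolding pairwise_def cb[symmetric, of _ _ x1] cb[symmetric, of _ _ x2] by (metis cb subsetD)
      then show "interior K1 \<inter> interior K2 = {}"
        unfolding cd disjnt_def using interior_subset by blast
    qed
    have fine: "\<gamma> fine p" unfolding fine_def p_def using D C by (auto simp: K_def)
    have le: "(\<Sum>i\<in>D. \<eta> * measure lebesgue (cball (m i) (r i))) \<le> (\<Sum>i\<in>D. case i of (x,c,d') \<Rightarrow> norm (measure lborel {c..d'} *\<^sub>R g x - integral {c..d'} g))"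
    proof (rule sum_mono)
      fix i assume i: "i \<in> D"
      obtain x c d' where eq: "i = (x,c,d')" by (cases i)
      have "(x,c,d') \<in> K" using i eq D C by auto
      then show "\<eta> * measure lebesgue (cball (m i) (r i)) \<le> (case i of (x,c,d') \<Rightarrow> norm (measure lborel {c..d'} *\<^sub>R g x - integral {c..d'} g))"
        unfolding eq cb by (auto simp: K_def)
    qed
    also have "\<dots> = (\<Sum>(x,k)\<in>p. norm (measure lborel k *\<^sub>R g x - integral k g))"
      unfolding p_def by (subst sum.reindex[OF inj]) (auto intro!: sum.cong)
    also have "\<dots> < \<eta> * (e/2)" by (rule H[OF tp fine])
    finally have "\<eta> * (\<Sum>i\<in>D. measure lebesgue (cball (m i) (r i))) < \<eta> * (e/2)" by (simp add: sum_distrib_left)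
    then show ?thesis using eta by simp
  qed
  define V where "V = (\<Union>i\<in>C. cball (m i) (r i))"
  have le: "measure lebesgue (\<Union>i\<in>I'. cball (m i) (r i)) \<le> e/2" if I': "I' \<subseteq> C" "finite I'" for I'
  proof -
    have "measure lebesgue (\<Union>i\<in>I'. cball (m i) (r i)) \<le> (\<Sum>i\<in>I'. measure lebesgue (cball (m i) (r i)))"
      by (rule measure_UNION_le) (use I' in auto)
    then show ?thesis using fin_le[of I'] I' by simp
  qed
  have Vm: "V \<in> lmeasurable \<and> measure lebesgue V \<le> e/2"
    unfolding V_def by (intro conjI fmeasurable_UN_bound[OF C(1) _ le] measure_UN_bound[OF C(1) _ le]) auto
  have "?E \<subseteq> V \<union> (?E - V)" by blast
  moreover have "V \<union> (?E - V) \<in> lmeasurable"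
    using Vm neg negligible_imp_measurable unfolding V_def by blast
  moreover have "measure lebesgue (V \<union> (?E - V)) < e"
  proof -
    have "measure lebesgue (V \<union> (?E - V)) \<le> measure lebesgue V + measure lebesgue (?E - V)"
      by (rule measure_Un_le) (use Vm neg negligible_imp_measurable in \<open>auto simp: V_def fmeasurable_def\<close>)
    also have "measure lebesgue (?E - V) = 0" using neg negligible_imp_measure0 unfolding V_def by blast
    finally show ?thesis using Vm e by simp
  qed
  ultimately show "\<exists>T. ?E \<subseteq> T \<and> T \<in> lmeasurable \<and> measure lebesgue T < e" by blast
qed

text \<open>The points that fail at accuracy 1/(n+1) form a null set for each n, and a point that
  fails for no n is a point of differentiability. Since x may be either endpoint of the test
  interval, difference quotients from both sides are controlled.\<close>

lemma negligible_not_differentiable_integral: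
  fixes g :: "real \<Rightarrow> real"
  assumes g: "g integrable_on {a..b}"
  shows "negligible {x\<in>{a<..<b}. \<not> ((\<lambda>t. integral {a..t} g) has_vector_derivative g x) (at x)}"
proof -
  define E where "E n = {x\<in>{a<..<b}. \<forall>d>0. \<exists>c d'. c \<le> x \<and> x \<le> d' \<and> c < d' \<and> d' - c < d \<and> {c..d'} \<subseteq> {a<..<b} \<and>
            (1 / real (Suc n)) * (d' - c) < \<bar>(d' - c) * g x - integral {c..d'} g\<bar>}" for n
  have "negligible (E n)" for n
    unfolding E_def by (rule negligible_not_differentiable_integral_aux[OF g]) simp
  then have "negligible (\<Union>n. E n)" by (intro negligible_countable_Union) auto
  moreover have "{x\<in>{a<..<b}. \<not> ((\<lambda>t. integral {a..t} g) has_vector_derivative g x) (at x)} \<subseteq> (\<Union>n. E n)"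
  proof (rule subsetI, rule ccontr)
    fix x assume x: "x \<in> {x\<in>{a<..<b}. \<not> ((\<lambda>t. integral {a..t} g) has_vector_derivative g x) (at x)}" and nE: "x \<notin> (\<Union>n. E n)"
    have ax: "a < x" "x < b" using x by auto
    have split: "integral {a..d'} g - integral {a..c} g = integral {c..d'} g" if "a \<le> c" "c \<le> d'" "d' \<le> b" for c d'
    proof -
      have "g integrable_on {a..d'}" using g that by (auto intro: integrable_on_subinterval)
      then show ?thesis using Henstock_Kurzweil_Integration.integral_combine[of a c d' g] that by simp
    qed
    have "((\<lambda>t. integral {a..t} g) has_vector_derivative g x) (at x)"
      unfolding has_vector_derivative_def has_derivative_at_alt
    proof (intro conjI allI impI)
      show "bounded_linear (\<lambda>xa. xa *\<^sub>R g x)" by (rule bounded_linear_scaleR_left)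
      fix e :: real assume e: "e > 0"
      obtain n where n: "1 / real (Suc n) < e" using e nat_approx_posE by blast
      have "x \<notin> E n" using nE by blast
      then obtain d where d: "d > 0" and D: "\<And>c d'. c \<le> x \<Longrightarrow> x \<le> d' \<Longrightarrow> c < d' \<Longrightarrow> d' - c < d \<Longrightarrow> {c..d'} \<subseteq> {a<..<b} \<Longrightarrow>
            \<bar>(d' - c) * g x - integral {c..d'} g\<bar> \<le> (1 / real (Suc n)) * (d' - c)"
        using ax unfolding E_def mem_Collect_eq not_less[symmetric] by simp blast
      define d0 where "d0 = min d (min (x - a) (b - x))"
      have "norm (integral {a..y} g - integral {a..x} g - (y - x) *\<^sub>R g x) \<le> e * norm (y - x)" if y: "norm (y - x) < d0" for y
      proof (cases "y = x")
        case False
        then consider "y < x" | "x < y" by linarith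
        then show ?thesis
        proof cases
          case 1
          have y': "d0 \<le> d" "d0 \<le> x - a" "d0 \<le> b - x" "x - y < d0" using y 1 by (auto simp: d0_def)
          have "\<bar>(x - y) * g x - integral {y..x} g\<bar> \<le> (1 / real (Suc n)) * (x - y)"
            by (rule D) (use 1 y' ax in auto)
          also have "\<dots> \<le> e * (x - y)" by (rule mult_right_mono) (use n 1 in auto)
          finally have "\<bar>(x - y) * g x - integral {y..x} g\<bar> \<le> e * (x - y)" .
          moreover have "integral {a..x} g - integral {a..y} g = integral {y..x} g"
            by (rule split) (use y' 1 ax in auto)
          moreover have "(y - x) * g x = - ((x - y) * g x)" by (simp add: algebra_simps)
          ultimately show ?thesis using 1 by simp
        next
          case 2
          have y': "d0 \<le> d" "d0 \<le> x - a" "d0 \<le> b - x" "y - x < d0" using y 2 by (auto simp: d0_def)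
          have "\<bar>(y - x) * g x - integral {x..y} g\<bar> \<le> (1 / real (Suc n)) * (y - x)"
            by (rule D) (use 2 y' ax in auto)
          also have "\<dots> \<le> e * (y - x)" by (rule mult_right_mono) (use n 2 in auto)
          finally have "\<bar>(y - x) * g x - integral {x..y} g\<bar> \<le> e * (y - x)" .
          moreover have "integral {a..y} g - integral {a..x} g = integral {x..y} g"
            by (rule split) (use y' 2 ax in auto)
          ultimately show ?thesis using 2 by simp
        qed
      qed simp
      moreover have "d0 > 0" using d ax by (simp add: d0_def)
      ultimately show "\<exists>d>0. \<forall>y. norm (y - x) < d \<longrightarrow> norm (integral {a..y} g - integral {a..x} g - (y - x) *\<^sub>R g x) \<le> e * norm (y - x)"
        by blast
    qed
    then show False using x by simp
  qed
  ultimately show ?thesis by (rule negligible_subset)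
qed

text \<open>Off a null set the indefinite integral of the density of each component is
  differentiable with the expected derivative, so \<open>dot\<close> agrees there with the density.
  On the null set \<open>dot\<close> is arbitrary, which is harmless for the complete measure
  \<open>lebesgue\<close>.\<close>

theorem abs_continuous_FTC:
  fixes f :: "real \<Rightarrow> real^'k"
  assumes ac: "abs_continuous_on_interval 0 T f" and T: "0 \<le> T"
  shows "set_integrable lebesgue {0..T} (\<lambda>s. dot T f s $ l)"
    and "0 \<le> u \<Longrightarrow> u \<le> v \<Longrightarrow> v \<le> T \<Longrightarrow> (LINT s:{u..v}|lebesgue. dot T f s $ l) = f v $ l - f u $ l"
proof -
  have ac_l: "abs_continuous_on_interval 0 T (\<lambda>s. f s $ l)" for l
    unfolding abs_continuous_on_interval_def
  proof (intro allI impI)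
    fix e :: real assume "e > 0"
    then obtain d where d: "d > 0" and D: "\<And>(I :: nat set) u v. interval_family 0 T I u v \<Longrightarrow> (\<Sum>i\<in>I. v i - u i) < d
     \<Longrightarrow> (\<Sum>i\<in>I. norm (f (v i) - f (u i))) < e"
      by (rule abs_continuous_on_intervalE[OF ac]) blast
    have "(\<Sum>i<m. norm (f (v i) $ l - f (u i) $ l)) < e"
      if uv: "\<forall>i<m. 0 \<le> u i \<and> u i \<le> v i \<and> v i \<le> T" "disjoint_family_on (\<lambda>i. {u i<..<v i}) {..<m}"
        "(\<Sum>i<m. v i - u i) < d" for m :: nat and u v
    proof -
      have "(\<Sum>i<m. norm (f (v i) $ l - f (u i) $ l)) \<le> (\<Sum>i<m. norm (f (v i) - f (u i)))"
      proof (rule sum_mono)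
        fix i show "norm (f (v i) $ l - f (u i) $ l) \<le> norm (f (v i) - f (u i))"
          using component_le_norm_cart[of "f (v i) - f (u i)" l] by simp
      qed
      also have "\<dots> < e" by (rule D) (use uv in \<open>auto simp: interval_family_def\<close>)
      finally show ?thesis .
    qed
    then show "\<exists>\<delta>>0. \<forall>(m::nat) u v. (\<forall>i<m. 0 \<le> u i \<and> u i \<le> v i \<and> v i \<le> T) \<longrightarrow>
       disjoint_family_on (\<lambda>i. {u i<..<v i}) {..<m} \<longrightarrow> (\<Sum>i<m. v i - u i) < \<delta> \<longrightarrow>
       (\<Sum>i<m. norm (f (v i) $ l - f (u i) $ l)) < e" using d by blast
  qed
  have "\<exists>g. g \<in> borel_measurable borel \<and> integrable lborel g \<and>
    (\<forall>x y. 0 \<le> x \<longrightarrow> x \<le> y \<longrightarrow> y \<le> T \<longrightarrow> (LINT t:{x..y}|lborel. g t) = f y $ l - f x $ l)" for l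
    using abs_continuous_density[OF ac_l T] by blast
  then obtain g where gm: "\<And>l. g l \<in> borel_measurable borel" and gi: "\<And>l. integrable lborel (g l)"
    and g: "\<And>l x y. 0 \<le> x \<Longrightarrow> x \<le> y \<Longrightarrow> y \<le> T \<Longrightarrow> (LINT t:{x..y}|lborel. g l t) = f y $ l - f x $ l"
    by metis
  have gsi: "set_integrable lborel {x..y} (g l)" for l x y
    unfolding set_integrable_def by (intro integrable_mult_indicator gi) auto
  have ginteg: "g l integrable_on {x..y}" and gint: "integral {x..y} (g l) = (LINT t:{x..y}|lborel. g l t)" for l x y
    using set_borel_integral_eq_integral[OF gsi[of x y l]] by auto
  \<comment> \<open>The endpoints are discarded as well, so that the derivative relative to [0, T]
    comes from a two-sided one.\<close>
  define E where "E = (\<Union>l. {x\<in>{0<..<T}. \<not> ((\<lambda>t. integral {0..t} (g l)) has_vector_derivative g l x) (at x)}) \<union> {0, T}"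
  have negE: "negligible E"
  proof -
    have "negligible {x\<in>{0<..<T}. \<not> ((\<lambda>t. integral {0..t} (g l)) has_vector_derivative g l x) (at x)}" for l
      by (rule negligible_not_differentiable_integral[OF ginteg])
    then show ?thesis unfolding E_def by (intro negligible_Un negligible_Union) auto
  qed
  have dot_eq: "dot T f s $ l = g l s" if s: "s \<in> {0..T}" "s \<notin> E" for s l
  proof -
    have s': "0 < s" "s < T" using s by (auto simp: E_def less_eq_real_def)
    have "((\<lambda>t. f t $ l) has_vector_derivative g l s) (at s)" for l
    proof -
      have "((\<lambda>t. integral {0..t} (g l)) has_vector_derivative g l s) (at s)" using s s' by (auto simp: E_def)
      then have "((\<lambda>t. integral {0..t} (g l) + f 0 $ l) has_vector_derivative g l s) (at s)"
        by (simp only: has_vector_derivative_add_const)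
      then show ?thesis
      proof (rule has_vector_derivative_transform_within_open[where S = "{0<..<T}"])
        show "integral {0..t} (g l) + f 0 $ l = f t $ l" if "t \<in> {0<..<T}" for t
          using g[of 0 t l] that by (simp add: gint)
      qed (use s' in auto)
    qed
    then have "(f has_vector_derivative (\<chi> l. g l s)) (at s)"
      unfolding has_vector_derivative_def
      by (subst has_derivative_componentwise_within) (auto simp: Basis_vec_def inner_axis axis_eq_axis has_vector_derivative_def)
    then have "(f has_vector_derivative (\<chi> l. g l s)) (at s within {0..T})" by (rule has_vector_derivative_at_within)
    then have "vector_derivative f (at s within {0..T}) = (\<chi> l. g l s)"
      by (rule vector_derivative_within_cbox[of 0 T s f, rotated 2, unfolded cbox_interval]) (use s s' in auto)
    then show ?thesis by (simp add: dot_def)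
  qed
  have AE_eq: "AE s in lebesgue. s \<in> {0..T} \<longrightarrow> dot T f s $ l = g l s" for l
  proof -
    have "E \<in> null_sets lebesgue" using negE by (simp add: negligible_iff_null_sets)
    then have "AE s in lebesgue. s \<notin> E" by (rule AE_not_in)
    then show ?thesis by eventually_elim (use dot_eq in auto)
  qed
  have gleb: "g l \<in> borel_measurable lebesgue" for l using gm by (simp add: borel_measurable_if_D measurable_completion)
  have gil: "set_integrable lebesgue {x..y} (g l)" for x y l
    unfolding set_integrable_def using gsi[of x y l, unfolded set_integrable_def] by (subst integrable_completion) auto
  have meas: "set_borel_measurable lebesgue {0..T} (\<lambda>s. dot T f s $ l)"
    unfolding set_borel_measurable_def
  proof (rule borel_measurable_AE)
    show "(\<lambda>s. indicator {0..T} s *\<^sub>R g l s) \<in> borel_measurable lebesgue"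
      using gil[of 0 T l] unfolding set_integrable_def by (rule borel_measurable_integrable)
    show "AE s in lebesgue. indicator {0..T} s *\<^sub>R g l s = indicator {0..T} s *\<^sub>R dot T f s $ l"
      using AE_eq[of l] by eventually_elim (auto simp: indicator_def)
  qed
  show *: "set_integrable lebesgue {0..T} (\<lambda>s. dot T f s $ l)"
    unfolding set_integrable_def
  proof (rule integrable_cong_AE_imp)
    show "integrable lebesgue (\<lambda>s. indicator {0..T} s *\<^sub>R g l s)" using gil[of 0 T l] by (simp add: set_integrable_def)
    show "(\<lambda>s. indicator {0..T} s *\<^sub>R dot T f s $ l) \<in> borel_measurable lebesgue" using meas by (simp add: set_borel_measurable_def)
    show "AE s in lebesgue. indicator {0..T} s *\<^sub>R g l s = indicator {0..T} s *\<^sub>R dot T f s $ l"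
      using AE_eq[of l] by eventually_elim (auto simp: indicator_def)
  qed
  assume uv: "0 \<le> u" "u \<le> v" "v \<le> T"
  have sub: "set_integrable lebesgue {u..v} (\<lambda>s. dot T f s $ l)"
    by (rule set_integrable_subset[OF *]) (use uv in auto)
  have "(LINT s:{u..v}|lebesgue. dot T f s $ l) = (LINT s:{u..v}|lebesgue. g l s)"
    unfolding set_lebesgue_integral_def
  proof (rule integral_cong_AE)
    show "(\<lambda>s. indicator {u..v} s *\<^sub>R dot T f s $ l) \<in> borel_measurable lebesgue"
      using sub unfolding set_integrable_def by (rule borel_measurable_integrable)
    show "(\<lambda>s. indicator {u..v} s *\<^sub>R g l s) \<in> borel_measurable lebesgue"
      using gil[of u v l] unfolding set_integrable_def by (rule borel_measurable_integrable)
    show "AE s in lebesgue. indicator {u..v} s *\<^sub>R dot T f s $ l = indicator {u..v} s *\<^sub>R g l s"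
      using AE_eq[of l] by eventually_elim (use uv in \<open>auto simp: indicator_def\<close>)
  qed
  also have "\<dots> = (LINT s:{u..v}|lborel. g l s)"
    unfolding set_lebesgue_integral_def using gm by (subst integral_completion) auto
  also have "\<dots> = f v $ l - f u $ l" by (rule g[OF uv])
  finally show "(LINT s:{u..v}|lebesgue. dot T f s $ l) = f v $ l - f u $ l" .
qed

subsection \<open>Exponential martingales of Brownian motion\<close>

text \<open>Completing the square: the tilted density is the normal density with mean c * \<sigma>^2
  and unchanged variance.\<close>

lemma nn_integral_exp_normal:
  assumes "0 < \<sigma>"
  shows "(\<integral>\<^sup>+x. ennreal (normal_density 0 \<sigma> x) * ennreal (exp (c * x - c\<^sup>2 * \<sigma>\<^sup>2 / 2)) \<partial>lborel) = 1"
proof -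
  have "normal_density 0 \<sigma> x * exp (c * x - c\<^sup>2 * \<sigma>\<^sup>2 / 2) = normal_density (c * \<sigma>\<^sup>2) \<sigma> x" for x
  proof -
    have "- ((x - 0)\<^sup>2 / (2 * \<sigma>\<^sup>2)) + (c * x - c\<^sup>2 * \<sigma>\<^sup>2 / 2) = - ((x - c * \<sigma>\<^sup>2)\<^sup>2 / (2 * \<sigma>\<^sup>2))"
      using assms by (simp add: field_simps power2_eq_square)
    then show ?thesis unfolding normal_density_def by (simp flip: exp_add)
  qed
  then have "(\<integral>\<^sup>+x. ennreal (normal_density 0 \<sigma> x) * ennreal (exp (c * x - c\<^sup>2 * \<sigma>\<^sup>2 / 2)) \<partial>lborel)
    = (\<integral>\<^sup>+x. ennreal (normal_density (c * \<sigma>\<^sup>2) \<sigma> x) \<partial>lborel)"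
    by (simp flip: ennreal_mult)
  also have "\<dots> = ennreal (\<integral>x. normal_density (c * \<sigma>\<^sup>2) \<sigma> x \<partial>lborel)"
    by (rule nn_integral_eq_integral) (use assms in auto)
  also have "\<dots> = 1" using assms by simp
  finally show ?thesis .
qed

lemma (in prob_space) indep_set_mono:
  "indep_set A B \<Longrightarrow> A' \<subseteq> A \<Longrightarrow> B' \<subseteq> B \<Longrightarrow> indep_set A' B'"
  unfolding indep_set_def by (elim indep_sets_mono_sets) (auto split: bool.split)

text \<open>Independence turns the expectation into an iterated integral in which c and X are
  constants; the inner Gaussian integral equals 1 whatever the value of c.\<close>

lemma (in prob_space) exp_martingale_step:
  fixes X :: "'a \<Rightarrow> ennreal" and c D :: "'a \<Rightarrow> real"
  assumes F: "sets F \<subseteq> events" "space F = space M"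
    and ind: "indep_set (sets F) (sigma_sets (space M) {D -` A \<inter> space M |A. A \<in> sets borel})"
    and D: "distributed M lborel D (normal_density 0 (sqrt \<delta>))" and \<delta>: "\<delta> > 0"
    and c: "c \<in> borel_measurable F" and X: "X \<in> borel_measurable F"
  shows "(\<integral>\<^sup>+\<omega>. X \<omega> * ennreal (exp (c \<omega> * D \<omega> - (c \<omega>)\<^sup>2 * \<delta> / 2)) \<partial>M) = (\<integral>\<^sup>+\<omega>. X \<omega> \<partial>M)"
proof -
  have sub: "subalgebra M F" using F by (simp add: subalgebra_def)
  have [measurable]: "c \<in> borel_measurable M" "X \<in> borel_measurable M"
    using measurable_from_subalg[OF sub] c X by auto
  have Dm[measurable]: "D \<in> borel_measurable M" using distributed_measurable[OF D] by simp
  define P where "P = (borel \<Otimes>\<^sub>M borel :: (ennreal \<times> real) measure)"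
  have cX: "(\<lambda>\<omega>. (X \<omega>, c \<omega>)) \<in> measurable F P" unfolding P_def using c X by measurable
  have cXM[measurable]: "(\<lambda>\<omega>. (X \<omega>, c \<omega>)) \<in> measurable M P" unfolding P_def by measurable
  \<comment> \<open>The dummy first component gives the increment the same type as the pair (X, c),
    as \<open>indep_var\<close> demands.\<close>
  define D' where "D' \<omega> = (0 :: ennreal, D \<omega>)" for \<omega>
  have D'm[measurable]: "D' \<in> measurable M P" unfolding P_def D'_def by measurable
  have "indep_var P (\<lambda>\<omega>. (X \<omega>, c \<omega>)) P D'"
    unfolding indep_var_eq
  proof (intro conjI cXM D'm)
    have 1: "sigma_sets (space M) {(\<lambda>\<omega>. (X \<omega>, c \<omega>)) -` A \<inter> space M |A. A \<in> sets P} \<subseteq> sets F"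
      using measurable_sets[OF cX] unfolding F(2)[symmetric] by (intro sets.sigma_sets_subset) auto
    have 2: "sigma_sets (space M) {D' -` A \<inter> space M |A. A \<in> sets P} \<subseteq> sigma_sets (space M) {D -` A \<inter> space M |A. A \<in> sets borel}"
    proof (rule sigma_sets_mono', clarify)
      fix A assume A: "A \<in> sets P"
      have "Pair 0 \<in> measurable borel P" unfolding P_def by measurable
      from measurable_sets[OF this A] have "Pair 0 -` A \<in> sets (borel :: real measure)" by simp
      then show "\<exists>B. D' -` A \<inter> space M = D -` B \<inter> space M \<and> B \<in> sets borel"
        by (intro exI[of _ "Pair 0 -` A"]) (auto simp: D'_def)
    qed
    show "indep_set (sigma_sets (space M) {(\<lambda>\<omega>. (X \<omega>, c \<omega>)) -` A \<inter> space M |A. A \<in> sets P})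
      (sigma_sets (space M) {D' -` A \<inter> space M |A. A \<in> sets P})"
      by (rule indep_set_mono[OF ind 1 2])
  qed
  then have prod: "distr M P (\<lambda>\<omega>. (X \<omega>, c \<omega>)) \<Otimes>\<^sub>M distr M P D' = distr M (P \<Otimes>\<^sub>M P) (\<lambda>\<omega>. ((X \<omega>, c \<omega>), D' \<omega>))"
    by (simp add: indep_var_distribution_eq)
  define f :: "(ennreal \<times> real) \<times> (ennreal \<times> real) \<Rightarrow> ennreal" where
    "f z = fst (fst z) * ennreal (exp (snd (fst z) * snd (snd z) - (snd (fst z))\<^sup>2 * \<delta> / 2))" for z
  have fm[measurable]: "f \<in> borel_measurable (P \<Otimes>\<^sub>M P)" unfolding f_def P_def by measurable
  have fm': "f \<in> borel_measurable (distr M P (\<lambda>\<omega>. (X \<omega>, c \<omega>)) \<Otimes>\<^sub>M distr M P D')"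
    using fm by (simp cong: measurable_cong_sets)
  interpret D: prob_space "distr M P D'" by (rule prob_space_distr) simp
  have "(\<integral>\<^sup>+\<omega>. X \<omega> * ennreal (exp (c \<omega> * D \<omega> - (c \<omega>)\<^sup>2 * \<delta> / 2)) \<partial>M) = (\<integral>\<^sup>+\<omega>. f ((X \<omega>, c \<omega>), D' \<omega>) \<partial>M)"
    by (simp add: f_def D'_def)
  also have "\<dots> = (\<integral>\<^sup>+z. f z \<partial>distr M (P \<Otimes>\<^sub>M P) (\<lambda>\<omega>. ((X \<omega>, c \<omega>), D' \<omega>)))"
    by (subst nn_integral_distr) auto
  also have "\<dots> = (\<integral>\<^sup>+z. \<integral>\<^sup>+d. f (z, d) \<partial>distr M P D' \<partial>distr M P (\<lambda>\<omega>. (X \<omega>, c \<omega>)))"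
    unfolding prod[symmetric] by (rule D.nn_integral_fst[OF fm', symmetric])
  also have "\<dots> = (\<integral>\<^sup>+z. fst z \<partial>distr M P (\<lambda>\<omega>. (X \<omega>, c \<omega>)))"
  proof (rule nn_integral_cong)
    fix z :: "ennreal \<times> real"
    obtain x k where z: "z = (x, k)" by (cases z)
    have zP: "z \<in> space P" by (simp add: P_def space_pair_measure)
    have "(\<lambda>d. f (z, d)) \<in> borel_measurable P" using measurable_Pair2[OF fm zP] .
    then have "(\<integral>\<^sup>+d. f (z, d) \<partial>distr M P D') = (\<integral>\<^sup>+d. x * ennreal (exp (k * D d - k\<^sup>2 * \<delta> / 2)) \<partial>M)"
      by (subst nn_integral_distr) (auto simp: z f_def D'_def)
    also have "\<dots> = x * (\<integral>\<^sup>+d. ennreal (exp (k * D d - k\<^sup>2 * \<delta> / 2)) \<partial>M)"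
      by (rule nn_integral_cmult) auto
    also have "(\<integral>\<^sup>+d. ennreal (exp (k * D d - k\<^sup>2 * \<delta> / 2)) \<partial>M)
      = (\<integral>\<^sup>+d. ennreal (normal_density 0 (sqrt \<delta>) d) * ennreal (exp (k * d - k\<^sup>2 * \<delta> / 2)) \<partial>lborel)"
      by (rule distributed_nn_integral[OF D, symmetric]) auto
    also have "\<dots> = 1" using nn_integral_exp_normal[of "sqrt \<delta>" k] \<delta> by simp
    finally show "(\<integral>\<^sup>+d. f (z, d) \<partial>distr M P D') = fst z" by (simp add: z)
  qed
  also have "\<dots> = (\<integral>\<^sup>+\<omega>. X \<omega> \<partial>M)"
    by (subst nn_integral_distr) (auto simp: P_def)
  finally show ?thesis .
qed

section \<open>Time grids, histories and independent families of Brownian motions\<close>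

definition grid :: "real set \<Rightarrow> nat \<Rightarrow> real" where
  "grid P i = sorted_list_of_set P ! i"

lemma grid_mem: "finite P \<Longrightarrow> i < card P \<Longrightarrow> grid P i \<in> P"
  unfolding grid_def by (metis nth_mem length_sorted_list_of_set set_sorted_list_of_set)

lemma grid_less: "finite P \<Longrightarrow> i < j \<Longrightarrow> j < card P \<Longrightarrow> grid P i < grid P j"
  unfolding grid_def using strict_sorted_list_of_set[of P] by (simp add: sorted_wrt_iff_nth_less)

lemma grid_less_iff: "finite P \<Longrightarrow> i < card P \<Longrightarrow> j < card P \<Longrightarrow> grid P i < grid P j \<longleftrightarrow> i < j"
  by (metis grid_less less_asym linorder_neqE_nat less_irrefl)

lemma grid_le_iff: "finite P \<Longrightarrow> i < card P \<Longrightarrow> j < card P \<Longrightarrow> grid P i \<le> grid P j \<longleftrightarrow> i \<le> j"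
  by (metis grid_less_iff not_less)

lemma grid_surj: "finite P \<Longrightarrow> p \<in> P \<Longrightarrow> \<exists>i<card P. grid P i = p"
  unfolding grid_def by (metis in_set_conv_nth length_sorted_list_of_set set_sorted_list_of_set)

lemma grid_Max: "finite P \<Longrightarrow> p \<in> P \<Longrightarrow> (\<And>q. q \<in> P \<Longrightarrow> q \<le> p) \<Longrightarrow> grid P (card P - 1) = p"
  by (metis Suc_pred' card_gt_0_iff empty_iff grid_le_iff grid_mem grid_surj le_antisym less_Suc_eq_le lessI)

lemma grid_Min: "finite P \<Longrightarrow> p \<in> P \<Longrightarrow> (\<And>q. q \<in> P \<Longrightarrow> p \<le> q) \<Longrightarrow> grid P 0 = p"
  by (metis card_gt_0_iff empty_iff grid_le_iff grid_mem grid_surj le_antisym zero_le)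

text \<open>Each component q has its own time horizon \<open>s q\<close>. This allows conditioning
  on all of \<open>B\<close> up to time T together with only a part of \<open>W\<close>.\<close>

definition hist :: "'w measure \<Rightarrow> ('q \<Rightarrow> real \<Rightarrow> 'w \<Rightarrow> real) \<Rightarrow> ('q \<Rightarrow> real) \<Rightarrow> 'w measure" where
  "hist M X s = sigma (space M) {X q u -` A \<inter> space M | q u A. 0 \<le> u \<and> u \<le> s q \<and> A \<in> sets borel}"

lemma space_hist[simp]: "space (hist M X s) = space M"
  unfolding hist_def by (rule space_measure_of) auto

lemma sets_hist: "sets (hist M X s) = sigma_sets (space M) {X q u -` A \<inter> space M | q u A. 0 \<le> u \<and> u \<le> s q \<and> A \<in> sets borel}"
  unfolding hist_def by (rule sets_measure_of) auto

lemma hist_mono: "(\<And>q. s q \<le> s' q) \<Longrightarrow> sets (hist M X s) \<subseteq> sets (hist M X s')"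
  unfolding sets_hist by (rule sigma_sets_mono') (blast intro: order_trans)

lemma measurable_hist: "0 \<le> u \<Longrightarrow> u \<le> s q \<Longrightarrow> X q u \<in> borel_measurable (hist M X s)"
  by (rule measurableI) (auto simp: sets_hist intro!: sigma_sets.Basic)

lemma measurable_hist_mono:
  "f \<in> measurable (hist M X s) N \<Longrightarrow> (\<And>q. s q \<le> s' q) \<Longrightarrow> f \<in> measurable (hist M X s') N"
  using measurable_mono[of N N "hist M X s" "hist M X s'"] hist_mono[of s s' M X] by auto

lemma hist_subset_iff:
  assumes "space N = space M" "\<And>q u. 0 \<le> u \<Longrightarrow> u \<le> s q \<Longrightarrow> X q u \<in> borel_measurable N"
  shows "sets (hist M X s) \<subseteq> sets N"
  unfolding sets_hist assms(1)[symmetric]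
  by (rule sets.sigma_sets_subset) (use measurable_sets[OF assms(2)] in auto)

text \<open>As the index type is finite and any \<open>E q\<close> may be the whole space, the
  single product formula over all components expresses their independence.\<close>

locale bm_family = prob_space M for M :: "'w measure" +
  fixes T :: real and X :: "'q::finite \<Rightarrow> real \<Rightarrow> 'w \<Rightarrow> real"
  assumes T_pos: "0 < T"
    and bm: "\<And>q. brownian_motion1 M T (X q)"
    and family_indep: "\<And>E. (\<And>q. E q \<in> sigma_sets (space M) {X q u -` A \<inter> space M | u A. 0 \<le> u \<and> u \<le> T \<and> A \<in> sets borel})
      \<Longrightarrow> prob (\<Inter>q. E q) = (\<Prod>q\<in>UNIV. prob (E q))"
begin

lemma X_measurable[measurable]: "0 \<le> u \<Longrightarrow> u \<le> T \<Longrightarrow> X q u \<in> borel_measurable M"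
  using bm[of q] by (auto simp: brownian_motion1_def)

lemma X_zero: "\<omega> \<in> space M \<Longrightarrow> X q 0 \<omega> = 0"
  using bm[of q] by (auto simp: brownian_motion1_def)

lemma increment_distributed:
  "0 \<le> s \<Longrightarrow> s < t \<Longrightarrow> t \<le> T \<Longrightarrow> distributed M lborel (\<lambda>\<omega>. X q t \<omega> - X q s \<omega>) (normal_density 0 (sqrt (t - s)))"
  using bm[of q] by (auto simp: brownian_motion1_def)

lemma hist_events: "(\<And>q. s q \<le> T) \<Longrightarrow> sets (hist M X s) \<subseteq> events"
  by (rule hist_subset_iff) (use order_trans X_measurable in \<open>blast+\<close>)

lemma hist_subalgebra: "(\<And>q. s q \<le> T) \<Longrightarrow> subalgebra M (hist M X s)"
  by (simp add: subalgebra_def hist_events)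

lemma measurable_hist_M: "f \<in> measurable (hist M X s) N \<Longrightarrow> (\<And>q. s q \<le> T) \<Longrightarrow> f \<in> measurable M N"
  using measurable_from_subalg hist_subalgebra by blast

abbreviation single_gen :: "'q \<Rightarrow> real \<Rightarrow> 'w set set" where
  "single_gen q s \<equiv> {X q u -` A \<inter> space M | u A. 0 \<le> u \<and> u \<le> s \<and> A \<in> sets borel}"

abbreviation increment_sigma :: "'q \<Rightarrow> real \<Rightarrow> real \<Rightarrow> 'w set set" where
  "increment_sigma q s t \<equiv> sigma_sets (space M) {(\<lambda>\<omega>. X q t \<omega> - X q s \<omega>) -` A \<inter> space M |A. A \<in> sets borel}"

text \<open>Values at finitely many times up to s are partial sums of increments along the partition
  by these times; the increment from s to t is appended as the last one, and
  \<open>brownian_motion1\<close> makes all of them independent.\<close>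

lemma cylinder_indep_increment:
  assumes st: "0 \<le> s" "s < t" "t \<le> T" and U: "finite U" "\<And>u. u \<in> U \<Longrightarrow> 0 \<le> u \<and> u \<le> s"
    and A: "\<And>u. u \<in> U \<Longrightarrow> A u \<in> sets borel" and V: "V \<in> sets borel"
  shows "prob ({\<omega>\<in>space M. \<forall>u\<in>U. X q u \<omega> \<in> A u} \<inter> {\<omega>\<in>space M. X q t \<omega> - X q s \<omega> \<in> V})
    = prob {\<omega>\<in>space M. \<forall>u\<in>U. X q u \<omega> \<in> A u} * prob {\<omega>\<in>space M. X q t \<omega> - X q s \<omega> \<in> V}"
proof -
  \<comment> \<open>Time 0 starts the telescoping sums, since the paths vanish there; s is included
    so that the last increment begins exactly at s.\<close>
  define P where "P = insert 0 (insert s U)"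
  have P: "finite P" "\<And>p. p \<in> P \<Longrightarrow> 0 \<le> p \<and> p \<le> s" "s \<in> P" "0 \<in> P" using U st by (auto simp: P_def)
  define n where "n = card P - 1"
  have cardP: "card P = Suc n" using card_gt_0_iff[of P] P(1,3) unfolding n_def by force
  define \<tau> where "\<tau> i = (if i \<le> n then grid P i else t)" for i
  have \<tau>n: "\<tau> n = s" using grid_Max[of P s] P by (auto simp: \<tau>_def n_def)
  have \<tau>0: "\<tau> 0 = 0" using grid_Min[of P 0] P by (auto simp: \<tau>_def)
  have \<tau>_range: "\<tau> i \<in> {0..T}" for i
    using grid_mem[OF P(1), of i] P(2)[of "grid P i"] st cardP by (auto simp: \<tau>_def)
  have \<tau>_mono: "\<tau> i \<le> \<tau> (Suc i)" if "i < Suc n" for i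
    using that grid_less[OF P(1), of i "Suc i"] grid_mem[OF P(1), of i] P(2)[of "grid P i"] st cardP
    by (auto simp: \<tau>_def)
  define \<Delta> where "\<Delta> i \<omega> = X q (\<tau> (Suc i)) \<omega> - X q (\<tau> i) \<omega>" for i \<omega>
  have ind: "indep_vars (\<lambda>_. borel) \<Delta> {..<Suc n}"
    using bm[of q] \<tau>_range \<tau>_mono unfolding brownian_motion1_def \<Delta>_def by blast
  have iv: "indep_var (PiM {..<n} (\<lambda>_. borel)) (\<lambda>\<omega>. restrict (\<lambda>i. \<Delta> i \<omega>) {..<n}) (PiM {n} (\<lambda>_. borel)) (\<lambda>\<omega>. restrict (\<lambda>i. \<Delta> i \<omega>) {n})"
    by (rule indep_var_restrict[OF ind]) auto
  have "\<exists>i\<le>n. \<tau> i = u" if "u \<in> U" for u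
    using grid_surj[OF P(1), of u] that cardP by (auto simp: P_def \<tau>_def less_Suc_eq_le)
  then obtain ix where ix: "\<And>u. u \<in> U \<Longrightarrow> ix u \<le> n \<and> \<tau> (ix u) = u" by metis
  have tele: "X q u \<omega> = (\<Sum>i<ix u. \<Delta> i \<omega>)" if "u \<in> U" "\<omega> \<in> space M" for u \<omega>
    using ix[OF that(1)] sum_lessThan_telescope[of "\<lambda>i. X q (\<tau> i) \<omega>" "ix u"] X_zero[OF that(2), of q]
    by (simp add: \<Delta>_def \<tau>0)
  define C where "C = {y \<in> space (PiM {..<n} (\<lambda>_. borel :: real measure)). \<forall>u\<in>U. (\<Sum>i<ix u. y i) \<in> A u}"
  have Cm: "C \<in> sets (PiM {..<n} (\<lambda>_. borel))"
  proof -
    have "{y \<in> space (PiM {..<n} (\<lambda>_. borel :: real measure)). (\<Sum>i<ix u. y i) \<in> A u} \<in> sets (PiM {..<n} (\<lambda>_. borel))" if "u \<in> U" for u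
    proof -
      have "(\<lambda>y. \<Sum>i<ix u. y i) \<in> borel_measurable (PiM {..<n} (\<lambda>_. borel :: real measure))"
        using ix[OF that] by (intro borel_measurable_sum measurable_component_singleton) auto
      then show ?thesis using A[OF that] by measurable
    qed
    then show ?thesis unfolding C_def using U(1)
      by (intro sets.sets_Collect_finite_All) auto
  qed
  define D where "D = {y \<in> space (PiM {n} (\<lambda>_. borel :: real measure)). y n \<in> V}"
  have Dm: "D \<in> sets (PiM {n} (\<lambda>_. borel))"
  proof -
    have "(\<lambda>y. y n) \<in> borel_measurable (PiM {n} (\<lambda>_. borel :: real measure))"
      by (rule measurable_component_singleton) auto
    then show ?thesis using V unfolding D_def by measurable
  qed
  have 1: "(\<lambda>\<omega>. restrict (\<lambda>i. \<Delta> i \<omega>) {..<n}) -` C \<inter> space M = {\<omega>\<in>space M. \<forall>u\<in>U. X q u \<omega> \<in> A u}"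
    using ix by (auto simp: C_def tele space_PiM) (smt (verit, best) lessThan_iff order.strict_trans2 restrict_apply' sum.cong)+
  have 2: "(\<lambda>\<omega>. restrict (\<lambda>i. \<Delta> i \<omega>) {n}) -` D \<inter> space M = {\<omega>\<in>space M. X q t \<omega> - X q s \<omega> \<in> V}"
    by (auto simp: D_def space_PiM \<Delta>_def \<tau>n) (auto simp: \<tau>_def)
  show ?thesis
  proof -
    have "prob ((\<lambda>\<omega>. (restrict (\<lambda>i. \<Delta> i \<omega>) {..<n}, restrict (\<lambda>i. \<Delta> i \<omega>) {n})) -` (C \<times> D) \<inter> space M) =
       prob {\<omega>\<in>space M. \<forall>u\<in>U. X q u \<omega> \<in> A u} * prob {\<omega>\<in>space M. X q t \<omega> - X q s \<omega> \<in> V}"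
      unfolding indep_varD[OF iv Cm Dm] 1 2 ..
    also have "(\<lambda>\<omega>. (restrict (\<lambda>i. \<Delta> i \<omega>) {..<n}, restrict (\<lambda>i. \<Delta> i \<omega>) {n})) -` (C \<times> D) \<inter> space M
       = {\<omega>\<in>space M. \<forall>u\<in>U. X q u \<omega> \<in> A u} \<inter> {\<omega>\<in>space M. X q t \<omega> - X q s \<omega> \<in> V}"
      unfolding 1[symmetric] 2[symmetric] by auto
    finally show ?thesis .
  qed
qed

text \<open>The cylinder sets are stable under intersection and generate the history, so the product
  formula extends from them to the generated sigma-algebras.\<close>

lemma single_indep_increment:
  assumes st: "0 \<le> s" "s < t" "t \<le> T"
  shows "indep_set (sigma_sets (space M) (single_gen q s)) (increment_sigma q s t)"
proof -
  define Cyl where "Cyl = {{\<omega>\<in>space M. \<forall>u\<in>U. X q u \<omega> \<in> A u} | U A. finite U \<and> (\<forall>u\<in>U. 0 \<le> u \<and> u \<le> s \<and> A u \<in> sets borel)}"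
  have Cyl_ev: "Cyl \<subseteq> events"
  proof
    fix C assume "C \<in> Cyl"
    then obtain U A where C: "C = {\<omega>\<in>space M. \<forall>u\<in>U. X q u \<omega> \<in> A u}" "finite U" "\<forall>u\<in>U. 0 \<le> u \<and> u \<le> s \<and> A u \<in> sets borel"
      by (auto simp: Cyl_def)
    have "{\<omega>\<in>space M. X q u \<omega> \<in> A u} \<in> events" if "u \<in> U" for u
    proof -
      have "X q u -` A u \<inter> space M \<in> events"
        using C(3) that st by (intro measurable_sets[OF X_measurable]) auto
      moreover have "X q u -` A u \<inter> space M = {\<omega>\<in>space M. X q u \<omega> \<in> A u}" by auto
      ultimately show ?thesis by simp
    qed
    then show "C \<in> events" unfolding C(1) using C(2) by (intro sets.sets_Collect_finite_All) auto
  qed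
  have "indep_set (sigma_sets (space M) Cyl) (sigma_sets (space M) {(\<lambda>\<omega>. X q t \<omega> - X q s \<omega>) -` A \<inter> space M |A. A \<in> sets borel})"
  proof (rule indep_set_sigma_sets)
    show "indep_set Cyl {(\<lambda>\<omega>. X q t \<omega> - X q s \<omega>) -` A \<inter> space M |A. A \<in> sets borel}"
    proof (rule indep_setI[OF Cyl_ev])
      have "(\<lambda>\<omega>. X q t \<omega> - X q s \<omega>) \<in> borel_measurable M" using st by (intro borel_measurable_diff X_measurable) auto
      then show "{(\<lambda>\<omega>. X q t \<omega> - X q s \<omega>) -` A \<inter> space M |A. A \<in> sets borel} \<subseteq> events" by (auto intro: measurable_sets)
      fix a b assume "a \<in> Cyl" and "b \<in> {(\<lambda>\<omega>. X q t \<omega> - X q s \<omega>) -` A \<inter> space M |A. A \<in> sets borel}"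
      then obtain U A V where a: "a = {\<omega>\<in>space M. \<forall>u\<in>U. X q u \<omega> \<in> A u}" "finite U" "\<forall>u\<in>U. 0 \<le> u \<and> u \<le> s \<and> A u \<in> sets borel"
        and b: "b = {\<omega>\<in>space M. X q t \<omega> - X q s \<omega> \<in> V}" "V \<in> sets borel"
        unfolding Cyl_def vimage_def Int_def by (auto simp: conj_commute)
      show "prob (a \<inter> b) = prob a * prob b"
        unfolding a(1) b(1) by (rule cylinder_indep_increment[OF st]) (use a b in auto)
    qed
    show "Int_stable Cyl"
    proof (rule Int_stableI)
      fix a b assume "a \<in> Cyl" "b \<in> Cyl"
      then obtain U A U' A' where a: "a = {\<omega>\<in>space M. \<forall>u\<in>U. X q u \<omega> \<in> A u}" "finite U" "\<forall>u\<in>U. 0 \<le> u \<and> u \<le> s \<and> A u \<in> sets borel"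
        and b: "b = {\<omega>\<in>space M. \<forall>u\<in>U'. X q u \<omega> \<in> A' u}" "finite U'" "\<forall>u\<in>U'. 0 \<le> u \<and> u \<le> s \<and> A' u \<in> sets borel"
        unfolding Cyl_def by blast
      define A'' where "A'' u = (if u \<in> U then A u else UNIV) \<inter> (if u \<in> U' then A' u else UNIV)" for u
      have "a \<inter> b = {\<omega>\<in>space M. \<forall>u\<in>U\<union>U'. X q u \<omega> \<in> A'' u}"
        unfolding a(1) b(1) A''_def by auto
      moreover have "finite (U \<union> U')" "\<forall>u\<in>U\<union>U'. 0 \<le> u \<and> u \<le> s \<and> A'' u \<in> sets borel"
        using a b by (auto simp: A''_def)
      ultimately show "a \<inter> b \<in> Cyl" unfolding Cyl_def by blast
    qed
    show "Int_stable {(\<lambda>\<omega>. X q t \<omega> - X q s \<omega>) -` A \<inter> space M |A. A \<in> sets borel}"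
    proof (rule Int_stableI, clarify)
      fix A B :: "real set" assume "A \<in> sets borel" "B \<in> sets borel"
      then show "\<exists>C. (\<lambda>\<omega>. X q t \<omega> - X q s \<omega>) -` A \<inter> space M \<inter> ((\<lambda>\<omega>. X q t \<omega> - X q s \<omega>) -` B \<inter> space M) = (\<lambda>\<omega>. X q t \<omega> - X q s \<omega>) -` C \<inter> space M \<and> C \<in> sets borel"
        by (intro exI[of _ "A \<inter> B"]) auto
    qed
  qed
  moreover have "sigma_sets (space M) (single_gen q s) \<subseteq> sigma_sets (space M) Cyl"
  proof (rule sigma_sets_mono')
    show "single_gen q s \<subseteq> Cyl"
    proof clarify
      fix u A assume "0 \<le> u" "u \<le> s" "A \<in> sets (borel :: real measure)"
      then show "X q u -` A \<inter> space M \<in> Cyl"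
        unfolding Cyl_def by (intro CollectI exI[of _ "{u}"] exI[of _ "\<lambda>_. A"]) auto
    qed
  qed
  ultimately show ?thesis by (rule indep_set_mono) auto
qed

text \<open>The other components may run ahead of the time \<open>s r\<close>. Intersections of one
  event per component form an intersection-stable generator; on them the increment is absorbed into
  the event of component r, \<open>family_indep\<close> separates the components, and
  \<open>single_indep_increment\<close> splits off the increment within component r.\<close>

lemma hist_indep_increment:
  assumes s: "\<And>q. 0 \<le> s q \<and> s q \<le> T" and t: "s r < t" "t \<le> T"
  shows "indep_set (sets (hist M X s)) (increment_sigma r (s r) t)"
proof -
  define G where "G q = sigma_sets (space M) (single_gen q (s q))" for q
  have gen_ev: "single_gen q u \<subseteq> events" if "u \<le> T" for q u
    using that X_measurable by (auto intro!: measurable_sets)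
  have G_alg: "sigma_algebra (space M) (G q)" for q
    unfolding G_def by (rule sigma_algebra_sigma_sets) auto
  have G_T: "G q \<subseteq> sigma_sets (space M) (single_gen q T)" for q
    unfolding G_def by (rule sigma_sets_mono') (use s in \<open>fastforce intro: order_trans\<close>)
  have G_ev: "G q \<subseteq> events" for q
    unfolding G_def by (rule sets.sigma_sets_subset) (use gen_ev s in auto)
  have inc_T: "increment_sigma r (s r) t \<subseteq> sigma_sets (space M) (single_gen r T)"
  proof -
    let ?N = "sigma (space M) (single_gen r T)"
    have N: "sets ?N = sigma_sets (space M) (single_gen r T)" "space ?N = space M"
      by (auto intro!: sets_measure_of space_measure_of)
    have "X r u \<in> borel_measurable ?N" if "0 \<le> u" "u \<le> T" for u
      by (rule measurableI) (use that N in \<open>auto intro!: sigma_sets.Basic\<close>)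
    then have "(\<lambda>\<omega>. X r t \<omega> - X r (s r) \<omega>) \<in> borel_measurable ?N"
      using s[of r] t by (intro borel_measurable_diff) auto
    then show ?thesis using N sets.sigma_sets_subset[of _ ?N] by (auto intro!: sets.sigma_sets_subset[of _ ?N, simplified N] dest: measurable_sets)
  qed
  define PS where "PS = {(\<Inter>q. E q) | E. \<forall>q. E q \<in> G q}"
  have "indep_set (sigma_sets (space M) PS) (sigma_sets (space M) (increment_sigma r (s r) t))"
  proof (rule indep_set_sigma_sets)
    show "indep_set PS (increment_sigma r (s r) t)"
    proof (rule indep_setI)
      show "PS \<subseteq> events" proof
        fix a assume "a \<in> PS"
        then obtain E where "a = (\<Inter>q. E q)" "\<And>q. E q \<in> G q" by (auto simp: PS_def)
        then show "a \<in> events" using G_ev by (auto intro!: sets.finite_INT)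
      qed
      show "increment_sigma r (s r) t \<subseteq> events"
        using inc_T sets.sigma_sets_subset[OF gen_ev[of T r]] by auto
      fix a b assume "a \<in> PS" and b: "b \<in> increment_sigma r (s r) t"
      then obtain E where a: "a = (\<Inter>q. E q)" and E: "\<And>q. E q \<in> G q" by (auto simp: PS_def)
      have Erb: "E r \<inter> b \<in> sigma_sets (space M) (single_gen r T)"
      proof -
        interpret sigma_algebra "space M" "sigma_sets (space M) (single_gen r T)"
          by (rule sigma_algebra_sigma_sets) auto
        show ?thesis by (rule Int[OF subsetD[OF G_T E] subsetD[OF inc_T b]])
      qed
      have "a \<inter> b = (\<Inter>q. (E(r := E r \<inter> b)) q)" unfolding a by (auto split: if_splits)
      then have "prob (a \<inter> b) = (\<Prod>q\<in>UNIV. prob ((E(r := E r \<inter> b)) q))"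
        using family_indep[of "E(r := E r \<inter> b)"] E G_T Erb by (simp add: subset_iff)
      also have "\<dots> = prob (E r \<inter> b) * (\<Prod>q\<in>UNIV-{r}. prob (E q))"
        by (subst prod.remove[of _ r]) (auto intro!: prod.cong)
      also have "prob (E r \<inter> b) = prob (E r) * prob b"
        by (rule indep_setD[OF single_indep_increment]) (use E[of r] b s t in \<open>auto simp: G_def\<close>)
      also have "prob (E r) * prob b * (\<Prod>q\<in>UNIV-{r}. prob (E q)) = (\<Prod>q\<in>UNIV. prob (E q)) * prob b"
        by (subst prod.remove[of UNIV r]) auto
      also have "(\<Prod>q\<in>UNIV. prob (E q)) = prob a"
        unfolding a by (rule family_indep[symmetric]) (use E G_T in auto)
      finally show "prob (a \<inter> b) = prob a * prob b" .
    qed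
    show "Int_stable PS"
    proof (rule Int_stableI)
      fix a b assume "a \<in> PS" "b \<in> PS"
      then obtain E E' where "a = (\<Inter>q. E q)" "b = (\<Inter>q. E' q)" and E: "\<And>q. E q \<in> G q" "\<And>q. E' q \<in> G q" by (auto simp: PS_def)
      then have "a \<inter> b = (\<Inter>q. E q \<inter> E' q)" by auto
      moreover have "E q \<inter> E' q \<in> G q" for q
      proof -
        interpret sigma_algebra "space M" "G q" by (rule G_alg)
        show ?thesis using E by auto
      qed
      ultimately show "a \<inter> b \<in> PS" unfolding PS_def by (intro CollectI exI[of _ "\<lambda>q. E q \<inter> E' q"]) auto
    qed
    show "Int_stable (increment_sigma r (s r) t)"
    proof (rule Int_stableI)
      interpret sigma_algebra "space M" "increment_sigma r (s r) t" by (rule sigma_algebra_sigma_sets) auto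
      show "a \<inter> b \<in> increment_sigma r (s r) t" if "a \<in> increment_sigma r (s r) t" "b \<in> increment_sigma r (s r) t" for a b
        using that by (rule Int)
    qed
  qed
  moreover have "sets (hist M X s) \<subseteq> sigma_sets (space M) PS"
    unfolding sets_hist
  proof (rule sigma_sets_mono', clarify)
    fix q u A assume u: "0 \<le> u" "u \<le> s q" "A \<in> sets (borel :: real measure)"
    define E where "E q' = (if q' = q then X q u -` A \<inter> space M else space M)" for q'
    have "E q' \<in> G q'" for q'
    proof -
      interpret sigma_algebra "space M" "G q'" by (rule G_alg)
      show ?thesis using u unfolding E_def G_def by (auto intro!: sigma_sets.Basic sigma_sets_top)
    qed
    moreover have "X q u -` A \<inter> space M = (\<Inter>q'. E q')" unfolding E_def by (auto split: if_splits)
    ultimately show "X q u -` A \<inter> space M \<in> PS" unfolding PS_def by blast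
  qed
  moreover have "increment_sigma r (s r) t \<subseteq> sigma_sets (space M) (increment_sigma r (s r) t)" by auto
  ultimately show ?thesis by (rule indep_set_mono)
qed

text \<open>Induction on the number of steps: Y and all earlier factors are known in the history at
  the start of the last step, so \<open>exp_martingale_step\<close> integrates the last factor out.
  All clocks may advance in a step, but only component r drives the sum.\<close>

lemma exp_martingale:
  fixes s :: "nat \<Rightarrow> 'q \<Rightarrow> real" and c :: "nat \<Rightarrow> 'w \<Rightarrow> real" and Y :: "'w \<Rightarrow> ennreal"
  assumes s_range: "\<And>i q. i \<le> N \<Longrightarrow> 0 \<le> s i q \<and> s i q \<le> T"
    and s_mono: "\<And>i q. i < N \<Longrightarrow> s i q \<le> s (Suc i) q" and s_less: "\<And>i. i < N \<Longrightarrow> s i r < s (Suc i) r"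
    and c: "\<And>i. i < N \<Longrightarrow> c i \<in> borel_measurable (hist M X (s i))"
    and Y: "Y \<in> borel_measurable (hist M X (s 0))"
  shows "(\<integral>\<^sup>+\<omega>. Y \<omega> * ennreal (exp (\<Sum>i<N. c i \<omega> * (X r (s (Suc i) r) \<omega> - X r (s i r) \<omega>)
      - (c i \<omega>)\<^sup>2 * (s (Suc i) r - s i r) / 2)) \<partial>M) = (\<integral>\<^sup>+\<omega>. Y \<omega> \<partial>M)"
  using assms
proof (induction N)
  case 0
  then show ?case by simp
next
  case (Suc N)
  define e where "e i \<omega> = c i \<omega> * (X r (s (Suc i) r) \<omega> - X r (s i r) \<omega>) - (c i \<omega>)\<^sup>2 * (s (Suc i) r - s i r) / 2" for i \<omega>
  have mono: "s i q \<le> s j q" if "i \<le> j" "j \<le> Suc N" for i j q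
    using that
  proof (induction j)
    case (Suc j) then show ?case using Suc.prems Suc(1) \<open>\<And>i q. i < Suc N \<Longrightarrow> s i q \<le> s (Suc i) q\<close>[of j q]
      by (cases "i = Suc j") auto
  qed simp
  have e_meas: "e i \<in> borel_measurable (hist M X (s N))" if "i < N" for i
  proof -
    have "c i \<in> borel_measurable (hist M X (s N))"
      by (rule measurable_hist_mono[OF Suc.prems(4)]) (use that mono in auto)
    moreover have "X r (s i r) \<in> borel_measurable (hist M X (s N))" "X r (s (Suc i) r) \<in> borel_measurable (hist M X (s N))"
      using that mono[of i N r] mono[of "Suc i" N r] Suc.prems(1)[of i r] Suc.prems(1)[of "Suc i" r] by (auto intro!: measurable_hist)
    ultimately show ?thesis unfolding e_def by measurable
  qed
  have Y_meas: "Y \<in> borel_measurable (hist M X (s N))"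
    by (rule measurable_hist_mono[OF Suc.prems(5)]) (use mono in auto)
  define Y' where "Y' \<omega> = Y \<omega> * ennreal (exp (\<Sum>i<N. e i \<omega>))" for \<omega>
  have Y'_meas: "Y' \<in> borel_measurable (hist M X (s N))"
    unfolding Y'_def using Y_meas e_meas by (intro borel_measurable_times_ennreal borel_measurable_sum measurable_compose[OF borel_measurable_sum measurable_ennreal] measurable_compose[OF _ measurable_ennreal] borel_measurable_exp) auto
  have "(\<integral>\<^sup>+\<omega>. Y \<omega> * ennreal (exp (\<Sum>i<Suc N. e i \<omega>)) \<partial>M) = (\<integral>\<^sup>+\<omega>. Y' \<omega> * ennreal (exp (e N \<omega>)) \<partial>M)"
    by (rule nn_integral_cong) (simp add: Y'_def exp_add ennreal_mult mult.assoc)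
  also have "\<dots> = (\<integral>\<^sup>+\<omega>. Y' \<omega> \<partial>M)"
    unfolding e_def
  proof (rule exp_martingale_step[OF _ _ hist_indep_increment])
    show "sets (hist M X (s N)) \<subseteq> events" using Suc.prems(1)[of N] by (intro hist_events) auto
    show "distributed M lborel (\<lambda>\<omega>. X r (s (Suc N) r) \<omega> - X r (s N r) \<omega>) (normal_density 0 (sqrt (s (Suc N) r - s N r)))"
      using Suc.prems(1)[of N r] Suc.prems(1)[of "Suc N" r] Suc.prems(3)[of N] by (intro increment_distributed) auto
  qed (use Suc.prems(1)[of N] Suc.prems(1)[of "Suc N" r] Suc.prems(3)[of N] Suc.prems(4)[of N] Y'_meas in auto)
  also have "\<dots> = (\<integral>\<^sup>+\<omega>. Y \<omega> \<partial>M)"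
    unfolding Y'_def e_def by (rule Suc.IH) (use Suc.prems in auto)
  finally show ?case unfolding e_def .
qed

text \<open>Chebyshev's inequality for the exponential martingale, whose mean is 1 while on E its
  exponent is at least \<open>a\<^sup>2 / (2 * \<kappa>)\<close>. Both the deviation and the bound
  on the quadratic variation are read on E only, so no stopping argument is involved.\<close>

lemma exp_tail_one_sided:
  fixes s :: "nat \<Rightarrow> 'q \<Rightarrow> real" and c :: "nat \<Rightarrow> 'w \<Rightarrow> real"
  assumes s_range: "\<And>i q. i \<le> N \<Longrightarrow> 0 \<le> s i q \<and> s i q \<le> T"
    and s_mono: "\<And>i q. i < N \<Longrightarrow> s i q \<le> s (Suc i) q" and s_less: "\<And>i. i < N \<Longrightarrow> s i r < s (Suc i) r"
    and c: "\<And>i. i < N \<Longrightarrow> c i \<in> borel_measurable (hist M X (s i))"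
    and a: "a > 0" and \<kappa>: "\<kappa> > 0" and E: "E \<in> events"
    and E1: "\<And>\<omega>. \<omega> \<in> E \<Longrightarrow> a \<le> (\<Sum>i<N. c i \<omega> * (X r (s (Suc i) r) \<omega> - X r (s i r) \<omega>))"
    and E2: "\<And>\<omega>. \<omega> \<in> E \<Longrightarrow> (\<Sum>i<N. (c i \<omega>)\<^sup>2 * (s (Suc i) r - s i r)) \<le> \<kappa>"
  shows "prob E \<le> exp (- a\<^sup>2 / (2 * \<kappa>))"
proof -
  \<comment> \<open>The maximizer of \<open>l * a - l\<^sup>2 / 2 * \<kappa>\<close>.\<close>
  define l where "l = a / \<kappa>"
  define e where "e \<omega> = (\<Sum>i<N. (l * c i \<omega>) * (X r (s (Suc i) r) \<omega> - X r (s i r) \<omega>)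
      - (l * c i \<omega>)\<^sup>2 * (s (Suc i) r - s i r) / 2)" for \<omega>
  have l: "l > 0" using a \<kappa> by (simp add: l_def)
  have e_ge: "a\<^sup>2 / (2 * \<kappa>) \<le> e \<omega>" if "\<omega> \<in> E" for \<omega>
  proof -
    have "e \<omega> = l * (\<Sum>i<N. c i \<omega> * (X r (s (Suc i) r) \<omega> - X r (s i r) \<omega>)) - l\<^sup>2 / 2 * (\<Sum>i<N. (c i \<omega>)\<^sup>2 * (s (Suc i) r - s i r))"
      unfolding e_def sum_subtractf sum_distrib_left by (simp add: power_mult_distrib mult.assoc)
    also have "\<dots> \<ge> l * a - l\<^sup>2 / 2 * \<kappa>"
      by (intro diff_mono mult_left_mono E1 E2 that) (use l in auto)
    also have "l * a - l\<^sup>2 / 2 * \<kappa> = a\<^sup>2 / (2 * \<kappa>)"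
      using \<kappa> by (simp add: l_def power2_eq_square field_simps)
    finally show ?thesis .
  qed
  have int: "(\<integral>\<^sup>+\<omega>. 1 * ennreal (exp (e \<omega>)) \<partial>M) = (\<integral>\<^sup>+\<omega>. 1 \<partial>M)"
    unfolding e_def by (rule exp_martingale[where s = s and c = "\<lambda>i \<omega>. l * c i \<omega>"]) (use s_range s_mono s_less c in auto)
  have "ennreal (exp (a\<^sup>2 / (2 * \<kappa>))) * emeasure M E = (\<integral>\<^sup>+\<omega>. ennreal (exp (a\<^sup>2 / (2 * \<kappa>))) * indicator E \<omega> \<partial>M)"
    using E by (simp add: nn_integral_cmult_indicator)
  also have "\<dots> \<le> (\<integral>\<^sup>+\<omega>. 1 * ennreal (exp (e \<omega>)) \<partial>M)"
    by (rule nn_integral_mono) (auto split: split_indicator intro!: ennreal_leI e_ge)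
  also have "\<dots> = 1" unfolding int by (simp add: emeasure_space_1)
  finally have "ennreal (exp (a\<^sup>2 / (2 * \<kappa>)) * prob E) \<le> ennreal 1"
    by (simp add: emeasure_eq_measure ennreal_mult)
  then have "exp (a\<^sup>2 / (2 * \<kappa>)) * prob E \<le> 1" by (subst (asm) ennreal_le_iff) auto
  then show ?thesis by (simp add: exp_minus field_simps)
qed

subsection \<open>Tail bounds for Ito integrals\<close>

text \<open>In contrast to \<open>simple_integrand\<close> the partition need only be weakly monotone and
  need not cover the whole interval, and the coefficients may be unbounded.\<close>

definition adapted_step :: "nat \<Rightarrow> (nat \<Rightarrow> real) \<Rightarrow> (nat \<Rightarrow> 'w \<Rightarrow> real) \<Rightarrow> bool" where
  "adapted_step m \<tau> \<xi> \<longleftrightarrow> (\<forall>i<m. 0 \<le> \<tau> i \<and> \<tau> i \<le> \<tau> (Suc i) \<and> \<tau> (Suc i) \<le> T \<and> \<xi> i \<in> borel_measurable (hist M X (\<lambda>_. \<tau> i)))"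

text \<open>On each cell of a finer grid a step integrand is constant and equals its value at the
  right endpoint. This brings step integrals with different partitions onto one grid.\<close>

lemma simple_integral_grid:
  assumes P: "finite P" and m: "\<And>i. i < m \<Longrightarrow> \<tau> i \<in> P \<and> \<tau> (Suc i) \<in> P \<and> \<tau> i \<le> \<tau> (Suc i)"
  shows "simple_integral b m \<tau> \<xi> \<omega>
    = (\<Sum>k<card P - 1. simple_process m \<tau> \<xi> (grid P (Suc k)) \<omega> * (b (grid P (Suc k)) \<omega> - b (grid P k) \<omega>))"
proof -
  have tele: "(\<Sum>k<card P - 1. indicator {\<tau> i<..\<tau> (Suc i)} (grid P (Suc k)) * (b (grid P (Suc k)) \<omega> - b (grid P k) \<omega>))
    = b (\<tau> (Suc i)) \<omega> - b (\<tau> i) \<omega>" if im: "i < m" for i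
  proof -
    obtain j where j: "j < card P" "grid P j = \<tau> i" using grid_surj[OF P] m[OF im] by blast
    obtain j' where j': "j' < card P" "grid P j' = \<tau> (Suc i)" using grid_surj[OF P] m[OF im] by blast
    have jj: "j \<le> j'" using grid_le_iff[OF P j(1) j'(1)] j j' m[OF im] by simp
    have ind: "indicator {\<tau> i<..\<tau> (Suc i)} (grid P (Suc k)) = (indicator {j..<j'} k :: real)" if "k < card P - 1" for k
    proof -
      have k: "Suc k < card P" using that by simp
      then show ?thesis using grid_less_iff[OF P j(1) k] grid_le_iff[OF P k j'(1)] j j' by (auto simp: indicator_def)
    qed
    have "(\<Sum>k<card P - 1. indicator {\<tau> i<..\<tau> (Suc i)} (grid P (Suc k)) * (b (grid P (Suc k)) \<omega> - b (grid P k) \<omega>))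
      = (\<Sum>k<card P - 1. indicator {j..<j'} k * (b (grid P (Suc k)) \<omega> - b (grid P k) \<omega>))"
      by (rule sum.cong) (simp_all add: ind)
    also have "\<dots> = (\<Sum>k\<in>{j..<j'}. b (grid P (Suc k)) \<omega> - b (grid P k) \<omega>)"
      by (rule sum.mono_neutral_cong_right) (use j' in auto)
    also have "\<dots> = b (grid P j') \<omega> - b (grid P j) \<omega>"
      using sum_Suc_diff'[OF jj, of "\<lambda>k. b (grid P k) \<omega>"] by simp
    finally show ?thesis by (simp add: j j')
  qed
  have "(\<Sum>k<card P - 1. simple_process m \<tau> \<xi> (grid P (Suc k)) \<omega> * (b (grid P (Suc k)) \<omega> - b (grid P k) \<omega>))
    = (\<Sum>i<m. \<xi> i \<omega> * (\<Sum>k<card P - 1. indicator {\<tau> i<..\<tau> (Suc i)} (grid P (Suc k)) * (b (grid P (Suc k)) \<omega> - b (grid P k) \<omega>)))"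
    unfolding simple_process_def sum_distrib_right sum_distrib_left by (subst sum.swap) (simp add: mult.assoc)
  also have "\<dots> = simple_integral b m \<tau> \<xi> \<omega>"
    unfolding simple_integral_def
  proof (rule sum.cong[OF refl])
    fix i assume "i \<in> {..<m}"
    then have "i < m" by simp
    show "\<xi> i \<omega> * (\<Sum>k<card P - 1. indicator {\<tau> i<..\<tau> (Suc i)} (grid P (Suc k)) * (b (grid P (Suc k)) \<omega> - b (grid P k) \<omega>))
      = \<xi> i \<omega> * (b (\<tau> (Suc i)) \<omega> - b (\<tau> i) \<omega>)"
      by (subst tele[OF \<open>i < m\<close>]) (rule refl)
  qed
  finally show ?thesis ..
qed

lemma simple_process_grid_const:
  assumes P: "finite P" and m: "\<And>i. i < m \<Longrightarrow> \<tau> i \<in> P \<and> \<tau> (Suc i) \<in> P"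
    and k: "Suc k < card P" and s: "grid P k < s" "s \<le> grid P (Suc k)"
  shows "simple_process m \<tau> \<xi> s \<omega> = simple_process m \<tau> \<xi> (grid P (Suc k)) \<omega>"
  unfolding simple_process_def
proof (rule sum.cong[OF refl])
  fix i assume "i \<in> {..<m}"
  then have i: "\<tau> i \<in> P" "\<tau> (Suc i) \<in> P" using m by auto
  have gap: "p < s \<longleftrightarrow> p < grid P (Suc k)" if pP: "p \<in> P" for p
  proof -
    obtain j where j: "j < card P" "grid P j = p" using grid_surj[OF P pP] by blast
    have "j \<le> k \<or> Suc k \<le> j" by auto
    then show ?thesis using grid_le_iff[OF P j(1), of k] grid_le_iff[OF P k j(1)] k s j(2) by auto
  qed
  show "\<xi> i \<omega> * indicator {\<tau> i<..\<tau> (Suc i)} s = \<xi> i \<omega> * indicator {\<tau> i<..\<tau> (Suc i)} (grid P (Suc k))"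
    using gap[OF i(1)] gap[OF i(2)] by (auto simp: indicator_def not_less[symmetric] simp del: not_less)
qed

text \<open>The value at the right end of a cell is known at its left end: only terms with \<tau> i
  before the right end survive, and \<tau> i is itself a grid point, hence at most the left
  end.\<close>

lemma adapted_step_grid_measurable:
  assumes P: "finite P" "P \<subseteq> {0..T}" and st: "adapted_step m \<tau> \<xi>"
    and m: "\<And>i. i < m \<Longrightarrow> \<tau> i \<in> P" and k: "Suc k < card P"
  shows "simple_process m \<tau> \<xi> (grid P (Suc k)) \<in> borel_measurable (hist M X (\<lambda>_. grid P k))"
  unfolding simple_process_def
proof (rule borel_measurable_sum)
  fix i assume "i \<in> {..<m}"
  then have i: "i < m" by simp
  show "(\<lambda>\<omega>. \<xi> i \<omega> * indicator {\<tau> i<..\<tau> (Suc i)} (grid P (Suc k))) \<in> borel_measurable (hist M X (\<lambda>_. grid P k))"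
  proof (cases "\<tau> i < grid P (Suc k)")
    case True
    obtain j where j: "j < card P" "grid P j = \<tau> i" using grid_surj[OF P(1)] m[OF i] by blast
    then have "j \<le> k" using grid_less_iff[OF P(1) j(1) k] True by auto
    then have "\<tau> i \<le> grid P k" using grid_le_iff[OF P(1) j(1), of k] j k by auto
    then have "\<xi> i \<in> borel_measurable (hist M X (\<lambda>_. grid P k))"
      using st i unfolding adapted_step_def by (metis measurable_hist_mono)
    then show ?thesis by (intro borel_measurable_times) auto
  qed (simp add: indicator_def)
qed

text \<open>The cells are disjoint subintervals of [0, T] on which S is constant; it is an
  inequality because they need not cover [0, T].\<close>

lemma nn_integral_grid_le:
  assumes P: "finite P" "P \<subseteq> {0..T}"
    and const: "\<And>k s. Suc k < card P \<Longrightarrow> grid P k < s \<Longrightarrow> s \<le> grid P (Suc k) \<Longrightarrow> S s = (S (grid P (Suc k)) :: real)"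
    and S: "(\<lambda>s. S s) \<in> borel_measurable borel"
  shows "ennreal (\<Sum>k<card P - 1. (S (grid P (Suc k)))\<^sup>2 * (grid P (Suc k) - grid P k)) \<le> (\<integral>\<^sup>+s\<in>{0..T}. ennreal ((S s)\<^sup>2) \<partial>lborel)"
proof -
  have "ennreal (\<Sum>k<card P - 1. (S (grid P (Suc k)))\<^sup>2 * (grid P (Suc k) - grid P k))
    = (\<Sum>k<card P - 1. ennreal ((S (grid P (Suc k)))\<^sup>2 * (grid P (Suc k) - grid P k)))"
    by (rule sum_ennreal[symmetric]) (use grid_less[OF P(1)] in \<open>auto simp: less_imp_le\<close>)
  also have "\<dots> = (\<Sum>k<card P - 1. \<integral>\<^sup>+s. ennreal ((S s)\<^sup>2) * indicator {grid P k<..grid P (Suc k)} s \<partial>lborel)"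
  proof (rule sum.cong[OF refl])
    fix k assume k: "k \<in> {..<card P - 1}"
    have "(\<integral>\<^sup>+s. ennreal ((S s)\<^sup>2) * indicator {grid P k<..grid P (Suc k)} s \<partial>lborel)
      = (\<integral>\<^sup>+s. ennreal ((S (grid P (Suc k)))\<^sup>2) * indicator {grid P k<..grid P (Suc k)} s \<partial>lborel)"
    proof (rule nn_integral_cong)
      fix s
      have "S s = S (grid P (Suc k))" if "s \<in> {grid P k<..grid P (Suc k)}" using k that by (intro const) auto
      then show "ennreal ((S s)\<^sup>2) * indicator {grid P k<..grid P (Suc k)} s = ennreal ((S (grid P (Suc k)))\<^sup>2) * indicator {grid P k<..grid P (Suc k)} s"
        by (simp split: split_indicator)
    qed
    also have "\<dots> = ennreal ((S (grid P (Suc k)))\<^sup>2 * (grid P (Suc k) - grid P k))"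
      using k grid_less[OF P(1), of k "Suc k"] by (subst nn_integral_cmult_indicator) (auto simp: ennreal_mult less_imp_le)
    finally show "ennreal ((S (grid P (Suc k)))\<^sup>2 * (grid P (Suc k) - grid P k)) = (\<integral>\<^sup>+s. ennreal ((S s)\<^sup>2) * indicator {grid P k<..grid P (Suc k)} s \<partial>lborel)" ..
  qed
  also have "\<dots> = (\<integral>\<^sup>+s. (\<Sum>k<card P - 1. ennreal ((S s)\<^sup>2) * indicator {grid P k<..grid P (Suc k)} s) \<partial>lborel)"
    by (rule nn_integral_sum[symmetric]) (use S in auto)
  also have "\<dots> \<le> (\<integral>\<^sup>+s\<in>{0..T}. ennreal ((S s)\<^sup>2) \<partial>lborel)"
  proof (rule nn_integral_mono)
    fix s :: real
    show "(\<Sum>k<card P - 1. ennreal ((S s)\<^sup>2) * indicator {grid P k<..grid P (Suc k)} s) \<le> ennreal ((S s)\<^sup>2) * indicator {0..T} s"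
    proof (cases "\<exists>k<card P - 1. s \<in> {grid P k<..grid P (Suc k)}")
      case True
      then obtain k where k: "k < card P - 1" "s \<in> {grid P k<..grid P (Suc k)}" by blast
      have "j = k" if "j < card P - 1" "s \<in> {grid P j<..grid P (Suc j)}" for j
      proof -
        have "grid P j < grid P (Suc k)" "grid P k < grid P (Suc j)" using that k by auto
        then have "j < Suc k" "k < Suc j" using grid_less_iff[OF P(1)] that k by auto
        then show ?thesis by simp
      qed
      then have "(\<Sum>j<card P - 1. ennreal ((S s)\<^sup>2) * indicator {grid P j<..grid P (Suc j)} s)
        = (\<Sum>j\<in>{k}. ennreal ((S s)\<^sup>2) * indicator {grid P j<..grid P (Suc j)} s)"
      proof (intro sum.mono_neutral_right ballI)
        fix j assume "j \<in> {..<card P - 1} - {k}"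
        then have "s \<notin> {grid P j<..grid P (Suc j)}" using \<open>\<And>j. j < card P - 1 \<Longrightarrow> s \<in> {grid P j<..grid P (Suc j)} \<Longrightarrow> j = k\<close> by blast
        then show "ennreal ((S s)\<^sup>2) * indicator {grid P j<..grid P (Suc j)} s = 0" by (simp add: indicator_def)
      next
        show "finite {..<card P - 1}" "{k} \<subseteq> {..<card P - 1}" using k by blast+
      qed
      moreover have "grid P k \<in> {0..T}" "grid P (Suc k) \<in> {0..T}" using subsetD[OF P(2) grid_mem[OF P(1)]] k(1) by auto
      ultimately show ?thesis using k(2) by (simp add: indicator_def)
    next
      case False
      then have "(\<Sum>j<card P - 1. ennreal ((S s)\<^sup>2) * indicator {grid P j<..grid P (Suc j)} s) = 0"
        by (intro sum.neutral) (auto simp add: indicator_def)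
      then show ?thesis by (simp only:) simp
    qed
  qed
  finally show ?thesis .
qed

lemma simple_process_borel: "(\<lambda>s. simple_process m \<tau> \<xi> s \<omega>) \<in> borel_measurable borel"
  unfolding simple_process_def by measurable

text \<open>On a common grid the difference is again an adapted step integral with quadratic
  variation at most \<kappa>; the factor 2 comes from applying the one-sided bound to both
  signs.\<close>

lemma step_difference_tail:
  assumes st: "adapted_step m \<tau> \<xi>" "adapted_step m' \<tau>' \<xi>'" and a: "a > 0" and \<kappa>: "\<kappa> > 0" and E: "E \<in> events"
    and E1: "\<And>\<omega>. \<omega> \<in> E \<Longrightarrow> a \<le> \<bar>simple_integral (X r) m \<tau> \<xi> \<omega> - simple_integral (X r) m' \<tau>' \<xi>' \<omega>\<bar>"
    and E2: "\<And>\<omega>. \<omega> \<in> E \<Longrightarrow> (\<integral>\<^sup>+s\<in>{0..T}. ennreal ((simple_process m \<tau> \<xi> s \<omega> - simple_process m' \<tau>' \<xi>' s \<omega>)\<^sup>2) \<partial>lborel) \<le> ennreal \<kappa>"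
  shows "prob E \<le> 2 * exp (- a\<^sup>2 / (2 * \<kappa>))"
proof -
  define P where "P = \<tau> ` {..<m} \<union> (\<tau> \<circ> Suc) ` {..<m} \<union> \<tau>' ` {..<m'} \<union> (\<tau>' \<circ> Suc) ` {..<m'} \<union> {0}"
  have P: "finite P" "P \<subseteq> {0..T}"
    using st T_pos unfolding P_def adapted_step_def by (auto intro: order_trans)
  have in1: "\<tau> i \<in> P \<and> \<tau> (Suc i) \<in> P \<and> \<tau> i \<le> \<tau> (Suc i)" if "i < m" for i
    using that st(1) by (auto simp: P_def adapted_step_def)
  have in2: "\<tau>' i \<in> P \<and> \<tau>' (Suc i) \<in> P \<and> \<tau>' i \<le> \<tau>' (Suc i)" if "i < m'" for i
    using that st(2) by (auto simp: P_def adapted_step_def)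
  define N where "N = card P - 1"
  have cardP: "card P = Suc N" using P card_gt_0_iff[of P] unfolding N_def by (auto simp: P_def)
  define D where "D s \<omega> = simple_process m \<tau> \<xi> s \<omega> - simple_process m' \<tau>' \<xi>' s \<omega>" for s \<omega>
  define c where "c k = D (grid P (Suc k))" for k
  define sv where "sv k = (\<lambda>_::'q. grid P k)" for k
  have c_meas: "c k \<in> borel_measurable (hist M X (sv k))" if "k < N" for k
    unfolding c_def D_def sv_def using that cardP in1 in2
    by (intro borel_measurable_diff adapted_step_grid_measurable P st) auto
  have diff: "simple_integral (X r) m \<tau> \<xi> \<omega> - simple_integral (X r) m' \<tau>' \<xi>' \<omega>
     = (\<Sum>k<N. c k \<omega> * (X r (sv (Suc k) r) \<omega> - X r (sv k r) \<omega>))" for \<omega>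
    using simple_integral_grid[where P=P and m=m and \<tau>=\<tau> and \<xi>=\<xi> and b="X r" and \<omega>=\<omega>]
      simple_integral_grid[where P=P and m=m' and \<tau>=\<tau>' and \<xi>=\<xi>' and b="X r" and \<omega>=\<omega>] in1 in2 P(1)
    by (simp add: c_def D_def sv_def N_def left_diff_distrib sum_subtractf)
  have q: "(\<Sum>k<N. (c k \<omega>)\<^sup>2 * (sv (Suc k) r - sv k r)) \<le> \<kappa>" if "\<omega> \<in> E" for \<omega>
  proof -
    have "ennreal (\<Sum>k<N. (c k \<omega>)\<^sup>2 * (sv (Suc k) r - sv k r)) \<le> (\<integral>\<^sup>+s\<in>{0..T}. ennreal ((D s \<omega>)\<^sup>2) \<partial>lborel)"
      unfolding c_def sv_def N_def
    proof (rule nn_integral_grid_le[OF P])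
      fix k s assume "Suc k < card P" "grid P k < s" "s \<le> grid P (Suc k)"
      then show "D s \<omega> = D (grid P (Suc k)) \<omega>"
        unfolding D_def using simple_process_grid_const[OF P(1)] in1 in2 by metis
    next
      show "(\<lambda>s. D s \<omega>) \<in> borel_measurable borel" unfolding D_def using simple_process_borel by measurable
    qed
    also have "\<dots> \<le> ennreal \<kappa>" using E2[OF that] by (simp add: D_def)
    finally show ?thesis using \<kappa> by (simp add: ennreal_le_iff)
  qed
  have sv_range: "0 \<le> sv i q \<and> sv i q \<le> T" if "i \<le> N" for i q
    using grid_mem[OF P(1), of i] P(2) that cardP by (auto simp: sv_def)
  have sv_less: "sv i q < sv (Suc i) q'" if "i < N" for i q q'
    using grid_less[OF P(1), of i "Suc i"] that cardP by (simp add: sv_def)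
  have I_meas: "(\<lambda>\<omega>. \<Sum>k<N. c k \<omega> * (X r (sv (Suc k) r) \<omega> - X r (sv k r) \<omega>)) \<in> borel_measurable M"
  proof (intro borel_measurable_sum borel_measurable_times borel_measurable_diff)
    fix k assume k: "k \<in> {..<N}"
    show "c k \<in> borel_measurable M" by (rule measurable_hist_M[OF c_meas]) (use k sv_range in auto)
    show "X r (sv (Suc k) r) \<in> borel_measurable M" "X r (sv k r) \<in> borel_measurable M"
      using k sv_range[of k r] sv_range[of "Suc k" r] by (auto intro!: X_measurable)
  qed
  define I where "I \<omega> = (\<Sum>k<N. c k \<omega> * (X r (sv (Suc k) r) \<omega> - X r (sv k r) \<omega>))" for \<omega>
  have I_meas[measurable]: "I \<in> borel_measurable M" using I_meas by (simp add: I_def[abs_def])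
  define E' where "E' = E \<inter> {\<omega>\<in>space M. a \<le> I \<omega>}"
  define E'' where "E'' = E \<inter> {\<omega>\<in>space M. a \<le> - I \<omega>}"
  have ev: "E' \<in> events" "E'' \<in> events" using E unfolding E'_def E''_def by measurable
  have 1: "prob E' \<le> exp (- a\<^sup>2 / (2 * \<kappa>))"
    by (rule exp_tail_one_sided[where s=sv and c=c and N=N and r=r])
      (use sv_range sv_less c_meas a \<kappa> ev q in \<open>auto simp: E'_def I_def less_imp_le\<close>)
  have 2: "prob E'' \<le> exp (- a\<^sup>2 / (2 * \<kappa>))"
    by (rule exp_tail_one_sided[where s=sv and c="\<lambda>k \<omega>. - c k \<omega>" and N=N and r=r])
      (use sv_range sv_less c_meas a \<kappa> ev q in \<open>auto simp: E''_def I_def less_imp_le sum_negf\<close>)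
  have "E \<subseteq> E' \<union> E''"
  proof
    fix \<omega> assume \<omega>: "\<omega> \<in> E"
    then have "a \<le> \<bar>I \<omega>\<bar>" using E1[OF \<omega>] unfolding diff I_def by simp
    moreover have "\<omega> \<in> space M" using \<omega> E sets.sets_into_space by auto
    ultimately show "\<omega> \<in> E' \<union> E''" using \<omega> unfolding E'_def E''_def by auto
  qed
  then have "prob E \<le> prob (E' \<union> E'')" using ev by (intro finite_measure_mono) auto
  also have "\<dots> \<le> prob E' + prob E''" using ev by (intro measure_Un_le) auto
  finally show ?thesis using 1 2 by simp
qed

lemma simple_integrand_imp_adapted_step:
  assumes F: "\<And>u. 0 \<le> u \<Longrightarrow> u \<le> T \<Longrightarrow> sets (F u) \<subseteq> sets (hist M X (\<lambda>_. u))" "\<And>u. space (F u) = space M"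
    and si: "simple_integrand F T m \<tau> \<xi>"
  shows "adapted_step m \<tau> \<xi>"
  unfolding adapted_step_def
proof (intro allI impI)
  fix i assume i: "i < m"
  have \<tau>: "\<tau> 0 = 0" "\<tau> m = T" "\<And>i. i < m \<Longrightarrow> \<tau> i < \<tau> (Suc i)" and \<xi>: "\<xi> i \<in> borel_measurable (F (\<tau> i))"
    using si i by (auto simp: simple_integrand_def)
  have mono: "\<tau> j \<le> \<tau> k" if "j \<le> k" "k \<le> m" for j k
    using that
  proof (induction k)
    case (Suc k) then show ?case using \<tau>(3)[of k] by (cases "j = Suc k") auto
  qed simp
  have r: "0 \<le> \<tau> i" "\<tau> i \<le> \<tau> (Suc i)" "\<tau> (Suc i) \<le> T"
    using mono[of 0 i] mono[of "Suc i" m] \<tau> i by (auto simp: less_imp_le)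
  then have "borel_measurable (F (\<tau> i)) \<subseteq> (borel_measurable (hist M X (\<lambda>_. \<tau> i)) :: ('w \<Rightarrow> real) set)"
    using F by (intro measurable_mono) auto
  then show "0 \<le> \<tau> i \<and> \<tau> i \<le> \<tau> (Suc i) \<and> \<tau> (Suc i) \<le> T \<and> \<xi> i \<in> borel_measurable (hist M X (\<lambda>_. \<tau> i))"
    using r \<xi> by auto
qed

lemma simple_process_measurable:
  assumes "adapted_step m \<tau> \<xi>"
  shows "(\<lambda>(s, \<omega>). simple_process m \<tau> \<xi> s \<omega>) \<in> borel_measurable (restrict_space borel {0..T} \<Otimes>\<^sub>M M)"
proof -
  have "(\<lambda>z. \<xi> i (snd z) * indicator {\<tau> i<..\<tau> (Suc i)} (fst z)) \<in> borel_measurable (restrict_space borel {0..T} \<Otimes>\<^sub>M M)" if "i < m" for i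
  proof -
    have [measurable]: "\<xi> i \<in> borel_measurable M"
      by (rule measurable_hist_M[of _ "\<lambda>_. \<tau> i"]) (use assms that in \<open>auto simp: adapted_step_def intro: order_trans\<close>)
    have [measurable]: "indicator {\<tau> i<..\<tau> (Suc i)} \<in> borel_measurable (restrict_space borel {0..T})"
      by (rule measurable_restrict_space1) auto
    show ?thesis by measurable
  qed
  then show ?thesis unfolding simple_process_def case_prod_beta' by (intro borel_measurable_sum) auto
qed

lemma simple_integral_measurable:
  assumes "adapted_step m \<tau> \<xi>"
  shows "simple_integral (X r) m \<tau> \<xi> \<in> borel_measurable M"
  unfolding simple_integral_def
proof (rule borel_measurable_sum)
  fix i assume i: "i \<in> {..<m}"
  have "\<xi> i \<in> borel_measurable M"
    by (rule measurable_hist_M[of _ "\<lambda>_. \<tau> i"]) (use assms i in \<open>auto simp: adapted_step_def intro: order_trans\<close>)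
  moreover have "X r (\<tau> (Suc i)) \<in> borel_measurable M" "X r (\<tau> i) \<in> borel_measurable M"
    using assms i by (auto simp: adapted_step_def intro!: X_measurable intro: order_trans)
  ultimately show "(\<lambda>\<omega>. \<xi> i \<omega> * (X r (\<tau> (Suc i)) \<omega> - X r (\<tau> i) \<omega>)) \<in> borel_measurable M" by measurable
qed

text \<open>Off events \<open>A k\<close> and \<open>B k\<close> of vanishing probability, the k-th
  simple integral is within a/2 of J and the k-th integrand within \<kappa> of H in squared L2
  distance. What remains is a deviation a/2 between two step integrals whose squared distance is at
  most 2\<kappa> + 2\<kappa>; the exponent (a/2)^2 / (2 * 4\<kappa>) is the origin of the
  32.\<close>

lemma ito_tail:
  assumes F: "\<And>u. 0 \<le> u \<Longrightarrow> u \<le> T \<Longrightarrow> sets (F u) \<subseteq> sets (hist M X (\<lambda>_. u))" "\<And>u. space (F u) = space M"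
    and ito: "has_ito_integral M F (X r) T H J"
    and st': "adapted_step m' \<tau>' \<xi>'" and a: "a > 0" and \<kappa>: "\<kappa> > 0" and E: "E \<in> events"
    and E1: "\<And>\<omega>. \<omega> \<in> E \<Longrightarrow> a \<le> \<bar>J \<omega> - simple_integral (X r) m' \<tau>' \<xi>' \<omega>\<bar>"
    and E2: "\<And>\<omega>. \<omega> \<in> E \<Longrightarrow> (\<integral>\<^sup>+s\<in>{0..T}. ennreal ((H s \<omega> - simple_process m' \<tau>' \<xi>' s \<omega>)\<^sup>2) \<partial>lborel) \<le> ennreal \<kappa>"
  shows "prob E \<le> 2 * exp (- a\<^sup>2 / (32 * \<kappa>))"
proof -
  define L where "L = restrict_space lborel {0..T}"
  have setsL: "sets L = sets (restrict_space borel {0..T})" unfolding L_def by (simp add: sets_restrict_space)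
  interpret L: finite_measure L
    unfolding L_def by (rule finite_measureI) (simp add: emeasure_restrict_space emeasure_lborel_Icc_eq)
  have toL: "(\<integral>\<^sup>+s\<in>{0..T}. f s \<partial>lborel) = (\<integral>\<^sup>+s. f s \<partial>L)" for f
    unfolding L_def by (subst nn_integral_restrict_space) auto
  obtain m \<tau> \<xi> where si: "\<And>k. simple_integrand F T (m k) (\<tau> k) (\<xi> k)"
    and c1: "null_in_probability M (\<lambda>k \<omega>. \<integral>\<^sup>+s\<in>{0..T}. ennreal ((simple_process (m k) (\<tau> k) (\<xi> k) s \<omega> - H s \<omega>)\<^sup>2) \<partial>lborel)"
    and c2: "null_in_probability M (\<lambda>k \<omega>. ennreal \<bar>simple_integral (X r) (m k) (\<tau> k) (\<xi> k) \<omega> - J \<omega>\<bar>)"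
    and Hm0: "(\<lambda>(s, \<omega>). H s \<omega>) \<in> borel_measurable (restrict_space borel {0..T} \<Otimes>\<^sub>M M)"
    and Jm[measurable]: "J \<in> borel_measurable M"
    using ito unfolding has_ito_integral_def by blast
  have st: "adapted_step (m k) (\<tau> k) (\<xi> k)" for k
    by (rule simple_integrand_imp_adapted_step[OF F si])
  have pairL: "sets (restrict_space borel {0..T} \<Otimes>\<^sub>M M) = sets (L \<Otimes>\<^sub>M M)"
    using setsL by (intro sets_pair_measure_cong) auto
  have Hm: "(\<lambda>z. H (fst z) (snd z)) \<in> borel_measurable (L \<Otimes>\<^sub>M M)"
    using Hm0 measurable_cong_sets[OF pairL refl] by (auto simp: case_prod_beta')
  have Sm: "(\<lambda>z. simple_process m \<tau> \<xi> (fst z) (snd z)) \<in> borel_measurable (L \<Otimes>\<^sub>M M)" if "adapted_step m \<tau> \<xi>" for m \<tau> \<xi>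
    using simple_process_measurable[OF that] measurable_cong_sets[OF pairL refl] by (auto simp: case_prod_beta')
  have sec: "(\<lambda>s. f s \<omega>) \<in> borel_measurable L" if "(\<lambda>z. f (fst z) (snd z)) \<in> borel_measurable (L \<Otimes>\<^sub>M M)" "\<omega> \<in> space M" for f :: "real \<Rightarrow> 'w \<Rightarrow> real" and \<omega>
    using measurable_compose[OF measurable_Pair2'[OF that(2)] that(1)] by simp
  have int_m: "(\<lambda>\<omega>. \<integral>\<^sup>+s. ennreal ((f s \<omega> - g s \<omega>)\<^sup>2) \<partial>L) \<in> borel_measurable M"
    if "(\<lambda>z. f (fst z) (snd z)) \<in> borel_measurable (L \<Otimes>\<^sub>M M)" "(\<lambda>z. g (fst z) (snd z)) \<in> borel_measurable (L \<Otimes>\<^sub>M M)" for f g :: "real \<Rightarrow> 'w \<Rightarrow> real"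
  proof (rule L.borel_measurable_nn_integral)
    have "(\<lambda>z. ennreal ((f (fst z) (snd z) - g (fst z) (snd z))\<^sup>2)) \<in> borel_measurable (L \<Otimes>\<^sub>M M)" using that by measurable
    from measurable_pair_swap[OF this] show "(\<lambda>(\<omega>, s). ennreal ((f s \<omega> - g s \<omega>)\<^sup>2)) \<in> borel_measurable (M \<Otimes>\<^sub>M L)"
      by (simp add: case_prod_beta')
  qed
  define A where "A k = {\<omega>\<in>space M. ennreal \<kappa> < (\<integral>\<^sup>+s\<in>{0..T}. ennreal ((simple_process (m k) (\<tau> k) (\<xi> k) s \<omega> - H s \<omega>)\<^sup>2) \<partial>lborel)}" for k
  define B where "B k = {\<omega>\<in>space M. ennreal (a/2) < ennreal \<bar>simple_integral (X r) (m k) (\<tau> k) (\<xi> k) \<omega> - J \<omega>\<bar>}" for k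
  have Am[measurable]: "A k \<in> events" for k
    unfolding A_def toL using int_m[OF Sm[OF st] Hm] by measurable
  have Bm[measurable]: "B k \<in> events" for k
    unfolding B_def using simple_integral_measurable[OF st, of r k] by measurable
  have "prob (E - A k - B k) \<le> 2 * exp (- (a/2)\<^sup>2 / (2 * (4 * \<kappa>)))" for k
  proof (rule step_difference_tail[OF st[of k] st', of "a/2" "4*\<kappa>" _ r])
    show "E - A k - B k \<in> events" using E by measurable
    fix \<omega> assume \<omega>: "\<omega> \<in> E - A k - B k"
    then have sp: "\<omega> \<in> space M" using E sets.sets_into_space by blast
    have "\<bar>simple_integral (X r) (m k) (\<tau> k) (\<xi> k) \<omega> - J \<omega>\<bar> \<le> a/2"
      using \<omega> sp a by (auto simp: B_def not_less ennreal_le_iff)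
    then show "a/2 \<le> \<bar>simple_integral (X r) (m k) (\<tau> k) (\<xi> k) \<omega> - simple_integral (X r) m' \<tau>' \<xi>' \<omega>\<bar>"
      using E1[OF DiffD1[OF DiffD1[OF \<omega>]]] by linarith
    let ?S = "\<lambda>s. simple_process (m k) (\<tau> k) (\<xi> k) s \<omega>" and ?S' = "\<lambda>s. simple_process m' \<tau>' \<xi>' s \<omega>" and ?H = "\<lambda>s. H s \<omega>"
    have [measurable]: "?S \<in> borel_measurable L" "?S' \<in> borel_measurable L" "?H \<in> borel_measurable L"
      using sec[OF Sm[OF st] sp] sec[OF Sm[OF st'] sp] sec[OF Hm sp] by auto
    have "(\<integral>\<^sup>+s. ennreal ((?S s - ?S' s)\<^sup>2) \<partial>L) \<le> (\<integral>\<^sup>+s. 2 * ennreal ((?S s - ?H s)\<^sup>2) + 2 * ennreal ((?H s - ?S' s)\<^sup>2) \<partial>L)"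
    proof (rule nn_integral_mono)
      fix s
      have "(x - z)\<^sup>2 \<le> 2 * (x - y)\<^sup>2 + 2 * (y - z)\<^sup>2" for x y z :: real
        using sum_squares_ge_zero[of "x + z - 2 * y" 0] by (simp add: power2_eq_square algebra_simps)
      from this[of "?S s" "?S' s" "?H s"] have "ennreal ((?S s - ?S' s)\<^sup>2) \<le> ennreal (2 * (?S s - ?H s)\<^sup>2 + 2 * (?H s - ?S' s)\<^sup>2)"
        by (rule ennreal_leI)
      then show "ennreal ((?S s - ?S' s)\<^sup>2) \<le> 2 * ennreal ((?S s - ?H s)\<^sup>2) + 2 * ennreal ((?H s - ?S' s)\<^sup>2)"
        by (simp add: ennreal_mult)
    qed
    also have "\<dots> = 2 * (\<integral>\<^sup>+s. ennreal ((?S s - ?H s)\<^sup>2) \<partial>L) + 2 * (\<integral>\<^sup>+s. ennreal ((?H s - ?S' s)\<^sup>2) \<partial>L)"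
      by (simp add: nn_integral_add nn_integral_cmult)
    also have "\<dots> \<le> 2 * ennreal \<kappa> + 2 * ennreal \<kappa>"
      using \<omega> sp E2[of \<omega>] by (intro add_mono mult_left_mono) (auto simp: A_def toL not_less)
    also have "\<dots> = ennreal (4 * \<kappa>)"
      using \<kappa> by (simp add: ennreal_mult[symmetric] flip: ennreal_plus ennreal_numeral)
    finally show "(\<integral>\<^sup>+s\<in>{0..T}. ennreal ((?S s - ?S' s)\<^sup>2) \<partial>lborel) \<le> ennreal (4 * \<kappa>)" unfolding toL .
  qed (use a \<kappa> in auto)
  moreover have "- (a/2)\<^sup>2 / (2 * (4 * \<kappa>)) = - a\<^sup>2 / (32 * \<kappa>)" using \<kappa> by (simp add: power2_eq_square field_simps)
  ultimately have tail: "prob (E - A k - B k) \<le> 2 * exp (- a\<^sup>2 / (32 * \<kappa>))" for k by simp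
  have le: "prob E \<le> prob (A k) + prob (B k) + 2 * exp (- a\<^sup>2 / (32 * \<kappa>))" for k
  proof -
    have "prob E \<le> prob (A k \<union> B k \<union> (E - A k - B k))" using E by (intro finite_measure_mono) auto
    also have "\<dots> \<le> prob (A k \<union> B k) + prob (E - A k - B k)" using E by (intro measure_Un_le) auto
    also have "prob (A k \<union> B k) \<le> prob (A k) + prob (B k)" by (intro measure_Un_le) auto
    finally show ?thesis using tail[of k] by simp
  qed
  have "(\<lambda>k. prob (A k)) \<longlonglongrightarrow> 0" using c1 \<kappa> unfolding null_in_probability_def A_def by blast
  moreover have "(\<lambda>k. prob (B k)) \<longlonglongrightarrow> 0" using c2 a half_gt_zero[OF a] unfolding null_in_probability_def B_def by blast
  ultimately have "(\<lambda>k. prob (A k) + prob (B k) + 2 * exp (- a\<^sup>2 / (32 * \<kappa>))) \<longlonglongrightarrow> 0 + 0 + 2 * exp (- a\<^sup>2 / (32 * \<kappa>))"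
    by (intro tendsto_intros)
  then show ?thesis using LIMSEQ_le_const[OF _ exI[of _ 0]] le by fastforce
qed

text \<open>Since the integrand is deterministic, its random approximants may be frozen at suitable points of the
  probability space; the integrals of the resulting step functions converge fast and depend on \<open>X r\<close> only.\<close>

lemma ito_deterministic_version:
  assumes F: "\<And>u. 0 \<le> u \<Longrightarrow> u \<le> T \<Longrightarrow> sets (F u) \<subseteq> sets (hist M X (\<lambda>_. u))" "\<And>u. space (F u) = space M"
    and ito: "has_ito_integral M F (X r) T (\<lambda>s _. k s) J"
    and t: "0 \<le> t" "t \<le> T" and kt: "\<And>s. t < s \<Longrightarrow> s \<le> T \<Longrightarrow> k s = 0"
  shows "\<exists>V \<in> borel_measurable (hist M X (\<lambda>q. if q = r then t else 0)). AE \<omega> in M. V \<omega> = J \<omega>"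
proof -
  obtain m \<tau> \<xi> where si: "\<And>k. simple_integrand F T (m k) (\<tau> k) (\<xi> k)"
    and c1: "null_in_probability M (\<lambda>i \<omega>. \<integral>\<^sup>+s\<in>{0..T}. ennreal ((simple_process (m i) (\<tau> i) (\<xi> i) s \<omega> - k s)\<^sup>2) \<partial>lborel)"
    and Jm[measurable]: "J \<in> borel_measurable M"
    using ito unfolding has_ito_integral_def by blast
  have st: "adapted_step (m k) (\<tau> k) (\<xi> k)" for k
    by (rule simple_integrand_imp_adapted_step[OF F si])
  \<comment> \<open>Chosen so that \<open>ito_tail\<close> at deviation (1/2)^j with squared
    distance \<open>e j\<close> gives 2 exp(-(j+1)), a summable bound.\<close>
  define e where "e j = (1/4)^j / (32 * (real j + 1))" for j
  have e_pos: "e j > 0" for j by (simp add: e_def)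
  \<comment> \<open>A sample point must exist for some i: otherwise the exceptional event would be
    the whole space for every i, against convergence to 0 in probability.\<close>
  have "\<exists>i \<omega>. \<omega> \<in> space M \<and> (\<integral>\<^sup>+s\<in>{0..T}. ennreal ((simple_process (m i) (\<tau> i) (\<xi> i) s \<omega> - k s)\<^sup>2) \<partial>lborel) \<le> ennreal (e j)" for j
  proof (rule ccontr)
    assume "\<not> ?thesis"
    then have all: "{\<omega>\<in>space M. ennreal (e j) < (\<integral>\<^sup>+s\<in>{0..T}. ennreal ((simple_process (m i) (\<tau> i) (\<xi> i) s \<omega> - k s)\<^sup>2) \<partial>lborel)} = space M" for i
      by (auto simp: not_le)
    have "(\<lambda>i::nat. prob (space M)) \<longlonglongrightarrow> 0"
      using c1[unfolded null_in_probability_def, rule_format, OF e_pos[of j]] unfolding all .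
    then show False by (simp add: prob_space LIMSEQ_const_iff)
  qed
  then obtain i \<omega>0 where \<omega>0: "\<And>j. (\<integral>\<^sup>+s\<in>{0..T}. ennreal ((simple_process (m (i j)) (\<tau> (i j)) (\<xi> (i j)) s (\<omega>0 j) - k s)\<^sup>2) \<partial>lborel) \<le> ennreal (e j)"
    by metis
  \<comment> \<open>Cutting the partition at t makes the integrals depend on \<open>X r\<close> up
    to time t only. It does not increase the distance to k, which vanishes after t.\<close>
  define \<tau>' where "\<tau>' j l = min (\<tau> (i j) l) t" for j l
  define \<xi>' where "\<xi>' j l = (\<lambda>_::'w. \<xi> (i j) l (\<omega>0 j))" for j l
  have st': "adapted_step (m (i j)) (\<tau>' j) (\<xi>' j)" for j
    using st[of "i j"] t by (auto simp: adapted_step_def \<tau>'_def \<xi>'_def min_def)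
  define D where "D j = simple_integral (X r) (m (i j)) (\<tau>' j) (\<xi>' j)" for j
  have Dm: "D j \<in> borel_measurable (hist M X (\<lambda>q. if q = r then t else 0))" for j
    unfolding D_def simple_integral_def
  proof (intro borel_measurable_sum borel_measurable_times borel_measurable_diff)
    fix l assume "l \<in> {..<m (i j)}"
    then have "0 \<le> \<tau>' j l" "0 \<le> \<tau>' j (Suc l)" using st'[of j] by (auto simp: adapted_step_def intro: order_trans)
    then show "X r (\<tau>' j (Suc l)) \<in> borel_measurable (hist M X (\<lambda>q. if q = r then t else 0))"
      "X r (\<tau>' j l) \<in> borel_measurable (hist M X (\<lambda>q. if q = r then t else 0))"
      by (auto intro!: measurable_hist simp: \<tau>'_def)
  qed (simp add: \<xi>'_def)
  have DM[measurable]: "D j \<in> borel_measurable M" for j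
    by (rule measurable_hist_M[OF Dm]) (use t T_pos in auto)
  define E where "E j = {\<omega>\<in>space M. (1/2)^j \<le> \<bar>J \<omega> - D j \<omega>\<bar>}" for j
  have Em[measurable]: "E j \<in> events" for j unfolding E_def by measurable
  have prob_E: "prob (E j) \<le> (1/2)^j" for j
  proof -
    have "prob (E j) \<le> 2 * exp (- ((1/2)^j)\<^sup>2 / (32 * e j))"
    proof (rule ito_tail[OF F ito st'[of j]])
      fix \<omega> assume "\<omega> \<in> E j"
      then show "(1/2)^j \<le> \<bar>J \<omega> - simple_integral (X r) (m (i j)) (\<tau>' j) (\<xi>' j) \<omega>\<bar>" by (simp add: E_def D_def)
      have "(\<integral>\<^sup>+s\<in>{0..T}. ennreal ((k s - simple_process (m (i j)) (\<tau>' j) (\<xi>' j) s \<omega>)\<^sup>2) \<partial>lborel)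
        \<le> (\<integral>\<^sup>+s\<in>{0..T}. ennreal ((simple_process (m (i j)) (\<tau> (i j)) (\<xi> (i j)) s (\<omega>0 j) - k s)\<^sup>2) \<partial>lborel)"
      proof (rule nn_integral_mono)
        fix s :: real
        show "ennreal ((k s - simple_process (m (i j)) (\<tau>' j) (\<xi>' j) s \<omega>)\<^sup>2) * indicator {0..T} s
           \<le> ennreal ((simple_process (m (i j)) (\<tau> (i j)) (\<xi> (i j)) s (\<omega>0 j) - k s)\<^sup>2) * indicator {0..T} s"
        proof (cases "s \<in> {0..T}")
          case True
          show ?thesis
          proof (cases "s \<le> t")
            case True
            then have "simple_process (m (i j)) (\<tau>' j) (\<xi>' j) s \<omega> = simple_process (m (i j)) (\<tau> (i j)) (\<xi> (i j)) s (\<omega>0 j)"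
              unfolding simple_process_def \<tau>'_def \<xi>'_def by (intro sum.cong) (auto simp: indicator_def)
            then show ?thesis by (simp add: power2_commute)
          next
            case False
            then have "simple_process (m (i j)) (\<tau>' j) (\<xi>' j) s \<omega> = 0"
              unfolding simple_process_def \<tau>'_def by (intro sum.neutral) (auto simp: indicator_def)
            moreover have "k s = 0" using False True kt by auto
            ultimately show ?thesis by simp
          qed
        qed simp
      qed
      also have "\<dots> \<le> ennreal (e j)" by (rule \<omega>0)
      finally show "(\<integral>\<^sup>+s\<in>{0..T}. ennreal ((k s - simple_process (m (i j)) (\<tau>' j) (\<xi>' j) s \<omega>)\<^sup>2) \<partial>lborel) \<le> ennreal (e j)" .
    qed (use e_pos in auto)
    also have "- ((1/2)^j)\<^sup>2 / (32 * e j) = - real (Suc j)"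
    proof -
      have "((1/2::real)^j)\<^sup>2 = (1/4)^j" by (simp add: power_mult[symmetric] mult.commute[of j 2] power_mult power2_eq_square flip: power_mult_distrib)
      then show ?thesis by (simp add: e_def field_simps)
    qed
    also have "2 * exp (- real (Suc j)) \<le> (1/2)^j"
    proof -
      have "exp (- real (Suc j)) = exp (-1) ^ Suc j" by (subst exp_of_nat_mult[symmetric]) simp
      also have "\<dots> \<le> (1/2::real) ^ Suc j"
      proof (rule power_mono)
        have "2 \<le> exp (1::real)" using exp_ge_add_one_self[of 1] by simp
        then show "exp (- 1) \<le> (1/2::real)" by (simp add: exp_minus field_simps)
      qed simp
      finally show ?thesis by simp
    qed
    finally show ?thesis .
  qed
  have "AE \<omega> in M. eventually (\<lambda>j. \<omega> \<in> space M - E j) sequentially"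
  proof (rule borel_cantelli_AE1)
    show "summable (\<lambda>j. prob (E j))"
      by (rule summable_comparison_test'[where g = "\<lambda>j. (1/2)^j" and N = 0]) (use prob_E in \<open>auto intro: summable_geometric\<close>)
  qed (auto simp: emeasure_eq_measure)
  then have AE: "AE \<omega> in M. lim (\<lambda>j. D j \<omega>) = J \<omega>"
  proof eventually_elim
    case (elim \<omega>)
    have "(\<lambda>j. D j \<omega> - J \<omega>) \<longlonglongrightarrow> 0"
    proof (rule tendsto_rabs_zero_cancel, rule tendsto_sandwich[OF _ _ tendsto_const LIMSEQ_power_zero[of "1/2"]])
      show "eventually (\<lambda>j. \<bar>D j \<omega> - J \<omega>\<bar> \<le> (1/2)^j) sequentially"
        using elim by eventually_elim (auto simp: E_def abs_minus_commute)
    qed auto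
    then have "(\<lambda>j. D j \<omega>) \<longlonglongrightarrow> J \<omega>" by (rule LIM_zero_cancel)
    then show ?case by (rule limI)
  qed
  \<comment> \<open>A pointwise limit of functions measurable for the history is again measurable
    for it, without completion; the choice of value where the limit does not exist affects only a
    null set.\<close>
  define V where "V = (\<lambda>\<omega>. lim (\<lambda>j. D j \<omega>))"
  have "V \<in> borel_measurable (hist M X (\<lambda>q. if q = r then t else 0))"
    unfolding V_def using Dm by (rule borel_measurable_lim_metric)
  moreover have "AE \<omega> in M. V \<omega> = J \<omega>" using AE unfolding V_def .
  ultimately show ?thesis by blast
qed

end

subsection \<open>Independent Brownian motions\<close>

text \<open>One family over the sum type, so that the results on \<open>bm_family\<close> serve for
  integrals against \<open>B\<close> and against \<open>W\<close>, and histories can treat the two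
  differently.\<close>

definition joint_family :: "(real \<Rightarrow> 'w \<Rightarrow> real^'p) \<Rightarrow> (real \<Rightarrow> 'w \<Rightarrow> real^'d) \<Rightarrow> 'p + 'd \<Rightarrow> real \<Rightarrow> 'w \<Rightarrow> real" where
  "joint_family B W q = (case q of Inl l \<Rightarrow> (\<lambda>t \<omega>. B t \<omega> $ l) | Inr j \<Rightarrow> (\<lambda>t \<omega>. W t \<omega> $ j))"

lemma borel_measurable_vec_iff:
  fixes f :: "'a \<Rightarrow> real^'k"
  shows "f \<in> borel_measurable M \<longleftrightarrow> (\<forall>l. (\<lambda>x. f x $ l) \<in> borel_measurable M)"
  by (subst borel_measurable_euclidean_space) (auto simp: Basis_vec_def inner_axis)

lemma trajectory_measurable:
  assumes "\<And>u. 0 \<le> u \<Longrightarrow> u \<le> t \<Longrightarrow> X u \<in> borel_measurable N"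
  shows "trajectory t X \<in> measurable N (path_algebra t)"
  unfolding path_algebra_def trajectory_def[abs_def] using assms by (intro measurable_restrict) auto

lemma natural_filtration_measurable:
  assumes "0 \<le> u" "u \<le> t"
  shows "X u \<in> borel_measurable (natural_filtration M X t)"
proof -
  have "trajectory t X \<in> space M \<rightarrow> space (path_algebra t)"
    by (auto simp: path_algebra_def space_PiM trajectory_def)
  then have "trajectory t X \<in> measurable (natural_filtration M X t) (path_algebra t)"
    unfolding natural_filtration_def by (rule measurable_vimage_algebra1)
  moreover have "(\<lambda>x. x u) \<in> measurable (path_algebra t) borel"
    unfolding path_algebra_def by (rule measurable_component_singleton) (use assms in auto)
  ultimately have "(\<lambda>\<omega>. trajectory t X \<omega> u) \<in> borel_measurable (natural_filtration M X t)"
    by (rule measurable_compose)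
  then show ?thesis using assms by (simp add: trajectory_def)
qed

lemma space_natural_filtration[simp]: "space (natural_filtration M X t) = space M"
  by (simp add: natural_filtration_def)

lemma natural_filtration_le:
  assumes "space N = space M" "\<And>u. 0 \<le> u \<Longrightarrow> u \<le> t \<Longrightarrow> X u \<in> borel_measurable N"
  shows "sets (natural_filtration M X t) \<subseteq> sets N"
  unfolding natural_filtration_def using assms by (intro sets_image_in_sets trajectory_measurable) auto

lemma driving_filtration_le_hist:
  "sets (driving_filtration M B W u) \<subseteq> sets (hist M (joint_family B W) (\<lambda>_. u))"
  unfolding driving_filtration_def
proof (rule natural_filtration_le)
  fix v assume v: "0 \<le> v" "v \<le> u"
  have "(\<lambda>\<omega>. B v \<omega> $ l) \<in> borel_measurable (hist M (joint_family B W) (\<lambda>_. u))" for l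
    using measurable_hist[of v "\<lambda>_. u" "Inl l" "joint_family B W" M] v by (simp add: joint_family_def)
  moreover have "(\<lambda>\<omega>. W v \<omega> $ j) \<in> borel_measurable (hist M (joint_family B W) (\<lambda>_. u))" for j
    using measurable_hist[of v "\<lambda>_. u" "Inr j" "joint_family B W" M] v by (simp add: joint_family_def)
  ultimately show "(\<lambda>\<omega>. (B v \<omega>, W v \<omega>)) \<in> borel_measurable (hist M (joint_family B W) (\<lambda>_. u))"
    by (intro borel_measurable_Pair) (auto simp: borel_measurable_vec_iff)
qed simp

lemma (in prob_space) brownian_components_indep:
  fixes B :: "real \<Rightarrow> 'a \<Rightarrow> real^'k"
  assumes "brownian_motion M T B"
    and E: "\<And>l. E l \<in> sigma_sets (space M) {(\<lambda>\<omega>. B u \<omega> $ l) -` A \<inter> space M | u A. 0 \<le> u \<and> u \<le> T \<and> A \<in> sets borel}"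
  shows "prob (\<Inter>l. E l) = (\<Prod>l\<in>UNIV. prob (E l))"
proof -
  let ?X = "\<lambda>l. trajectory T (\<lambda>t \<omega>. B t \<omega> $ l)"
  have ind: "indep_sets (\<lambda>l. sigma_sets (space M) {?X l -` A \<inter> space M | A. A \<in> sets (path_algebra T)}) UNIV"
    using assms(1) unfolding brownian_motion_def indep_vars_def by blast
  have "E l \<in> sigma_sets (space M) {?X l -` A \<inter> space M | A. A \<in> sets (path_algebra T)}" for l
  proof -
    have nf: "sets (natural_filtration M (\<lambda>t \<omega>. B t \<omega> $ l) T) = {?X l -` A \<inter> space M | A. A \<in> sets (path_algebra T)}"
      unfolding natural_filtration_def
      by (rule sets_vimage_algebra2) (auto simp: path_algebra_def space_PiM trajectory_def)
    have "sigma_sets (space M) {(\<lambda>\<omega>. B u \<omega> $ l) -` A \<inter> space M | u A. 0 \<le> u \<and> u \<le> T \<and> A \<in> sets borel}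
      \<subseteq> sets (natural_filtration M (\<lambda>t \<omega>. B t \<omega> $ l) T)"
    proof -
      have "{(\<lambda>\<omega>. B u \<omega> $ l) -` A \<inter> space M | u A. 0 \<le> u \<and> u \<le> T \<and> A \<in> sets borel} \<subseteq> sets (natural_filtration M (\<lambda>t \<omega>. B t \<omega> $ l) T)"
        using measurable_sets[OF natural_filtration_measurable[of _ T "\<lambda>t \<omega>. B t \<omega> $ l" M]] by auto
      from sets.sigma_sets_subset[OF this] show ?thesis by simp
    qed
    then show ?thesis using E[of l] nf by auto
  qed
  then show ?thesis by (intro indep_setsD[OF ind]) auto
qed

text \<open>Independence of \<open>B\<close> and \<open>W\<close> splits the product into its left
  and right indices; within each half the components are independent by
  \<open>brownian_motion\<close>.\<close>

lemma bm_family_joint: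
  fixes B :: "real \<Rightarrow> 'w \<Rightarrow> real^'p" and W :: "real \<Rightarrow> 'w \<Rightarrow> real^'d"
  assumes M: "prob_space M" and T: "T > 0" and B: "brownian_motion M T B" and W: "brownian_motion M T W"
    and ind: "independent_processes M T B W"
  shows "bm_family M T (joint_family B W)"
proof -
  interpret prob_space M by (rule M)
  let ?X = "joint_family B W"
  show ?thesis
  proof
    show "0 < T" by (rule T)
    show "brownian_motion1 M T (?X q)" for q
      using B W by (cases q) (auto simp: joint_family_def brownian_motion_def)
    fix E assume E: "\<And>q. E q \<in> sigma_sets (space M) {?X q u -` A \<inter> space M | u A. 0 \<le> u \<and> u \<le> T \<and> A \<in> sets borel}"
    have EB: "E (Inl l) \<in> sigma_sets (space M) {(\<lambda>\<omega>. B u \<omega> $ l) -` A \<inter> space M | u A. 0 \<le> u \<and> u \<le> T \<and> A \<in> sets borel}" for l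
      using E[of "Inl l"] by (simp add: joint_family_def)
    have EW: "E (Inr j) \<in> sigma_sets (space M) {(\<lambda>\<omega>. W u \<omega> $ j) -` A \<inter> space M | u A. 0 \<le> u \<and> u \<le> T \<and> A \<in> sets borel}" for j
      using E[of "Inr j"] by (simp add: joint_family_def)
    have sub: "sigma_sets (space M) {(\<lambda>\<omega>. Y u \<omega> $ l) -` A \<inter> space M | u A. 0 \<le> u \<and> u \<le> T \<and> A \<in> sets borel}
        \<subseteq> sets (natural_filtration M Y T)" for Y :: "real \<Rightarrow> 'w \<Rightarrow> real^'k" and l
    proof -
      have "(\<lambda>\<omega>. Y u \<omega> $ l) \<in> borel_measurable (natural_filtration M Y T)" if "0 \<le> u" "u \<le> T" for u
        using natural_filtration_measurable[OF that, of Y M] by (simp add: borel_measurable_vec_iff)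
      then have "{(\<lambda>\<omega>. Y u \<omega> $ l) -` A \<inter> space M | u A. 0 \<le> u \<and> u \<le> T \<and> A \<in> sets borel} \<subseteq> sets (natural_filtration M Y T)"
        using measurable_sets[of _ "natural_filtration M Y T" borel] by fastforce
      from sets.sigma_sets_subset[OF this] show ?thesis by simp
    qed
    have 1: "(\<Inter>l. E (Inl l)) \<in> sets (natural_filtration M B T)"
      using EB sub[of B] by (intro sets.finite_INT) auto
    have 2: "(\<Inter>j. E (Inr j)) \<in> sets (natural_filtration M W T)"
      using EW sub[of W] by (intro sets.finite_INT) auto
    have "(\<Inter>q. E q) = (\<Inter>l. E (Inl l)) \<inter> (\<Inter>j. E (Inr j))"
      by (auto, metis sum.exhaust)
    then have "prob (\<Inter>q. E q) = prob (\<Inter>l. E (Inl l)) * prob (\<Inter>j. E (Inr j))"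
      using indep_setD[OF ind[unfolded independent_processes_def] 1 2] by simp
    also have "\<dots> = (\<Prod>l\<in>UNIV. prob (E (Inl l))) * (\<Prod>j\<in>UNIV. prob (E (Inr j)))"
      using brownian_components_indep[OF B EB] brownian_components_indep[OF W EW] by simp
    also have "\<dots> = (\<Prod>q\<in>UNIV. prob (E q))"
      by (subst UNIV_Plus_UNIV[symmetric], subst prod.Plus) auto
    finally show "prob (\<Inter>q. E q) = (\<Prod>q\<in>UNIV. prob (E q))" .
  qed
qed

subsection \<open>Riemann sums\<close>

lemma set_integral_split_lebesgue:
  fixes f :: "real \<Rightarrow> real"
  assumes "set_integrable lebesgue {a..c} f" "a \<le> b" "b \<le> c"
  shows "(LINT s:{a..c}|lebesgue. f s) = (LINT s:{a..b}|lebesgue. f s) + (LINT s:{b..c}|lebesgue. f s)"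
proof -
  have sub: "set_integrable lebesgue {a..b} f" "set_integrable lebesgue {b..c} f"
    using assms by (auto intro: set_integrable_subset)
  have "f integrable_on {a..c}" using set_lebesgue_integral_eq_integral(1)[OF assms(1)] .
  from Henstock_Kurzweil_Integration.integral_combine[OF assms(2,3) this] show ?thesis
    using set_lebesgue_integral_eq_integral(2)[OF assms(1)] set_lebesgue_integral_eq_integral(2)[OF sub(1)]
      set_lebesgue_integral_eq_integral(2)[OF sub(2)] by simp
qed

lemma set_integrable_continuous_mult:
  fixes \<phi> \<psi> :: "real \<Rightarrow> real"
  assumes "continuous_on {a..b} \<phi>" "set_integrable lebesgue {a..b} \<psi>"
  shows "set_integrable lebesgue {a..b} (\<lambda>s. \<phi> s * \<psi> s)"
proof -
  have cp: "compact (\<phi> ` {a..b})" by (rule compact_continuous_image[OF assms(1)]) simp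
  then obtain C where C: "\<And>s. s \<in> {a..b} \<Longrightarrow> \<bar>\<phi> s\<bar> \<le> C"
    using compact_imp_bounded[OF cp] unfolding bounded_iff by (metis imageI real_norm_def)
  have m1: "(\<lambda>s. indicator {a..b} s *\<^sub>R \<phi> s) \<in> borel_measurable lebesgue"
    using borel_measurable_continuous_on_indicator[OF _ assms(1)] by (auto intro: measurable_completion)
  have m2: "(\<lambda>s. indicator {a..b} s *\<^sub>R \<psi> s) \<in> borel_measurable lebesgue"
    using assms(2) unfolding set_integrable_def by (rule borel_measurable_integrable)
  have eq: "indicator {a..b} s *\<^sub>R (\<phi> s * \<psi> s) = (indicator {a..b} s *\<^sub>R \<phi> s) * (indicator {a..b} s *\<^sub>R \<psi> s)" for s
    by (simp add: indicator_def)
  show ?thesis unfolding set_integrable_def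
  proof (rule Bochner_Integration.integrable_bound)
    show "integrable lebesgue (\<lambda>s. C * (indicator {a..b} s *\<^sub>R \<psi> s))"
      using assms(2) unfolding set_integrable_def by (rule integrable_mult_right)
    show "(\<lambda>s. indicator {a..b} s *\<^sub>R (\<phi> s * \<psi> s)) \<in> borel_measurable lebesgue"
      unfolding eq using m1 m2 by (rule borel_measurable_times)
    show "AE s in lebesgue. norm (indicator {a..b} s *\<^sub>R (\<phi> s * \<psi> s)) \<le> norm (C * (indicator {a..b} s *\<^sub>R \<psi> s))"
    proof (rule AE_I2)
      fix s
      show "norm (indicator {a..b} s *\<^sub>R (\<phi> s * \<psi> s)) \<le> norm (C * (indicator {a..b} s *\<^sub>R \<psi> s))"
        using C[of s] by (cases "s \<in> {a..b}") (auto simp: abs_mult intro!: mult_right_mono)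
    qed
  qed
qed

definition mesh :: "real \<Rightarrow> nat \<Rightarrow> nat \<Rightarrow> real" where
  "mesh T m k = T * real k / real m"

lemma mesh_0[simp]: "mesh T m 0 = 0" by (simp add: mesh_def)
lemma mesh_end[simp]: "m > 0 \<Longrightarrow> mesh T m m = T" by (simp add: mesh_def)
lemma mesh_diff: "mesh T m (Suc k) - mesh T m k = T / real m"
  by (simp add: mesh_def field_simps flip: diff_divide_distrib add_divide_distrib)
lemma mesh_nonneg: "0 \<le> T \<Longrightarrow> 0 \<le> mesh T m k" by (simp add: mesh_def)
lemma mesh_le: "0 \<le> T \<Longrightarrow> k \<le> m \<Longrightarrow> mesh T m k \<le> T"
  by (cases "m = 0") (auto simp: mesh_def field_simps intro!: mult_left_mono)
lemma mesh_mono: "0 \<le> T \<Longrightarrow> k \<le> l \<Longrightarrow> mesh T m k \<le> mesh T m l"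
  by (simp add: mesh_def divide_right_mono mult_left_mono)
lemma mesh_less: "0 < T \<Longrightarrow> 0 < m \<Longrightarrow> mesh T m k < mesh T m (Suc k)"
  using mesh_diff[of T m k] by (smt (verit) divide_pos_pos of_nat_0_less_iff)

lemma set_integral_mesh_split:
  fixes f :: "real \<Rightarrow> real"
  assumes T: "0 \<le> T" and m: "m > 0" and f: "set_integrable lebesgue {0..T} f"
  shows "(LINT s:{0..T}|lebesgue. f s) = (\<Sum>k<m. LINT s:{mesh T m k..mesh T m (Suc k)}|lebesgue. f s)"
proof -
  have "(LINT s:{0..mesh T m n}|lebesgue. f s) = (\<Sum>k<n. LINT s:{mesh T m k..mesh T m (Suc k)}|lebesgue. f s)" if "n \<le> m" for n
    using that
  proof (induction n)
    case 0
    have "set_integrable lebesgue {0..0} f" by (rule set_integrable_subset[OF f]) (use T in auto)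
    from set_lebesgue_integral_eq_integral(2)[OF this] show ?case by simp
  next
    case (Suc n)
    have "set_integrable lebesgue {0..mesh T m (Suc n)} f"
      by (rule set_integrable_subset[OF f]) (use mesh_le[OF T Suc.prems] in auto)
    from set_integral_split_lebesgue[OF this mesh_nonneg[OF T] mesh_mono[OF T], of n] Suc
    show ?case by simp
  qed
  from this[OF order_refl] show ?thesis using m by simp
qed

lemma riemann_stieltjes_bound:
  fixes \<phi> \<psi> :: "real \<Rightarrow> real"
  assumes T: "0 \<le> T" and m: "m > 0" and \<phi>: "continuous_on {0..T} \<phi>" and \<psi>: "set_integrable lebesgue {0..T} \<psi>"
    and osc: "\<And>k s. k < m \<Longrightarrow> mesh T m k \<le> s \<Longrightarrow> s \<le> mesh T m (Suc k) \<Longrightarrow> \<bar>\<phi> s - \<phi> (mesh T m k)\<bar> \<le> \<kappa>"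
  shows "\<bar>(LINT s:{0..T}|lebesgue. \<phi> s * \<psi> s) - (\<Sum>k<m. \<phi> (mesh T m k) * (LINT s:{mesh T m k..mesh T m (Suc k)}|lebesgue. \<psi> s))\<bar>
     \<le> \<kappa> * (LINT s:{0..T}|lebesgue. \<bar>\<psi> s\<bar>)"
proof -
  let ?P = "\<lambda>k. {mesh T m k..mesh T m (Suc k)}"
  have sub: "?P k \<subseteq> {0..T}" if "k < m" for k
    using mesh_nonneg[OF T, of m k] mesh_le[OF T, of "Suc k" m] that by auto
  have i1: "set_integrable lebesgue (?P k) (\<lambda>s. \<phi> s * \<psi> s)" if "k < m" for k
    by (rule set_integrable_subset[OF set_integrable_continuous_mult[OF \<phi> \<psi>]]) (use sub[OF that] in auto)
  have i2: "set_integrable lebesgue (?P k) \<psi>" if "k < m" for k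
    by (rule set_integrable_subset[OF \<psi>]) (use sub[OF that] in auto)
  have i3: "set_integrable lebesgue {0..T} (\<lambda>s. \<bar>\<psi> s\<bar>)" using \<psi> by (rule set_integrable_abs)
  have i4: "set_integrable lebesgue (?P k) (\<lambda>s. \<bar>\<psi> s\<bar>)" if "k < m" for k
    using i2[OF that] by (rule set_integrable_abs)
  have piece: "\<bar>(LINT s:?P k|lebesgue. \<phi> s * \<psi> s) - \<phi> (mesh T m k) * (LINT s:?P k|lebesgue. \<psi> s)\<bar> \<le> \<kappa> * (LINT s:?P k|lebesgue. \<bar>\<psi> s\<bar>)"
    if k: "k < m" for k
  proof -
    have eq: "(LINT s:?P k|lebesgue. \<phi> s * \<psi> s) - \<phi> (mesh T m k) * (LINT s:?P k|lebesgue. \<psi> s) = (LINT s:?P k|lebesgue. \<phi> s * \<psi> s - \<phi> (mesh T m k) * \<psi> s)"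
      using i1[OF k] i2[OF k] by (subst set_integral_diff) auto
    have "\<bar>(LINT s:?P k|lebesgue. \<phi> s * \<psi> s - \<phi> (mesh T m k) * \<psi> s)\<bar> \<le> (LINT s:?P k|lebesgue. \<bar>\<phi> s * \<psi> s - \<phi> (mesh T m k) * \<psi> s\<bar>)"
      using set_integral_norm_bound[of lebesgue "?P k" "\<lambda>s. \<phi> s * \<psi> s - \<phi> (mesh T m k) * \<psi> s"] i1[OF k] i2[OF k] by auto
    also have "\<dots> \<le> (LINT s:?P k|lebesgue. \<kappa> * \<bar>\<psi> s\<bar>)"
    proof (rule set_integral_mono)
      show "set_integrable lebesgue (?P k) (\<lambda>s. \<bar>\<phi> s * \<psi> s - \<phi> (mesh T m k) * \<psi> s\<bar>)"
        using i1[OF k] i2[OF k] by (intro set_integrable_abs set_integral_diff) auto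
      show "set_integrable lebesgue (?P k) (\<lambda>s. \<kappa> * \<bar>\<psi> s\<bar>)" using i4[OF k] by auto
      fix s assume "s \<in> ?P k"
      then have "\<bar>\<phi> s - \<phi> (mesh T m k)\<bar> \<le> \<kappa>" using osc k by auto
      then show "\<bar>\<phi> s * \<psi> s - \<phi> (mesh T m k) * \<psi> s\<bar> \<le> \<kappa> * \<bar>\<psi> s\<bar>"
        by (simp add: left_diff_distrib[symmetric] abs_mult mult_right_mono)
    qed
    finally show ?thesis unfolding eq by simp
  qed
  have eq: "(LINT s:{0..T}|lebesgue. \<phi> s * \<psi> s) - (\<Sum>k<m. \<phi> (mesh T m k) * (LINT s:?P k|lebesgue. \<psi> s))
    = (\<Sum>k<m. (LINT s:?P k|lebesgue. \<phi> s * \<psi> s) - \<phi> (mesh T m k) * (LINT s:?P k|lebesgue. \<psi> s))"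
    using set_integral_mesh_split[OF T m set_integrable_continuous_mult[OF \<phi> \<psi>]] by (simp add: sum_subtractf)
  have "\<bar>\<Sum>k<m. (LINT s:?P k|lebesgue. \<phi> s * \<psi> s) - \<phi> (mesh T m k) * (LINT s:?P k|lebesgue. \<psi> s)\<bar> \<le> (\<Sum>k<m. \<kappa> * (LINT s:?P k|lebesgue. \<bar>\<psi> s\<bar>))"
    by (rule order_trans[OF sum_abs sum_mono]) (use piece in auto)
  also have "\<dots> = \<kappa> * (LINT s:{0..T}|lebesgue. \<bar>\<psi> s\<bar>)"
    using set_integral_mesh_split[OF T m i3] by (simp add: sum_distrib_left)
  finally show ?thesis unfolding eq .
qed

lemma eventually_mesh_osc:
  fixes \<phi> :: "real \<Rightarrow> 'a::metric_space"
  assumes T: "0 < T" and \<phi>: "continuous_on {0..T} \<phi>" and \<kappa>: "\<kappa> > 0"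
  shows "\<forall>\<^sub>F m in sequentially. m > 0 \<and> (\<forall>s\<in>{0..T}. \<forall>t\<in>{0..T}. \<bar>s - t\<bar> \<le> T / real m \<longrightarrow> dist (\<phi> s) (\<phi> t) < \<kappa>)"
proof -
  have "uniformly_continuous_on {0..T} \<phi>" by (rule compact_uniformly_continuous[OF \<phi>]) simp
  then obtain d where d: "d > 0" "\<And>s t. s \<in> {0..T} \<Longrightarrow> t \<in> {0..T} \<Longrightarrow> dist s t < d \<Longrightarrow> dist (\<phi> s) (\<phi> t) < \<kappa>"
    unfolding uniformly_continuous_on_def using \<kappa> by metis
  have "(\<lambda>m. T / real m) \<longlonglongrightarrow> 0" by (rule lim_const_over_n)
  then have "\<forall>\<^sub>F m in sequentially. T / real m < d" using d(1) by (rule order_tendstoD)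
  then show ?thesis using eventually_gt_at_top[of 0]
    by eventually_elim (use d in \<open>auto simp: dist_real_def\<close>)
qed

lemma riemann_stieltjes_tendsto:
  fixes \<phi> \<psi> :: "real \<Rightarrow> real"
  assumes T: "0 < T" and \<phi>: "continuous_on {0..T} \<phi>" and \<psi>: "set_integrable lebesgue {0..T} \<psi>"
  shows "(\<lambda>m. \<Sum>k<m. \<phi> (mesh T m k) * (LINT s:{mesh T m k..mesh T m (Suc k)}|lebesgue. \<psi> s))
     \<longlonglongrightarrow> (LINT s:{0..T}|lebesgue. \<phi> s * \<psi> s)"
proof (rule LIMSEQ_I)
  fix e :: real assume e: "e > 0"
  define C where "C = (LINT s:{0..T}|lebesgue. \<bar>\<psi> s\<bar>)"
  have C: "C \<ge> 0" unfolding C_def set_lebesgue_integral_def by (rule Bochner_Integration.integral_nonneg) (auto simp: indicator_def)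
  define \<kappa> where "\<kappa> = e / (2 * (C + 1))"
  have \<kappa>: "\<kappa> > 0" using C e by (simp add: \<kappa>_def)
  have "\<kappa> * C \<le> \<kappa> * (C + 1)" using \<kappa> by simp
  also have "\<dots> = e/2" using C by (simp add: \<kappa>_def divide_simps)
  finally have \<kappa>C: "\<kappa> * C < e" using e by simp
  have "\<forall>\<^sub>F m in sequentially. norm ((\<Sum>k<m. \<phi> (mesh T m k) * (LINT s:{mesh T m k..mesh T m (Suc k)}|lebesgue. \<psi> s)) - (LINT s:{0..T}|lebesgue. \<phi> s * \<psi> s)) < e"
    using eventually_mesh_osc[OF T \<phi> \<kappa>]
  proof eventually_elim
    case (elim m)
    have "\<bar>(LINT s:{0..T}|lebesgue. \<phi> s * \<psi> s) - (\<Sum>k<m. \<phi> (mesh T m k) * (LINT s:{mesh T m k..mesh T m (Suc k)}|lebesgue. \<psi> s))\<bar> \<le> \<kappa> * C"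
      unfolding C_def
    proof (rule riemann_stieltjes_bound[OF _ _ \<phi> \<psi>])
      fix k s assume k: "k < m" and s: "mesh T m k \<le> s" "s \<le> mesh T m (Suc k)"
      have "s \<in> {0..T}" "mesh T m k \<in> {0..T}"
        using s mesh_nonneg[of T m k] mesh_le[of T "Suc k" m] mesh_le[of T k m] k T by auto
      moreover have "\<bar>s - mesh T m k\<bar> \<le> T / real m" using s mesh_diff[of T m k] by simp
      ultimately show "\<bar>\<phi> s - \<phi> (mesh T m k)\<bar> \<le> \<kappa>" using elim by (force simp: dist_real_def)
    qed (use elim T in auto)
    then show ?case using \<kappa>C by (simp add: abs_minus_commute)
  qed
  then show "\<exists>no. \<forall>m\<ge>no. norm ((\<Sum>k<m. \<phi> (mesh T m k) * (LINT s:{mesh T m k..mesh T m (Suc k)}|lebesgue. \<psi> s)) - (LINT s:{0..T}|lebesgue. \<phi> s * \<psi> s)) < e"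
    by (simp add: eventually_sequentially)
qed

lemma set_integral_lebesgue_lborel:
  fixes \<phi> :: "real \<Rightarrow> real"
  assumes "continuous_on {a..b} \<phi>"
  shows "(LINT s:{a..b}|lebesgue. \<phi> s) = (LINT s:{a..b}|lborel. \<phi> s)"
  unfolding set_lebesgue_integral_def
  using borel_measurable_continuous_on_indicator[OF _ assms] by (subst integral_completion) auto

lemma set_integrable_const_Icc: "set_integrable lebesgue {a..b::real} (\<lambda>_. c :: real)"
  unfolding set_integrable_def
proof (rule integrable_completion[THEN iffD2])
  show "integrable lborel (\<lambda>x. indicator {a..b} x *\<^sub>R c)"
    by (intro integrable_scaleR_left) (simp add: emeasure_lborel_Icc_eq)
qed auto

lemma LINT_one_Icc: "a \<le> b \<Longrightarrow> (LINT s:{a..b::real}|lebesgue. 1) = b - a"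
  by (simp add: set_integral_lebesgue_lborel set_lebesgue_integral_def)

lemma riemann_tendsto:
  fixes \<phi> :: "real \<Rightarrow> real"
  assumes T: "0 < T" and \<phi>: "continuous_on {0..T} \<phi>"
  shows "(\<lambda>m. \<Sum>k<m. \<phi> (mesh T m k) * (T / real m)) \<longlonglongrightarrow> (LINT s:{0..T}|lborel. \<phi> s)"
proof -
  have "(LINT s:{mesh T m k..mesh T m (Suc k)}|lebesgue. 1) = T / real m" for m k
    using LINT_one_Icc[OF mesh_mono[of T k "Suc k" m]] T mesh_diff[of T m k] by simp
  with riemann_stieltjes_tendsto[OF T \<phi> set_integrable_const_Icc[of 0 T 1]] set_integral_lebesgue_lborel[OF \<phi>]
  show ?thesis by simp
qed

lemma riemann_bound:
  fixes \<phi> :: "real \<Rightarrow> real"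
  assumes T: "0 \<le> T" and m: "m > 0" and \<phi>: "continuous_on {0..T} \<phi>"
    and osc: "\<And>k s. k < m \<Longrightarrow> mesh T m k \<le> s \<Longrightarrow> s \<le> mesh T m (Suc k) \<Longrightarrow> \<bar>\<phi> s - \<phi> (mesh T m k)\<bar> \<le> \<kappa>"
  shows "\<bar>(LINT s:{0..T}|lborel. \<phi> s) - (\<Sum>k<m. \<phi> (mesh T m k) * (T / real m))\<bar> \<le> \<kappa> * T"
proof -
  have "(LINT s:{mesh T m k..mesh T m (Suc k)}|lebesgue. 1) = T / real m" for k
    using LINT_one_Icc[OF mesh_mono[of T k "Suc k" m]] T mesh_diff[of T m k] by simp
  with riemann_stieltjes_bound[OF T m \<phi> set_integrable_const_Icc[of 0 T 1] osc] set_integral_lebesgue_lborel[OF \<phi>] T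
  show ?thesis by (simp add: LINT_one_Icc)
qed

subsection \<open>Tubes in path space\<close>

lemma mspace_C0_space:
  "f \<in> mspace (C0_space T) \<longleftrightarrow> f \<in> extensional {0..T} \<and> continuous_on {0..T} f \<and> f 0 = 0"
proof -
  have "bounded (f ` {0..T})" if "continuous_on {0..T} f"
    using that by (intro compact_imp_bounded compact_continuous_image) auto
  moreover have "Metric_space.mbounded UNIV dist A \<longleftrightarrow> bounded A" for A :: "(real^'k) set"
    by simp
  ultimately show ?thesis
    unfolding C0_space_def C_space_def by auto
qed

lemma mdist_C0_space_le:
  assumes "f \<in> mspace (C0_space T)" "g \<in> mspace (C0_space T)" "0 \<le> T"
  shows "mdist (C0_space T) f g \<le> \<rho> \<longleftrightarrow> (\<forall>t\<in>{0..T}. norm (f t - g t) \<le> \<rho>)"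
proof -
  have "f \<in> mspace (C_space T)" "g \<in> mspace (C_space T)" using assms by (auto simp: C0_space_def)
  then show ?thesis
    unfolding C0_space_def mdist_submetric C_space_def
    using cfunspace_mdist_le[of f "top_of_set {0..T}" euclidean_metric g \<rho>] assms(3)
    by (simp add: dist_norm)
qed

abbreviation C0_prod :: "real \<Rightarrow> ((real \<Rightarrow> real^'k) \<times> (real \<Rightarrow> real^'k)) topology" where
  "C0_prod T \<equiv> prod_topology (mtopology_of (C0_space T)) (mtopology_of (C0_space T))"

text \<open>The closed tube, written pointwise so that it can be used path by path; the upper bounds
  and the conditioning on \<open>B\<close> refer to it. \<open>open_tube\<close> serves for
  coverings and for the lower bound.\<close>

definition tube :: "real \<Rightarrow> (real \<Rightarrow> real^'k) \<Rightarrow> (real \<Rightarrow> real^'k) \<Rightarrow> real \<Rightarrow> ((real \<Rightarrow> real^'k) \<times> (real \<Rightarrow> real^'k)) set" where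
  "tube T f g \<rho> = {(f', g') \<in> mspace (C0_space T) \<times> mspace (C0_space T).
     \<forall>t\<in>{0..T}. norm (f' t - f t) \<le> \<rho> \<and> norm (g' t - g t) \<le> \<rho>}"

definition open_tube :: "real \<Rightarrow> (real \<Rightarrow> real^'k) \<Rightarrow> (real \<Rightarrow> real^'k) \<Rightarrow> real \<Rightarrow> ((real \<Rightarrow> real^'k) \<times> (real \<Rightarrow> real^'k)) set" where
  "open_tube T f g \<rho> = Metric_space.mball (mspace (C0_space T)) (mdist (C0_space T)) f \<rho> \<times>
     Metric_space.mball (mspace (C0_space T)) (mdist (C0_space T)) g \<rho>"

context
  fixes T :: real and f g :: "real \<Rightarrow> real^'k"
  assumes T: "0 \<le> T" and f: "f \<in> mspace (C0_space T)" and g: "g \<in> mspace (C0_space T)"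
begin

interpretation C0: Metric_space "mspace (C0_space T :: (real \<Rightarrow> real^'k) metric)" "mdist (C0_space T :: (real \<Rightarrow> real^'k) metric)"
  by (rule Metric_space_mspace_mdist)

lemma openin_open_tube: "openin (C0_prod T) (open_tube T f g \<rho>)"
  unfolding open_tube_def mtopology_of_def openin_prod_Times_iff by (simp add: C0.openin_mball)

lemma center_in_open_tube: "\<rho> > 0 \<Longrightarrow> (f, g) \<in> open_tube T f g \<rho>"
  unfolding open_tube_def using f g by simp

lemma tube_eq: "tube T f g \<rho> = C0.mcball f \<rho> \<times> C0.mcball g \<rho>"
  unfolding tube_def using f g T
  by (auto simp: C0.mcball_def mdist_C0_space_le norm_minus_commute)

lemma closedin_tube: "closedin (C0_prod T) (tube T f g \<rho>)"
  unfolding tube_eq mtopology_of_def closedin_prod_Times_iff by (simp add: C0.closedin_mcball)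

lemma open_tube_subset: "open_tube T f g \<rho> \<subseteq> tube T f g \<rho>"
  unfolding tube_eq open_tube_def by auto

lemma tube_subset_open:
  assumes U: "openin (C0_prod T) U" "(f, g) \<in> U"
  shows "\<exists>\<rho>>0. tube T f g \<rho> \<subseteq> U"
proof -
  obtain V V' where V: "openin C0.mtopology V" "openin C0.mtopology V'" "f \<in> V" "g \<in> V'" "V \<times> V' \<subseteq> U"
    using U unfolding mtopology_of_def openin_prod_topology_alt by meson
  obtain r r' where r: "r > 0" "r' > 0" "C0.mball f r \<subseteq> V" "C0.mball g r' \<subseteq> V'"
    using V unfolding C0.openin_mtopology by meson
  have "C0.mcball f (min r r' / 2) \<subseteq> V" "C0.mcball g (min r r' / 2) \<subseteq> V'"
    using r by (auto simp: subset_iff C0.mcball_def C0.mball_def)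
  then have "tube T f g (min r r' / 2) \<subseteq> U" unfolding tube_eq using V(5) by blast
  then show ?thesis using r by (intro exI[of _ "min r r' / 2"]) auto
qed

end

lemma tube_mono: "\<rho> \<le> \<rho>' \<Longrightarrow> tube T f g \<rho> \<subseteq> tube T f g \<rho>'"
  unfolding tube_def by (auto intro: order_trans)

subsection \<open>Exponentially small events\<close>

lemma eln_less_imp:
  assumes "e > 0" "0 \<le> p" "ereal e * eln p < ereal (- b)"
  shows "p \<le> exp (- b / e)"
proof (cases "p = 0")
  case False
  then have "e * ln p < - b" using assms by (simp add: eln_def)
  then have "ln p \<le> - b / e" using assms(1) by (simp add: field_simps)
  then show ?thesis using False assms(2) by (metis exp_le_cancel_iff exp_ln order_le_less)
qed simp

lemma le_imp_eln_le:
  assumes "e > 0" "0 \<le> p" "p \<le> exp (- b / e)"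
  shows "ereal e * eln p \<le> ereal (- b)"
proof (cases "p = 0")
  case False
  then have "ln p \<le> - b / e" using assms by (metis ln_exp ln_le_cancel_iff exp_gt_zero order_le_less)
  then show ?thesis using False assms(1) by (simp add: eln_def field_simps)
qed (use assms in \<open>simp add: eln_def\<close>)

lemma less_eln_imp:
  assumes "e > 0" "0 \<le> p" "ereal (- c) < ereal e * eln p"
  shows "exp (- c / e) \<le> p"
proof (cases "p = 0")
  case False
  then have "- c < e * ln p" using assms by (simp add: eln_def)
  then have "- c / e \<le> ln p" using assms(1) by (simp add: field_simps)
  then show ?thesis using False assms(2) by (metis exp_le_cancel_iff exp_ln order_le_less)
qed (use assms in \<open>simp add: eln_def\<close>)

lemma le_imp_le_eln:
  assumes "e > 0" "exp (- c / e) \<le> p"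
  shows "ereal (- c) \<le> ereal e * eln p"
proof -
  have p: "p > 0" using assms(2) exp_gt_zero[of "- c / e"] by linarith
  then have "- c / e \<le> ln p" using assms by (metis ln_exp ln_le_cancel_iff exp_gt_zero)
  then show ?thesis using p assms(1) by (simp add: eln_def field_simps)
qed

lemma sets_borel_of_top_open: "openin X U \<Longrightarrow> U \<in> sets (borel_of_top X)"
  unfolding borel_of_top_def by (subst sets_measure_of) (auto dest: openin_subset)

lemma space_borel_of_top[simp]: "space (borel_of_top X) = topspace X"
  unfolding borel_of_top_def by (rule space_measure_of) (auto dest: openin_subset)

lemma sets_borel_of_top_closed: "closedin X C \<Longrightarrow> C \<in> sets (borel_of_top X)"
proof -
  assume C: "closedin X C"
  then have "topspace X - C \<in> sets (borel_of_top X)" by (intro sets_borel_of_top_open) auto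
  from sets.compl_sets[OF this] have "topspace X - (topspace X - C) \<in> sets (borel_of_top X)" by simp
  moreover have "topspace X - (topspace X - C) = C" using closedin_subset[OF C] by auto
  ultimately show ?thesis by simp
qed

lemma borel_of_top_euclidean: "sets (borel_of_top euclidean) = sets borel"
  by (simp add: borel_of_top_def borel_def)

locale ldp_speed = prob_space M for M :: "'w measure" +
  fixes \<epsilon> :: "nat \<Rightarrow> real"
  assumes eps_pos: "\<And>n. \<epsilon> n > 0" and eps_lim: "\<epsilon> \<longlonglongrightarrow> 0"
begin

lemma eps2_pos: "(\<epsilon> n)\<^sup>2 > 0" using eps_pos[of n] by simp

lemma eps_nz: "\<epsilon> n \<noteq> 0" using eps_pos[of n] by simp

lemma inverse_eps2_at_top: "filterlim (\<lambda>n. 1 / (\<epsilon> n)\<^sup>2) at_top sequentially"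
proof -
  have "((\<lambda>n. (\<epsilon> n)\<^sup>2) \<longlongrightarrow> 0) sequentially" using tendsto_power[OF eps_lim, of 2] by simp
  then have "filterlim (\<lambda>n. inverse ((\<epsilon> n)\<^sup>2)) at_top sequentially"
    by (rule filterlim_inverse_at_top) (simp add: eps_nz)
  then show ?thesis by (simp add: inverse_eq_divide)
qed

lemma eventually_absorb_const:
  assumes "b < b'"
  shows "\<forall>\<^sub>F n in sequentially. C * exp (- b' / (\<epsilon> n)\<^sup>2) \<le> exp (- b / (\<epsilon> n)\<^sup>2)"
proof -
  have "\<forall>\<^sub>F n in sequentially. \<bar>C\<bar> / (b' - b) \<le> 1 / (\<epsilon> n)\<^sup>2"
    using inverse_eps2_at_top by (simp add: filterlim_at_top)
  then show ?thesis
  proof eventually_elim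
    case (elim n)
    have "C \<le> \<bar>C\<bar>" by simp
    also have "\<dots> \<le> (b' - b) / (\<epsilon> n)\<^sup>2" using elim assms by (simp add: field_simps)
    also have "\<dots> \<le> exp ((b' - b) / (\<epsilon> n)\<^sup>2)" using exp_ge_add_one_self[of "(b' - b) / (\<epsilon> n)\<^sup>2"] by linarith
    finally have "C * exp (- b' / (\<epsilon> n)\<^sup>2) \<le> exp ((b' - b) / (\<epsilon> n)\<^sup>2) * exp (- b' / (\<epsilon> n)\<^sup>2)"
      by (rule mult_right_mono) simp
    also have "\<dots> = exp (- b / (\<epsilon> n)\<^sup>2)" by (simp flip: exp_add add: diff_divide_distrib)
    finally show ?case .
  qed
qed

text \<open>Logarithmic upper bound with exponent a in outer measure: the sets themselves need not
  be measurable. Quantifying over b < a lets constant factors, and hence finite unions, be absorbed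
  without changing a.\<close>

definition exp_small :: "(nat \<Rightarrow> 'w set) \<Rightarrow> real \<Rightarrow> bool" where
  "exp_small A a \<longleftrightarrow> (\<forall>b<a. \<forall>\<^sub>F n in sequentially. \<exists>E\<in>events. A n \<inter> space M \<subseteq> E \<and> prob E \<le> exp (- b / (\<epsilon> n)\<^sup>2))"

lemma exp_smallD:
  assumes "exp_small A a" "b < a" "\<And>n. A n \<in> events"
  shows "\<forall>\<^sub>F n in sequentially. prob (A n) \<le> exp (- b / (\<epsilon> n)\<^sup>2)"
  using assms(1)[unfolded exp_small_def, rule_format, OF assms(2)]
proof eventually_elim
  case (elim n)
  then obtain E where E: "E \<in> events" "A n \<inter> space M \<subseteq> E" "prob E \<le> exp (- b / (\<epsilon> n)\<^sup>2)" by blast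
  have "A n \<subseteq> E" using E(2) sets.sets_into_space[OF assms(3)[of n]] by auto
  then show ?case using finite_measure_mono[of "A n" E] E by simp
qed

lemma exp_smallI:
  assumes "\<And>n. E n \<in> events" "\<And>b. b < a \<Longrightarrow> \<forall>\<^sub>F n in sequentially. prob (E n) \<le> exp (- b / (\<epsilon> n)\<^sup>2)"
    "\<And>n. A n \<inter> space M \<subseteq> E n"
  shows "exp_small A a"
  unfolding exp_small_def
proof (intro allI impI)
  fix b assume "b < a"
  from assms(2)[OF this] show "\<forall>\<^sub>F n in sequentially. \<exists>E\<in>events. A n \<inter> space M \<subseteq> E \<and> prob E \<le> exp (- b / (\<epsilon> n)\<^sup>2)"
    by eventually_elim (use assms in blast)
qed

lemma exp_small_mono_eventually:
  assumes "exp_small A a" "\<forall>\<^sub>F n in sequentially. B n \<inter> space M \<subseteq> A n"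
  shows "exp_small B a"
  unfolding exp_small_def
proof (intro allI impI)
  fix b assume "b < a"
  from assms(1)[unfolded exp_small_def, rule_format, OF this] assms(2)
  show "\<forall>\<^sub>F n in sequentially. \<exists>E\<in>events. B n \<inter> space M \<subseteq> E \<and> prob E \<le> exp (- b / (\<epsilon> n)\<^sup>2)"
    by eventually_elim blast
qed

lemma exp_small_mono: "exp_small A a \<Longrightarrow> (\<And>n. B n \<inter> space M \<subseteq> A n) \<Longrightarrow> exp_small B a"
  by (rule exp_small_mono_eventually) (auto intro: always_eventually)

text \<open>Needed because the formula for the log-price holds only almost surely, separately for
  each n.\<close>

lemma exp_small_AE:
  assumes A: "exp_small A a" and N: "\<And>n. AE \<omega> in M. \<omega> \<in> B n \<longrightarrow> \<omega> \<in> A n"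
  shows "exp_small B a"
  unfolding exp_small_def
proof (intro allI impI)
  fix b assume "b < a"
  from A[unfolded exp_small_def, rule_format, OF this]
  show "\<forall>\<^sub>F n in sequentially. \<exists>E\<in>events. B n \<inter> space M \<subseteq> E \<and> prob E \<le> exp (- b / (\<epsilon> n)\<^sup>2)"
  proof eventually_elim
    case (elim n)
    then obtain E where E: "E \<in> events" "A n \<inter> space M \<subseteq> E" "prob E \<le> exp (- b / (\<epsilon> n)\<^sup>2)" by blast
    obtain Z where Z: "Z \<in> null_sets M" "{\<omega>\<in>space M. \<not> (\<omega> \<in> B n \<longrightarrow> \<omega> \<in> A n)} \<subseteq> Z"
      using AE_E[OF N[of n]] by (metis null_setsI)
    have "prob (E \<union> Z) \<le> prob E + prob Z" using E Z by (intro measure_Un_le) auto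
    also have "prob Z = 0" using Z by (simp add: measure_eq_0_null_sets)
    finally have "prob (E \<union> Z) \<le> exp (- b / (\<epsilon> n)\<^sup>2)" using E by simp
    moreover have "B n \<inter> space M \<subseteq> E \<union> Z" using E Z by auto
    ultimately show ?case using E Z by (intro bexI[of _ "E \<union> Z"]) auto
  qed
qed

lemma exp_small_Un:
  assumes A: "exp_small A a" and B: "exp_small B a"
  shows "exp_small (\<lambda>n. A n \<union> B n) a"
  unfolding exp_small_def
proof (intro allI impI)
  fix b assume b: "b < a"
  define b' where "b' = (a + b) / 2"
  have b': "b < b'" "b' < a" using b by (auto simp: b'_def)
  from A[unfolded exp_small_def, rule_format, OF b'(2)] B[unfolded exp_small_def, rule_format, OF b'(2)]
    eventually_absorb_const[OF b'(1), of 2]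
  show "\<forall>\<^sub>F n in sequentially. \<exists>E\<in>events. (A n \<union> B n) \<inter> space M \<subseteq> E \<and> prob E \<le> exp (- b / (\<epsilon> n)\<^sup>2)"
  proof eventually_elim
    case (elim n)
    then obtain E E' where E: "E \<in> events" "A n \<inter> space M \<subseteq> E" "prob E \<le> exp (- b' / (\<epsilon> n)\<^sup>2)"
      and E': "E' \<in> events" "B n \<inter> space M \<subseteq> E'" "prob E' \<le> exp (- b' / (\<epsilon> n)\<^sup>2)" by blast
    have "prob (E \<union> E') \<le> prob E + prob E'" using E E' by (intro measure_Un_le) auto
    then have "prob (E \<union> E') \<le> exp (- b / (\<epsilon> n)\<^sup>2)" using E E' elim(3) by linarith
    then show ?case using E E' by (intro bexI[of _ "E \<union> E'"]) auto
  qed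
qed

lemma exp_small_empty: "exp_small (\<lambda>n. {}) a"
  unfolding exp_small_def by (auto intro!: bexI[of _ "{}"] always_eventually)

lemma exp_small_UN:
  assumes "finite I" "\<And>i. i \<in> I \<Longrightarrow> exp_small (A i) a"
  shows "exp_small (\<lambda>n. \<Union>i\<in>I. A i n) a"
  using assms
proof (induction I)
  case (insert i I)
  then show ?case using exp_small_Un[of "A i" a "\<lambda>n. \<Union>i\<in>I. A i n"] by simp
qed (simp add: exp_small_empty)

lemma LDP_upper:
  assumes L: "satisfies_LDP M X (\<lambda>n. 1 / (\<epsilon> n)\<^sup>2) I \<xi>" and C: "closedin X C"
    and a: "\<And>x. x \<in> C \<Longrightarrow> ereal a \<le> I x"
  shows "exp_small (\<lambda>n. {\<omega>\<in>space M. \<xi> n \<omega> \<in> C}) a"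
proof (rule exp_smallI)
  have \<xi>: "\<xi> n \<in> M \<rightarrow>\<^sub>M borel_of_top X" for n using L by (simp add: satisfies_LDP_def)
  show ev: "{\<omega>\<in>space M. \<xi> n \<omega> \<in> C} \<in> events" for n
    using measurable_sets[OF \<xi> sets_borel_of_top_closed[OF C], of n] by (simp add: vimage_def Int_def conj_commute)
  fix b assume b: "b < a"
  have pr: "measure (distr M (borel_of_top X) (\<xi> n)) C = prob {\<omega>\<in>space M. \<xi> n \<omega> \<in> C}" for n
    by (subst measure_distr[OF \<xi> sets_borel_of_top_closed[OF C]]) (simp add: vimage_def Int_def conj_commute)
  have "limsup (\<lambda>n. ereal ((\<epsilon> n)\<^sup>2) * eln (measure (distr M (borel_of_top X) (\<xi> n)) C)) \<le> - (INF x\<in>C. I x)"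
    using L C unfolding satisfies_LDP_def LDP_def by simp
  then have "limsup (\<lambda>n. ereal ((\<epsilon> n)\<^sup>2) * eln (prob {\<omega>\<in>space M. \<xi> n \<omega> \<in> C})) \<le> - (INF x\<in>C. I x)"
    unfolding pr .
  also have "\<dots> \<le> - ereal a" unfolding ereal_minus_le_minus by (rule INF_greatest[OF a])
  also have "\<dots> < ereal (- b)" using b by simp
  finally have "\<forall>\<^sub>F n in sequentially. ereal ((\<epsilon> n)\<^sup>2) * eln (prob {\<omega>\<in>space M. \<xi> n \<omega> \<in> C}) < ereal (- b)"
    by (rule Limsup_lessD)
  then show "\<forall>\<^sub>F n in sequentially. prob {\<omega>\<in>space M. \<xi> n \<omega> \<in> C} \<le> exp (- b / (\<epsilon> n)\<^sup>2)"
    by eventually_elim (rule eln_less_imp[OF eps2_pos measure_nonneg])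
qed auto

lemma LDP_lower:
  assumes L: "satisfies_LDP M X (\<lambda>n. 1 / (\<epsilon> n)\<^sup>2) I \<xi>" and U: "openin X U" and x: "x \<in> U" "I x < ereal c"
  shows "\<forall>\<^sub>F n in sequentially. exp (- c / (\<epsilon> n)\<^sup>2) \<le> prob {\<omega>\<in>space M. \<xi> n \<omega> \<in> U}"
proof -
  have \<xi>: "\<xi> n \<in> M \<rightarrow>\<^sub>M borel_of_top X" for n using L by (simp add: satisfies_LDP_def)
  have pr: "measure (distr M (borel_of_top X) (\<xi> n)) U = prob {\<omega>\<in>space M. \<xi> n \<omega> \<in> U}" for n
    by (subst measure_distr[OF \<xi> sets_borel_of_top_open[OF U]]) (simp add: vimage_def Int_def conj_commute)
  have "ereal (- c) < - (INF x\<in>U. I x)"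
    using INF_lower[of x U I] x by (metis ereal_less_uminus_reorder order_le_less_trans uminus_ereal.simps(1) ereal_minus_less_minus)
  also have "\<dots> \<le> liminf (\<lambda>n. ereal ((\<epsilon> n)\<^sup>2) * eln (measure (distr M (borel_of_top X) (\<xi> n)) U))"
    using L U unfolding satisfies_LDP_def LDP_def by simp
  also have "\<dots> = liminf (\<lambda>n. ereal ((\<epsilon> n)\<^sup>2) * eln (prob {\<omega>\<in>space M. \<xi> n \<omega> \<in> U}))"
    unfolding pr ..
  finally have "\<forall>\<^sub>F n in sequentially. ereal (- c) < ereal ((\<epsilon> n)\<^sup>2) * eln (prob {\<omega>\<in>space M. \<xi> n \<omega> \<in> U})"
    by (rule less_LiminfD)
  then show ?thesis by eventually_elim (rule less_eln_imp[OF eps2_pos measure_nonneg])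
qed

text \<open>A local form of the large deviation principle suffices in Euclidean space. Its two halves together already
  yield that the rate function is lower semicontinuous with compact level sets.\<close>

lemma LDP_euclidean_local:
  fixes \<xi> :: "nat \<Rightarrow> 'w \<Rightarrow> 'e::euclidean_space" and I :: "'e \<Rightarrow> ereal"
  assumes \<xi>[measurable]: "\<And>n. \<xi> n \<in> borel_measurable M" and I_nonneg: "\<And>z. 0 \<le> I z"
    and up: "\<And>z a. ereal a < I z \<Longrightarrow> \<exists>r>0. exp_small (\<lambda>n. {\<omega>. dist (\<xi> n \<omega>) z < r}) a"
    and low: "\<And>z c r. I z < ereal c \<Longrightarrow> r > 0 \<Longrightarrow> \<forall>\<^sub>F n in sequentially. exp (- c / (\<epsilon> n)\<^sup>2) \<le> prob {\<omega>\<in>space M. dist (\<xi> n \<omega>) z < r}"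
    and tight: "\<And>a. \<exists>R. exp_small (\<lambda>n. {\<omega>. R < norm (\<xi> n \<omega>)}) a"
  shows "satisfies_LDP M euclidean (\<lambda>n. 1 / (\<epsilon> n)\<^sup>2) I \<xi> \<and> good_rate_function euclidean I"
proof -
  \<comment> \<open>Exponential smallness on an open set bounds the rate from below: a point of
    smaller rate would force exp(-c/\<epsilon>^2) below exp(-c'/\<epsilon>^2) with c < c'. Both
    semicontinuity and compactness of the level sets rest on this.\<close>
  have lower_bound: "ereal a \<le> I z" if U: "open U" "z \<in> U" and small: "exp_small (\<lambda>n. {\<omega>. \<xi> n \<omega> \<in> U}) a" for U z a
  proof (rule ccontr)
    assume "\<not> ereal a \<le> I z"
    then have "I z < ereal a" by (simp add: not_le)
    then obtain c where c: "I z < ereal c" "c < a" using ereal_dense2[of "I z" "ereal a"] by auto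
    obtain r where r: "r > 0" "ball z r \<subseteq> U" using U open_contains_ball by blast
    define c' where "c' = (a + c) / 2"
    have c': "c < c'" "c' < a" using c by (auto simp: c'_def)
    have "exp_small (\<lambda>n. {\<omega>\<in>space M. dist (\<xi> n \<omega>) z < r}) a"
      by (rule exp_small_mono[OF small]) (use r in \<open>auto simp: dist_commute subset_iff\<close>)
    from exp_smallD[OF this c'(2)] have "\<forall>\<^sub>F n in sequentially. prob {\<omega>\<in>space M. dist (\<xi> n \<omega>) z < r} \<le> exp (- c' / (\<epsilon> n)\<^sup>2)"
      by measurable
    moreover note low[OF c(1) r(1)]
    moreover note eventually_absorb_const[OF c'(1), of 2]
    ultimately have "\<forall>\<^sub>F n in sequentially. False"
    proof eventually_elim
      case (elim n)
      have "exp (- c' / (\<epsilon> n)\<^sup>2) > 0" by simp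
      then show ?case using elim by linarith
    qed
    then show False by simp
  qed
  have lsc: "open {z. ereal a < I z}" for a
    unfolding open_contains_ball
  proof
    fix z assume "z \<in> {z. ereal a < I z}"
    then obtain a' where a': "ereal a < ereal a'" "ereal a' < I z" using ereal_dense2[of "ereal a" "I z"] by auto
    obtain r where r: "r > 0" "exp_small (\<lambda>n. {\<omega>. dist (\<xi> n \<omega>) z < r}) a'" using up[OF a'(2)] by blast
    have "ereal a' \<le> I y" if "y \<in> ball z r" for y
      by (rule lower_bound[OF open_ball that]) (use r in \<open>simp add: dist_commute\<close>)
    then show "\<exists>e>0. ball z e \<subseteq> {z. ereal a < I z}"
      using r a' by (intro exI[of _ r]) (auto intro: less_le_trans[of _ "ereal a'"])
  qed
  have lsc': "open {z. a < I z}" for a :: ereal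
  proof (cases a)
    case MInf
    then have "{z. a < I z} = UNIV" using I_nonneg by (auto intro: less_le_trans[of _ 0])
    then show ?thesis by simp
  qed (auto simp: lsc)
  have rate: "rate_function euclidean I"
    unfolding rate_function_def using I_nonneg lsc' by simp
  have compact: "compact {z. I z \<le> ereal a}" for a
  proof -
    have cl: "closed {z. I z \<le> ereal a}"
      using lsc[of a] by (simp add: closed_def Collect_neg_eq[symmetric] not_le)
    \<comment> \<open>Exponent a + 1 and not a: outside the ball the rate is then at least a + 1, so
      no point of the level set lies there.\<close>
    obtain R where R: "exp_small (\<lambda>n. {\<omega>. R < norm (\<xi> n \<omega>)}) (a + 1)" using tight by blast
    have "norm z \<le> R" if "I z \<le> ereal a" for z
    proof (rule ccontr)
      assume "\<not> norm z \<le> R"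
      then have mem: "z \<in> {z. R < norm z}" by simp
      have op: "open {z::'e. R < norm z}" by (intro open_Collect_less continuous_intros)
      have "ereal (a + 1) \<le> I z" using lower_bound[OF op mem] R by simp
      then have "ereal (a + 1) \<le> ereal a" using that by (rule order_trans)
      then show False by simp
    qed
    then have "bounded {z. I z \<le> ereal a}" unfolding bounded_iff by blast
    then show ?thesis using cl compact_eq_bounded_closed by blast
  qed
  have good: "good_rate_function euclidean I"
    unfolding good_rate_function_def using rate compact by simp
  have \<xi>': "\<xi> n \<in> M \<rightarrow>\<^sub>M borel_of_top euclidean" for n
    using \<xi>[of n] unfolding measurable_cong_sets[OF refl borel_of_top_euclidean, of M] .
  have ev: "{\<omega>\<in>space M. \<xi> n \<omega> \<in> S} \<in> events" if "S \<in> sets borel" for n S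
  proof -
    have "{\<omega>\<in>space M. \<xi> n \<omega> \<in> S} = \<xi> n -` S \<inter> space M" by blast
    then show ?thesis using measurable_sets[OF \<xi> that, of n] by (simp only:)
  qed
  have pr: "measure (distr M (borel_of_top euclidean) (\<xi> n)) S = prob {\<omega>\<in>space M. \<xi> n \<omega> \<in> S}" if "S \<in> sets borel" for n S
  proof -
    have "S \<in> sets (borel_of_top euclidean)" using that unfolding borel_of_top_euclidean .
    moreover have "{\<omega>\<in>space M. \<xi> n \<omega> \<in> S} = \<xi> n -` S \<inter> space M" by blast
    ultimately show ?thesis using measure_distr[OF \<xi>'] by (simp only:)
  qed
  have open_part: "- (INF x\<in>\<Theta>. I x) \<le> liminf (\<lambda>n. ereal ((\<epsilon> n)\<^sup>2) * eln (prob {\<omega>\<in>space M. \<xi> n \<omega> \<in> \<Theta>}))" if \<Theta>: "open \<Theta>" for \<Theta>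
  proof -
    let ?L = "liminf (\<lambda>n. ereal ((\<epsilon> n)\<^sup>2) * eln (prob {\<omega>\<in>space M. \<xi> n \<omega> \<in> \<Theta>}))"
    have "- ?L \<le> I z" if z: "z \<in> \<Theta>" for z
    proof (rule dense_ge)
      fix y assume y: "I z < y"
      then obtain c where c: "I z < ereal c" "ereal c < y" using ereal_dense2 by blast
      obtain r where r: "r > 0" "ball z r \<subseteq> \<Theta>" using \<Theta> z open_contains_ball by blast
      have "\<forall>\<^sub>F n in sequentially. ereal (- c) \<le> ereal ((\<epsilon> n)\<^sup>2) * eln (prob {\<omega>\<in>space M. \<xi> n \<omega> \<in> \<Theta>})"
        using low[OF c(1) r(1)]
      proof eventually_elim
        case (elim n)
        have "{\<omega>\<in>space M. \<xi> n \<omega> \<in> \<Theta>} \<in> events" by (rule ev[OF borel_open[OF \<Theta>]])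
        then have "prob {\<omega>\<in>space M. dist (\<xi> n \<omega>) z < r} \<le> prob {\<omega>\<in>space M. \<xi> n \<omega> \<in> \<Theta>}"
          by (intro finite_measure_mono) (use r in \<open>auto simp: dist_commute subset_iff\<close>)
        then show ?case using elim by (intro le_imp_le_eln eps2_pos) auto
      qed
      then have "ereal (- c) \<le> ?L" by (rule Liminf_bounded)
      then have "- ?L \<le> - ereal (- c)" unfolding ereal_minus_le_minus .
      then have "- ?L \<le> ereal c" by simp
      then show "- ?L \<le> y" using c(2) by simp
    qed
    then have "- ?L \<le> (INF x\<in>\<Theta>. I x)" by (rule INF_greatest)
    then show ?thesis by (simp add: ereal_uminus_le_reorder)
  qed
  have closed_part: "limsup (\<lambda>n. ereal ((\<epsilon> n)\<^sup>2) * eln (prob {\<omega>\<in>space M. \<xi> n \<omega> \<in> \<Gamma>})) \<le> - (INF x\<in>\<Gamma>. I x)" if \<Gamma>: "closed \<Gamma>" for \<Gamma>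
  proof -
    let ?L = "limsup (\<lambda>n. ereal ((\<epsilon> n)\<^sup>2) * eln (prob {\<omega>\<in>space M. \<xi> n \<omega> \<in> \<Gamma>}))"
    have "(INF x\<in>\<Gamma>. I x) \<le> - ?L"
    proof (rule dense_le)
      fix y assume y: "y < (INF x\<in>\<Gamma>. I x)"
      then obtain a where a: "y < ereal a" "ereal a < (INF x\<in>\<Gamma>. I x)" using ereal_dense2 by blast
      obtain b where b: "y < ereal b" "b < a" using ereal_dense2[OF a(1)] by auto
      have Ia: "ereal a < I z" if "z \<in> \<Gamma>" for z using a(2) INF_lower[OF that, of I] by (rule less_le_trans)
      \<comment> \<open>Exponential tightness reduces \<Gamma> to a compact part, which finitely
        many of the balls supplied by the local upper bound cover.\<close>
      obtain R where R: "exp_small (\<lambda>n. {\<omega>. R < norm (\<xi> n \<omega>)}) a" using tight by blast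
      have cp: "compact (\<Gamma> \<inter> cball 0 R)" using \<Gamma> by (intro closed_Int_compact) auto
      have "\<exists>r>0. exp_small (\<lambda>n. {\<omega>. dist (\<xi> n \<omega>) z < r}) a" if "z \<in> \<Gamma>" for z using up[OF Ia[OF that]] .
      then obtain r where r: "\<And>z. z \<in> \<Gamma> \<Longrightarrow> r z > 0 \<and> exp_small (\<lambda>n. {\<omega>. dist (\<xi> n \<omega>) z < r z}) a" by metis
      obtain S where S: "S \<subseteq> \<Gamma> \<inter> cball 0 R" "finite S" "\<Gamma> \<inter> cball 0 R \<subseteq> (\<Union>z\<in>S. ball z (r z))"
        using compactE_image[OF cp, of "\<Gamma> \<inter> cball 0 R" "\<lambda>z. ball z (r z)"] r by (metis (no_types, lifting) IntD1 UN_I centre_in_ball open_ball subsetI)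
      have "exp_small (\<lambda>n. {\<omega>. R < norm (\<xi> n \<omega>)} \<union> (\<Union>z\<in>S. {\<omega>. dist (\<xi> n \<omega>) z < r z})) a"
        by (intro exp_small_Un exp_small_UN R) (use S r in auto)
      then have "exp_small (\<lambda>n. {\<omega>\<in>space M. \<xi> n \<omega> \<in> \<Gamma>}) a"
      proof (rule exp_small_mono, intro subsetI)
        fix n \<omega> assume "\<omega> \<in> {\<omega>\<in>space M. \<xi> n \<omega> \<in> \<Gamma>} \<inter> space M"
        then have "\<xi> n \<omega> \<in> \<Gamma>" by simp
        then have "R < norm (\<xi> n \<omega>) \<or> \<xi> n \<omega> \<in> (\<Union>z\<in>S. ball z (r z))" using S(3) by (force simp: not_less)
        then show "\<omega> \<in> {\<omega>. R < norm (\<xi> n \<omega>)} \<union> (\<Union>z\<in>S. {\<omega>. dist (\<xi> n \<omega>) z < r z})" by (auto simp: dist_commute)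
      qed
      moreover have "{\<omega>\<in>space M. \<xi> n \<omega> \<in> \<Gamma>} \<in> events" for n by (rule ev[OF borel_closed[OF \<Gamma>]])
      ultimately have "\<forall>\<^sub>F n in sequentially. prob {\<omega>\<in>space M. \<xi> n \<omega> \<in> \<Gamma>} \<le> exp (- b / (\<epsilon> n)\<^sup>2)"
        using b(2) by (intro exp_smallD) auto
      then have "\<forall>\<^sub>F n in sequentially. ereal ((\<epsilon> n)\<^sup>2) * eln (prob {\<omega>\<in>space M. \<xi> n \<omega> \<in> \<Gamma>}) \<le> ereal (- b)"
        by eventually_elim (intro le_imp_eln_le eps2_pos measure_nonneg)
      then have "?L \<le> ereal (- b)" by (rule Limsup_bounded)
      then have "- ereal (- b) \<le> - ?L" unfolding ereal_minus_le_minus .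
      then have "ereal b \<le> - ?L" by simp
      then show "y \<le> - ?L" using b(1) by simp
    qed
    then have "- (- ?L) \<le> - (INF x\<in>\<Gamma>. I x)" unfolding ereal_minus_le_minus .
    then show ?thesis by simp
  qed
  have "LDP euclidean (\<lambda>n. 1 / (\<epsilon> n)\<^sup>2) I (\<lambda>n. distr M (borel_of_top euclidean) (\<xi> n))"
    unfolding LDP_def using inverse_eps2_at_top rate open_part closed_part pr by (simp add: borel_open borel_closed)
  then show ?thesis unfolding satisfies_LDP_def using \<xi>' good by simp
qed

end

subsection \<open>Oscillation of the coefficients along the paths\<close>

lemma continuous_on_path_compose:
  assumes "continuous_on UNIV (h :: 'a::topological_space \<Rightarrow> 'b::topological_space)" "continuous_on S g"
  shows "continuous_on S (\<lambda>s. h (g s))"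
  by (rule continuous_on_compose2[OF assms]) auto

text \<open>All paths in the tube stay in one ball, where h is uniformly continuous and bounded, and
  they share the modulus of continuity of g up to the width of the tube. Hence one mesh size and one
  bound serve for the whole tube.\<close>

lemma tube_modulus:
  fixes g :: "real \<Rightarrow> real^'p" and h :: "real^'p \<Rightarrow> real"
  assumes T: "0 < T" and g: "continuous_on {0..T} g" and h: "continuous_on UNIV h" and \<kappa>: "\<kappa> > 0"
  shows "\<exists>\<rho>>0. \<exists>m0>0. \<exists>C. \<forall>g'. (\<forall>t\<in>{0..T}. norm (g' t - g t) \<le> \<rho>) \<longrightarrow>
    (\<forall>m\<ge>m0. \<forall>s\<in>{0..T}. \<forall>t\<in>{0..T}. \<bar>s - t\<bar> \<le> T / real m \<longrightarrow> \<bar>h (g' s) - h (g' t)\<bar> \<le> \<kappa>) \<and> (\<forall>t\<in>{0..T}. \<bar>h (g' t)\<bar> \<le> C)"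
proof -
  have "bounded (g ` {0..T})" by (rule compact_imp_bounded[OF compact_continuous_image[OF g]]) simp
  then obtain R where R: "\<And>t. t \<in> {0..T} \<Longrightarrow> norm (g t) \<le> R" unfolding bounded_iff by (metis imageI)
  have hc: "continuous_on (cball 0 (R + 1)) h" by (rule continuous_on_subset[OF h]) simp
  have "uniformly_continuous_on (cball 0 (R + 1)) h" by (rule compact_uniformly_continuous[OF hc]) simp
  then obtain d where d: "d > 0" and D: "\<And>x y. norm x \<le> R + 1 \<Longrightarrow> norm y \<le> R + 1 \<Longrightarrow> dist x y < d \<Longrightarrow> dist (h x) (h y) < \<kappa>"
    unfolding uniformly_continuous_on_def using \<kappa> by (metis mem_cball_0)
  have "bounded (h ` cball 0 (R + 1))" by (rule compact_imp_bounded[OF compact_continuous_image[OF hc]]) simp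
  then obtain C where C: "\<And>x. norm x \<le> R + 1 \<Longrightarrow> \<bar>h x\<bar> \<le> C" unfolding bounded_iff by (metis imageI mem_cball_0 real_norm_def)
  \<comment> \<open>Two tube errors and one oscillation of g, each at most d/4, stay below d; the
    bound 1 keeps the paths in the ball of radius R + 1.\<close>
  define \<rho> where "\<rho> = min 1 (d / 4)"
  have \<rho>: "\<rho> > 0" "\<rho> \<le> 1" "\<rho> \<le> d / 4" using d by (auto simp: \<rho>_def)
  obtain m0 where m0: "\<And>m. m \<ge> m0 \<Longrightarrow> m > 0 \<and> (\<forall>s\<in>{0..T}. \<forall>t\<in>{0..T}. \<bar>s - t\<bar> \<le> T / real m \<longrightarrow> dist (g s) (g t) < d / 4)"
    using eventually_mesh_osc[OF T g, of "d / 4"] d unfolding eventually_sequentially by auto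
  have "\<bar>h (g' s) - h (g' t)\<bar> \<le> \<kappa>" if g': "\<forall>t\<in>{0..T}. norm (g' t - g t) \<le> \<rho>" and m: "m \<ge> m0"
    and s: "s \<in> {0..T}" and t: "t \<in> {0..T}" and st: "\<bar>s - t\<bar> \<le> T / real m" for g' m s t
  proof -
    have n: "norm (g' u) \<le> R + 1" if "u \<in> {0..T}" for u
      using norm_triangle_sub[of "g' u" "g u"] R[OF that] g' that \<rho> by fastforce
    have "dist (g' s) (g' t) \<le> dist (g' s) (g s) + dist (g s) (g t) + dist (g t) (g' t)"
      using dist_triangle[of "g' s" "g' t" "g s"] dist_triangle[of "g s" "g' t" "g t"] by linarith
    moreover have "dist (g' s) (g s) \<le> d / 4" "dist (g t) (g' t) \<le> d / 4"
    proof -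
      have "norm (g' u - g u) \<le> d / 4" if "u \<in> {0..T}" for u using g' that \<rho>(3) by force
      then show "dist (g' s) (g s) \<le> d / 4" "dist (g t) (g' t) \<le> d / 4"
        using s t by (simp_all add: dist_norm norm_minus_commute)
    qed
    moreover have "dist (g s) (g t) < d / 4" using m0[OF m] s t st by blast
    ultimately have "dist (g' s) (g' t) < d" using d by linarith
    from D[OF n[OF s] n[OF t] this] show ?thesis by (simp add: dist_real_def)
  qed
  moreover have "\<bar>h (g' t)\<bar> \<le> C" if g': "\<forall>t\<in>{0..T}. norm (g' t - g t) \<le> \<rho>" and t: "t \<in> {0..T}" for g' t
  proof (rule C)
    show "norm (g' t) \<le> R + 1" using norm_triangle_sub[of "g' t" "g t"] R[OF t] g' t \<rho> by fastforce
  qed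
  ultimately have "\<forall>g'. (\<forall>t\<in>{0..T}. norm (g' t - g t) \<le> \<rho>) \<longrightarrow>
    (\<forall>m\<ge>m0. \<forall>s\<in>{0..T}. \<forall>t\<in>{0..T}. \<bar>s - t\<bar> \<le> T / real m \<longrightarrow> \<bar>h (g' s) - h (g' t)\<bar> \<le> \<kappa>) \<and> (\<forall>t\<in>{0..T}. \<bar>h (g' t)\<bar> \<le> C)"
    by blast
  then show ?thesis using \<rho>(1) m0[of m0] by blast
qed

lemma tube_modulus_finite:
  fixes g :: "real \<Rightarrow> real^'p" and H :: "(real^'p \<Rightarrow> real) set"
  assumes T: "0 < T" and g: "continuous_on {0..T} g" and H: "finite H" "\<And>h. h \<in> H \<Longrightarrow> continuous_on UNIV h" and \<kappa>: "\<kappa> > 0"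
  shows "\<exists>\<rho>>0. \<exists>m0>0. \<exists>C. \<forall>g'. (\<forall>t\<in>{0..T}. norm (g' t - g t) \<le> \<rho>) \<longrightarrow> (\<forall>h\<in>H.
    (\<forall>m\<ge>m0. \<forall>s\<in>{0..T}. \<forall>t\<in>{0..T}. \<bar>s - t\<bar> \<le> T / real m \<longrightarrow> \<bar>h (g' s) - h (g' t)\<bar> \<le> \<kappa>) \<and> (\<forall>t\<in>{0..T}. \<bar>h (g' t)\<bar> \<le> C))"
  using H
proof (induction H)
  case empty
  then show ?case by (intro exI[of _ 1] conjI exI[of _ "1::nat"] exI[of _ 0]) auto
next
  case (insert h H)
  then obtain \<rho> and m0 :: nat and C where 1: "\<rho> > 0" "m0 > 0"
    "\<And>g' h. (\<forall>t\<in>{0..T}. norm (g' t - g t) \<le> \<rho>) \<Longrightarrow> h \<in> H \<Longrightarrow>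
      (\<forall>m\<ge>m0. \<forall>s\<in>{0..T}. \<forall>t\<in>{0..T}. \<bar>s - t\<bar> \<le> T / real m \<longrightarrow> \<bar>h (g' s) - h (g' t)\<bar> \<le> \<kappa>) \<and> (\<forall>t\<in>{0..T}. \<bar>h (g' t)\<bar> \<le> C)"
    by (metis insertCI)
  obtain \<rho>' and m0' :: nat and C' where 2: "\<rho>' > 0" "m0' > 0"
    "\<And>g'. (\<forall>t\<in>{0..T}. norm (g' t - g t) \<le> \<rho>') \<Longrightarrow>
      (\<forall>m\<ge>m0'. \<forall>s\<in>{0..T}. \<forall>t\<in>{0..T}. \<bar>s - t\<bar> \<le> T / real m \<longrightarrow> \<bar>h (g' s) - h (g' t)\<bar> \<le> \<kappa>) \<and> (\<forall>t\<in>{0..T}. \<bar>h (g' t)\<bar> \<le> C')"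
    using tube_modulus[OF T g insert.prems[of h] \<kappa>] by (metis insertI1)
  show ?case
  proof (rule exI[of _ "min \<rho> \<rho>'"], rule conjI[rotated], rule exI[of _ "max m0 m0'"], rule conjI[rotated], rule exI[of _ "max C C'"], intro conjI allI impI ballI)
    fix g' :: "real \<Rightarrow> real^'p" and h' m s t
    assume g': "\<forall>t\<in>{0..T}. norm (g' t - g t) \<le> min \<rho> \<rho>'" and h': "h' \<in> insert h H" and m: "max m0 m0' \<le> m"
      and st: "s \<in> {0..T}" "t \<in> {0..T}" "\<bar>s - t\<bar> \<le> T / real m"
    have "\<forall>t\<in>{0..T}. norm (g' t - g t) \<le> \<rho>" "\<forall>t\<in>{0..T}. norm (g' t - g t) \<le> \<rho>'" using g' by auto
    then show "\<bar>h' (g' s) - h' (g' t)\<bar> \<le> \<kappa>" using 1(3)[of g' h'] 2(3)[of g'] h' m st by auto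
  next
    fix g' :: "real \<Rightarrow> real^'p" and h' t
    assume g': "\<forall>t\<in>{0..T}. norm (g' t - g t) \<le> min \<rho> \<rho>'" and h': "h' \<in> insert h H" and t: "t \<in> {0..T}"
    have "\<forall>t\<in>{0..T}. norm (g' t - g t) \<le> \<rho>" "\<forall>t\<in>{0..T}. norm (g' t - g t) \<le> \<rho>'" using g' by auto
    then have "(h' \<in> H \<longrightarrow> \<bar>h' (g' t)\<bar> \<le> C) \<and> (h' = h \<longrightarrow> \<bar>h' (g' t)\<bar> \<le> C')" using 1(3)[of g' h'] 2(3)[of g'] t by auto
    then show "\<bar>h' (g' t)\<bar> \<le> max C C'" using h' by auto
  qed (use 1 2 in auto)
qed

locale volterra_model =
  fixes M :: "'w measure" and T :: real and \<epsilon> :: "nat \<Rightarrow> real"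
    and B :: "real \<Rightarrow> 'w \<Rightarrow> real^'p" and W :: "real \<Rightarrow> 'w \<Rightarrow> real^'d"
    and Bh :: "nat \<Rightarrow> real \<Rightarrow> 'w \<Rightarrow> real^'p"
    and Kn :: "nat \<Rightarrow> 'p \<Rightarrow> real \<Rightarrow> real \<Rightarrow> real" and K :: "'p \<Rightarrow> real \<Rightarrow> real \<Rightarrow> real"
  assumes M: "prob_space M" and T: "T > 0"
    and eps_pos: "\<And>n. \<epsilon> n > 0" and eps_lim: "\<epsilon> \<longlonglongrightarrow> 0"
    and BM_B: "brownian_motion M T B" and BM_W: "brownian_motion M T W"
    and indep: "independent_processes M T B W"
    and volterra_n: "\<And>n l. volterra_kernel T (Kn n l)" and volterra: "\<And>l. volterra_kernel T (K l)"
    and Bh_continuous: "\<And>n \<omega>. \<omega> \<in> space M \<Longrightarrow> continuous_on {0..T} (\<lambda>t. Bh n t \<omega>)"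
    and Bh_eq: "\<And>n l t. t \<in> {0..T} \<Longrightarrow>
           has_ito_integral M (driving_filtration M B W) (\<lambda>s \<omega>. B s \<omega> $ l) T (\<lambda>s _. Kn n l t s) (\<lambda>\<omega>. Bh n t \<omega> $ l)"
    and LDP_B: "satisfies_LDP M (C0_prod T) (\<lambda>n. 1 / (\<epsilon> n)\<^sup>2) (I_B_hatB T K)
           (\<lambda>n \<omega>. (trajectory T (\<lambda>t \<omega>. \<epsilon> n *\<^sub>R B t \<omega>) \<omega>, trajectory T (Bh n) \<omega>))"
    and good_B: "good_rate_function (C0_prod T) (I_B_hatB T K)"
begin

sublocale ldp_speed M \<epsilon>
  using M eps_pos eps_lim by (intro ldp_speed.intro ldp_speed_axioms.intro)

sublocale bm_family M T "joint_family B W"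
  by (rule bm_family_joint[OF M T BM_B BM_W indep])

abbreviation X where "X \<equiv> joint_family B W"

definition path_pair :: "nat \<Rightarrow> 'w \<Rightarrow> (real \<Rightarrow> real^'p) \<times> (real \<Rightarrow> real^'p)" where
  "path_pair n \<omega> = (trajectory T (\<lambda>t \<omega>. \<epsilon> n *\<^sub>R B t \<omega>) \<omega>, trajectory T (Bh n) \<omega>)"

lemma path_pair_measurable: "path_pair n \<in> M \<rightarrow>\<^sub>M borel_of_top (C0_prod T)"
  using LDP_B unfolding satisfies_LDP_def path_pair_def[abs_def] by blast

lemma LDP_path: "satisfies_LDP M (C0_prod T) (\<lambda>n. 1 / (\<epsilon> n)\<^sup>2) (I_B_hatB T K) path_pair"
  using LDP_B unfolding path_pair_def[abs_def] .

lemma path_pair_mspace: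
  assumes "\<omega> \<in> space M"
  shows "fst (path_pair n \<omega>) \<in> mspace (C0_space T)" "snd (path_pair n \<omega>) \<in> mspace (C0_space T)"
  using measurable_space[OF path_pair_measurable assms, of n] by (auto simp: mem_Times_iff)

lemma path_pair_apply:
  assumes "t \<in> {0..T}"
  shows "fst (path_pair n \<omega>) t = \<epsilon> n *\<^sub>R B t \<omega>" "snd (path_pair n \<omega>) t = Bh n t \<omega>"
  using assms by (auto simp: path_pair_def trajectory_def)

lemma path_pair_event:
  assumes "S \<in> sets (borel_of_top (C0_prod T))"
  shows "{\<omega>\<in>space M. path_pair n \<omega> \<in> S} \<in> events"
  using measurable_sets[OF path_pair_measurable assms, of n] by (simp add: vimage_def Int_def conj_commute)

lemma tube_event:
  assumes "f \<in> mspace (C0_space T)" "g \<in> mspace (C0_space T)"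
  shows "{\<omega>\<in>space M. path_pair n \<omega> \<in> tube T f g \<rho>} \<in> events"
  using path_pair_event[OF sets_borel_of_top_closed[OF closedin_tube[OF _ assms]]] T by simp

text \<open>By goodness the level set is compact, so finitely many open tubes cover it, with radii
  that may depend on the centre. On the closed complement of their union the rate is at least a, and
  the large deviation upper bound applies there. For negative a the level set is empty.\<close>

lemma level_cover:
  assumes \<rho>: "\<And>f g. f \<in> mspace (C0_space T) \<Longrightarrow> g \<in> mspace (C0_space T) \<Longrightarrow> I_B_hatB T K (f, g) \<le> ereal a \<Longrightarrow> \<rho> (f, g) > 0"
  shows "\<exists>S. finite S \<and> S \<subseteq> {x \<in> mspace (C0_space T) \<times> mspace (C0_space T). I_B_hatB T K x \<le> ereal a} \<and>
    exp_small (\<lambda>n. {\<omega>. \<forall>x\<in>S. path_pair n \<omega> \<notin> tube T (fst x) (snd x) (\<rho> x)}) a"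
proof -
  define L where "L = {x \<in> mspace (C0_space T) \<times> mspace (C0_space T). I_B_hatB T K x \<le> ereal a}"
  define U where "U x = open_tube T (fst x) (snd x) (\<rho> x)" for x :: "(real \<Rightarrow> real^'p) \<times> (real \<Rightarrow> real^'p)"
  have T0: "0 \<le> T" using T by simp
  have Lm: "fst x \<in> mspace (C0_space T)" "snd x \<in> mspace (C0_space T)" "\<rho> x > 0" if "x \<in> L" for x
    using that \<rho>[of "fst x" "snd x"] by (auto simp: L_def)
  have Uo: "openin (C0_prod T) (U x)" if "x \<in> L" for x
    unfolding U_def by (rule openin_open_tube[OF T0 Lm(1,2)[OF that]])
  have "compactin (C0_prod T) L"
  proof (cases "a \<ge> 0")
    case True
    then show ?thesis using good_B unfolding good_rate_function_def L_def by simp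
  next
    case False
    have "0 \<le> I_B_hatB T K x" if "x \<in> topspace (C0_prod T)" for x
      using good_B that unfolding good_rate_function_def rate_function_def by blast
    then have "\<not> I_B_hatB T K x \<le> ereal a" if "x \<in> topspace (C0_prod T)" for x
      using that False by (metis ereal_less_eq(3) order_trans zero_ereal_def)
    then have "L = {}" unfolding L_def by auto
    then show ?thesis by simp
  qed
  moreover have "L \<subseteq> \<Union>(U ` L)"
  proof
    fix x assume "x \<in> L"
    then have "x \<in> U x" using center_in_open_tube[OF T0 Lm(1)[OF \<open>x \<in> L\<close>] Lm(2)[OF \<open>x \<in> L\<close>] Lm(3)[OF \<open>x \<in> L\<close>]] by (simp add: U_def)
    then show "x \<in> \<Union>(U ` L)" using \<open>x \<in> L\<close> by blast
  qed
  ultimately obtain F where F: "finite F" "F \<subseteq> U ` L" "L \<subseteq> \<Union>F"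
    using compactinD[of "C0_prod T" L "U ` L"] Uo by blast
  obtain S where S: "finite S" "S \<subseteq> L" "F = U ` S" using F(1,2) finite_subset_image by metis
  define C where "C = topspace (C0_prod T) - (\<Union>x\<in>S. U x)"
  have C: "closedin (C0_prod T) C"
    unfolding C_def using Uo S by (intro closedin_diff closedin_topspace openin_Union) auto
  have "ereal a \<le> I_B_hatB T K x" if "x \<in> C" for x
  proof (rule ccontr)
    assume "\<not> ereal a \<le> I_B_hatB T K x"
    then have "x \<in> L" using that by (auto simp: C_def L_def)
    then show False using that F S by (auto simp: C_def)
  qed
  from LDP_upper[OF LDP_path C this]
  have "exp_small (\<lambda>n. {\<omega>\<in>space M. path_pair n \<omega> \<in> C}) a" .
  then have "exp_small (\<lambda>n. {\<omega>. \<forall>x\<in>S. path_pair n \<omega> \<notin> tube T (fst x) (snd x) (\<rho> x)}) a"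
  proof (rule exp_small_mono)
    fix n
    show "{\<omega>. \<forall>x\<in>S. path_pair n \<omega> \<notin> tube T (fst x) (snd x) (\<rho> x)} \<inter> space M \<subseteq> {\<omega>\<in>space M. path_pair n \<omega> \<in> C}"
    proof clarify
      fix \<omega> assume \<omega>: "\<forall>x\<in>S. path_pair n \<omega> \<notin> tube T (fst x) (snd x) (\<rho> x)" "\<omega> \<in> space M"
      have "path_pair n \<omega> \<notin> U x" if "x \<in> S" for x
      proof -
        have "x \<in> L" using that S(2) by blast
        from open_tube_subset[OF T0 Lm(1)[OF this] Lm(2)[OF this], of "\<rho> x"] show ?thesis
          using \<omega>(1) that by (auto simp: U_def)
      qed
      then show "path_pair n \<omega> \<in> C" using path_pair_mspace[OF \<omega>(2), of n] by (auto simp: C_def mem_Times_iff)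
    qed
  qed
  then show ?thesis using S unfolding L_def by blast
qed

text \<open>Each of the finitely many tubes from \<open>level_cover\<close> comes with its own mesh
  size and bound; their maxima are uniform. The exponent a is prescribed in advance, and mesh size
  and bound depend on it.\<close>

lemma good_events:
  fixes H :: "(real^'p \<Rightarrow> real) set"
  assumes H: "finite H" "\<And>h. h \<in> H \<Longrightarrow> continuous_on UNIV h" and \<kappa>: "\<kappa> > 0"
  shows "\<exists>G. \<exists>m0>0. \<exists>C. (\<forall>n. G n \<in> events) \<and> exp_small (\<lambda>n. space M - G n) a \<and>
    (\<forall>n. \<forall>\<omega>\<in>G n. \<forall>h\<in>H. (\<forall>m\<ge>m0. \<forall>s\<in>{0..T}. \<forall>t\<in>{0..T}. \<bar>s - t\<bar> \<le> T / real m \<longrightarrow> \<bar>h (Bh n s \<omega>) - h (Bh n t \<omega>)\<bar> \<le> \<kappa>)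
       \<and> (\<forall>t\<in>{0..T}. \<bar>h (Bh n t \<omega>)\<bar> \<le> C))"
proof -
  let ?P = "\<lambda>g \<rho> m0 C. \<rho> > 0 \<and> m0 > 0 \<and> (\<forall>g'. (\<forall>t\<in>{0..T}. norm (g' t - g t) \<le> \<rho>) \<longrightarrow> (\<forall>h\<in>H.
    (\<forall>m\<ge>m0. \<forall>s\<in>{0..T}. \<forall>t\<in>{0..T}. \<bar>s - t\<bar> \<le> T / real m \<longrightarrow> \<bar>h (g' s) - h (g' t)\<bar> \<le> \<kappa>) \<and> (\<forall>t\<in>{0..T}. \<bar>h (g' t)\<bar> \<le> C)))"
  have "\<forall>g. \<exists>\<rho> m0 C. g \<in> mspace (C0_space T) \<longrightarrow> ?P g \<rho> m0 C"
  proof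
    fix g :: "real \<Rightarrow> real^'p"
    show "\<exists>\<rho> m0 C. g \<in> mspace (C0_space T) \<longrightarrow> ?P g \<rho> m0 C"
    proof (cases "g \<in> mspace (C0_space T)")
      case True
      then have "continuous_on {0..T} g" by (simp add: mspace_C0_space)
      from tube_modulus_finite[OF T this H \<kappa>] show ?thesis by blast
    qed blast
  qed
  then obtain \<rho> m0 C where P: "\<And>g. g \<in> mspace (C0_space T) \<Longrightarrow> ?P g (\<rho> g) (m0 g) (C g)" by metis
  obtain S where S: "finite S" "S \<subseteq> {x \<in> mspace (C0_space T) \<times> mspace (C0_space T). I_B_hatB T K x \<le> ereal a}"
    and small: "exp_small (\<lambda>n. {\<omega>. \<forall>x\<in>S. path_pair n \<omega> \<notin> tube T (fst x) (snd x) (\<rho> (snd x))}) a"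
    using level_cover[of a "\<lambda>x. \<rho> (snd x)"] P by auto
  define G where "G n = (\<Union>x\<in>S. {\<omega>\<in>space M. path_pair n \<omega> \<in> tube T (fst x) (snd x) (\<rho> (snd x))})" for n
  define m1 where "m1 = Max (insert 1 ((\<lambda>x. m0 (snd x)) ` S))"
  define C1 where "C1 = Max (insert 0 ((\<lambda>x. C (snd x)) ` S))"
  have m1: "m1 > 0" "\<And>x. x \<in> S \<Longrightarrow> m0 (snd x) \<le> m1" and C1: "\<And>x. x \<in> S \<Longrightarrow> C (snd x) \<le> C1"
    using S(1) by (auto simp: m1_def C1_def Max_gr_iff)
  have "G n \<in> events" for n
    unfolding G_def using S by (intro sets.finite_UN tube_event) auto
  moreover have "exp_small (\<lambda>n. space M - G n) a"
    by (rule exp_small_mono[OF small]) (auto simp: G_def)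
  moreover have "(\<forall>m\<ge>m1. \<forall>s\<in>{0..T}. \<forall>t\<in>{0..T}. \<bar>s - t\<bar> \<le> T / real m \<longrightarrow> \<bar>h (Bh n s \<omega>) - h (Bh n t \<omega>)\<bar> \<le> \<kappa>)
       \<and> (\<forall>t\<in>{0..T}. \<bar>h (Bh n t \<omega>)\<bar> \<le> C1)" if "\<omega> \<in> G n" "h \<in> H" for n \<omega> h
  proof -
    obtain x where x: "x \<in> S" "path_pair n \<omega> \<in> tube T (fst x) (snd x) (\<rho> (snd x))" using \<open>\<omega> \<in> G n\<close> by (auto simp: G_def)
    have sx: "snd x \<in> mspace (C0_space T)" using x S by auto
    have "\<forall>t\<in>{0..T}. norm (Bh n t \<omega> - snd x t) \<le> \<rho> (snd x)"
      using x(2) path_pair_apply(2)[of _ n \<omega>] unfolding tube_def by (auto simp: case_prod_beta')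
    with spec[OF conjunct2[OF conjunct2[OF P[OF sx]]], of "\<lambda>t. Bh n t \<omega>"] \<open>h \<in> H\<close> have "(\<forall>m\<ge>m0 (snd x). \<forall>s\<in>{0..T}. \<forall>t\<in>{0..T}. \<bar>s - t\<bar> \<le> T / real m \<longrightarrow> \<bar>h (Bh n s \<omega>) - h (Bh n t \<omega>)\<bar> \<le> \<kappa>)
       \<and> (\<forall>t\<in>{0..T}. \<bar>h (Bh n t \<omega>)\<bar> \<le> C (snd x))" by blast
    then show ?thesis using m1(2)[OF x(1)] C1[OF x(1)] by (meson order_trans)
  qed
  ultimately show ?thesis using m1(1) by (intro exI[of _ G] exI[of _ m1] exI[of _ C1] conjI) blast+
qed

lemma driving_le: "sets (driving_filtration M B W u) \<subseteq> sets (hist M X (\<lambda>_. u))"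
  by (rule driving_filtration_le_hist)

lemma space_driving: "space (driving_filtration M B W u) = space M"
  by (simp add: driving_filtration_def)

lemma Bh_version_ex:
  assumes t: "t \<in> {0..T}"
  shows "\<exists>V \<in> borel_measurable (hist M X (\<lambda>q. if q = Inl l then t else 0)). AE \<omega> in M. V \<omega> = Bh n t \<omega> $ l"
proof (rule ito_deterministic_version[OF driving_le space_driving])
  show "has_ito_integral M (driving_filtration M B W) (X (Inl l)) T (\<lambda>s _. Kn n l t s) (\<lambda>\<omega>. Bh n t \<omega> $ l)"
    using Bh_eq[OF t, of l n] by (simp add: joint_family_def)
  show "Kn n l t s = 0" if "t < s" "s \<le> T" for s
    using volterra_n[of n l] t that unfolding volterra_kernel_def by auto
qed (use t in auto)

text \<open>\<open>Bh n t\<close> itself need not be measurable for the uncompleted history. Its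
  version is chosen componentwise, from the history of the corresponding component of
  \<open>B\<close> up to t, with all other components stopped at time 0.\<close>

definition Bh_version :: "nat \<Rightarrow> real \<Rightarrow> 'w \<Rightarrow> real^'p" where
  "Bh_version n t \<omega> = (\<chi> l. (SOME V. V \<in> borel_measurable (hist M X (\<lambda>q. if q = Inl l then t else 0)) \<and>
     (AE \<omega> in M. V \<omega> = Bh n t \<omega> $ l)) \<omega>)"

lemma Bh_version:
  assumes t: "t \<in> {0..T}"
  shows "Bh_version n t \<in> borel_measurable (hist M X (\<lambda>q. case q of Inl l \<Rightarrow> t | Inr j \<Rightarrow> 0))"
    and "AE \<omega> in M. Bh_version n t \<omega> = Bh n t \<omega>"
proof -
  let ?Q = "\<lambda>l V. V \<in> borel_measurable (hist M X (\<lambda>q. if q = Inl l then t else 0)) \<and> (AE \<omega> in M. V \<omega> = Bh n t \<omega> $ l)"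
  have Q: "?Q l (SOME V. ?Q l V)" for l
    using Bh_version_ex[OF t, of l n] by (intro someI_ex[of "?Q l"]) blast
  have comp: "(\<lambda>\<omega>. Bh_version n t \<omega> $ l) = (SOME V. ?Q l V)" for l by (auto simp: Bh_version_def)
  have "(\<lambda>\<omega>. Bh_version n t \<omega> $ l) \<in> borel_measurable (hist M X (\<lambda>q. case q of Inl l \<Rightarrow> t | Inr j \<Rightarrow> 0))" for l
    unfolding comp by (rule measurable_hist_mono[OF conjunct1[OF Q]]) (use t in \<open>auto split: sum.split\<close>)
  then show "Bh_version n t \<in> borel_measurable (hist M X (\<lambda>q. case q of Inl l \<Rightarrow> t | Inr j \<Rightarrow> 0))"
    by (simp add: borel_measurable_vec_iff)
  have "AE \<omega> in M. \<forall>l\<in>UNIV. Bh_version n t \<omega> $ l = Bh n t \<omega> $ l"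
    using conjunct2[OF Q] unfolding comp[symmetric, THEN fun_cong] by (intro AE_finite_allI) auto
  then show "AE \<omega> in M. Bh_version n t \<omega> = Bh n t \<omega>" by eventually_elim (simp add: vec_eq_iff)
qed

definition riemann_ito :: "nat \<Rightarrow> nat \<Rightarrow> (real^'p \<Rightarrow> real) \<Rightarrow> 'p + 'd \<Rightarrow> 'w \<Rightarrow> real" where
  "riemann_ito n m h q \<omega> = (\<Sum>k<m. h (Bh n (mesh T m k) \<omega>) * (X q (mesh T m (Suc k)) \<omega> - X q (mesh T m k) \<omega>))"

lemma mesh_range: "k \<le> m \<Longrightarrow> mesh T m k \<in> {0..T}"
  using mesh_nonneg[of T m k] mesh_le[of T k m] T by simp

lemma mesh_locate:
  assumes m: "m > 0" and s: "0 < s" "s \<le> T"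
  shows "\<exists>k<m. mesh T m k < s \<and> s \<le> mesh T m (Suc k)"
proof -
  define k where "k = nat (\<lceil>s * real m / T\<rceil> - 1)"
  have pos: "s * real m / T > 0" using s m T by simp
  have "\<lceil>s * real m / T\<rceil> \<ge> 1" using pos by linarith
  then have k: "real k < s * real m / T" "s * real m / T \<le> real k + 1" unfolding k_def by linarith+
  have "s * real m / T \<le> real m" using s m T by (simp add: field_simps mult_right_mono)
  then have "k < m" using k(1) by linarith
  moreover have "mesh T m k < s" "s \<le> mesh T m (Suc k)"
    using k m T by (auto simp: mesh_def field_simps)
  ultimately show ?thesis by blast
qed

lemma ito_riemann_tail:
  assumes h: "continuous_on UNIV h" and m: "m > 0" and \<kappa>: "\<kappa> > 0" and \<delta>: "\<delta> > 0"
    and ito: "has_ito_integral M (driving_filtration M B W) (X r) T (\<lambda>s \<omega>. h (Bh n s \<omega>)) J"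
    and E: "E \<in> events" and E1: "\<And>\<omega>. \<omega> \<in> E \<Longrightarrow> \<delta> \<le> \<bar>J \<omega> - riemann_ito n m h r \<omega>\<bar>"
    and E2: "\<And>\<omega> s t. \<omega> \<in> E \<Longrightarrow> s \<in> {0..T} \<Longrightarrow> t \<in> {0..T} \<Longrightarrow> \<bar>s - t\<bar> \<le> T / real m \<Longrightarrow> \<bar>h (Bh n s \<omega>) - h (Bh n t \<omega>)\<bar> \<le> \<kappa>"
  shows "prob E \<le> 2 * exp (- \<delta>\<^sup>2 / (32 * (\<kappa>\<^sup>2 * T)))"
proof -
  define \<xi> where "\<xi> k \<omega> = h (Bh_version n (mesh T m k) \<omega>)" for k \<omega>
  have hm: "h \<in> borel_measurable borel" by (rule borel_measurable_continuous_onI[OF h])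
  have st: "adapted_step m (mesh T m) \<xi>"
    unfolding adapted_step_def
  proof (intro allI impI conjI)
    fix k assume k: "k < m"
    show "0 \<le> mesh T m k" "mesh T m k \<le> mesh T m (Suc k)" "mesh T m (Suc k) \<le> T"
      using mesh_range[of k m] mesh_range[of "Suc k" m] mesh_mono[of T k "Suc k" m] k T by auto
    have "Bh_version n (mesh T m k) \<in> borel_measurable (hist M X (\<lambda>_. mesh T m k))"
      by (rule measurable_hist_mono[OF Bh_version(1)]) (use mesh_range[of k m] k in \<open>auto split: sum.split\<close>)
    from measurable_compose[OF this hm] show "\<xi> k \<in> borel_measurable (hist M X (\<lambda>_. mesh T m k))"
      by (simp add: \<xi>_def[abs_def])
  qed
  have "AE \<omega> in M. \<forall>k\<in>{..<m}. Bh_version n (mesh T m k) \<omega> = Bh n (mesh T m k) \<omega>"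
    by (intro AE_finite_allI) (use Bh_version(2) mesh_range in auto)
  from AE_E[OF this] obtain N where N': "{\<omega>\<in>space M. \<not> (\<forall>k\<in>{..<m}. Bh_version n (mesh T m k) \<omega> = Bh n (mesh T m k) \<omega>)} \<subseteq> N"
    "emeasure M N = 0" "N \<in> events" .
  then have N: "N \<in> null_sets M" by (intro null_setsI)
  have V: "Bh_version n (mesh T m k) \<omega> = Bh n (mesh T m k) \<omega>" if "\<omega> \<in> E - N" "k < m" for \<omega> k
    using N'(1) that sets.sets_into_space[OF E] by blast
  have "prob (E - N) \<le> 2 * exp (- \<delta>\<^sup>2 / (32 * (\<kappa>\<^sup>2 * T)))"
  proof (rule ito_tail[OF driving_le space_driving ito st])
    show "E - N \<in> events" using E N'(3) by (rule sets.Diff)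
    fix \<omega> assume \<omega>: "\<omega> \<in> E - N"
    have "simple_integral (X r) m (mesh T m) \<xi> \<omega> = riemann_ito n m h r \<omega>"
      unfolding simple_integral_def riemann_ito_def \<xi>_def by (rule sum.cong) (use V[OF \<omega>] in auto)
    then show "\<delta> \<le> \<bar>J \<omega> - simple_integral (X r) m (mesh T m) \<xi> \<omega>\<bar>" using E1 \<omega> by simp
    have "(\<integral>\<^sup>+s\<in>{0..T}. ennreal ((h (Bh n s \<omega>) - simple_process m (mesh T m) \<xi> s \<omega>)\<^sup>2) \<partial>lborel) \<le> (\<integral>\<^sup>+s\<in>{0..T}. ennreal (\<kappa>\<^sup>2) \<partial>lborel)"
    proof (rule nn_integral_mono_AE)
      \<comment> \<open>The cells of a simple process are open on the left, so s = 0 belongs to none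
        of them.\<close>
      have "AE s in lborel. s \<noteq> (0::real)" by (rule AE_lborel_singleton)
      then show "AE s in lborel. ennreal ((h (Bh n s \<omega>) - simple_process m (mesh T m) \<xi> s \<omega>)\<^sup>2) * indicator {0..T} s \<le> ennreal (\<kappa>\<^sup>2) * indicator {0..T} s"
      proof eventually_elim
        case (elim s)
        show ?case
        proof (cases "s \<in> {0..T}")
          case True
          then have s: "0 < s" "s \<le> T" using elim by auto
          obtain k where k: "k < m" "mesh T m k < s" "s \<le> mesh T m (Suc k)" using mesh_locate[OF m s] by blast
          have uniq: "j = k" if "mesh T m j < s" "s \<le> mesh T m (Suc j)" for j
          proof -
            have "mesh T m j < mesh T m (Suc k)" "mesh T m k < mesh T m (Suc j)" using that k by auto
            then have "j < Suc k" "k < Suc j" using mesh_mono[of T "Suc k" j m] mesh_mono[of T "Suc j" k m] T by (force simp: not_less[symmetric])+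
            then show ?thesis by simp
          qed
          have "simple_process m (mesh T m) \<xi> s \<omega> = (\<Sum>j\<in>{k}. \<xi> j \<omega> * indicator {mesh T m j<..mesh T m (Suc j)} s)"
            unfolding simple_process_def
          proof (rule sum.mono_neutral_right)
            show "\<forall>i\<in>{..<m} - {k}. \<xi> i \<omega> * indicator {mesh T m i<..mesh T m (Suc i)} s = 0"
              using uniq by (auto simp: indicator_def)
          qed (use k in auto)
          also have "\<dots> = h (Bh n (mesh T m k) \<omega>)" using k V[OF \<omega> k(1)] by (simp add: \<xi>_def)
          finally have "simple_process m (mesh T m) \<xi> s \<omega> = h (Bh n (mesh T m k) \<omega>)" .
          moreover have "\<bar>h (Bh n s \<omega>) - h (Bh n (mesh T m k) \<omega>)\<bar> \<le> \<kappa>"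
            by (rule E2) (use \<omega> True k mesh_range[of k m] mesh_diff[of T m k] in auto)
          ultimately have "\<bar>h (Bh n s \<omega>) - simple_process m (mesh T m) \<xi> s \<omega>\<bar>\<^sup>2 \<le> \<kappa>\<^sup>2"
            by (intro power_mono) auto
          then show ?thesis by (intro mult_right_mono ennreal_leI) auto
        qed simp
      qed
    qed
    also have "\<dots> = ennreal (\<kappa>\<^sup>2 * T)" using T by (subst nn_integral_cmult_indicator) (auto simp: ennreal_mult)
    finally show "(\<integral>\<^sup>+s\<in>{0..T}. ennreal ((h (Bh n s \<omega>) - simple_process m (mesh T m) \<xi> s \<omega>)\<^sup>2) \<partial>lborel) \<le> ennreal (\<kappa>\<^sup>2 * T)" .
  qed (use \<delta> \<kappa> T in auto)
  moreover have "prob (E - N) = prob E" using measure_Diff_null_set[OF E N] .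
  ultimately show ?thesis by simp
qed

end

section \<open>Cameron-Martin paths and their Volterra transforms\<close>

lemma cameron_martin_mspace: "f \<in> cameron_martin T \<Longrightarrow> f \<in> mspace (C0_space T)"
  by (simp add: cameron_martin_def)

lemma cameron_martin_FTC:
  assumes "f \<in> cameron_martin T" "0 \<le> T"
  shows "set_integrable lebesgue {0..T} (\<lambda>s. dot T f s $ l)"
    and "0 \<le> u \<Longrightarrow> u \<le> v \<Longrightarrow> v \<le> T \<Longrightarrow> (LINT s:{u..v}|lebesgue. dot T f s $ l) = f v $ l - f u $ l"
  using abs_continuous_FTC[of T f] assms by (auto simp: cameron_martin_def)

lemma set_borel_measurable_integrable:
  "set_integrable M A f \<Longrightarrow> set_borel_measurable M A f"
  unfolding set_integrable_def set_borel_measurable_def by (rule borel_measurable_integrable)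

text \<open>A stand-in for the Cauchy-Schwarz inequality under the integral: the weight \<eta> is
  chosen later to make the second term small.\<close>

lemma young_weighted:
  fixes a b \<eta> :: real
  assumes "\<eta> > 0"
  shows "\<bar>a * b\<bar> \<le> a\<^sup>2 / (2 * \<eta>) + \<eta> * b\<^sup>2 / 2"
proof -
  have "0 \<le> (\<bar>a\<bar> - \<eta> * \<bar>b\<bar>)\<^sup>2" by simp
  also have "\<dots> = a\<^sup>2 - 2 * \<eta> * \<bar>a * b\<bar> + \<eta>\<^sup>2 * b\<^sup>2" by (simp add: power2_eq_square algebra_simps abs_mult)
  finally have "2 * \<eta> * \<bar>a * b\<bar> \<le> a\<^sup>2 + \<eta>\<^sup>2 * b\<^sup>2" by simp
  then have "\<bar>a * b\<bar> \<le> (a\<^sup>2 + \<eta>\<^sup>2 * b\<^sup>2) / (2 * \<eta>)" using assms by (simp add: field_simps)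
  also have "\<dots> = a\<^sup>2 / (2 * \<eta>) + \<eta> * b\<^sup>2 / 2" using assms by (simp add: field_simps power2_eq_square)
  finally show ?thesis .
qed

text \<open>The difference of two values of the transform is the integral of a kernel difference
  against the derivative of f. The Hoelder condition makes the kernel difference small in L2, and
  the derivative has finite energy.\<close>

lemma volterra_hat_mspace:
  fixes K :: "'p::finite \<Rightarrow> real \<Rightarrow> real \<Rightarrow> real"
  assumes T: "T > 0" and K: "\<And>l. volterra_kernel T (K l)" and f: "f \<in> cameron_martin T"
  shows "hat T K f \<in> mspace (C0_space T)"
proof -
  have T0: "0 \<le> T" using T by simp
  note fi = cameron_martin_FTC(1)[OF f T0]
  let ?\<psi> = "\<lambda>l s. dot T f s $ l"
  have sq: "set_integrable lebesgue {0..T} (\<lambda>s. (norm (dot T f s))\<^sup>2)" using f by (simp add: cameron_martin_def)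
  have kmeas: "set_borel_measurable lebesgue {0..T} (K l t)" if t: "t \<in> {0..T}" for l t
  proof -
    have km: "(\<lambda>(t, s). K l t s) \<in> borel_measurable (restrict_space borel ({0..T} \<times> {0..T}))"
      using K[of l] by (simp add: volterra_kernel_def)
    have "Pair t \<in> measurable (restrict_space borel {0..T}) (restrict_space borel ({0..T} \<times> {0..T}))"
      by (rule measurable_restrict_space2) (use t in \<open>auto simp: space_restrict_space intro!: measurable_restrict_space1 borel_measurable_continuous_onI continuous_intros\<close>)
    from measurable_compose[OF this km] have "K l t \<in> borel_measurable (restrict_space borel {0..T})" by simp
    then have "(\<lambda>s. indicator {0..T} s *\<^sub>R K l t s) \<in> borel_measurable borel"
      by (subst (asm) borel_measurable_restrict_space_iff) auto
    then show ?thesis unfolding set_borel_measurable_def by (auto intro: measurable_completion)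
  qed
  have kint: "set_integrable lebesgue {0..T} (\<lambda>s. (k s)\<^sup>2) \<and> (LINT s:{0..T}|lebesgue. (k s)\<^sup>2) \<le> C"
    if km: "set_borel_measurable lebesgue {0..T} k" and le: "(\<integral>\<^sup>+s\<in>{0..T}. ennreal ((k s)\<^sup>2) \<partial>lborel) \<le> ennreal C" and C: "C \<ge> 0" for k C
  proof -
    let ?h = "\<lambda>s. indicator {0..T} s *\<^sub>R (k s)\<^sup>2"
    have hm: "?h \<in> borel_measurable lebesgue"
    proof -
      have "?h = (\<lambda>s. (indicator {0..T} s *\<^sub>R k s)\<^sup>2)" by (auto simp: indicator_def)
      then show ?thesis using km unfolding set_borel_measurable_def by simp
    qed
    have "(\<integral>\<^sup>+s. ennreal (?h s) \<partial>lebesgue) = (\<integral>\<^sup>+s. ennreal (?h s) \<partial>lborel)"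
      using nn_integral_completion by blast
    also have "\<dots> = (\<integral>\<^sup>+s\<in>{0..T}. ennreal ((k s)\<^sup>2) \<partial>lborel)" by (rule nn_integral_cong) (auto simp: indicator_def)
    finally have nn: "(\<integral>\<^sup>+s. ennreal (?h s) \<partial>lebesgue) \<le> ennreal C" using le by simp
    then have int: "integrable lebesgue ?h"
      by (intro integrableI_nonneg hm) (auto simp: le_less_trans)
    have "(LINT s|lebesgue. ?h s) = enn2real (\<integral>\<^sup>+s. ennreal (?h s) \<partial>lebesgue)"
      by (rule integral_eq_nn_integral[OF hm]) auto
    also have "\<dots> \<le> C" using nn C by (metis enn2real_ennreal enn2real_mono ennreal_less_top)
    finally show ?thesis using int unfolding set_integrable_def set_lebesgue_integral_def by simp
  qed
  have \<psi>sq: "set_integrable lebesgue {0..T} (\<lambda>s. (?\<psi> l s)\<^sup>2)" for l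
    unfolding set_integrable_def
  proof (rule Bochner_Integration.integrable_bound[OF sq[unfolded set_integrable_def]])
    have "(\<lambda>s. indicator {0..T} s *\<^sub>R (?\<psi> l s)\<^sup>2) = (\<lambda>s. (indicator {0..T} s *\<^sub>R ?\<psi> l s)\<^sup>2)" by (auto simp: indicator_def)
    then show "(\<lambda>s. indicator {0..T} s *\<^sub>R (?\<psi> l s)\<^sup>2) \<in> borel_measurable lebesgue"
      using set_borel_measurable_integrable[OF fi[of l]] unfolding set_borel_measurable_def by simp
    show "AE s in lebesgue. norm (indicator {0..T} s *\<^sub>R (?\<psi> l s)\<^sup>2) \<le> norm (indicator {0..T} s *\<^sub>R (norm (dot T f s))\<^sup>2)"
    proof (rule AE_I2)
      fix s
      have "(?\<psi> l s)\<^sup>2 \<le> (norm (dot T f s))\<^sup>2"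
        using component_le_norm_cart[of "dot T f s" l] by (metis abs_ge_zero power2_abs power_mono)
      then show "norm (indicator {0..T} s *\<^sub>R (?\<psi> l s)\<^sup>2) \<le> norm (indicator {0..T} s *\<^sub>R (norm (dot T f s))\<^sup>2)"
        by (simp add: indicator_def)
    qed
  qed
  define D where "D l = (LINT s:{0..T}|lebesgue. (?\<psi> l s)\<^sup>2)" for l
  have D0: "D l \<ge> 0" for l unfolding D_def set_lebesgue_integral_def by (rule Bochner_Integration.integral_nonneg) (auto simp: indicator_def)
  have prod: "set_integrable lebesgue {0..T} (\<lambda>s. k s * ?\<psi> l s) \<and> \<bar>LINT s:{0..T}|lebesgue. k s * ?\<psi> l s\<bar> \<le> C / (2 * \<eta>) + \<eta> * D l / 2"
    if km: "set_borel_measurable lebesgue {0..T} k" and le: "(\<integral>\<^sup>+s\<in>{0..T}. ennreal ((k s)\<^sup>2) \<partial>lborel) \<le> ennreal C" and C: "C \<ge> 0" and \<eta>: "\<eta> > 0" for k C \<eta> l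
  proof -
    note ki = kint[OF km le C]
    let ?b = "\<lambda>s. (k s)\<^sup>2 / (2 * \<eta>) + \<eta> * (?\<psi> l s)\<^sup>2 / 2"
    have bi: "set_integrable lebesgue {0..T} ?b"
      using conjunct1[OF ki] \<psi>sq[of l] by (intro set_integral_add) auto
    have bound: "\<bar>k s * ?\<psi> l s\<bar> \<le> ?b s" for s by (rule young_weighted[OF \<eta>])
    have i: "set_integrable lebesgue {0..T} (\<lambda>s. k s * ?\<psi> l s)"
      unfolding set_integrable_def
    proof (rule Bochner_Integration.integrable_bound[OF bi[unfolded set_integrable_def]])
      have "(\<lambda>s. indicator {0..T} s *\<^sub>R (k s * ?\<psi> l s)) = (\<lambda>s. (indicator {0..T} s *\<^sub>R k s) * (indicator {0..T} s *\<^sub>R ?\<psi> l s))" by (auto simp: indicator_def)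
      then show "(\<lambda>s. indicator {0..T} s *\<^sub>R (k s * ?\<psi> l s)) \<in> borel_measurable lebesgue"
        using km set_borel_measurable_integrable[OF fi[of l]] unfolding set_borel_measurable_def by simp
      show "AE s in lebesgue. norm (indicator {0..T} s *\<^sub>R (k s * ?\<psi> l s)) \<le> norm (indicator {0..T} s *\<^sub>R ?b s)"
        using bound by (intro AE_I2) (auto simp: indicator_def intro: order_trans[OF _ abs_ge_self])
    qed
    have "\<bar>LINT s:{0..T}|lebesgue. k s * ?\<psi> l s\<bar> \<le> (LINT s:{0..T}|lebesgue. \<bar>k s * ?\<psi> l s\<bar>)"
      using set_integral_norm_bound[OF i] by simp
    also have "\<dots> \<le> (LINT s:{0..T}|lebesgue. ?b s)"
      by (rule set_integral_mono[OF set_integrable_abs[OF i] bi bound])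
    also have "\<dots> = (LINT s:{0..T}|lebesgue. (k s)\<^sup>2) / (2 * \<eta>) + \<eta> * D l / 2"
      using conjunct1[OF ki] \<psi>sq[of l] by (subst set_integral_add) (auto simp: D_def)
    also have "\<dots> \<le> C / (2 * \<eta>) + \<eta> * D l / 2"
      using conjunct2[OF ki] \<eta> by (simp add: divide_right_mono)
    finally show ?thesis using i by simp
  qed
  \<comment> \<open>The kernel vanishes for u > t, so all times t share the domain [0, T] and
    kernels at different times can be subtracted under one integral.\<close>
  have hat_eq: "hat T K f t $ l = (LINT u:{0..T}|lebesgue. K l t u * ?\<psi> l u)" if t: "t \<in> {0..T}" for t l
  proof -
    have "indicator {0..t} u *\<^sub>R (K l t u * ?\<psi> l u) = indicator {0..T} u *\<^sub>R (K l t u * ?\<psi> l u)" for u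
      using K[of l] t unfolding volterra_kernel_def by (auto simp: indicator_def)
    then have "(LINT u:{0..t}|lebesgue. K l t u * ?\<psi> l u) = (LINT u:{0..T}|lebesgue. K l t u * ?\<psi> l u)"
      unfolding set_lebesgue_integral_def by (simp only:)
    then show ?thesis using t by (simp add: hat_def)
  qed
  have sqK: "(\<integral>\<^sup>+s\<in>{0..T}. ennreal ((K l t s)\<^sup>2) \<partial>lborel) < \<infinity>" if t: "t \<in> {0..T}" for l t
  proof -
    have "(\<integral>\<^sup>+s\<in>{0..T}. ennreal ((K l t s)\<^sup>2) \<partial>lborel) \<le> (SUP t\<in>{0..T}. \<integral>\<^sup>+s\<in>{0..T}. ennreal ((K l t s)\<^sup>2) \<partial>lborel)"
      by (rule SUP_upper[OF t])
    also have "\<dots> < \<infinity>" using K[of l] by (simp add: volterra_kernel_def)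
    finally show ?thesis .
  qed
  have prodK: "set_integrable lebesgue {0..T} (\<lambda>s. K l t s * ?\<psi> l s)" if t: "t \<in> {0..T}" for l t
  proof -
    obtain C where "C \<ge> 0" "(\<integral>\<^sup>+s\<in>{0..T}. ennreal ((K l t s)\<^sup>2) \<partial>lborel) = ennreal C"
    proof (cases "\<integral>\<^sup>+s\<in>{0..T}. ennreal ((K l t s)\<^sup>2) \<partial>lborel" rule: ennreal_cases)
      case top
      then show ?thesis using sqK[OF t, of l] by simp
    qed
    then show ?thesis using prod[OF kmeas[OF t, of l], of C 1 l] by simp
  qed
  have cont: "continuous_on {0..T} (\<lambda>t. hat T K f t $ l)" for l
    unfolding continuous_on_iff
  proof (intro ballI allI impI)
    fix t e :: real assume t: "t \<in> {0..T}" and e: "e > 0"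
    obtain c \<alpha> where c: "c > 0" "\<alpha> > 0" and hold: "\<And>\<delta> t1 t2. \<delta> \<in> {0..T} \<Longrightarrow> t1 \<in> {0..T} \<Longrightarrow> t2 \<in> {0..T} \<Longrightarrow> \<bar>t1 - t2\<bar> \<le> \<delta> \<Longrightarrow>
        (\<integral>\<^sup>+s\<in>{0..T}. ennreal ((K l t1 s - K l t2 s)\<^sup>2) \<partial>lborel) \<le> ennreal (c * \<delta> powr \<alpha>)"
      using K[of l, unfolded volterra_kernel_def, THEN conjunct2, THEN conjunct2, THEN conjunct2, THEN conjunct2, THEN conjunct2]
      by blast
    \<comment> \<open>This weight keeps the energy term below e/2; \<delta> is then chosen so small
      that the kernel term is below e/4.\<close>
    define \<eta> where "\<eta> = e / (D l + 1)"
    have \<eta>: "\<eta> > 0" using e D0[of l] by (simp add: \<eta>_def)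
    have \<eta>D: "\<eta> * D l / 2 < e / 2" using e D0[of l] by (simp add: \<eta>_def field_simps)
    have "((\<lambda>\<delta>. c * \<delta> powr \<alpha>) \<longlongrightarrow> c * 0 powr \<alpha>) (at_right 0)"
      by (intro tendsto_intros tendsto_powr2) (use c in \<open>auto intro!: eventually_at_right_less[THEN eventually_mono]\<close>)
    then have "\<forall>\<^sub>F \<delta> in at_right 0. c * \<delta> powr \<alpha> < \<eta> * e / 2"
      using \<eta> e by (intro order_tendstoD) auto
    moreover have "\<forall>\<^sub>F \<delta> in at_right 0. \<delta> < T" using T by (rule eventually_at_right_real[THEN eventually_mono]) auto
    moreover have "\<forall>\<^sub>F \<delta> in at_right (0::real). 0 < \<delta>" by (rule eventually_at_right_less)
    ultimately have "\<forall>\<^sub>F \<delta> in at_right 0. 0 < \<delta> \<and> \<delta> < T \<and> c * \<delta> powr \<alpha> < \<eta> * e / 2" by eventually_elim auto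
    then obtain \<delta> where \<delta>: "0 < \<delta>" "\<delta> < T" "c * \<delta> powr \<alpha> < \<eta> * e / 2"
      using eventually_happens[of _ "at_right (0::real)"] trivial_limit_at_right_real by blast
    have "dist (hat T K f t' $ l) (hat T K f t $ l) < e" if t': "t' \<in> {0..T}" "dist t' t < \<delta>" for t'
    proof -
      have km: "set_borel_measurable lebesgue {0..T} (\<lambda>s. K l t' s - K l t s)"
        using kmeas[OF t'(1), of l] kmeas[OF t, of l] unfolding set_borel_measurable_def by (simp add: right_diff_distrib)
      have le: "(\<integral>\<^sup>+s\<in>{0..T}. ennreal ((K l t' s - K l t s)\<^sup>2) \<partial>lborel) \<le> ennreal (c * \<delta> powr \<alpha>)"
        by (rule hold) (use \<delta> t t' in \<open>auto simp: dist_real_def\<close>)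
      have "hat T K f t' $ l - hat T K f t $ l = (LINT u:{0..T}|lebesgue. (K l t' u - K l t u) * ?\<psi> l u)"
        unfolding hat_eq[OF t'(1)] hat_eq[OF t] left_diff_distrib
        by (rule set_integral_diff(2)[symmetric]) (auto intro: prodK t t')
      also have "\<bar>\<dots>\<bar> \<le> (c * \<delta> powr \<alpha>) / (2 * \<eta>) + \<eta> * D l / 2"
        using prod[OF km le _ \<eta>, of l] c by simp
      finally have "\<bar>hat T K f t' $ l - hat T K f t $ l\<bar> \<le> (c * \<delta> powr \<alpha>) / (2 * \<eta>) + \<eta> * D l / 2" .
      moreover have "(c * \<delta> powr \<alpha>) / (2 * \<eta>) < (\<eta> * e / 2) / (2 * \<eta>)"
        by (rule divide_strict_right_mono[OF \<delta>(3)]) (use \<eta> in simp)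
      moreover have "(\<eta> * e / 2) / (2 * \<eta>) = e / 4" using \<eta> by simp
      ultimately show ?thesis using \<eta>D e unfolding dist_real_def by linarith
    qed
    then show "\<exists>d>0. \<forall>x'\<in>{0..T}. dist x' t < d \<longrightarrow> dist (hat T K f x' $ l) (hat T K f t $ l) < e" using \<delta>(1) by blast
  qed
  have "hat T K f 0 $ l = 0" for l
  proof -
    have "set_integrable lebesgue {0..0} (\<lambda>s. K l 0 s * ?\<psi> l s)"
      by (rule set_integrable_subset[OF prodK]) (use T in auto)
    from set_lebesgue_integral_eq_integral(2)[OF this] show ?thesis using T by (simp add: hat_def)
  qed
  then have "hat T K f 0 = 0" by (simp add: vec_eq_iff)
  moreover have "continuous_on {0..T} (hat T K f)"
    using cont by (subst continuous_on_componentwise) (auto simp: Basis_vec_def inner_axis)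
  ultimately show ?thesis unfolding mspace_C0_space by (simp add: hat_def)
qed

section \<open>Independent increments and Gaussian small balls\<close>

context bm_family
begin

text \<open>The counterpart of \<open>exp_martingale\<close> for events: the last increment is
  independent of everything known at its start, and the history must be carried along in the
  induction to say so.\<close>

lemma sequential_indep:
  fixes s :: "nat \<Rightarrow> 'q \<Rightarrow> real" and V :: "nat \<Rightarrow> real set"
  assumes s_range: "\<And>i q. i \<le> N \<Longrightarrow> 0 \<le> s i q \<and> s i q \<le> T"
    and s_mono: "\<And>i q. i < N \<Longrightarrow> s i q \<le> s (Suc i) q" and s_less: "\<And>i. i < N \<Longrightarrow> s i r < s (Suc i) r"
    and V: "\<And>i. i < N \<Longrightarrow> V i \<in> sets borel" and E: "E \<in> sets (hist M X (s 0))"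
  shows "E \<inter> {\<omega>\<in>space M. \<forall>i<N. X r (s (Suc i) r) \<omega> - X r (s i r) \<omega> \<in> V i} \<in> sets (hist M X (s N)) \<and>
    prob (E \<inter> {\<omega>\<in>space M. \<forall>i<N. X r (s (Suc i) r) \<omega> - X r (s i r) \<omega> \<in> V i})
     = prob E * (\<Prod>i<N. prob {\<omega>\<in>space M. X r (s (Suc i) r) \<omega> - X r (s i r) \<omega> \<in> V i})"
  using assms
proof (induction N)
  case 0
  then have "E \<subseteq> space M" using sets.sets_into_space by fastforce
  then have "E \<inter> {\<omega>\<in>space M. True} = E" by auto
  then show ?case using 0 by simp
next
  case (Suc N)
  let ?D = "\<lambda>i \<omega>. X r (s (Suc i) r) \<omega> - X r (s i r) \<omega>"
  define F where "F = E \<inter> {\<omega>\<in>space M. \<forall>i<N. ?D i \<omega> \<in> V i}"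
  define G where "G = {\<omega>\<in>space M. ?D N \<omega> \<in> V N}"
  have IH: "F \<in> sets (hist M X (s N))" "prob F = prob E * (\<Prod>i<N. prob {\<omega>\<in>space M. ?D i \<omega> \<in> V i})"
    unfolding F_def using Suc.IH Suc.prems by auto
  have eq: "E \<inter> {\<omega>\<in>space M. \<forall>i<Suc N. ?D i \<omega> \<in> V i} = F \<inter> G"
    by (auto simp: F_def G_def less_Suc_eq)
  have G_eq: "G = ?D N -` V N \<inter> space M" by (auto simp: G_def)
  have Dm: "?D N \<in> borel_measurable (hist M X (s (Suc N)))"
    using Suc.prems(1)[of N r] Suc.prems(1)[of "Suc N" r] Suc.prems(2)[of N r]
    by (intro borel_measurable_diff measurable_hist) auto
  have "G \<in> sets (hist M X (s (Suc N)))"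
    unfolding G_eq using measurable_sets[OF Dm Suc.prems(4)[of N]] by simp
  moreover have "F \<in> sets (hist M X (s (Suc N)))"
    using IH(1) hist_mono[of "s N" "s (Suc N)" M X] Suc.prems(2) by auto
  ultimately have FG: "F \<inter> G \<in> sets (hist M X (s (Suc N)))" by (rule sets.Int[rotated])
  have "prob (F \<inter> G) = prob F * prob G"
  proof (rule indep_setD[OF hist_indep_increment IH(1)])
    show "G \<in> increment_sigma r (s N r) (s (Suc N) r)"
      unfolding G_eq using Suc.prems(4)[of N] by (intro sigma_sets.Basic) auto
  qed (use Suc.prems in auto)
  then show ?case unfolding eq using FG IH(2) by (simp add: G_def mult.assoc)
qed

text \<open>The increment is the integral of the indicator of ]s, t], compared with the empty step
  integrand; its quadratic variation is at most T.\<close>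

lemma increment_tail:
  assumes "0 \<le> s" "s < t" "t \<le> T" "a > 0"
  shows "prob {\<omega>\<in>space M. a \<le> \<bar>X r t \<omega> - X r s \<omega>\<bar>} \<le> 2 * exp (- a\<^sup>2 / (2 * T))"
proof (rule step_difference_tail[where m = 1 and \<tau> = "\<lambda>i. if i = 0 then s else t" and \<xi> = "\<lambda>_ _. 1"
      and m' = 0 and \<tau>' = "\<lambda>_. 0" and \<xi>' = "\<lambda>_ _. 0" and r = r])
  have "X r t \<in> borel_measurable M" "X r s \<in> borel_measurable M" using assms by auto
  then show "{\<omega>\<in>space M. a \<le> \<bar>X r t \<omega> - X r s \<omega>\<bar>} \<in> events" by measurable
  fix \<omega>
  assume "\<omega> \<in> {\<omega>\<in>space M. a \<le> \<bar>X r t \<omega> - X r s \<omega>\<bar>}"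
  then show "a \<le> \<bar>simple_integral (X r) 1 (\<lambda>i. if i = 0 then s else t) (\<lambda>_ _. 1) \<omega> - simple_integral (X r) 0 (\<lambda>_. 0) (\<lambda>_ _. 0) \<omega>\<bar>"
    by (simp add: simple_integral_def)
  have "(\<integral>\<^sup>+u\<in>{0..T}. ennreal ((simple_process 1 (\<lambda>i. if i = 0 then s else t) (\<lambda>_ _. 1) u \<omega> - simple_process 0 (\<lambda>_. 0) (\<lambda>_ _. 0) u \<omega>)\<^sup>2) \<partial>lborel)
    \<le> (\<integral>\<^sup>+u\<in>{0..T}. 1 \<partial>lborel)"
    by (rule nn_integral_mono) (auto simp: simple_process_def indicator_def)
  also have "\<dots> = ennreal T" using T_pos by simp
  finally show "(\<integral>\<^sup>+u\<in>{0..T}. ennreal ((simple_process 1 (\<lambda>i. if i = 0 then s else t) (\<lambda>_ _. 1) u \<omega> - simple_process 0 (\<lambda>_. 0) (\<lambda>_ _. 0) u \<omega>)\<^sup>2) \<partial>lborel) \<le> ennreal T" .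
qed (use assms T_pos in \<open>auto simp: adapted_step_def\<close>)

end

text \<open>The density is bounded below by its value at (|h| + r') / \<epsilon> on an interval of
  length 2 r' / \<epsilon>. The radius r' < r is taken so small that replacing |h| by |h| + r' costs
  less than \<eta> in the exponent.\<close>

lemma (in ldp_speed) normal_small_ball:
  assumes D: "distributed M lborel D (normal_density 0 (sqrt \<delta>))" and \<delta>: "\<delta> > 0" and r: "r > 0" and \<eta>: "\<eta> > 0"
  shows "\<forall>\<^sub>F n in sequentially. exp (- (h\<^sup>2 / (2 * \<delta>) + \<eta>) / (\<epsilon> n)\<^sup>2) \<le> prob {\<omega>\<in>space M. \<bar>\<epsilon> n * D \<omega> - h\<bar> < r}"
proof -
  have "((\<lambda>r'. (\<bar>h\<bar> + r')\<^sup>2 / (2 * \<delta>)) \<longlongrightarrow> (\<bar>h\<bar> + 0)\<^sup>2 / (2 * \<delta>)) (at_right 0)"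
    using \<delta> by (intro tendsto_intros) auto
  then have "\<forall>\<^sub>F r' in at_right 0. (\<bar>h\<bar> + r')\<^sup>2 / (2 * \<delta>) < h\<^sup>2 / (2 * \<delta>) + \<eta>"
    using \<eta> by (intro order_tendstoD) auto
  moreover have "\<forall>\<^sub>F r' in at_right 0. r' < r" using r by (rule eventually_at_right_real[THEN eventually_mono]) auto
  moreover have "\<forall>\<^sub>F r' in at_right (0::real). 0 < r'" by (rule eventually_at_right_less)
  ultimately have "\<forall>\<^sub>F r' in at_right 0. 0 < r' \<and> r' < r \<and> (\<bar>h\<bar> + r')\<^sup>2 / (2 * \<delta>) < h\<^sup>2 / (2 * \<delta>) + \<eta>" by eventually_elim auto
  then obtain r' where r': "0 < r'" "r' < r" "(\<bar>h\<bar> + r')\<^sup>2 / (2 * \<delta>) < h\<^sup>2 / (2 * \<delta>) + \<eta>"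
    using eventually_happens[of _ "at_right (0::real)"] trivial_limit_at_right_real by blast
  have Dm[measurable]: "D \<in> borel_measurable M" using distributed_measurable[OF D] by simp
  define q where "q = 2 * r' / sqrt (2 * pi * \<delta>)"
  have q: "q > 0" using r' \<delta> by (simp add: q_def)
  have "\<forall>\<^sub>F n in sequentially. \<epsilon> n < q" using eps_lim q by (rule order_tendstoD)
  then show ?thesis
  proof eventually_elim
    case (elim n)
    let ?e = "\<epsilon> n"
    have e: "?e > 0" by (rule eps_pos)
    define A where "A = {(h - r') / ?e .. (h + r') / ?e}"
    define c where "c = 1 / sqrt (2 * pi * \<delta>) * exp (- ((\<bar>h\<bar> + r') / ?e)\<^sup>2 / (2 * \<delta>))"
    have dens: "c \<le> normal_density 0 (sqrt \<delta>) x" if "x \<in> A" for x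
    proof -
      have "\<bar>x\<bar> \<le> (\<bar>h\<bar> + r') / ?e" using that e r'(1) by (auto simp: A_def field_simps abs_le_iff)
      then have "x\<^sup>2 \<le> ((\<bar>h\<bar> + r') / ?e)\<^sup>2" by (metis abs_ge_zero power2_abs power_mono)
      then have "- ((\<bar>h\<bar> + r') / ?e)\<^sup>2 / (2 * \<delta>) \<le> - (x - 0)\<^sup>2 / (2 * (sqrt \<delta>)\<^sup>2)"
        using \<delta> by (simp add: divide_right_mono)
      then have "exp (- ((\<bar>h\<bar> + r') / ?e)\<^sup>2 / (2 * \<delta>)) \<le> exp (- (x - 0)\<^sup>2 / (2 * (sqrt \<delta>)\<^sup>2))" by simp
      then show ?thesis unfolding c_def normal_density_def using \<delta> by (simp add: divide_right_mono)
    qed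
    have c0: "c \<ge> 0" using \<delta> by (simp add: c_def)
    have "emeasure lborel A = ennreal ((h + r') / ?e - (h - r') / ?e)"
      unfolding A_def using e r'(1) by (intro emeasure_lborel_Icc) (simp add: divide_right_mono)
    also have "(h + r') / ?e - (h - r') / ?e = 2 * r' / ?e" by (simp flip: diff_divide_distrib)
    finally have len: "emeasure lborel A = ennreal (2 * r' / ?e)" .
    have "ennreal (c * (2 * r' / ?e)) = ennreal c * emeasure lborel A"
      unfolding len by (rule ennreal_mult[OF c0]) (use e r'(1) in simp)
    also have "\<dots> = (\<integral>\<^sup>+x. ennreal c * indicator A x \<partial>lborel)"
      by (rule nn_integral_cmult_indicator[symmetric]) (simp add: A_def)
    also have "\<dots> \<le> (\<integral>\<^sup>+x. ennreal (normal_density 0 (sqrt \<delta>) x) * indicator A x \<partial>lborel)"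
      by (rule nn_integral_mono) (auto simp: indicator_def intro!: ennreal_leI dens)
    also have "\<dots> = emeasure M (D -` A \<inter> space M)"
      by (rule distributed_emeasure[OF D, symmetric]) (simp add: A_def)
    finally have "c * (2 * r' / ?e) \<le> prob (D -` A \<inter> space M)"
      by (simp add: emeasure_eq_measure)
    also have "\<dots> \<le> prob {\<omega>\<in>space M. \<bar>?e * D \<omega> - h\<bar> < r}"
    proof (rule finite_measure_mono)
      show "D -` A \<inter> space M \<subseteq> {\<omega>\<in>space M. \<bar>?e * D \<omega> - h\<bar> < r}"
      proof
        fix \<omega> assume "\<omega> \<in> D -` A \<inter> space M"
        then have "(h - r') / ?e \<le> D \<omega>" "D \<omega> \<le> (h + r') / ?e" "\<omega> \<in> space M" by (auto simp: A_def)
        then have "h - r' \<le> ?e * D \<omega>" "?e * D \<omega> \<le> h + r'" using e by (auto simp: field_simps)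
        then show "\<omega> \<in> {\<omega>\<in>space M. \<bar>?e * D \<omega> - h\<bar> < r}" using r'(2) \<open>\<omega> \<in> space M\<close> by auto
      qed
    qed measurable
    finally have P: "c * (2 * r' / ?e) \<le> prob {\<omega>\<in>space M. \<bar>?e * D \<omega> - h\<bar> < r}" .
    have "exp (- (h\<^sup>2 / (2 * \<delta>) + \<eta>) / ?e\<^sup>2) \<le> exp (- ((\<bar>h\<bar> + r') / ?e)\<^sup>2 / (2 * \<delta>))"
    proof -
      have "((\<bar>h\<bar> + r') / ?e)\<^sup>2 / (2 * \<delta>) = ((\<bar>h\<bar> + r')\<^sup>2 / (2 * \<delta>)) / ?e\<^sup>2" by (simp add: power_divide)
      also have "\<dots> \<le> (h\<^sup>2 / (2 * \<delta>) + \<eta>) / ?e\<^sup>2" using r'(3) by (intro divide_right_mono) auto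
      finally have "- ((h\<^sup>2 / (2 * \<delta>) + \<eta>) / ?e\<^sup>2) \<le> - (((\<bar>h\<bar> + r') / ?e)\<^sup>2 / (2 * \<delta>))" by (simp only: neg_le_iff_le)
      then show ?thesis unfolding exp_le_cancel_iff minus_divide_left .
    qed
    also have "\<dots> \<le> (q / ?e) * exp (- ((\<bar>h\<bar> + r') / ?e)\<^sup>2 / (2 * \<delta>))"
      using elim e by (simp add: field_simps)
    also have "\<dots> = c * (2 * r' / ?e)" by (simp add: c_def q_def)
    finally show ?case using P by linarith
  qed
qed

subsection \<open>Discretization of the rate function\<close>

definition M_riemann :: "real \<Rightarrow> (real^'p \<Rightarrow> real^'d) \<Rightarrow> nat \<Rightarrow> (real \<Rightarrow> real^'p) \<Rightarrow> real^'d" where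
  "M_riemann T \<mu> m g = (\<chi> i. \<Sum>k<m. \<mu> (g (mesh T m k)) $ i * (T / real m))"

definition Phi_riemann :: "real \<Rightarrow> (real^'p \<Rightarrow> real^'p^'d) \<Rightarrow> nat \<Rightarrow> (real \<Rightarrow> real^'p) \<Rightarrow> (real \<Rightarrow> real^'p) \<Rightarrow> real^'d" where
  "Phi_riemann T \<sigma>' m f g = (\<chi> i. \<Sum>l\<in>UNIV. \<Sum>k<m. \<sigma>' (g (mesh T m k)) $ i $ l * (f (mesh T m (Suc k)) $ l - f (mesh T m k) $ l))"

text \<open>The increments w are an argument, so that scaled Wiener increments and a deterministic
  control can both be inserted.\<close>

definition W_riemann :: "real \<Rightarrow> (real^'p \<Rightarrow> real^'d^'d) \<Rightarrow> nat \<Rightarrow> (real \<Rightarrow> real^'p) \<Rightarrow> ('d \<Rightarrow> nat \<Rightarrow> real) \<Rightarrow> real^'d" where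
  "W_riemann T \<sigma> m g w = (\<chi> i. \<Sum>j\<in>UNIV. \<Sum>k<m. \<sigma> (g (mesh T m k)) $ i $ j * w j k)"

text \<open>\<open>dual_coeff \<sigma> \<theta> y j\<close> is the \<open>j\<close>-th component of \<open>\<sigma>(y)\<^sup>T \<theta>\<close>.\<close>

definition dual_coeff :: "(real^'p \<Rightarrow> real^'d^'d) \<Rightarrow> real^'d \<Rightarrow> real^'p \<Rightarrow> 'd \<Rightarrow> real" where
  "dual_coeff \<sigma> \<theta> y j = (\<Sum>i\<in>UNIV. \<sigma> y $ i $ j * \<theta> $ i)"

text \<open>Riemann sum for the quadratic form of \<open>A_mat\<close> at \<theta>; times
  \<epsilon>^2 it is the variance of \<open>\<theta> \<bullet> W_riemann\<close> when g is held
  fixed and w consists of \<epsilon>-scaled Wiener increments.\<close>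

definition quad_riemann :: "real \<Rightarrow> (real^'p \<Rightarrow> real^'d^'d) \<Rightarrow> real^'d \<Rightarrow> nat \<Rightarrow> (real \<Rightarrow> real^'p) \<Rightarrow> real" where
  "quad_riemann T \<sigma> \<theta> m g = (\<Sum>j\<in>UNIV. \<Sum>k<m. (dual_coeff \<sigma> \<theta> (g (mesh T m k)) j)\<^sup>2 * (T / real m))"

lemma inner_W_riemann:
  "\<theta> \<bullet> W_riemann T \<sigma> m g w = (\<Sum>j\<in>UNIV. \<Sum>k<m. dual_coeff \<sigma> \<theta> (g (mesh T m k)) j * w j k)"
proof -
  have "\<theta> \<bullet> W_riemann T \<sigma> m g w = (\<Sum>i\<in>UNIV. \<Sum>j\<in>UNIV. \<Sum>k<m. \<theta> $ i * (\<sigma> (g (mesh T m k)) $ i $ j * w j k))"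
    by (simp add: inner_vec_def W_riemann_def sum_distrib_left)
  also have "\<dots> = (\<Sum>j\<in>UNIV. \<Sum>k<m. \<Sum>i\<in>UNIV. \<theta> $ i * (\<sigma> (g (mesh T m k)) $ i $ j * w j k))"
    by (subst sum.swap, intro sum.cong refl, subst sum.swap) simp
  also have "\<dots> = (\<Sum>j\<in>UNIV. \<Sum>k<m. dual_coeff \<sigma> \<theta> (g (mesh T m k)) j * w j k)"
    unfolding dual_coeff_def sum_distrib_right by (simp add: ac_simps)
  finally show ?thesis .
qed

lemma diffusion_matrix_apply:
  "(diffusion_matrix \<sigma> y *v \<theta>) $ i = (\<Sum>j\<in>UNIV. \<sigma> y $ i $ j * dual_coeff \<sigma> \<theta> y j)"
proof -
  have "(diffusion_matrix \<sigma> y *v \<theta>) $ i = (\<Sum>i'\<in>UNIV. \<Sum>j\<in>UNIV. \<sigma> y $ i $ j * \<sigma> y $ i' $ j * \<theta> $ i')"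
    unfolding diffusion_matrix_def matrix_vector_mult_def matrix_matrix_mult_def transpose_def
    by (simp add: sum_distrib_right)
  also have "\<dots> = (\<Sum>j\<in>UNIV. \<sigma> y $ i $ j * dual_coeff \<sigma> \<theta> y j)"
    unfolding dual_coeff_def sum_distrib_left by (subst sum.swap) (simp add: ac_simps)
  finally show ?thesis .
qed

text \<open>The Wiener increments of an optimal control for the linear form \<open>\<theta>\<close>.\<close>

definition dual_control :: "real \<Rightarrow> (real^'p \<Rightarrow> real^'d^'d) \<Rightarrow> real^'d \<Rightarrow> nat \<Rightarrow> (real \<Rightarrow> real^'p) \<Rightarrow> 'd \<Rightarrow> nat \<Rightarrow> real" where
  "dual_control T \<sigma> \<theta> m g j k = dual_coeff \<sigma> \<theta> (g (mesh T m k)) j * (T / real m)"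

lemma inner_W_riemann_dual_control:
  "\<theta> \<bullet> W_riemann T \<sigma> m g (dual_control T \<sigma> \<theta> m g) = quad_riemann T \<sigma> \<theta> m g"
  unfolding inner_W_riemann quad_riemann_def dual_control_def by (simp add: power2_eq_square mult.assoc)

context
  fixes T :: real and g :: "real \<Rightarrow> real^'p" and \<mu> :: "real^'p \<Rightarrow> real^'d" and \<sigma> :: "real^'p \<Rightarrow> real^'d^'d" and \<sigma>' :: "real^'p \<Rightarrow> real^'p^'d"
  assumes T: "0 < T" and g: "continuous_on {0..T} g"
    and mu: "\<And>i. continuous_on UNIV (\<lambda>y. \<mu> y $ i)" and sigma: "\<And>i j. continuous_on UNIV (\<lambda>y. \<sigma> y $ i $ j)"
    and sigma': "\<And>i l. continuous_on UNIV (\<lambda>y. \<sigma>' y $ i $ l)" and nondeg: "\<And>y. det (diffusion_matrix \<sigma> y) \<noteq> 0"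
begin

lemma M_riemann_tendsto: "(\<lambda>m. M_riemann T \<mu> m g) \<longlonglongrightarrow> M_vec T \<mu> g"
proof (rule vec_tendstoI)
  fix i
  have "continuous_on {0..T} (\<lambda>t. \<mu> (g t) $ i)" by (rule continuous_on_path_compose[OF mu g])
  from riemann_tendsto[OF T this] show "(\<lambda>m. M_riemann T \<mu> m g $ i) \<longlonglongrightarrow> M_vec T \<mu> g $ i"
    by (simp add: M_riemann_def M_vec_def)
qed

lemma Phi_riemann_tendsto:
  assumes f: "f \<in> cameron_martin T"
  shows "(\<lambda>m. Phi_riemann T \<sigma>' m f g) \<longlonglongrightarrow> Phi T \<sigma>' f g T"
proof (rule vec_tendstoI)
  fix i
  have T0: "0 \<le> T" using T by simp
  have "(\<lambda>m. \<Sum>k<m. \<sigma>' (g (mesh T m k)) $ i $ l * (f (mesh T m (Suc k)) $ l - f (mesh T m k) $ l)) \<longlonglongrightarrow> (LINT s:{0..T}|lebesgue. \<sigma>' (g s) $ i $ l * dot T f s $ l)" for l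
  proof -
    have "continuous_on {0..T} (\<lambda>t. \<sigma>' (g t) $ i $ l)" by (rule continuous_on_path_compose[OF sigma' g])
    note lim = riemann_stieltjes_tendsto[OF T this cameron_martin_FTC(1)[OF f T0, of l]]
    have "(\<Sum>k<m. \<sigma>' (g (mesh T m k)) $ i $ l * (LINT s:{mesh T m k..mesh T m (Suc k)}|lebesgue. dot T f s $ l))
       = (\<Sum>k<m. \<sigma>' (g (mesh T m k)) $ i $ l * (f (mesh T m (Suc k)) $ l - f (mesh T m k) $ l))" for m
    proof (rule sum.cong[OF refl])
      fix k assume "k \<in> {..<m}"
      then have "(LINT s:{mesh T m k..mesh T m (Suc k)}|lebesgue. dot T f s $ l) = f (mesh T m (Suc k)) $ l - f (mesh T m k) $ l"
        by (intro cameron_martin_FTC(2)[OF f T0] mesh_nonneg mesh_mono mesh_le T0) auto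
      then show "\<sigma>' (g (mesh T m k)) $ i $ l * (LINT s:{mesh T m k..mesh T m (Suc k)}|lebesgue. dot T f s $ l) = \<sigma>' (g (mesh T m k)) $ i $ l * (f (mesh T m (Suc k)) $ l - f (mesh T m k) $ l)"
        by (simp only:)
    qed
    then show ?thesis using lim by simp
  qed
  then show "(\<lambda>m. Phi_riemann T \<sigma>' m f g $ i) \<longlonglongrightarrow> Phi T \<sigma>' f g T $ i"
    unfolding Phi_riemann_def Phi_def by (auto intro!: tendsto_sum)
qed

text \<open>By \<open>diffusion_matrix_apply\<close>, inserting the control
  \<open>\<sigma>\<^sup>T \<theta> dt\<close> turns the sum into a Riemann sum of
  \<open>\<sigma> \<sigma>\<^sup>T \<theta>\<close>.\<close>

lemma W_riemann_tendsto: "(\<lambda>m. W_riemann T \<sigma> m g (dual_control T \<sigma> \<theta> m g)) \<longlonglongrightarrow> A_mat T \<sigma> g *v \<theta>"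
proof (rule vec_tendstoI)
  fix i
  have cont: "continuous_on {0..T} (\<lambda>t. diffusion_matrix \<sigma> (g t) $ i $ i')" for i'
  proof -
    have "continuous_on UNIV (\<lambda>y. diffusion_matrix \<sigma> y $ i $ i')"
      unfolding diffusion_matrix_def matrix_matrix_mult_def transpose_def
      by (simp, intro continuous_intros sigma)
    then show ?thesis by (rule continuous_on_path_compose[OF _ g])
  qed
  have "W_riemann T \<sigma> m g (dual_control T \<sigma> \<theta> m g) $ i
     = (\<Sum>i'\<in>UNIV. (\<Sum>k<m. diffusion_matrix \<sigma> (g (mesh T m k)) $ i $ i' * (T / real m)) * \<theta> $ i')" for m
  proof -
    have "W_riemann T \<sigma> m g (dual_control T \<sigma> \<theta> m g) $ i
      = (\<Sum>k<m. (T / real m) * (\<Sum>j\<in>UNIV. \<sigma> (g (mesh T m k)) $ i $ j * dual_coeff \<sigma> \<theta> (g (mesh T m k)) j))"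
      unfolding W_riemann_def dual_control_def sum_distrib_left by (simp, subst sum.swap) (simp add: ac_simps)
    also have "\<dots> = (\<Sum>k<m. (T / real m) * (\<Sum>i'\<in>UNIV. diffusion_matrix \<sigma> (g (mesh T m k)) $ i $ i' * \<theta> $ i'))"
      unfolding diffusion_matrix_apply[symmetric] by (simp add: matrix_vector_mult_def)
    also have "\<dots> = (\<Sum>i'\<in>UNIV. (\<Sum>k<m. diffusion_matrix \<sigma> (g (mesh T m k)) $ i $ i' * (T / real m)) * \<theta> $ i')"
      unfolding sum_distrib_left sum_distrib_right by (subst sum.swap) (simp add: ac_simps)
    finally show ?thesis .
  qed
  moreover have "(\<lambda>m. \<Sum>i'\<in>UNIV. (\<Sum>k<m. diffusion_matrix \<sigma> (g (mesh T m k)) $ i $ i' * (T / real m)) * \<theta> $ i')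
     \<longlonglongrightarrow> (\<Sum>i'\<in>UNIV. (LINT t:{0..T}|lborel. diffusion_matrix \<sigma> (g t) $ i $ i') * \<theta> $ i')"
    by (intro tendsto_sum tendsto_mult_right riemann_tendsto[OF T cont])
  ultimately show "(\<lambda>m. W_riemann T \<sigma> m g (dual_control T \<sigma> \<theta> m g) $ i) \<longlonglongrightarrow> (A_mat T \<sigma> g *v \<theta>) $ i"
    by (simp add: A_mat_def matrix_vector_mult_def)
qed

lemma quad_riemann_tendsto: "(\<lambda>m. quad_riemann T \<sigma> \<theta> m g) \<longlonglongrightarrow> \<theta> \<bullet> (A_mat T \<sigma> g *v \<theta>)"
  unfolding inner_W_riemann_dual_control[symmetric] by (intro tendsto_inner tendsto_const W_riemann_tendsto)

text \<open>The integrand of the quadratic form is the squared length of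
  \<open>\<sigma>\<^sup>T \<theta>\<close>, which is positive because
  \<open>\<sigma> \<sigma>\<^sup>T\<close> is invertible. It is continuous in time, so its minimum
  over [0, T] is positive and bounds all Riemann sums from below.\<close>

lemma A_mat_pos: assumes "\<theta> \<noteq> 0" shows "0 < \<theta> \<bullet> (A_mat T \<sigma> g *v \<theta>)"
proof -
  define q where "q t = (\<Sum>j\<in>UNIV. (dual_coeff \<sigma> \<theta> (g t) j)\<^sup>2)" for t
  have "continuous_on UNIV (\<lambda>y. \<Sum>j\<in>UNIV. (dual_coeff \<sigma> \<theta> y j)\<^sup>2)"
    unfolding dual_coeff_def by (intro continuous_intros sigma)
  then have q: "continuous_on {0..T} q" unfolding q_def by (rule continuous_on_path_compose[OF _ g])
  have pos: "q t > 0" for t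
  proof -
    have "q t \<ge> 0" unfolding q_def by (intro sum_nonneg) auto
    moreover have "q t \<noteq> 0"
    proof
      assume "q t = 0"
      then have "dual_coeff \<sigma> \<theta> (g t) j = 0" for j unfolding q_def by (simp add: sum_nonneg_eq_0_iff)
      then have "diffusion_matrix \<sigma> (g t) *v \<theta> = 0" by (simp add: vec_eq_iff diffusion_matrix_apply)
      moreover have "invertible (diffusion_matrix \<sigma> (g t))" using nondeg by (simp add: invertible_det_nz)
      ultimately show False using assms by (metis invertible_left_inverse matrix_left_invertible_ker)
    qed
    ultimately show ?thesis by simp
  qed
  obtain t0 where "t0 \<in> {0..T}" "\<And>t. t \<in> {0..T} \<Longrightarrow> q t0 \<le> q t"
    using continuous_attains_inf[of "{0..T}" q] q T by auto
  then have c0: "\<And>t. t \<in> {0..T} \<Longrightarrow> q t0 \<le> q t" "q t0 > 0" using pos by auto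
  have "q t0 * T \<le> quad_riemann T \<sigma> \<theta> m g" if "m > 0" for m
  proof -
    have "q t0 * T = (\<Sum>k<m. q t0 * (T / real m))" using that by simp
    also have "\<dots> \<le> (\<Sum>k<m. q (mesh T m k) * (T / real m))"
      using T mesh_nonneg[of T m] mesh_le[of T _ m] by (intro sum_mono mult_right_mono c0) auto
    also have "\<dots> = quad_riemann T \<sigma> \<theta> m g"
      unfolding quad_riemann_def q_def sum_distrib_right by (rule sum.swap)
    finally show ?thesis .
  qed
  then have "q t0 * T \<le> \<theta> \<bullet> (A_mat T \<sigma> g *v \<theta>)"
    by (intro LIMSEQ_le_const[OF quad_riemann_tendsto] exI[of _ 1]) auto
  moreover have "q t0 * T > 0" using c0 T by simp
  ultimately show ?thesis by linarith
qed

lemma A_mat_solve: "A_mat T \<sigma> g *v (matrix_inv (A_mat T \<sigma> g) *v v) = v"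
proof -
  have "\<exists>B. B ** A_mat T \<sigma> g = mat 1"
    unfolding matrix_left_invertible_ker using A_mat_pos by (metis inner_zero_right less_irrefl)
  then have "invertible (A_mat T \<sigma> g)" by (simp add: invertible_left_inverse)
  then have "A_mat T \<sigma> g ** matrix_inv (A_mat T \<sigma> g) = mat 1"
    using someI_ex[of "\<lambda>A'. A_mat T \<sigma> g ** A' = mat 1 \<and> A' ** A_mat T \<sigma> g = mat 1"] unfolding invertible_def matrix_inv_def by blast
  then show ?thesis by (simp add: matrix_vector_mul_assoc)
qed

lemma A_mat_inv_nonneg: "0 \<le> v \<bullet> (matrix_inv (A_mat T \<sigma> g) *v v)"
proof -
  define \<theta> where "\<theta> = matrix_inv (A_mat T \<sigma> g) *v v"
  have "v \<bullet> \<theta> = \<theta> \<bullet> (A_mat T \<sigma> g *v \<theta>)" using A_mat_solve[of v] by (simp add: \<theta>_def inner_commute)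
  moreover have "0 \<le> \<theta> \<bullet> (A_mat T \<sigma> g *v \<theta>)" using A_mat_pos[of \<theta>] by (cases "\<theta> = 0") auto
  ultimately show ?thesis by (simp add: \<theta>_def)
qed

end

lemma tendsto_if_dist_le_inverse:
  fixes x :: "nat \<Rightarrow> 'z::real_normed_vector"
  assumes "\<And>n. norm (x n - l) \<le> 1 / real (Suc n)"
  shows "x \<longlonglongrightarrow> l"
proof -
  have null: "(\<lambda>n. 1 / real (Suc n)) \<longlonglongrightarrow> 0" using LIMSEQ_inverse_real_of_nat by (simp add: inverse_eq_divide)
  have "(\<lambda>n. x n - l) \<longlonglongrightarrow> 0" by (rule Lim_null_comparison[OF _ null]) (use assms in auto)
  then show ?thesis by (rule LIM_zero_cancel)
qed

lemma tube_continuity: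
  fixes F :: "(real \<Rightarrow> real^'p) \<Rightarrow> (real \<Rightarrow> real^'p) \<Rightarrow> ('j \<Rightarrow> real) \<Rightarrow> 'e::metric_space"
  assumes seq: "\<And>fn gn wn. (\<And>t. t \<in> S \<Longrightarrow> (\<lambda>n. fn n t) \<longlonglongrightarrow> f t) \<Longrightarrow> (\<And>t. t \<in> S \<Longrightarrow> (\<lambda>n. gn n t) \<longlonglongrightarrow> g t) \<Longrightarrow>
      (\<And>j. j \<in> J \<Longrightarrow> (\<lambda>n. wn n j) \<longlonglongrightarrow> w j) \<Longrightarrow> (\<lambda>n. F (fn n) (gn n) (wn n)) \<longlonglongrightarrow> F f g w" and e: "e > 0"
  shows "\<exists>\<rho>>0. \<forall>f' g' w'. (\<forall>t\<in>S. norm (f' t - f t) \<le> \<rho> \<and> norm (g' t - g t) \<le> \<rho>) \<longrightarrow> (\<forall>j\<in>J. \<bar>w' j - w j\<bar> \<le> \<rho>) \<longrightarrow> dist (F f' g' w') (F f g w) < e"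
proof (rule ccontr)
  assume neg: "\<not> ?thesis"
  have "\<exists>f' g' w'. (\<forall>t\<in>S. norm (f' t - f t) \<le> 1 / real (Suc n) \<and> norm (g' t - g t) \<le> 1 / real (Suc n)) \<and> (\<forall>j\<in>J. \<bar>w' j - w j\<bar> \<le> 1 / real (Suc n)) \<and> \<not> dist (F f' g' w') (F f g w) < e" for n
  proof -
    have "1 / real (Suc n) > 0" by simp
    then show ?thesis using neg by blast
  qed
  then obtain fn gn wn where fn: "\<And>n t. t \<in> S \<Longrightarrow> norm (fn n t - f t) \<le> 1 / real (Suc n)"
    and gn: "\<And>n t. t \<in> S \<Longrightarrow> norm (gn n t - g t) \<le> 1 / real (Suc n)"
    and wn: "\<And>n j. j \<in> J \<Longrightarrow> \<bar>wn n j - w j\<bar> \<le> 1 / real (Suc n)"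
    and F: "\<And>n. \<not> dist (F (fn n) (gn n) (wn n)) (F f g w) < e" by metis
  have "(\<lambda>n. F (fn n) (gn n) (wn n)) \<longlonglongrightarrow> F f g w"
    by (rule seq) (rule tendsto_if_dist_le_inverse, use fn gn wn in force)+
  then have "\<forall>\<^sub>F n in sequentially. dist (F (fn n) (gn n) (wn n)) (F f g w) < e" using e by (rule tendstoD)
  then show False using F by (simp add: eventually_sequentially)
qed

lemma tendsto_continuous_compose:
  fixes h :: "'a::t2_space \<Rightarrow> 'b::topological_space"
  assumes "continuous_on UNIV h" "(\<lambda>n. x n) \<longlonglongrightarrow> l"
  shows "(\<lambda>n. h (x n)) \<longlonglongrightarrow> h l"
  by (rule continuous_on_tendsto_compose[OF assms]) auto

subsection \<open>Exponential approximation of the log-price\<close>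

locale log_price = volterra_model M T \<epsilon> B W Bh Kn K
  for M :: "'w measure" and T :: real and \<epsilon> :: "nat \<Rightarrow> real"
    and B :: "real \<Rightarrow> 'w \<Rightarrow> real^'p" and W :: "real \<Rightarrow> 'w \<Rightarrow> real^'d"
    and Bh :: "nat \<Rightarrow> real \<Rightarrow> 'w \<Rightarrow> real^'p"
    and Kn :: "nat \<Rightarrow> 'p \<Rightarrow> real \<Rightarrow> real \<Rightarrow> real" and K :: "'p \<Rightarrow> real \<Rightarrow> real \<Rightarrow> real" +
  fixes \<mu> :: "real^'p \<Rightarrow> real^'d" and \<sigma> :: "real^'p \<Rightarrow> real^'d^'d" and \<sigma>' :: "real^'p \<Rightarrow> real^'p^'d"
    and JB :: "nat \<Rightarrow> 'd \<Rightarrow> 'p \<Rightarrow> 'w \<Rightarrow> real" and JW :: "nat \<Rightarrow> 'd \<Rightarrow> 'd \<Rightarrow> 'w \<Rightarrow> real"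
    and Z :: "nat \<Rightarrow> 'w \<Rightarrow> real^'d"
  assumes mu_continuous: "\<And>i. continuous_on UNIV (\<lambda>y. \<mu> y $ i)" and sigma_continuous: "\<And>i j. continuous_on UNIV (\<lambda>y. \<sigma> y $ i $ j)"
    and sigma'_continuous: "\<And>i l. continuous_on UNIV (\<lambda>y. \<sigma>' y $ i $ l)"
    and nondegenerate: "\<And>y. det (diffusion_matrix \<sigma> y) \<noteq> 0"
    and JB: "\<And>n i l. has_ito_integral M (driving_filtration M B W) (\<lambda>s \<omega>. B s \<omega> $ l) T (\<lambda>s \<omega>. \<sigma>' (Bh n s \<omega>) $ i $ l) (JB n i l)"
    and JW: "\<And>n i j. has_ito_integral M (driving_filtration M B W) (\<lambda>s \<omega>. W s \<omega> $ j) T (\<lambda>s \<omega>. \<sigma> (Bh n s \<omega>) $ i $ j) (JW n i j)"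
    and Z_measurable: "\<And>n. Z n \<in> borel_measurable M"
    and Z_eq: "\<And>n i. AE \<omega> in M. Z n \<omega> $ i =
           (LINT s:{0..T}|lborel. \<mu> (Bh n s \<omega>) $ i
               - 1/2 * (\<epsilon> n)\<^sup>2 * (\<Sum>j\<in>UNIV. (\<sigma> (Bh n s \<omega>) $ i $ j)\<^sup>2)
               - 1/2 * (\<epsilon> n)\<^sup>2 * (\<Sum>l\<in>UNIV. (\<sigma>' (Bh n s \<omega>) $ i $ l)\<^sup>2))
           + \<epsilon> n * (\<Sum>l\<in>UNIV. JB n i l \<omega>) + \<epsilon> n * (\<Sum>j\<in>UNIV. JW n i j \<omega>)"
begin

definition W_increments :: "nat \<Rightarrow> nat \<Rightarrow> 'w \<Rightarrow> 'd \<Rightarrow> nat \<Rightarrow> real" where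
  "W_increments n m \<omega> j k = \<epsilon> n * (W (mesh T m (Suc k)) \<omega> $ j - W (mesh T m k) \<omega> $ j)"

definition Z_riemann :: "nat \<Rightarrow> nat \<Rightarrow> 'w \<Rightarrow> real^'d" where
  "Z_riemann n m \<omega> = M_riemann T \<mu> m (\<lambda>t. Bh n t \<omega>) + Phi_riemann T \<sigma>' m (\<lambda>t. \<epsilon> n *\<^sub>R B t \<omega>) (\<lambda>t. Bh n t \<omega>)
     + W_riemann T \<sigma> m (\<lambda>t. Bh n t \<omega>) (W_increments n m \<omega>)"

lemma Bh_measurable: "t \<in> {0..T} \<Longrightarrow> Bh n t \<in> borel_measurable M"
  unfolding borel_measurable_vec_iff using Bh_eq by (auto simp: has_ito_integral_def)

lemma riemann_ito_measurable:
  assumes h: "continuous_on UNIV h"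
  shows "riemann_ito n m h r \<in> borel_measurable M"
  unfolding riemann_ito_def
proof (intro borel_measurable_sum borel_measurable_times borel_measurable_diff)
  fix k assume "k \<in> {..<m}"
  then have r: "mesh T m k \<in> {0..T}" "mesh T m (Suc k) \<in> {0..T}" using mesh_range[of k m] mesh_range[of "Suc k" m] by auto
  show "(\<lambda>\<omega>. h (Bh n (mesh T m k) \<omega>)) \<in> borel_measurable M"
    by (rule measurable_compose[OF Bh_measurable[OF r(1)] borel_measurable_continuous_onI[OF h]])
  show "X r (mesh T m (Suc k)) \<in> borel_measurable M" "X r (mesh T m k) \<in> borel_measurable M" using r by auto
qed

text \<open>After multiplication by \<epsilon> a deviation \<delta> becomes \<delta> / \<epsilon>
  for the integral itself, so the Gaussian tail produces exactly the speed \<epsilon>^-2. The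
  exponent grows without bound as \<kappa> tends to 0.\<close>

lemma exp_small_ito:
  assumes h: "continuous_on UNIV h" and m: "m > 0" and \<kappa>: "\<kappa> > 0" and \<delta>: "\<delta> > 0"
    and ito: "\<And>n. has_ito_integral M (driving_filtration M B W) (X r) T (\<lambda>s \<omega>. h (Bh n s \<omega>)) (J n)"
    and G: "\<And>n. G n \<in> events"
    and osc: "\<And>n \<omega> s t. \<omega> \<in> G n \<Longrightarrow> s \<in> {0..T} \<Longrightarrow> t \<in> {0..T} \<Longrightarrow> \<bar>s - t\<bar> \<le> T / real m \<Longrightarrow> \<bar>h (Bh n s \<omega>) - h (Bh n t \<omega>)\<bar> \<le> \<kappa>"
    and a: "a \<le> \<delta>\<^sup>2 / (32 * (\<kappa>\<^sup>2 * T))"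
  shows "exp_small (\<lambda>n. G n \<inter> {\<omega>. \<delta> \<le> \<epsilon> n * \<bar>J n \<omega> - riemann_ito n m h r \<omega>\<bar>}) a"
proof (rule exp_smallI[where E = "\<lambda>n. G n \<inter> {\<omega>\<in>space M. \<delta> \<le> \<epsilon> n * \<bar>J n \<omega> - riemann_ito n m h r \<omega>\<bar>}"])
  have [measurable]: "J n \<in> borel_measurable M" "riemann_ito n m h r \<in> borel_measurable M" for n
    using ito[of n] riemann_ito_measurable[OF h] by (auto simp: has_ito_integral_def)
  show ev: "G n \<inter> {\<omega>\<in>space M. \<delta> \<le> \<epsilon> n * \<bar>J n \<omega> - riemann_ito n m h r \<omega>\<bar>} \<in> events" for n using G[of n] by measurable
  fix b assume b: "b < a"
  show "\<forall>\<^sub>F n in sequentially. prob (G n \<inter> {\<omega>\<in>space M. \<delta> \<le> \<epsilon> n * \<bar>J n \<omega> - riemann_ito n m h r \<omega>\<bar>}) \<le> exp (- b / (\<epsilon> n)\<^sup>2)"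
    using eventually_absorb_const[OF less_le_trans[OF b a], of 2]
  proof eventually_elim
    case (elim n)
    have "prob (G n \<inter> {\<omega>\<in>space M. \<delta> \<le> \<epsilon> n * \<bar>J n \<omega> - riemann_ito n m h r \<omega>\<bar>}) \<le> 2 * exp (- (\<delta> / \<epsilon> n)\<^sup>2 / (32 * (\<kappa>\<^sup>2 * T)))"
      by (rule ito_riemann_tail[OF h m \<kappa> _ ito ev]) (use \<delta> eps_pos[of n] osc in \<open>auto simp: field_simps\<close>)
    also have "- (\<delta> / \<epsilon> n)\<^sup>2 / (32 * (\<kappa>\<^sup>2 * T)) = - (\<delta>\<^sup>2 / (32 * (\<kappa>\<^sup>2 * T))) / (\<epsilon> n)\<^sup>2"
      by (simp add: power_divide)
    finally show ?case using elim by linarith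
  qed
qed auto

lemma Z_riemann_component:
  "Z_riemann n m \<omega> $ i = (\<Sum>k<m. \<mu> (Bh n (mesh T m k) \<omega>) $ i * (T / real m))
     + \<epsilon> n * (\<Sum>l\<in>UNIV. riemann_ito n m (\<lambda>y. \<sigma>' y $ i $ l) (Inl l) \<omega>)
     + \<epsilon> n * (\<Sum>j\<in>UNIV. riemann_ito n m (\<lambda>y. \<sigma> y $ i $ j) (Inr j) \<omega>)"
  unfolding Z_riemann_def M_riemann_def Phi_riemann_def W_riemann_def W_increments_def riemann_ito_def joint_family_def
  by (simp add: sum_distrib_left right_diff_distrib algebra_simps)

definition coefficients :: "(real^'p \<Rightarrow> real) set" where
  "coefficients = range (\<lambda>i y. \<mu> y $ i) \<union> range (\<lambda>(i, j) y. \<sigma> y $ i $ j) \<union> range (\<lambda>(i, l) y. \<sigma>' y $ i $ l)"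

lemma coefficients: "finite coefficients" "\<And>h. h \<in> coefficients \<Longrightarrow> continuous_on UNIV h"
  "(\<lambda>y. \<mu> y $ i) \<in> coefficients" "(\<lambda>y. \<sigma> y $ i $ j) \<in> coefficients" "(\<lambda>y. \<sigma>' y $ i $ l) \<in> coefficients"
  unfolding coefficients_def
  by (auto simp: mu_continuous sigma_continuous sigma'_continuous)

text \<open>The term in \<kappa> is the Riemann sum error of \<mu>; the two correction terms of the
  drift are of order \<epsilon>^2 as soon as the coefficients are bounded along the path.\<close>

lemma drift_bound:
  assumes \<omega>: "\<omega> \<in> space M" and m: "m > 0"
    and osc: "\<And>s t. s \<in> {0..T} \<Longrightarrow> t \<in> {0..T} \<Longrightarrow> \<bar>s - t\<bar> \<le> T / real m \<Longrightarrow> \<bar>\<mu> (Bh n s \<omega>) $ i - \<mu> (Bh n t \<omega>) $ i\<bar> \<le> \<kappa>"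
    and bound: "\<And>h t. h \<in> coefficients \<Longrightarrow> t \<in> {0..T} \<Longrightarrow> \<bar>h (Bh n t \<omega>)\<bar> \<le> C"
  shows "\<bar>(LINT s:{0..T}|lborel. \<mu> (Bh n s \<omega>) $ i
               - 1/2 * (\<epsilon> n)\<^sup>2 * (\<Sum>j\<in>UNIV. (\<sigma> (Bh n s \<omega>) $ i $ j)\<^sup>2)
               - 1/2 * (\<epsilon> n)\<^sup>2 * (\<Sum>l\<in>UNIV. (\<sigma>' (Bh n s \<omega>) $ i $ l)\<^sup>2))
      - (\<Sum>k<m. \<mu> (Bh n (mesh T m k) \<omega>) $ i * (T / real m))\<bar>
    \<le> \<kappa> * T + (\<epsilon> n)\<^sup>2 * ((real CARD('d) + real CARD('p)) * C\<^sup>2 * T)"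
proof -
  let ?q = "\<lambda>s. (\<Sum>j\<in>UNIV. (\<sigma> (Bh n s \<omega>) $ i $ j)\<^sup>2) + (\<Sum>l\<in>UNIV. (\<sigma>' (Bh n s \<omega>) $ i $ l)\<^sup>2)"
  note Bc = Bh_continuous[OF \<omega>, of n]
  have mc: "continuous_on {0..T} (\<lambda>s. \<mu> (Bh n s \<omega>) $ i)" by (rule continuous_on_path_compose[OF mu_continuous Bc])
  have qc: "continuous_on {0..T} ?q"
    by (intro continuous_intros continuous_on_path_compose[OF sigma_continuous Bc] continuous_on_path_compose[OF sigma'_continuous Bc])
  have q: "\<bar>?q s\<bar> \<le> (real CARD('d) + real CARD('p)) * C\<^sup>2" if s: "s \<in> {0..T}" for s
  proof -
    have 1: "(\<sigma> (Bh n s \<omega>) $ i $ j)\<^sup>2 \<le> C\<^sup>2" for j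
      using bound[OF coefficients(4)[of i j] s] by (metis abs_ge_zero power2_abs power_mono)
    have 2: "(\<sigma>' (Bh n s \<omega>) $ i $ l)\<^sup>2 \<le> C\<^sup>2" for l
      using bound[OF coefficients(5)[of i l] s] by (metis abs_ge_zero power2_abs power_mono)
    have "(\<Sum>j\<in>UNIV. (\<sigma> (Bh n s \<omega>) $ i $ j)\<^sup>2) \<le> real CARD('d) * C\<^sup>2" using sum_bounded_above[of UNIV "\<lambda>j. (\<sigma> (Bh n s \<omega>) $ i $ j)\<^sup>2" "C\<^sup>2"] 1 by simp
    moreover have "(\<Sum>l\<in>UNIV. (\<sigma>' (Bh n s \<omega>) $ i $ l)\<^sup>2) \<le> real CARD('p) * C\<^sup>2" using sum_bounded_above[of UNIV "\<lambda>l. (\<sigma>' (Bh n s \<omega>) $ i $ l)\<^sup>2" "C\<^sup>2"] 2 by simp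
    moreover have "?q s \<ge> 0" by (intro add_nonneg_nonneg sum_nonneg) auto
    ultimately show ?thesis by (simp add: distrib_right)
  qed
  have int: "set_integrable lborel {0..T} f" if "continuous_on {0..T} f" for f :: "real \<Rightarrow> real"
    unfolding set_integrable_def by (rule borel_integrable_compact[OF _ that]) simp
  have "(LINT s:{0..T}|lborel. \<mu> (Bh n s \<omega>) $ i
               - 1/2 * (\<epsilon> n)\<^sup>2 * (\<Sum>j\<in>UNIV. (\<sigma> (Bh n s \<omega>) $ i $ j)\<^sup>2)
               - 1/2 * (\<epsilon> n)\<^sup>2 * (\<Sum>l\<in>UNIV. (\<sigma>' (Bh n s \<omega>) $ i $ l)\<^sup>2))
    = (LINT s:{0..T}|lborel. \<mu> (Bh n s \<omega>) $ i - (1/2 * (\<epsilon> n)\<^sup>2) * ?q s)"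
    by (rule set_lebesgue_integral_cong) (auto simp: algebra_simps)
  also have "\<dots> = (LINT s:{0..T}|lborel. \<mu> (Bh n s \<omega>) $ i) - (LINT s:{0..T}|lborel. (1/2 * (\<epsilon> n)\<^sup>2) * ?q s)"
    by (rule set_integral_diff(2)[OF int[OF mc] int]) (intro continuous_intros qc)
  also have "(LINT s:{0..T}|lborel. (1/2 * (\<epsilon> n)\<^sup>2) * ?q s) = (1/2 * (\<epsilon> n)\<^sup>2) * (LINT s:{0..T}|lborel. ?q s)"
    by (rule set_integral_mult_right)
  finally have eq: "(LINT s:{0..T}|lborel. \<mu> (Bh n s \<omega>) $ i
               - 1/2 * (\<epsilon> n)\<^sup>2 * (\<Sum>j\<in>UNIV. (\<sigma> (Bh n s \<omega>) $ i $ j)\<^sup>2)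
               - 1/2 * (\<epsilon> n)\<^sup>2 * (\<Sum>l\<in>UNIV. (\<sigma>' (Bh n s \<omega>) $ i $ l)\<^sup>2))
    = (LINT s:{0..T}|lborel. \<mu> (Bh n s \<omega>) $ i) - (1/2 * (\<epsilon> n)\<^sup>2) * (LINT s:{0..T}|lborel. ?q s)" .
  have "\<bar>LINT s:{0..T}|lborel. ?q s\<bar> \<le> (LINT s:{0..T}|lborel. \<bar>?q s\<bar>)"
    using set_integral_norm_bound[OF int[OF qc]] by simp
  also have "\<dots> \<le> (LINT s:{0..T}|lborel. (real CARD('d) + real CARD('p)) * C\<^sup>2)"
    by (rule set_integral_mono[OF set_integrable_abs[OF int[OF qc]] int q]) auto
  also have "\<dots> = (real CARD('d) + real CARD('p)) * C\<^sup>2 * T" using T by (simp add: set_lebesgue_integral_def)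
  finally have "\<bar>LINT s:{0..T}|lborel. ?q s\<bar> \<le> (real CARD('d) + real CARD('p)) * C\<^sup>2 * T" .
  then have "(1/2 * (\<epsilon> n)\<^sup>2) * \<bar>LINT s:{0..T}|lborel. ?q s\<bar> \<le> (\<epsilon> n)\<^sup>2 * ((real CARD('d) + real CARD('p)) * C\<^sup>2 * T)"
    by (intro mult_mono) auto
  moreover have "\<bar>(1/2 * (\<epsilon> n)\<^sup>2) * (LINT s:{0..T}|lborel. ?q s)\<bar> = (1/2 * (\<epsilon> n)\<^sup>2) * \<bar>LINT s:{0..T}|lborel. ?q s\<bar>"
    by (simp add: abs_mult)
  moreover have "\<bar>(LINT s:{0..T}|lborel. \<mu> (Bh n s \<omega>) $ i) - (\<Sum>k<m. \<mu> (Bh n (mesh T m k) \<omega>) $ i * (T / real m))\<bar> \<le> \<kappa> * T"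
  proof (rule riemann_bound[OF _ m mc])
    fix k s assume k: "k < m" "mesh T m k \<le> s" "s \<le> mesh T m (Suc k)"
    then show "\<bar>\<mu> (Bh n s \<omega>) $ i - \<mu> (Bh n (mesh T m k) \<omega>) $ i\<bar> \<le> \<kappa>"
      using mesh_range[of k m] mesh_range[of "Suc k" m] mesh_diff[of T m k] by (intro osc) auto
  qed (use T in auto)
  ultimately show ?thesis unfolding eq by linarith
qed

text \<open>The target exponent a fixes the admissible oscillation \<kappa>, and
  \<open>good_events\<close> supplies a mesh size that achieves it outside an event of exponent a.
  On the good event each stochastic integral is controlled by \<open>exp_small_ito\<close> and the
  drift by \<open>drift_bound\<close>.\<close>

lemma exponential_approximation:
  assumes \<delta>: "\<delta> > 0"
  shows "\<exists>m0>0. \<forall>m\<ge>m0. exp_small (\<lambda>n. {\<omega>. \<delta> \<le> norm (Z n \<omega> - Z_riemann n m \<omega>)}) a"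
proof -
  define D where "D = real CARD('d)"
  define N where "N = real CARD('d) + real CARD('p)"
  \<comment> \<open>Each of the D components collects N errors from stochastic integrals and one
    from the drift, each at most \<delta>1; with one unit to spare the total stays below
    \<delta>.\<close>
  define \<delta>1 where "\<delta>1 = \<delta> / (D * (N + 2))"
  have D: "D > 0" "N > 0" by (auto simp: D_def N_def intro!: add_pos_pos)
  have \<delta>1: "\<delta>1 > 0" using \<delta> D by (simp add: \<delta>1_def)
  \<comment> \<open>The first bound keeps the Riemann error of the drift below \<delta>1 / 4, the
    second raises the Gaussian exponent to at least |a| + 1.\<close>
  define \<kappa> where "\<kappa> = min (\<delta>1 / (4 * T)) (\<delta>1 / sqrt (32 * T * (\<bar>a\<bar> + 1)))"
  have r: "sqrt (32 * T * (\<bar>a\<bar> + 1)) > 0" using T by simp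
  have \<kappa>: "\<kappa> > 0" "\<kappa> * T \<le> \<delta>1 / 4" "\<kappa> * sqrt (32 * T * (\<bar>a\<bar> + 1)) \<le> \<delta>1"
  proof -
    show "\<kappa> > 0" using \<delta>1 T r by (simp add: \<kappa>_def)
    have "\<kappa> \<le> \<delta>1 / (4 * T)" by (simp add: \<kappa>_def)
    then show "\<kappa> * T \<le> \<delta>1 / 4" using T by (simp add: field_simps)
    have "\<kappa> \<le> \<delta>1 / sqrt (32 * T * (\<bar>a\<bar> + 1))" by (simp add: \<kappa>_def)
    then show "\<kappa> * sqrt (32 * T * (\<bar>a\<bar> + 1)) \<le> \<delta>1" using r by (simp add: pos_le_divide_eq)
  qed
  have a: "a \<le> \<delta>1\<^sup>2 / (32 * (\<kappa>\<^sup>2 * T))"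
  proof -
    have "(\<kappa> * sqrt (32 * T * (\<bar>a\<bar> + 1)))\<^sup>2 \<le> \<delta>1\<^sup>2" using \<kappa>(1,3) r by (intro power_mono) auto
    then have "\<kappa>\<^sup>2 * (32 * T * (\<bar>a\<bar> + 1)) \<le> \<delta>1\<^sup>2" using T by (simp add: power_mult_distrib)
    then have "(\<bar>a\<bar> + 1) * (32 * (\<kappa>\<^sup>2 * T)) \<le> \<delta>1\<^sup>2" by (simp add: algebra_simps)
    moreover have "32 * (\<kappa>\<^sup>2 * T) > 0" using \<kappa> T by simp
    ultimately have "\<bar>a\<bar> + 1 \<le> \<delta>1\<^sup>2 / (32 * (\<kappa>\<^sup>2 * T))" by (simp only: pos_le_divide_eq)
    then show ?thesis by simp
  qed
  obtain G and m0 :: nat and C where G: "\<And>n. G n \<in> events" "exp_small (\<lambda>n. space M - G n) a" and m0: "m0 > 0"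
    and osc: "\<And>n \<omega> h m s t. \<omega> \<in> G n \<Longrightarrow> h \<in> coefficients \<Longrightarrow> m \<ge> m0 \<Longrightarrow> s \<in> {0..T} \<Longrightarrow> t \<in> {0..T} \<Longrightarrow> \<bar>s - t\<bar> \<le> T / real m \<Longrightarrow> \<bar>h (Bh n s \<omega>) - h (Bh n t \<omega>)\<bar> \<le> \<kappa>"
    and bound: "\<And>n \<omega> h t. \<omega> \<in> G n \<Longrightarrow> h \<in> coefficients \<Longrightarrow> t \<in> {0..T} \<Longrightarrow> \<bar>h (Bh n t \<omega>)\<bar> \<le> C"
    using good_events[OF coefficients(1,2) \<kappa>(1), of a] by blast
  have "exp_small (\<lambda>n. {\<omega>. \<delta> \<le> norm (Z n \<omega> - Z_riemann n m \<omega>)}) a" if m: "m \<ge> m0" for m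
  proof -
    have m_pos: "m > 0" using m m0 by simp
    define BB where "BB i l n = G n \<inter> {\<omega>. \<delta>1 \<le> \<epsilon> n * \<bar>JB n i l \<omega> - riemann_ito n m (\<lambda>y. \<sigma>' y $ i $ l) (Inl l) \<omega>\<bar>}" for i l n
    define BW where "BW i j n = G n \<inter> {\<omega>. \<delta>1 \<le> \<epsilon> n * \<bar>JW n i j \<omega> - riemann_ito n m (\<lambda>y. \<sigma> y $ i $ j) (Inr j) \<omega>\<bar>}" for i j n
    have sBB: "exp_small (BB i l) a" for i l
      unfolding BB_def
      by (rule exp_small_ito[OF sigma'_continuous m_pos \<kappa>(1) \<delta>1 _ G(1) osc[OF _ coefficients(5) m] a]) (use JB in \<open>auto simp: joint_family_def\<close>)
    have sBW: "exp_small (BW i j) a" for i j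
      unfolding BW_def
      by (rule exp_small_ito[OF sigma_continuous m_pos \<kappa>(1) \<delta>1 _ G(1) osc[OF _ coefficients(4) m] a]) (use JW in \<open>auto simp: joint_family_def\<close>)
    define A where "A n = (space M - G n) \<union> ((\<Union>(i,l)\<in>UNIV. BB i l n) \<union> (\<Union>(i,j)\<in>UNIV. BW i j n))" for n
    have sA: "exp_small A a"
      unfolding A_def using sBB sBW
      by (intro exp_small_Un G(2)) (auto simp: case_prod_beta' intro!: exp_small_UN)
    have "(\<lambda>n. (\<epsilon> n)\<^sup>2 * (N * C\<^sup>2 * T)) \<longlonglongrightarrow> 0\<^sup>2 * (N * C\<^sup>2 * T)" by (intro tendsto_intros eps_lim)
    then have ev: "\<forall>\<^sub>F n in sequentially. (\<epsilon> n)\<^sup>2 * (N * C\<^sup>2 * T) < \<delta>1 / 4" using \<delta>1 by (intro order_tendstoD) auto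
    \<comment> \<open>The sample points where the almost sure formula for \<open>Z n\<close> fails;
      they are removed first and restored by \<open>exp_small_AE\<close>.\<close>
    define bad where "bad n \<omega> \<longleftrightarrow> (\<exists>i. Z n \<omega> $ i \<noteq>
           (LINT s:{0..T}|lborel. \<mu> (Bh n s \<omega>) $ i
               - 1/2 * (\<epsilon> n)\<^sup>2 * (\<Sum>j\<in>UNIV. (\<sigma> (Bh n s \<omega>) $ i $ j)\<^sup>2)
               - 1/2 * (\<epsilon> n)\<^sup>2 * (\<Sum>l\<in>UNIV. (\<sigma>' (Bh n s \<omega>) $ i $ l)\<^sup>2))
           + \<epsilon> n * (\<Sum>l\<in>UNIV. JB n i l \<omega>) + \<epsilon> n * (\<Sum>j\<in>UNIV. JW n i j \<omega>))" for n \<omega>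
    have "\<omega> \<in> A n" if small: "(\<epsilon> n)\<^sup>2 * (N * C\<^sup>2 * T) < \<delta>1 / 4" and \<omega>: "\<omega> \<in> space M" and nb: "\<not> bad n \<omega>"
      and large: "\<delta> \<le> norm (Z n \<omega> - Z_riemann n m \<omega>)" for n \<omega>
    proof (rule ccontr)
      assume nA: "\<omega> \<notin> A n"
      then have \<omega>G: "\<omega> \<in> G n" using \<omega> by (auto simp: A_def)
      have jb: "\<epsilon> n * \<bar>JB n i l \<omega> - riemann_ito n m (\<lambda>y. \<sigma>' y $ i $ l) (Inl l) \<omega>\<bar> \<le> \<delta>1" for i l
        using nA \<omega>G by (auto simp: A_def BB_def not_le less_imp_le)
      have jw: "\<epsilon> n * \<bar>JW n i j \<omega> - riemann_ito n m (\<lambda>y. \<sigma> y $ i $ j) (Inr j) \<omega>\<bar> \<le> \<delta>1" for i j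
        using nA \<omega>G by (auto simp: A_def BW_def not_le less_imp_le)
      have "\<bar>(Z n \<omega> - Z_riemann n m \<omega>) $ i\<bar> < (N + 2) * \<delta>1" for i
      proof -
        let ?I = "(LINT s:{0..T}|lborel. \<mu> (Bh n s \<omega>) $ i
               - 1/2 * (\<epsilon> n)\<^sup>2 * (\<Sum>j\<in>UNIV. (\<sigma> (Bh n s \<omega>) $ i $ j)\<^sup>2)
               - 1/2 * (\<epsilon> n)\<^sup>2 * (\<Sum>l\<in>UNIV. (\<sigma>' (Bh n s \<omega>) $ i $ l)\<^sup>2))"
        let ?R = "\<Sum>k<m. \<mu> (Bh n (mesh T m k) \<omega>) $ i * (T / real m)"
        let ?b = "\<lambda>l. JB n i l \<omega> - riemann_ito n m (\<lambda>y. \<sigma>' y $ i $ l) (Inl l) \<omega>"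
        let ?w = "\<lambda>j. JW n i j \<omega> - riemann_ito n m (\<lambda>y. \<sigma> y $ i $ j) (Inr j) \<omega>"
        have "Z n \<omega> $ i = ?I + \<epsilon> n * (\<Sum>l\<in>UNIV. JB n i l \<omega>) + \<epsilon> n * (\<Sum>j\<in>UNIV. JW n i j \<omega>)"
          using nb unfolding bad_def by blast
        then have eq: "(Z n \<omega> - Z_riemann n m \<omega>) $ i = (?I - ?R) + (\<Sum>l\<in>UNIV. \<epsilon> n * ?b l) + (\<Sum>j\<in>UNIV. \<epsilon> n * ?w j)"
          unfolding vector_minus_component Z_riemann_component by (simp add: sum_distrib_left[symmetric] sum_subtractf algebra_simps)
        have "\<bar>?I - ?R\<bar> \<le> \<kappa> * T + (\<epsilon> n)\<^sup>2 * (N * C\<^sup>2 * T)"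
          unfolding N_def
        proof (rule drift_bound[OF \<omega> m_pos])
          show "\<bar>\<mu> (Bh n s \<omega>) $ i - \<mu> (Bh n t \<omega>) $ i\<bar> \<le> \<kappa>" if "s \<in> {0..T}" "t \<in> {0..T}" "\<bar>s - t\<bar> \<le> T / real m" for s t
            using osc[OF \<omega>G coefficients(3) m that] .
          show "\<bar>h (Bh n t \<omega>)\<bar> \<le> C" if "h \<in> coefficients" "t \<in> {0..T}" for h t
            using bound[OF \<omega>G that] .
        qed
        then have 1: "\<bar>?I - ?R\<bar> < \<delta>1" using small \<kappa>(2) \<delta>1 by linarith
        have "\<bar>\<Sum>l\<in>UNIV. \<epsilon> n * ?b l\<bar> \<le> (\<Sum>l\<in>(UNIV::'p set). \<delta>1)"
          using jb[of i] eps_pos[of n] by (intro order_trans[OF sum_abs] sum_mono) (simp add: abs_mult)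
        moreover have "\<bar>\<Sum>j\<in>UNIV. \<epsilon> n * ?w j\<bar> \<le> (\<Sum>l\<in>(UNIV::'d set). \<delta>1)"
          using jw[of i] eps_pos[of n] by (intro order_trans[OF sum_abs] sum_mono) (simp add: abs_mult)
        ultimately have "\<bar>(Z n \<omega> - Z_riemann n m \<omega>) $ i\<bar> < \<delta>1 + real CARD('p) * \<delta>1 + real CARD('d) * \<delta>1"
          unfolding eq using 1 by simp
        also have "\<dots> \<le> (N + 2) * \<delta>1" using \<delta>1 by (simp add: N_def algebra_simps)
        finally show ?thesis .
      qed
      then have "(\<Sum>i\<in>UNIV. \<bar>(Z n \<omega> - Z_riemann n m \<omega>) $ i\<bar>) < (\<Sum>i\<in>(UNIV::'d set). (N + 2) * \<delta>1)"
        by (intro sum_strict_mono) auto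
      also have "\<dots> = \<delta>" using D by (simp add: D_def[symmetric] \<delta>1_def)
      finally have "norm (Z n \<omega> - Z_riemann n m \<omega>) < \<delta>" using norm_le_l1_cart le_less_trans by blast
      then show False using large by simp
    qed
    then have "\<forall>\<^sub>F n in sequentially. ({\<omega>. \<delta> \<le> norm (Z n \<omega> - Z_riemann n m \<omega>)} - {\<omega>. bad n \<omega>}) \<inter> space M \<subseteq> A n"
      using ev by (auto elim!: eventually_mono)
    then have "exp_small (\<lambda>n. {\<omega>. \<delta> \<le> norm (Z n \<omega> - Z_riemann n m \<omega>)} - {\<omega>. bad n \<omega>}) a"
      by (rule exp_small_mono_eventually[OF sA])
    then show ?thesis
    proof (rule exp_small_AE)
      fix n
      have "AE \<omega> in M. \<forall>i\<in>UNIV. Z n \<omega> $ i =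
           (LINT s:{0..T}|lborel. \<mu> (Bh n s \<omega>) $ i
               - 1/2 * (\<epsilon> n)\<^sup>2 * (\<Sum>j\<in>UNIV. (\<sigma> (Bh n s \<omega>) $ i $ j)\<^sup>2)
               - 1/2 * (\<epsilon> n)\<^sup>2 * (\<Sum>l\<in>UNIV. (\<sigma>' (Bh n s \<omega>) $ i $ l)\<^sup>2))
           + \<epsilon> n * (\<Sum>l\<in>UNIV. JB n i l \<omega>) + \<epsilon> n * (\<Sum>j\<in>UNIV. JW n i j \<omega>)"
        by (intro AE_finite_allI Z_eq) auto
      then show "AE \<omega> in M. \<omega> \<in> {\<omega>. \<delta> \<le> norm (Z n \<omega> - Z_riemann n m \<omega>)} \<longrightarrow> \<omega> \<in> {\<omega>. \<delta> \<le> norm (Z n \<omega> - Z_riemann n m \<omega>)} - {\<omega>. bad n \<omega>}"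
        by eventually_elim (auto simp: bad_def)
    qed
  qed
  then show ?thesis using m0 by blast
qed

end

lemma (in ldp_speed) exp_small_increment:
  assumes "bm_family M T X" "0 \<le> s" "s < t" "t \<le> T"
  shows "\<exists>R>0. exp_small (\<lambda>n. {\<omega>. R \<le> \<epsilon> n * \<bar>X r t \<omega> - X r s \<omega>\<bar>}) a"
proof -
  interpret bm_family M T X by (rule assms(1))
  \<comment> \<open>Chosen so that the Gaussian exponent \<open>R\<^sup>2 / (2 * T)\<close> equals
    |a| + 1.\<close>
  define R where "R = sqrt (2 * T * (\<bar>a\<bar> + 1))"
  have R: "R > 0" using T_pos by (simp add: R_def)
  have R2: "R\<^sup>2 / (2 * T) = \<bar>a\<bar> + 1" using T_pos by (simp add: R_def)
  have "exp_small (\<lambda>n. {\<omega>. R \<le> \<epsilon> n * \<bar>X r t \<omega> - X r s \<omega>\<bar>}) a"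
  proof (rule exp_smallI[where E = "\<lambda>n. {\<omega>\<in>space M. R / \<epsilon> n \<le> \<bar>X r t \<omega> - X r s \<omega>\<bar>}"])
    have [measurable]: "X r t \<in> borel_measurable M" "X r s \<in> borel_measurable M" using assms by auto
    show "{\<omega>\<in>space M. R / \<epsilon> n \<le> \<bar>X r t \<omega> - X r s \<omega>\<bar>} \<in> events" for n by measurable
    show "{\<omega>. R \<le> \<epsilon> n * \<bar>X r t \<omega> - X r s \<omega>\<bar>} \<inter> space M \<subseteq> {\<omega>\<in>space M. R / \<epsilon> n \<le> \<bar>X r t \<omega> - X r s \<omega>\<bar>}" for n
      using eps_pos[of n] by (auto simp: field_simps)
    fix b assume b: "b < a"
    then have "b < \<bar>a\<bar> + 1" by simp
    from eventually_absorb_const[OF this, of 2]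
    show "\<forall>\<^sub>F n in sequentially. prob {\<omega>\<in>space M. R / \<epsilon> n \<le> \<bar>X r t \<omega> - X r s \<omega>\<bar>} \<le> exp (- b / (\<epsilon> n)\<^sup>2)"
    proof eventually_elim
      case (elim n)
      have "prob {\<omega>\<in>space M. R / \<epsilon> n \<le> \<bar>X r t \<omega> - X r s \<omega>\<bar>} \<le> 2 * exp (- (R / \<epsilon> n)\<^sup>2 / (2 * T))"
        by (rule increment_tail) (use assms R eps_pos[of n] in auto)
      also have "- (R / \<epsilon> n)\<^sup>2 / (2 * T) = - (R\<^sup>2 / (2 * T)) / (\<epsilon> n)\<^sup>2" by (simp add: power_divide)
      finally show ?case using elim unfolding R2 by linarith
    qed
  qed
  then show ?thesis using R by blast
qed

context log_price
begin

lemma joint_increment: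
  "X (Inl l) t \<omega> = B t \<omega> $ l" "X (Inr j) t \<omega> = W t \<omega> $ j"
  by (auto simp: joint_family_def)

lemma exponential_tightness: "\<exists>R. exp_small (\<lambda>n. {\<omega>. R < norm (Z n \<omega>)}) a"
proof -
  obtain m1 where m1: "m1 > 0" "\<And>m. m \<ge> m1 \<Longrightarrow> exp_small (\<lambda>n. {\<omega>. 1 \<le> norm (Z n \<omega> - Z_riemann n m \<omega>)}) a"
    using exponential_approximation[of 1 a] by auto
  define \<kappa> :: real where "\<kappa> = 1"
  have \<kappa>: "\<kappa> > 0" by (simp add: \<kappa>_def)
  obtain G and m0 :: nat and C where G: "\<And>n. G n \<in> events" "exp_small (\<lambda>n. space M - G n) a" and m0: "m0 > 0"
    and osc: "\<And>n \<omega> h m s t. \<omega> \<in> G n \<Longrightarrow> h \<in> coefficients \<Longrightarrow> m \<ge> m0 \<Longrightarrow> s \<in> {0..T} \<Longrightarrow> t \<in> {0..T} \<Longrightarrow> \<bar>s - t\<bar> \<le> T / real m \<Longrightarrow> \<bar>h (Bh n s \<omega>) - h (Bh n t \<omega>)\<bar> \<le> \<kappa>"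
    and bound: "\<And>n \<omega> h t. \<omega> \<in> G n \<Longrightarrow> h \<in> coefficients \<Longrightarrow> t \<in> {0..T} \<Longrightarrow> \<bar>h (Bh n t \<omega>)\<bar> \<le> C"
    using good_events[OF coefficients(1,2) \<kappa>, of a] by blast
  define m where "m = m1"
  have m: "m > 0" using m1 by (simp add: m_def)
  define P where "P k q R \<longleftrightarrow> R > 0 \<and> exp_small (\<lambda>n. {\<omega>. R \<le> \<epsilon> n * \<bar>X q (mesh T m (Suc k)) \<omega> - X q (mesh T m k) \<omega>\<bar>}) a" for k q R
  have "\<exists>R. P k q R" if "k < m" for k q
    unfolding P_def by (rule exp_small_increment[OF bm_family_axioms]) (use that mesh_range[of k m] mesh_range[of "Suc k" m] mesh_less[OF T m, of k] in auto)
  then obtain R where RP: "\<And>k q. k < m \<Longrightarrow> P k q (R k q)" by metis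
  have R: "R k q > 0 \<and> exp_small (\<lambda>n. {\<omega>. R k q \<le> \<epsilon> n * \<bar>X q (mesh T m (Suc k)) \<omega> - X q (mesh T m k) \<omega>\<bar>}) a" if "k < m" for k q
    using RP[OF that, of q] by (simp only: P_def)
  define A where "A n = {\<omega>. 1 \<le> norm (Z n \<omega> - Z_riemann n m \<omega>)} \<union> ((space M - G n) \<union>
     (\<Union>k\<in>{..<m}. \<Union>q. {\<omega>. R k q \<le> \<epsilon> n * \<bar>X q (mesh T m (Suc k)) \<omega> - X q (mesh T m k) \<omega>\<bar>}))" for n
  have sA: "exp_small A a"
    unfolding A_def using R m1(2)[of m] by (intro exp_small_Un G(2) exp_small_UN) (auto simp: m_def)
  define b where "b = (\<Sum>k<m. C * (T / real m)) + (\<Sum>q\<in>UNIV. \<Sum>k<m. C * R k q)"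
  have "norm (Z n \<omega>) \<le> 1 + real CARD('d) * b" if \<omega>: "\<omega> \<in> space M" "\<omega> \<notin> A n" for n \<omega>
  proof -
    have \<omega>G: "\<omega> \<in> G n" using \<omega> by (auto simp: A_def)
    have C0: "C \<ge> 0" using bound[OF \<omega>G coefficients(3)[of undefined], of 0] T by force
    have inc: "\<bar>\<epsilon> n * (X q (mesh T m (Suc k)) \<omega> - X q (mesh T m k) \<omega>)\<bar> \<le> R k q" if "k < m" for k q
      using \<omega>(2) that eps_pos[of n] by (auto simp: A_def abs_mult not_le less_imp_le)
    have ito: "\<bar>\<epsilon> n * riemann_ito n m h q \<omega>\<bar> \<le> (\<Sum>k<m. C * R k q)" if h: "h \<in> coefficients" for h q
    proof -
      have "\<epsilon> n * riemann_ito n m h q \<omega> = (\<Sum>k<m. h (Bh n (mesh T m k) \<omega>) * (\<epsilon> n * (X q (mesh T m (Suc k)) \<omega> - X q (mesh T m k) \<omega>)))"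
        unfolding riemann_ito_def sum_distrib_left by (simp add: ac_simps)
      also have "\<bar>\<dots>\<bar> \<le> (\<Sum>k<m. C * R k q)"
      proof (rule order_trans[OF sum_abs sum_mono])
        fix k assume k: "k \<in> {..<m}"
        have "\<bar>h (Bh n (mesh T m k) \<omega>)\<bar> \<le> C" by (rule bound[OF \<omega>G h]) (use k mesh_range[of k m] in auto)
        then show "\<bar>h (Bh n (mesh T m k) \<omega>) * (\<epsilon> n * (X q (mesh T m (Suc k)) \<omega> - X q (mesh T m k) \<omega>))\<bar> \<le> C * R k q"
          unfolding abs_mult[of "h _"] using k inc by (intro mult_mono C0) auto
      qed
      finally show ?thesis .
    qed
    have comp: "\<bar>Z_riemann n m \<omega> $ i\<bar> \<le> b" for i
    proof -
      have 1: "\<bar>\<Sum>k<m. \<mu> (Bh n (mesh T m k) \<omega>) $ i * (T / real m)\<bar> \<le> (\<Sum>k<m. C * (T / real m))"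
      proof (rule order_trans[OF sum_abs sum_mono])
        fix k assume k: "k \<in> {..<m}"
        have "\<bar>\<mu> (Bh n (mesh T m k) \<omega>) $ i\<bar> \<le> C" by (rule bound[OF \<omega>G coefficients(3)]) (use k mesh_range[of k m] in auto)
        then show "\<bar>\<mu> (Bh n (mesh T m k) \<omega>) $ i * (T / real m)\<bar> \<le> C * (T / real m)"
          using T unfolding abs_mult by (intro mult_mono C0) auto
      qed
      have 2: "\<bar>\<epsilon> n * (\<Sum>l\<in>UNIV. riemann_ito n m (\<lambda>y. \<sigma>' y $ i $ l) (Inl l) \<omega>)\<bar> \<le> (\<Sum>l\<in>UNIV. \<Sum>k<m. C * R k (Inl l))"
        unfolding sum_distrib_left by (rule order_trans[OF sum_abs sum_mono]) (rule ito[OF coefficients(5)])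
      have 3: "\<bar>\<epsilon> n * (\<Sum>j\<in>UNIV. riemann_ito n m (\<lambda>y. \<sigma> y $ i $ j) (Inr j) \<omega>)\<bar> \<le> (\<Sum>j\<in>UNIV. \<Sum>k<m. C * R k (Inr j))"
        unfolding sum_distrib_left by (rule order_trans[OF sum_abs sum_mono]) (rule ito[OF coefficients(4)])
      have "(\<Sum>q\<in>UNIV. \<Sum>k<m. C * R k q) = (\<Sum>l\<in>UNIV. \<Sum>k<m. C * R k (Inl l)) + (\<Sum>j\<in>UNIV. \<Sum>k<m. C * R k (Inr j))"
        by (subst UNIV_Plus_UNIV[symmetric], subst sum.Plus) auto
      then show ?thesis unfolding Z_riemann_component b_def using 1 2 3 by linarith
    qed
    have "norm (Z_riemann n m \<omega>) \<le> (\<Sum>i\<in>UNIV. \<bar>Z_riemann n m \<omega> $ i\<bar>)" by (rule norm_le_l1_cart)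
    also have "\<dots> \<le> real CARD('d) * b" using sum_bounded_above[of UNIV "\<lambda>i. \<bar>Z_riemann n m \<omega> $ i\<bar>" b] comp by simp
    finally have "norm (Z_riemann n m \<omega>) \<le> real CARD('d) * b" .
    moreover have "norm (Z n \<omega> - Z_riemann n m \<omega>) < 1" using \<omega> by (auto simp: A_def not_le)
    ultimately show ?thesis using norm_triangle_sub[of "Z n \<omega>" "Z_riemann n m \<omega>"] by linarith
  qed
  then have "exp_small (\<lambda>n. {\<omega>. 1 + real CARD('d) * b < norm (Z n \<omega>)}) a"
    by (intro exp_small_mono[OF sA]) (force simp: not_le[symmetric])
  then show ?thesis by blast
qed

section \<open>Conditioning on B\<close>

definition hist_B :: "'w measure" where
  "hist_B = hist M X (\<lambda>q. case q of Inl l \<Rightarrow> T | Inr j \<Rightarrow> 0)"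

text \<open>The horizons at which \<open>B\<close> and the components of \<open>W\<close> in J are
  known up to T, the other components only at time 0. Inductions over J release the components of
  \<open>W\<close> one at a time, and \<open>W_step\<close> moves the clock of a single component
  along the mesh.\<close>

definition W_time :: "'d set \<Rightarrow> 'p + 'd \<Rightarrow> real" where
  "W_time J q = (case q of Inl l \<Rightarrow> T | Inr j \<Rightarrow> if j \<in> J then T else 0)"

lemma W_time_range: "0 \<le> W_time J q \<and> W_time J q \<le> T"
  using T by (auto simp: W_time_def split: sum.split)

lemma hist_B_W_time: "hist_B = hist M X (W_time {})"
  by (simp add: hist_B_def W_time_def[abs_def])

definition W_step :: "'d set \<Rightarrow> 'd \<Rightarrow> nat \<Rightarrow> nat \<Rightarrow> 'p + 'd \<Rightarrow> real" where
  "W_step J j m i = (W_time J)(Inr j := mesh T m i)"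

lemma W_time_step:
  assumes j: "j \<notin> J" and m: "m > 0"
  shows "i \<le> m \<Longrightarrow> 0 \<le> W_step J j m i q" "i \<le> m \<Longrightarrow> W_step J j m i q \<le> T"
    "W_step J j m i q \<le> W_step J j m (Suc i) q" "W_step J j m i (Inr j) < W_step J j m (Suc i) (Inr j)"
    "W_step J j m 0 = W_time J" "W_step J j m m = W_time (insert j J)" "W_step J j m i (Inr j) = mesh T m i"
proof -
  show "i \<le> m \<Longrightarrow> 0 \<le> W_step J j m i q" "i \<le> m \<Longrightarrow> W_step J j m i q \<le> T"
    using W_time_range[of J q] mesh_range[of i m] by (auto simp: W_step_def)
  show "W_step J j m i q \<le> W_step J j m (Suc i) q" using mesh_mono[of T i "Suc i" m] T by (auto simp: W_step_def)
  show "W_step J j m i (Inr j) < W_step J j m (Suc i) (Inr j)" using mesh_less[OF T m] by (simp add: W_step_def)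
  show "W_step J j m 0 = W_time J" using j by (auto simp: W_step_def W_time_def)
  show "W_step J j m m = W_time (insert j J)" using m by (auto simp: W_step_def W_time_def fun_eq_iff split: sum.split)
  show "W_step J j m i (Inr j) = mesh T m i" by (simp add: W_step_def)
qed

text \<open>Coefficients that depend on all of \<open>B\<close> up to T are anticipating with
  respect to time, but they are already known in \<open>hist_B\<close>, before any component of
  \<open>W\<close> starts. Hence \<open>exp_martingale\<close> applies to each component of
  \<open>W\<close> in turn.\<close>

lemma W_martingale:
  assumes m: "m > 0" and c: "\<And>j k. k < m \<Longrightarrow> c j k \<in> borel_measurable hist_B" and Y: "Y \<in> borel_measurable hist_B"
    and J: "finite J"
  shows "(\<lambda>\<omega>. Y \<omega> * ennreal (exp (\<Sum>j\<in>J. \<Sum>k<m. c j k \<omega> * (W (mesh T m (Suc k)) \<omega> $ j - W (mesh T m k) \<omega> $ j)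
      - (c j k \<omega>)\<^sup>2 * (T / real m) / 2))) \<in> borel_measurable (hist M X (W_time J)) \<and>
    (\<integral>\<^sup>+\<omega>. Y \<omega> * ennreal (exp (\<Sum>j\<in>J. \<Sum>k<m. c j k \<omega> * (W (mesh T m (Suc k)) \<omega> $ j - W (mesh T m k) \<omega> $ j)
      - (c j k \<omega>)\<^sup>2 * (T / real m) / 2)) \<partial>M) = (\<integral>\<^sup>+\<omega>. Y \<omega> \<partial>M)"
  using J
proof (induction J)
  case empty
  then show ?case using Y by (simp add: hist_B_W_time)
next
  case (insert j J)
  let ?e = "\<lambda>j \<omega>. \<Sum>k<m. c j k \<omega> * (W (mesh T m (Suc k)) \<omega> $ j - W (mesh T m k) \<omega> $ j) - (c j k \<omega>)\<^sup>2 * (T / real m) / 2"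
  define Y' where "Y' = (\<lambda>\<omega>. Y \<omega> * ennreal (exp (\<Sum>j\<in>J. ?e j \<omega>)))"
  have IH: "Y' \<in> borel_measurable (hist M X (W_time J))" "(\<integral>\<^sup>+\<omega>. Y' \<omega> \<partial>M) = (\<integral>\<^sup>+\<omega>. Y \<omega> \<partial>M)"
    unfolding Y'_def using insert.IH by auto
  let ?s = "W_step J j m"
  note s = W_time_step[OF insert.hyps(2) m]
  have W0: "W_time {} q \<le> W_time J' q" for J' q using T by (auto simp: W_time_def split: sum.split)
  have s_ge: "W_time {} q \<le> ?s i q" for i q
    using W0[of q J] mesh_nonneg[of T m i] T by (auto simp: W_step_def W_time_def)
  have c': "c j k \<in> borel_measurable (hist M X (?s k))" if "k < m" for k
    by (rule measurable_hist_mono[OF c[OF that, unfolded hist_B_W_time]]) (rule s_ge)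
  have step: "Y \<omega> * ennreal (exp (\<Sum>j\<in>insert j J. ?e j \<omega>)) = Y' \<omega> * ennreal (exp (?e j \<omega>))" for \<omega>
    using insert.hyps by (simp add: Y'_def exp_add ennreal_mult ac_simps)
  have "(\<integral>\<^sup>+\<omega>. Y' \<omega> * ennreal (exp (\<Sum>i<m. c j i \<omega> * (X (Inr j) (?s (Suc i) (Inr j)) \<omega> - X (Inr j) (?s i (Inr j)) \<omega>)
      - (c j i \<omega>)\<^sup>2 * (?s (Suc i) (Inr j) - ?s i (Inr j)) / 2)) \<partial>M) = (\<integral>\<^sup>+\<omega>. Y' \<omega> \<partial>M)"
    by (rule exp_martingale[where s = ?s and c = "c j"]) (use s(1,2,3,4) c' IH(1) in \<open>simp_all add: s(5)\<close>)
  then have "(\<integral>\<^sup>+\<omega>. Y' \<omega> * ennreal (exp (?e j \<omega>)) \<partial>M) = (\<integral>\<^sup>+\<omega>. Y \<omega> \<partial>M)"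
    unfolding s(7) joint_increment mesh_diff IH(2) .
  moreover have "(\<lambda>\<omega>. Y' \<omega> * ennreal (exp (?e j \<omega>))) \<in> borel_measurable (hist M X (W_time (insert j J)))"
  proof -
    have [measurable]: "Y' \<in> borel_measurable (hist M X (W_time (insert j J)))"
      by (rule measurable_hist_mono[OF IH(1)]) (use T in \<open>auto simp: W_time_def split: sum.split\<close>)
    have "(\<lambda>\<omega>. ?e j \<omega>) \<in> borel_measurable (hist M X (W_time (insert j J)))"
    proof (rule borel_measurable_sum)
      fix k assume k: "k \<in> {..<m}"
      have [measurable]: "c j k \<in> borel_measurable (hist M X (W_time (insert j J)))"
        by (rule measurable_hist_mono[OF c[unfolded hist_B_W_time]]) (use k W0 in auto)
      have "X (Inr j) u \<in> borel_measurable (hist M X (W_time (insert j J)))" if "u \<in> {0..T}" for u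
        by (rule measurable_hist) (use that in \<open>auto simp: W_time_def\<close>)
      then have [measurable]: "(\<lambda>\<omega>. W (mesh T m (Suc k)) \<omega> $ j) \<in> borel_measurable (hist M X (W_time (insert j J)))"
        "(\<lambda>\<omega>. W (mesh T m k) \<omega> $ j) \<in> borel_measurable (hist M X (W_time (insert j J)))"
        using mesh_range[of k m] mesh_range[of "Suc k" m] k by (auto simp: joint_family_def)
      show "(\<lambda>\<omega>. c j k \<omega> * (W (mesh T m (Suc k)) \<omega> $ j - W (mesh T m k) \<omega> $ j) - (c j k \<omega>)\<^sup>2 * (T / real m) / 2) \<in> borel_measurable (hist M X (W_time (insert j J)))"
        by measurable
    qed
    then have [measurable]: "(\<lambda>\<omega>. ?e j \<omega>) \<in> borel_measurable (hist M X (W_time (insert j J)))" .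
    show ?thesis by measurable
  qed
  ultimately show ?case unfolding step by simp
qed

text \<open>The same induction over the components of \<open>W\<close>, with
  \<open>sequential_indep\<close> in place of the martingale.\<close>

lemma W_indep:
  assumes m: "m > 0" and E: "E \<in> sets hist_B" and V: "\<And>j k. V j k \<in> sets borel" and J: "finite J"
  shows "E \<inter> {\<omega>\<in>space M. \<forall>j\<in>J. \<forall>k<m. W (mesh T m (Suc k)) \<omega> $ j - W (mesh T m k) \<omega> $ j \<in> V j k} \<in> sets (hist M X (W_time J)) \<and>
    prob (E \<inter> {\<omega>\<in>space M. \<forall>j\<in>J. \<forall>k<m. W (mesh T m (Suc k)) \<omega> $ j - W (mesh T m k) \<omega> $ j \<in> V j k})
     = prob E * (\<Prod>j\<in>J. \<Prod>k<m. prob {\<omega>\<in>space M. W (mesh T m (Suc k)) \<omega> $ j - W (mesh T m k) \<omega> $ j \<in> V j k})"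
  using J
proof (induction J)
  case empty
  have "E \<inter> {\<omega>\<in>space M. True} = E" using sets.sets_into_space[OF E] by (auto simp: hist_B_def)
  then show ?case using E by (simp add: hist_B_W_time)
next
  case (insert j J)
  let ?D = "\<lambda>j k \<omega>. W (mesh T m (Suc k)) \<omega> $ j - W (mesh T m k) \<omega> $ j"
  define F where "F = E \<inter> {\<omega>\<in>space M. \<forall>j\<in>J. \<forall>k<m. ?D j k \<omega> \<in> V j k}"
  have IH: "F \<in> sets (hist M X (W_time J))" "prob F = prob E * (\<Prod>j\<in>J. \<Prod>k<m. prob {\<omega>\<in>space M. ?D j k \<omega> \<in> V j k})"
    unfolding F_def using insert.IH by auto
  let ?s = "W_step J j m"
  note s = W_time_step[OF insert.hyps(2) m]
  have "F \<inter> {\<omega>\<in>space M. \<forall>i<m. X (Inr j) (?s (Suc i) (Inr j)) \<omega> - X (Inr j) (?s i (Inr j)) \<omega> \<in> V j i} \<in> sets (hist M X (?s m)) \<and>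
    prob (F \<inter> {\<omega>\<in>space M. \<forall>i<m. X (Inr j) (?s (Suc i) (Inr j)) \<omega> - X (Inr j) (?s i (Inr j)) \<omega> \<in> V j i})
     = prob F * (\<Prod>i<m. prob {\<omega>\<in>space M. X (Inr j) (?s (Suc i) (Inr j)) \<omega> - X (Inr j) (?s i (Inr j)) \<omega> \<in> V j i})"
    by (rule sequential_indep[where s = ?s and V = "V j"]) (use s(1,2,3,4) V IH(1) in \<open>simp_all add: s(5)\<close>)
  then have "F \<inter> {\<omega>\<in>space M. \<forall>i<m. ?D j i \<omega> \<in> V j i} \<in> sets (hist M X (W_time (insert j J))) \<and>
    prob (F \<inter> {\<omega>\<in>space M. \<forall>i<m. ?D j i \<omega> \<in> V j i}) = prob F * (\<Prod>i<m. prob {\<omega>\<in>space M. ?D j i \<omega> \<in> V j i})"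
    unfolding s(6,7) joint_increment .
  moreover have "F \<inter> {\<omega>\<in>space M. \<forall>i<m. ?D j i \<omega> \<in> V j i} = E \<inter> {\<omega>\<in>space M. \<forall>j\<in>insert j J. \<forall>k<m. ?D j k \<omega> \<in> V j k}"
    by (auto simp: F_def)
  ultimately show ?case using IH(2) insert.hyps by (simp add: ac_simps)
qed

lemma closure_rational_times: "closure ({0<..<T} \<inter> \<rat>) = {0..T}"
proof
  have "closure ({0<..<T} \<inter> \<rat>) \<subseteq> closure {0<..<T}" by (rule closure_mono) auto
  also have "\<dots> = {0..T}" using T by simp
  finally show "closure ({0<..<T} \<inter> \<rat>) \<subseteq> {0..T}" .
  have "{0<..<T} \<inter> closure \<rat> \<subseteq> closure ({0<..<T} \<inter> \<rat>)" by (rule open_Int_closure_subset) auto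
  moreover have "closure (\<rat> :: real set) = UNIV" by (rule Rats_closure_real)
  ultimately have "closure {0<..<T} \<subseteq> closure ({0<..<T} \<inter> \<rat>)" by (intro closure_minimal) auto
  then show "{0..T} \<subseteq> closure ({0<..<T} \<inter> \<rat>)" using T by simp
qed

text \<open>By continuity a tube is determined by countably many times, so up to a null set it is an event of
  the history of \<open>B\<close>.\<close>

lemma tube_version:
  assumes f: "f \<in> mspace (C0_space T)" and g: "g \<in> mspace (C0_space T)"
  shows "\<exists>E\<in>sets hist_B. AE \<omega> in M. \<omega> \<in> E \<longleftrightarrow> path_pair n \<omega> \<in> tube T f g \<rho>"
proof -
  define Q where "Q = {0<..<T} \<inter> (\<rat> :: real set)"
  have Q: "countable Q" "Q \<subseteq> {0..T}" "closure Q = {0..T}"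
  proof -
    show "countable Q" unfolding Q_def by (rule countable_subset[OF Int_lower2 countable_rat])
    show "Q \<subseteq> {0..T}" by (auto simp: Q_def)
    show "closure Q = {0..T}" unfolding Q_def by (rule closure_rational_times)
  qed
  define E where "E = {\<omega>\<in>space hist_B. \<forall>t\<in>Q. norm (\<epsilon> n *\<^sub>R B t \<omega> - f t) \<le> \<rho> \<and> norm (Bh_version n t \<omega> - g t) \<le> \<rho>}"
  have sp: "space hist_B = space M" by (simp add: hist_B_def)
  have "{\<omega>\<in>space hist_B. norm (\<epsilon> n *\<^sub>R B t \<omega> - f t) \<le> \<rho> \<and> norm (Bh_version n t \<omega> - g t) \<le> \<rho>} \<in> sets hist_B" if "t \<in> Q" for t
  proof -
    have t: "t \<in> {0..T}" using that Q(2) by auto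
    have "(\<lambda>\<omega>. B t \<omega> $ l) \<in> borel_measurable hist_B" for l
      using measurable_hist[of t "\<lambda>q. case q of Inl l \<Rightarrow> T | Inr j \<Rightarrow> 0" "Inl l" X M] t
      by (simp add: hist_B_def joint_family_def)
    then have [measurable]: "B t \<in> borel_measurable hist_B" by (simp add: borel_measurable_vec_iff)
    have [measurable]: "Bh_version n t \<in> borel_measurable hist_B"
      unfolding hist_B_def by (rule measurable_hist_mono[OF Bh_version(1)[OF t]]) (use t in \<open>auto split: sum.split\<close>)
    show ?thesis by measurable
  qed
  then have EB: "E \<in> sets hist_B" unfolding E_def by (rule sets.sets_Collect_countable_All'[OF _ Q(1)])
  have "AE \<omega> in M. \<forall>t\<in>Q. Bh_version n t \<omega> = Bh n t \<omega>"
    using Q by (subst AE_ball_countable) (auto intro: Bh_version(2))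
  then have "AE \<omega> in M. \<omega> \<in> E \<longleftrightarrow> path_pair n \<omega> \<in> tube T f g \<rho>"
    using AE_space
  proof eventually_elim
    case (elim \<omega>)
    let ?f = "fst (path_pair n \<omega>)" and ?g = "snd (path_pair n \<omega>)"
    note mem = path_pair_mspace[OF elim(2), of n]
    have c: "continuous_on {0..T} (\<lambda>t. norm (?f t - f t))" "continuous_on {0..T} (\<lambda>t. norm (?g t - g t))"
      using mem f g unfolding mspace_C0_space by (auto intro!: continuous_intros)
    have "\<omega> \<in> E \<longleftrightarrow> (\<forall>t\<in>Q. norm (?f t - f t) \<le> \<rho> \<and> norm (?g t - g t) \<le> \<rho>)"
      using elim Q(2) path_pair_apply[of _ n \<omega>] by (auto simp: E_def sp subset_iff)
    also have "\<dots> \<longleftrightarrow> (\<forall>t\<in>{0..T}. norm (?f t - f t) \<le> \<rho> \<and> norm (?g t - g t) \<le> \<rho>)"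
    proof
      assume *: "\<forall>t\<in>Q. norm (?f t - f t) \<le> \<rho> \<and> norm (?g t - g t) \<le> \<rho>"
      show "\<forall>t\<in>{0..T}. norm (?f t - f t) \<le> \<rho> \<and> norm (?g t - g t) \<le> \<rho>"
        using continuous_le_on_closure[of Q "\<lambda>t. norm (?f t - f t)" _ \<rho>] continuous_le_on_closure[of Q "\<lambda>t. norm (?g t - g t)" _ \<rho>] c * Q(3)
        by auto
    qed (use Q in auto)
    also have "\<dots> \<longleftrightarrow> path_pair n \<omega> \<in> tube T f g \<rho>"
      using mem by (cases "path_pair n \<omega>") (auto simp: tube_def)
    finally show ?case .
  qed
  then show ?thesis using EB by blast
qed

end

context
  fixes T :: real and m :: nat and S :: "real set" and gn :: "nat \<Rightarrow> real \<Rightarrow> real^'p" and g :: "real \<Rightarrow> real^'p"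
  assumes mesh_S: "\<And>k. k \<le> m \<Longrightarrow> mesh T m k \<in> S" and gn: "\<And>t. t \<in> S \<Longrightarrow> (\<lambda>n. gn n t) \<longlonglongrightarrow> g t"
begin

lemma continuous_coefficient_limit:
  fixes h :: "real^'p \<Rightarrow> real"
  assumes "continuous_on UNIV h" "k < m"
  shows "(\<lambda>n. h (gn n (mesh T m k))) \<longlonglongrightarrow> h (g (mesh T m k))"
  by (rule tendsto_continuous_compose[OF assms(1) gn[OF mesh_S]]) (use assms in simp)

lemma M_riemann_limit:
  assumes "\<And>i. continuous_on UNIV (\<lambda>y. \<mu> y $ i)"
  shows "(\<lambda>n. M_riemann T \<mu> m (gn n)) \<longlonglongrightarrow> M_riemann T \<mu> m g"
proof (rule vec_tendstoI)
  fix i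
  show "(\<lambda>n. M_riemann T \<mu> m (gn n) $ i) \<longlonglongrightarrow> M_riemann T \<mu> m g $ i"
    unfolding M_riemann_def vec_lambda_beta
    by (intro tendsto_sum tendsto_mult_right continuous_coefficient_limit[OF assms]) auto
qed

lemma Phi_riemann_limit:
  assumes "\<And>i l. continuous_on UNIV (\<lambda>y. \<sigma>' y $ i $ l)" and fn: "\<And>t. t \<in> S \<Longrightarrow> (\<lambda>n. fn n t) \<longlonglongrightarrow> f t"
  shows "(\<lambda>n. Phi_riemann T \<sigma>' m (fn n) (gn n)) \<longlonglongrightarrow> Phi_riemann T \<sigma>' m f g"
proof (rule vec_tendstoI)
  fix i
  show "(\<lambda>n. Phi_riemann T \<sigma>' m (fn n) (gn n) $ i) \<longlonglongrightarrow> Phi_riemann T \<sigma>' m f g $ i"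
    unfolding Phi_riemann_def vec_lambda_beta
  proof (intro tendsto_sum tendsto_mult tendsto_diff)
    fix l k assume k: "k \<in> {..<m}"
    show "(\<lambda>n. \<sigma>' (gn n (mesh T m k)) $ i $ l) \<longlonglongrightarrow> \<sigma>' (g (mesh T m k)) $ i $ l"
      by (rule continuous_coefficient_limit[OF assms(1)]) (use k in simp)
    show "(\<lambda>n. fn n (mesh T m (Suc k)) $ l) \<longlonglongrightarrow> f (mesh T m (Suc k)) $ l"
      by (rule tendsto_vec_nth[OF fn[OF mesh_S]]) (use k in simp)
    show "(\<lambda>n. fn n (mesh T m k) $ l) \<longlonglongrightarrow> f (mesh T m k) $ l"
      by (rule tendsto_vec_nth[OF fn[OF mesh_S]]) (use k in simp)
  qed
qed

lemma W_riemann_limit: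
  assumes "\<And>i j. continuous_on UNIV (\<lambda>y. \<sigma> y $ i $ j)" and wn: "\<And>j k. k < m \<Longrightarrow> (\<lambda>n. wn n j k) \<longlonglongrightarrow> w j k"
  shows "(\<lambda>n. W_riemann T \<sigma> m (gn n) (wn n)) \<longlonglongrightarrow> W_riemann T \<sigma> m g w"
proof (rule vec_tendstoI)
  fix i
  show "(\<lambda>n. W_riemann T \<sigma> m (gn n) (wn n) $ i) \<longlonglongrightarrow> W_riemann T \<sigma> m g w $ i"
    unfolding W_riemann_def vec_lambda_beta
    by (intro tendsto_sum tendsto_mult continuous_coefficient_limit[OF assms(1)] wn) auto
qed

lemma quad_riemann_limit:
  assumes "\<And>i j. continuous_on UNIV (\<lambda>y. \<sigma> y $ i $ j)"
  shows "(\<lambda>n. quad_riemann T \<sigma> \<theta> m (gn n)) \<longlonglongrightarrow> quad_riemann T \<sigma> \<theta> m g"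
proof -
  have "continuous_on UNIV (\<lambda>y. dual_coeff \<sigma> \<theta> y j)" for j
    unfolding dual_coeff_def by (intro continuous_intros assms)
  then show ?thesis
    unfolding quad_riemann_def
    by (intro tendsto_sum tendsto_mult_right tendsto_power continuous_coefficient_limit) auto
qed

end

context log_price
begin

subsection \<open>Large deviation bounds\<close>

lemma mem_tube_path_pair:
  assumes "path_pair n \<omega> \<in> tube T f g \<rho>" "t \<in> {0..T}"
  shows "norm (\<epsilon> n *\<^sub>R B t \<omega> - f t) \<le> \<rho> \<and> norm (Bh n t \<omega> - g t) \<le> \<rho>"
  using assms unfolding path_pair_apply[OF assms(2), of n \<omega>, symmetric] tube_def by (cases "path_pair n \<omega>") auto

lemma hist_B_events: "sets hist_B \<subseteq> events"
  unfolding hist_B_W_time by (rule hist_events) (use W_time_range in auto)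

lemma W_measurable: "t \<in> {0..T} \<Longrightarrow> (\<lambda>\<omega>. W t \<omega> $ j) \<in> borel_measurable M"
  using X_measurable[of t "Inr j"] by (simp add: joint_family_def)

text \<open>Given \<open>B\<close>, the sum \<open>W_riemann\<close> is Gaussian; this is the exponential Chebyshev inequality for it.\<close>

lemma tilted_bound:
  fixes s \<rho> :: real and n m :: nat and \<theta> :: "real^'d" and f g :: "real \<Rightarrow> real^'p"
  assumes m: "m > 0" and f: "f \<in> mspace (C0_space T)" and g: "g \<in> mspace (C0_space T)"
  defines "D \<equiv> {\<omega>\<in>space M. path_pair n \<omega> \<in> tube T f g \<rho> \<and>
    s \<le> \<theta> \<bullet> W_riemann T \<sigma> m (\<lambda>t. Bh n t \<omega>) (W_increments n m \<omega>) - quad_riemann T \<sigma> \<theta> m (\<lambda>t. Bh n t \<omega>) / 2}"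
  shows "D \<in> events" "prob D \<le> exp (- s / (\<epsilon> n)\<^sup>2) * prob {\<omega>\<in>space M. path_pair n \<omega> \<in> tube T f g \<rho>}"
proof -
  let ?E = "{\<omega>\<in>space M. path_pair n \<omega> \<in> tube T f g \<rho>}"
  define U where "U \<omega> = \<theta> \<bullet> W_riemann T \<sigma> m (\<lambda>t. Bh n t \<omega>) (W_increments n m \<omega>) - quad_riemann T \<sigma> \<theta> m (\<lambda>t. Bh n t \<omega>) / 2" for \<omega>
  have E: "?E \<in> events" by (rule tube_event[OF f g])
  have dual: "continuous_on UNIV (\<lambda>y. dual_coeff \<sigma> \<theta> y j)" for j
    unfolding dual_coeff_def by (intro continuous_intros sigma_continuous)
  have dual_meas: "(\<lambda>\<omega>. dual_coeff \<sigma> \<theta> (Bh n (mesh T m k) \<omega>) j) \<in> borel_measurable M" if "k < m" for j k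
    by (rule measurable_compose[OF Bh_measurable borel_measurable_continuous_onI[OF dual]]) (use that mesh_range[of k m] in simp)
  have U: "U \<in> borel_measurable M"
    unfolding U_def inner_W_riemann quad_riemann_def W_increments_def
    by (intro borel_measurable_diff borel_measurable_sum borel_measurable_times borel_measurable_divide borel_measurable_power borel_measurable_const
        dual_meas W_measurable mesh_range) auto
  have D_eq: "D = ?E \<inter> {\<omega>\<in>space M. s \<le> U \<omega>}" by (auto simp: D_def U_def)
  have "{\<omega>\<in>space M. s \<le> U \<omega>} \<in> events" using U by measurable
  then show D: "D \<in> events" unfolding D_eq using E by (rule sets.Int[rotated])
  \<comment> \<open>\<open>W_martingale\<close> requires an event of \<open>hist_B\<close>; the tube
    event agrees with one up to a null set.\<close>
  obtain E' where E': "E' \<in> sets hist_B" and AE1: "AE \<omega> in M. \<omega> \<in> E' \<longleftrightarrow> path_pair n \<omega> \<in> tube T f g \<rho>"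
    using tube_version[OF f g, of n \<rho>] by blast
  have E'M: "E' \<in> events" using E' hist_B_events by blast
  \<comment> \<open>Tilting the scaled increments by \<open>dual_coeff\<close> / \<epsilon>^2 means
    tilting the increments of \<open>W\<close> by \<open>dual_coeff\<close> / \<epsilon>; the
    resulting exponent S equals U / \<epsilon>^2.\<close>
  define c where "c j k \<omega> = dual_coeff \<sigma> \<theta> (Bh_version n (mesh T m k) \<omega>) j / \<epsilon> n" for j k \<omega>
  define S where "S \<omega> = (\<Sum>j\<in>UNIV. \<Sum>k<m. c j k \<omega> * (W (mesh T m (Suc k)) \<omega> $ j - W (mesh T m k) \<omega> $ j) - (c j k \<omega>)\<^sup>2 * (T / real m) / 2)" for \<omega>
  have c: "c j k \<in> borel_measurable hist_B" if k: "k < m" for j k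
  proof -
    have t: "mesh T m k \<in> {0..T}" using mesh_range[of k m] k by simp
    have "Bh_version n (mesh T m k) \<in> borel_measurable hist_B"
      unfolding hist_B_def by (rule measurable_hist_mono[OF Bh_version(1)[OF t]]) (use t in \<open>auto split: sum.split\<close>)
    from measurable_compose[OF this borel_measurable_continuous_onI[OF dual]] show ?thesis
      unfolding c_def by (intro borel_measurable_divide) auto
  qed
  have Y: "(indicator E' :: 'w \<Rightarrow> ennreal) \<in> borel_measurable hist_B" using E' by (rule borel_measurable_indicator)
  have mart: "(\<lambda>\<omega>. indicator E' \<omega> * ennreal (exp (S \<omega>))) \<in> borel_measurable (hist M X (W_time UNIV))"
    "(\<integral>\<^sup>+\<omega>. indicator E' \<omega> * ennreal (exp (S \<omega>)) \<partial>M) = (\<integral>\<^sup>+\<omega>. indicator E' \<omega> \<partial>M)"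
    using W_martingale[where c = c, OF m c Y finite] unfolding S_def by auto
  have mM: "(\<lambda>\<omega>. indicator E' \<omega> * ennreal (exp (S \<omega>))) \<in> borel_measurable M"
    by (rule measurable_hist_M[OF mart(1)]) (use W_time_range in auto)
  have "AE \<omega> in M. \<forall>k\<in>{..<m}. Bh_version n (mesh T m k) \<omega> = Bh n (mesh T m k) \<omega>"
    by (rule AE_finite_allI) (auto intro!: Bh_version(2) simp: mesh_range[simplified])
  then have AE2: "AE \<omega> in M. S \<omega> = U \<omega> / (\<epsilon> n)\<^sup>2"
  proof eventually_elim
    case (elim \<omega>)
    let ?d = "\<lambda>j k. dual_coeff \<sigma> \<theta> (Bh n (mesh T m k) \<omega>) j" and ?w = "\<lambda>j k. W (mesh T m (Suc k)) \<omega> $ j - W (mesh T m k) \<omega> $ j"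
    have "S \<omega> = (\<Sum>j\<in>UNIV. \<Sum>k<m. (?d j k * (\<epsilon> n * ?w j k) - (?d j k)\<^sup>2 * (T / real m) / 2) / (\<epsilon> n)\<^sup>2)"
      unfolding S_def c_def
    proof (intro sum.cong refl)
      fix j k assume "k \<in> {..<m}"
      then have eq: "Bh_version n (mesh T m k) \<omega> = Bh n (mesh T m k) \<omega>" using elim by simp
      show "dual_coeff \<sigma> \<theta> (Bh_version n (mesh T m k) \<omega>) j / \<epsilon> n * ?w j k - (dual_coeff \<sigma> \<theta> (Bh_version n (mesh T m k) \<omega>) j / \<epsilon> n)\<^sup>2 * (T / real m) / 2
        = (?d j k * (\<epsilon> n * ?w j k) - (?d j k)\<^sup>2 * (T / real m) / 2) / (\<epsilon> n)\<^sup>2"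
        unfolding eq using eps_nz[of n] by (simp add: diff_divide_distrib power_divide power2_eq_square)
    qed
    also have "\<dots> = U \<omega> / (\<epsilon> n)\<^sup>2"
      unfolding U_def inner_W_riemann quad_riemann_def W_increments_def
      by (simp add: sum_divide_distrib[symmetric] sum_subtractf)
    finally show ?case .
  qed
  have e2: "(\<epsilon> n)\<^sup>2 > 0" by (rule eps2_pos)
  have "ennreal (prob D) = (\<integral>\<^sup>+\<omega>. indicator D \<omega> \<partial>M)" using D by (simp add: emeasure_eq_measure)
  also have "\<dots> \<le> (\<integral>\<^sup>+\<omega>. ennreal (exp (- s / (\<epsilon> n)\<^sup>2)) * (indicator E' \<omega> * ennreal (exp (S \<omega>))) \<partial>M)"
  proof (rule nn_integral_mono_AE)
    show "AE \<omega> in M. indicator D \<omega> \<le> ennreal (exp (- s / (\<epsilon> n)\<^sup>2)) * (indicator E' \<omega> * ennreal (exp (S \<omega>)))"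
      using AE1 AE2
    proof eventually_elim
      case (elim \<omega>)
      show ?case
      proof (cases "\<omega> \<in> D")
        case True
        then have "\<omega> \<in> E'" "s \<le> U \<omega>" using elim by (auto simp: D_eq)
        have "- s / (\<epsilon> n)\<^sup>2 + S \<omega> = (U \<omega> - s) / (\<epsilon> n)\<^sup>2" unfolding elim(2) by (simp add: diff_divide_distrib)
        also have "\<dots> \<ge> 0" using \<open>s \<le> U \<omega>\<close> e2 by (intro divide_nonneg_pos) auto
        finally have "1 \<le> exp (- s / (\<epsilon> n)\<^sup>2) * exp (S \<omega>)" unfolding exp_add[symmetric] by simp
        then have "1 \<le> ennreal (exp (- s / (\<epsilon> n)\<^sup>2)) * ennreal (exp (S \<omega>))"
          by (simp add: ennreal_mult[symmetric] ennreal_1[symmetric] del: ennreal_1)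
        then show ?thesis using True \<open>\<omega> \<in> E'\<close> by simp
      qed simp
    qed
  qed
  also have "\<dots> = ennreal (exp (- s / (\<epsilon> n)\<^sup>2)) * (\<integral>\<^sup>+\<omega>. indicator E' \<omega> \<partial>M)"
    unfolding mart(2)[symmetric] by (rule nn_integral_cmult[OF mM])
  also have "(\<integral>\<^sup>+\<omega>. indicator E' \<omega> \<partial>M) = ennreal (prob E')" using E'M by (simp add: emeasure_eq_measure)
  also have "prob E' = prob ?E"
  proof (rule finite_measure_eq_AE[OF _ E'M E])
    show "AE \<omega> in M. \<omega> \<in> E' \<longleftrightarrow> \<omega> \<in> ?E" using AE1 AE_space by eventually_elim auto
  qed
  finally show "prob D \<le> exp (- s / (\<epsilon> n)\<^sup>2) * prob ?E"
    by (simp add: ennreal_mult[symmetric])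
qed

lemma rate_limits:
  assumes f: "f \<in> cameron_martin T" and g: "g \<in> mspace (C0_space T)"
  shows "(\<lambda>m. M_riemann T \<mu> m g) \<longlonglongrightarrow> M_vec T \<mu> g" "(\<lambda>m. Phi_riemann T \<sigma>' m f g) \<longlonglongrightarrow> Phi T \<sigma>' f g T"
    "(\<lambda>m. W_riemann T \<sigma> m g (dual_control T \<sigma> \<theta> m g)) \<longlonglongrightarrow> A_mat T \<sigma> g *v \<theta>"
    "(\<lambda>m. quad_riemann T \<sigma> \<theta> m g) \<longlonglongrightarrow> \<theta> \<bullet> (A_mat T \<sigma> g *v \<theta>)"
    "A_mat T \<sigma> g *v (matrix_inv (A_mat T \<sigma> g) *v v) = v" "0 \<le> v \<bullet> (matrix_inv (A_mat T \<sigma> g) *v v)"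
proof -
  have gc: "continuous_on {0..T} g" using g by (simp add: mspace_C0_space)
  note prems = T gc mu_continuous sigma_continuous sigma'_continuous nondegenerate
  show "(\<lambda>m. M_riemann T \<mu> m g) \<longlonglongrightarrow> M_vec T \<mu> g" by (rule M_riemann_tendsto[OF prems])
  show "(\<lambda>m. Phi_riemann T \<sigma>' m f g) \<longlonglongrightarrow> Phi T \<sigma>' f g T" by (rule Phi_riemann_tendsto[OF prems f])
  show "(\<lambda>m. W_riemann T \<sigma> m g (dual_control T \<sigma> \<theta> m g)) \<longlonglongrightarrow> A_mat T \<sigma> g *v \<theta>" by (rule W_riemann_tendsto[OF prems])
  show "(\<lambda>m. quad_riemann T \<sigma> \<theta> m g) \<longlonglongrightarrow> \<theta> \<bullet> (A_mat T \<sigma> g *v \<theta>)" by (rule quad_riemann_tendsto[OF prems])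
  show "A_mat T \<sigma> g *v (matrix_inv (A_mat T \<sigma> g) *v v) = v" by (rule A_mat_solve[OF prems])
  show "0 \<le> v \<bullet> (matrix_inv (A_mat T \<sigma> g) *v v)" by (rule A_mat_inv_nonneg[OF prems])
qed

text \<open>The two costs add up because \<open>tilted_bound\<close> keeps the probability of the
  tube as a factor. The linear form \<theta> is chosen optimally for the centre (f, hat f) and stays
  nearly optimal throughout a thin tube.\<close>

lemma tube_upper_bound:
  fixes z :: "real^'d" and a :: real
  assumes f: "f \<in> cameron_martin T"
  defines "g \<equiv> hat T K f"
  defines "v \<equiv> z - Phi T \<sigma>' f g T - M_vec T \<mu> g"
  assumes a: "a < 1/2 * cm_norm_sq T f + 1/2 * (v \<bullet> (matrix_inv (A_mat T \<sigma> g) *v v))"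
  shows "\<exists>\<rho>>0. \<exists>r>0. exp_small (\<lambda>n. {\<omega>. dist (Z n \<omega>) z < r} \<inter> {\<omega>. path_pair n \<omega> \<in> tube T f g \<rho>}) a"
proof -
  have T0: "0 \<le> T" using T by simp
  have fm: "f \<in> mspace (C0_space T)" by (rule cameron_martin_mspace[OF f])
  have gm: "g \<in> mspace (C0_space T)" unfolding g_def by (rule volterra_hat_mspace) (use f T volterra in auto)
  note lim = rate_limits[OF f gm]
  define \<theta> where "\<theta> = matrix_inv (A_mat T \<sigma> g) *v v"
  have A\<theta>: "A_mat T \<sigma> g *v \<theta> = v" unfolding \<theta>_def by (rule lim(5))
  define Q where "Q = 1/2 * (v \<bullet> \<theta>)"
  define c where "c = 1/2 * cm_norm_sq T f"
  \<comment> \<open>Two units are lost in the probability of the tube and three in the Gaussian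
    bound; the sixth keeps the exponent above a.\<close>
  define \<eta> where "\<eta> = (c + Q - a) / 6"
  have \<eta>: "\<eta> > 0" using a by (simp add: \<eta>_def c_def Q_def \<theta>_def)
  define r where "r = \<eta> / (norm \<theta> + 1) / 2"
  have n1: "norm \<theta> + 1 > 0" using norm_ge_zero[of \<theta>] by linarith
  have r: "r > 0" using \<eta> n1 by (simp add: r_def)
  have r2: "norm \<theta> * (2 * r) \<le> \<eta>"
  proof -
    have "norm \<theta> * (2 * r) \<le> (norm \<theta> + 1) * (2 * r)" using r by (intro mult_right_mono) auto
    also have "\<dots> = \<eta>" unfolding r_def times_divide_eq_right using n1 by simp
    finally show ?thesis .
  qed
  define \<Psi> where "\<Psi> m f' g' = \<theta> \<bullet> (z - M_riemann T \<mu> m g' - Phi_riemann T \<sigma>' m f' g') - quad_riemann T \<sigma> \<theta> m g' / 2" for m f' g'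
  have "(\<lambda>m. \<Psi> m f g) \<longlonglongrightarrow> \<theta> \<bullet> (z - M_vec T \<mu> g - Phi T \<sigma>' f g T) - \<theta> \<bullet> (A_mat T \<sigma> g *v \<theta>) / 2"
    unfolding \<Psi>_def by (intro tendsto_intros lim) auto
  also have "\<theta> \<bullet> (z - M_vec T \<mu> g - Phi T \<sigma>' f g T) - \<theta> \<bullet> (A_mat T \<sigma> g *v \<theta>) / 2 = Q"
  proof -
    have "z - M_vec T \<mu> g - Phi T \<sigma>' f g T = v" by (simp add: v_def)
    then show ?thesis unfolding A\<theta> by (simp add: Q_def inner_commute)
  qed
  finally have "\<forall>\<^sub>F m in sequentially. Q - \<eta> < \<Psi> m f g" using \<eta> by (intro order_tendstoD) auto
  then obtain m1 where m1: "\<And>m. m \<ge> m1 \<Longrightarrow> Q - \<eta> < \<Psi> m f g" unfolding eventually_sequentially by blast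
  obtain m0 where m0: "m0 > 0" "\<And>m. m \<ge> m0 \<Longrightarrow> exp_small (\<lambda>n. {\<omega>. r \<le> norm (Z n \<omega> - Z_riemann n m \<omega>)}) a"
    using exponential_approximation[OF r, of a] by blast
  define m where "m = max m0 m1"
  have m: "m > 0" "m \<ge> m0" "m \<ge> m1" using m0(1) by (auto simp: m_def)
  \<comment> \<open>No Wiener increments enter \<Psi>; the third argument of
    \<open>tube_continuity\<close> is a dummy over the empty index set.\<close>
  have "\<exists>\<rho>>0. \<forall>f' g' w'. (\<forall>t\<in>{0..T}. norm (f' t - f t) \<le> \<rho> \<and> norm (g' t - g t) \<le> \<rho>) \<longrightarrow> (\<forall>j\<in>({}::unit set). \<bar>w' j - (0::real)\<bar> \<le> \<rho>) \<longrightarrow>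
      dist (\<Psi> m f' g') (\<Psi> m f g) < \<eta>"
  proof (rule tube_continuity[where F = "\<lambda>f' g' _. \<Psi> m f' g'" and w = "\<lambda>_. 0", OF _ \<eta>])
    fix fn gn :: "nat \<Rightarrow> real \<Rightarrow> real^'p" and wn :: "nat \<Rightarrow> unit \<Rightarrow> real"
    assume fn: "\<And>t. t \<in> {0..T} \<Longrightarrow> (\<lambda>n. fn n t) \<longlonglongrightarrow> f t" and gn: "\<And>t. t \<in> {0..T} \<Longrightarrow> (\<lambda>n. gn n t) \<longlonglongrightarrow> g t"
    show "(\<lambda>n. \<Psi> m (fn n) (gn n)) \<longlonglongrightarrow> \<Psi> m f g"
      unfolding \<Psi>_def
      by (intro tendsto_intros M_riemann_limit[OF mesh_range gn mu_continuous] Phi_riemann_limit[OF mesh_range gn sigma'_continuous fn]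
          quad_riemann_limit[OF mesh_range gn sigma_continuous]) auto
  qed
  then obtain \<rho>1 where \<rho>1: "\<rho>1 > 0" and near: "\<And>f' g'. (\<forall>t\<in>{0..T}. norm (f' t - f t) \<le> \<rho>1 \<and> norm (g' t - g t) \<le> \<rho>1) \<Longrightarrow> dist (\<Psi> m f' g') (\<Psi> m f g) < \<eta>"
    by blast
  \<comment> \<open>Lower semicontinuity: on a neighbourhood of (f, g) the rate of the path pair is
    still above c - \<eta>, so a thin tube costs nearly as much as its centre.\<close>
  let ?O = "{x\<in>topspace (C0_prod T). ereal (c - \<eta>) < I_B_hatB T K x}"
  have O: "openin (C0_prod T) ?O"
    using good_B unfolding good_rate_function_def rate_function_def by blast
  have "I_B_hatB T K (f, g) = ereal c" using f by (simp add: I_B_hatB_def g_def c_def)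
  then have "(f, g) \<in> ?O" using fm gm \<eta> by simp
  from tube_subset_open[OF T0 fm gm O this] obtain \<rho>2 where \<rho>2: "\<rho>2 > 0" "tube T f g \<rho>2 \<subseteq> ?O" by blast
  define \<rho> where "\<rho> = min \<rho>1 \<rho>2"
  have \<rho>: "\<rho> > 0" "\<rho> \<le> \<rho>1" "\<rho> \<le> \<rho>2" using \<rho>1 \<rho>2 by (auto simp: \<rho>_def)
  define E where "E n = {\<omega>\<in>space M. path_pair n \<omega> \<in> tube T f g \<rho>}" for n
  have Ev: "E n \<in> events" for n unfolding E_def by (rule tube_event[OF fm gm])
  have sE: "exp_small E (c - \<eta>)"
    unfolding E_def
  proof (rule LDP_upper[OF LDP_path closedin_tube[OF T0 fm gm]])
    fix x assume "x \<in> tube T f g \<rho>"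
    then have "x \<in> ?O" using \<rho>2(2) tube_mono[OF \<rho>(3), of T f g] by blast
    then show "ereal (c - \<eta>) \<le> I_B_hatB T K x" by (auto intro: less_imp_le)
  qed
  define D where "D n = {\<omega>\<in>space M. path_pair n \<omega> \<in> tube T f g \<rho> \<and>
    Q - 3 * \<eta> \<le> \<theta> \<bullet> W_riemann T \<sigma> m (\<lambda>t. Bh n t \<omega>) (W_increments n m \<omega>) - quad_riemann T \<sigma> \<theta> m (\<lambda>t. Bh n t \<omega>) / 2}" for n
  have D: "D n \<in> events" "prob (D n) \<le> exp (- (Q - 3 * \<eta>) / (\<epsilon> n)\<^sup>2) * prob (E n)" for n
    unfolding D_def E_def by (rule tilted_bound[OF m(1) fm gm])+
  have "exp_small D a"
  proof (rule exp_smallI[of D])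
    fix b assume b: "b < a"
    have "c - 2 * \<eta> < c - \<eta>" using \<eta> by simp
    from exp_smallD[OF sE this Ev]
    show "\<forall>\<^sub>F n in sequentially. prob (D n) \<le> exp (- b / (\<epsilon> n)\<^sup>2)"
    proof eventually_elim
      case (elim n)
      have "prob (D n) \<le> exp (- (Q - 3 * \<eta>) / (\<epsilon> n)\<^sup>2) * exp (- (c - 2 * \<eta>) / (\<epsilon> n)\<^sup>2)"
        by (rule order_trans[OF D(2) mult_left_mono[OF elim]]) simp
      also have "\<dots> = exp (- (Q + c - 5 * \<eta>) / (\<epsilon> n)\<^sup>2)"
        unfolding exp_add[symmetric] add_divide_distrib[symmetric] by (simp add: algebra_simps)
      also have "\<dots> \<le> exp (- b / (\<epsilon> n)\<^sup>2)"
        using b \<eta> unfolding exp_le_cancel_iff by (intro divide_right_mono) (simp_all add: \<eta>_def field_simps)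
      finally show ?case .
    qed
  qed (use D in auto)
  then have "exp_small (\<lambda>n. {\<omega>. r \<le> norm (Z n \<omega> - Z_riemann n m \<omega>)} \<union> D n) a"
    by (rule exp_small_Un[OF m0(2)[OF m(2)]])
  then have "exp_small (\<lambda>n. {\<omega>. dist (Z n \<omega>) z < r} \<inter> {\<omega>. path_pair n \<omega> \<in> tube T f g \<rho>}) a"
  proof (rule exp_small_mono)
    fix n
    show "({\<omega>. dist (Z n \<omega>) z < r} \<inter> {\<omega>. path_pair n \<omega> \<in> tube T f g \<rho>}) \<inter> space M \<subseteq> {\<omega>. r \<le> norm (Z n \<omega> - Z_riemann n m \<omega>)} \<union> D n"
    proof
      fix \<omega> assume "\<omega> \<in> ({\<omega>. dist (Z n \<omega>) z < r} \<inter> {\<omega>. path_pair n \<omega> \<in> tube T f g \<rho>}) \<inter> space M"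
      then have d: "dist (Z n \<omega>) z < r" and tb: "path_pair n \<omega> \<in> tube T f g \<rho>" and \<omega>: "\<omega> \<in> space M" by auto
      show "\<omega> \<in> {\<omega>. r \<le> norm (Z n \<omega> - Z_riemann n m \<omega>)} \<union> D n"
      proof (cases "r \<le> norm (Z n \<omega> - Z_riemann n m \<omega>)")
        case False
        let ?f = "\<lambda>t. \<epsilon> n *\<^sub>R B t \<omega>" and ?g = "\<lambda>t. Bh n t \<omega>"
        have "dist (\<Psi> m ?f ?g) (\<Psi> m f g) < \<eta>"
          using mem_tube_path_pair[OF tb] \<rho>(2) by (intro near) (meson order_trans)
        then have \<Psi>: "Q - 2 * \<eta> < \<Psi> m ?f ?g" using m1[OF m(3)] unfolding dist_real_def by linarith
        have "norm (Z_riemann n m \<omega> - z) \<le> norm (Z n \<omega> - Z_riemann n m \<omega>) + norm (Z n \<omega> - z)"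
          using norm_triangle_ineq[of "Z_riemann n m \<omega> - Z n \<omega>" "Z n \<omega> - z"] by (simp add: norm_minus_commute)
        also have "\<dots> \<le> 2 * r" using False d by (simp add: dist_norm)
        finally have "norm \<theta> * norm (Z_riemann n m \<omega> - z) \<le> norm \<theta> * (2 * r)" by (intro mult_left_mono) auto
        then have "\<bar>\<theta> \<bullet> (Z_riemann n m \<omega> - z)\<bar> \<le> \<eta>" using Cauchy_Schwarz_ineq2[of \<theta> "Z_riemann n m \<omega> - z"] r2 by linarith
        moreover have "\<theta> \<bullet> W_riemann T \<sigma> m ?g (W_increments n m \<omega>) - quad_riemann T \<sigma> \<theta> m ?g / 2
          = \<Psi> m ?f ?g + \<theta> \<bullet> (Z_riemann n m \<omega> - z)"
          unfolding \<Psi>_def Z_riemann_def by (simp add: inner_diff_right inner_add_right)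
        ultimately have "Q - 3 * \<eta> \<le> \<theta> \<bullet> W_riemann T \<sigma> m ?g (W_increments n m \<omega>) - quad_riemann T \<sigma> \<theta> m ?g / 2"
          using \<Psi> by linarith
        then have "\<omega> \<in> D n" unfolding D_def using \<omega> tb by blast
        then show ?thesis by (rule UnI2)
      qed simp
    qed
  qed
  then show ?thesis using \<rho>(1) r by blast
qed

text \<open>Every path pair of rate at most a is a Cameron-Martin path with its transform and gets a
  tube and a radius from \<open>tube_upper_bound\<close>. Finitely many tubes suffice by
  \<open>level_cover\<close>, and leaving all of them already has exponent a. The smallest of the
  finitely many radii serves for the ball.\<close>

lemma ball_upper_bound:
  assumes a: "ereal a < I_T T \<mu> \<sigma> \<sigma>' K z"
  shows "\<exists>r>0. exp_small (\<lambda>n. {\<omega>. dist (Z n \<omega>) z < r}) a"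
proof -
  define P where "P x \<rho> r \<longleftrightarrow> \<rho> > 0 \<and> r > 0 \<and> exp_small (\<lambda>n. {\<omega>. dist (Z n \<omega>) z < r} \<inter> {\<omega>. path_pair n \<omega> \<in> tube T (fst x) (snd x) \<rho>}) a"
    for x :: "(real \<Rightarrow> real^'p) \<times> (real \<Rightarrow> real^'p)" and \<rho> r :: real
  have ex: "\<exists>\<rho> r. P x \<rho> r" if "I_B_hatB T K x \<le> ereal a" for x
  proof -
    obtain f g where x: "x = (f, g)" by (cases x)
    have f: "f \<in> cameron_martin T" and g: "g = hat T K f"
      using that unfolding x I_B_hatB_def by (auto split: if_splits)
    let ?v = "z - Phi T \<sigma>' f (hat T K f) T - M_vec T \<mu> (hat T K f)"
    have "I_T T \<mu> \<sigma> \<sigma>' K z \<le> ereal (1/2 * cm_norm_sq T f + 1/2 * (?v \<bullet> (matrix_inv (A_mat T \<sigma> (hat T K f)) *v ?v)))"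
      unfolding I_T_def Let_def by (rule INF_lower[OF f])
    with a have "ereal a < ereal (1/2 * cm_norm_sq T f + 1/2 * (?v \<bullet> (matrix_inv (A_mat T \<sigma> (hat T K f)) *v ?v)))" by (rule less_le_trans)
    then have "a < 1/2 * cm_norm_sq T f + 1/2 * (?v \<bullet> (matrix_inv (A_mat T \<sigma> (hat T K f)) *v ?v))" by (simp only: less_ereal.simps)
    from tube_upper_bound[OF f this] show ?thesis unfolding P_def x g by auto
  qed
  then obtain \<rho> r where P: "\<And>x. I_B_hatB T K x \<le> ereal a \<Longrightarrow> P x (\<rho> x) (r x)" by metis
  obtain S where S: "finite S" "S \<subseteq> {x \<in> mspace (C0_space T) \<times> mspace (C0_space T). I_B_hatB T K x \<le> ereal a}"
    and cover: "exp_small (\<lambda>n. {\<omega>. \<forall>x\<in>S. path_pair n \<omega> \<notin> tube T (fst x) (snd x) (\<rho> x)}) a"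
    using level_cover[of a \<rho>] P unfolding P_def by blast
  have PS: "P x (\<rho> x) (r x)" if "x \<in> S" for x using that S(2) P by blast
  define r0 where "r0 = Min (insert 1 (r ` S))"
  have r0: "r0 > 0" "\<And>x. x \<in> S \<Longrightarrow> r0 \<le> r x"
    unfolding r0_def using S(1) PS by (auto simp: P_def)
  have "exp_small (\<lambda>n. {\<omega>. \<forall>x\<in>S. path_pair n \<omega> \<notin> tube T (fst x) (snd x) (\<rho> x)} \<union>
      (\<Union>x\<in>S. {\<omega>. dist (Z n \<omega>) z < r x} \<inter> {\<omega>. path_pair n \<omega> \<in> tube T (fst x) (snd x) (\<rho> x)})) a"
    by (intro exp_small_Un[OF cover] exp_small_UN[OF S(1)]) (use PS in \<open>simp only: P_def\<close>)
  then have "exp_small (\<lambda>n. {\<omega>. dist (Z n \<omega>) z < r0}) a"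
  proof (rule exp_small_mono)
    fix n
    show "{\<omega>. dist (Z n \<omega>) z < r0} \<inter> space M \<subseteq> {\<omega>. \<forall>x\<in>S. path_pair n \<omega> \<notin> tube T (fst x) (snd x) (\<rho> x)} \<union>
      (\<Union>x\<in>S. {\<omega>. dist (Z n \<omega>) z < r x} \<inter> {\<omega>. path_pair n \<omega> \<in> tube T (fst x) (snd x) (\<rho> x)})"
      using r0(2) by (auto intro: less_le_trans)
  qed
  then show ?thesis using r0(1) by blast
qed

text \<open>The tube event is replaced by its version in \<open>hist_B\<close>, to which
  \<open>W_indep\<close> applies. This makes the cost of the tube and the cost of steering
  \<open>W\<close> multiply.\<close>

lemma tube_W_increments_indep:
  assumes f: "f \<in> mspace (C0_space T)" and g: "g \<in> mspace (C0_space T)" and m: "m > 0" and V: "\<And>j k. V j k \<in> sets borel"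
  defines "H \<equiv> {\<omega>\<in>space M. \<forall>j\<in>UNIV. \<forall>k<m. W (mesh T m (Suc k)) \<omega> $ j - W (mesh T m k) \<omega> $ j \<in> V j k}"
  shows "{\<omega>\<in>space M. path_pair n \<omega> \<in> tube T f g \<rho>} \<inter> H \<in> events"
    "prob ({\<omega>\<in>space M. path_pair n \<omega> \<in> tube T f g \<rho>} \<inter> H) = prob {\<omega>\<in>space M. path_pair n \<omega> \<in> tube T f g \<rho>} *
      (\<Prod>j\<in>UNIV. \<Prod>k<m. prob {\<omega>\<in>space M. W (mesh T m (Suc k)) \<omega> $ j - W (mesh T m k) \<omega> $ j \<in> V j k})"
proof -
  let ?E = "{\<omega>\<in>space M. path_pair n \<omega> \<in> tube T f g \<rho>}"
  have E: "?E \<in> events" by (rule tube_event[OF f g])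
  obtain E' where E': "E' \<in> sets hist_B" and AE1: "AE \<omega> in M. \<omega> \<in> E' \<longleftrightarrow> path_pair n \<omega> \<in> tube T f g \<rho>"
    using tube_version[OF f g, of n \<rho>] by blast
  have E'M: "E' \<in> events" using E' hist_B_events by blast
  have sub: "sets (hist M X (W_time J)) \<subseteq> events" for J by (rule hist_events) (use W_time_range in auto)
  have sp: "space M \<in> sets hist_B" using sets.top[of hist_B] by (simp add: hist_B_def)
  have "space M \<inter> H \<in> sets (hist M X (W_time UNIV))"
    unfolding H_def using W_indep[where V = V, OF m sp V finite] by blast
  moreover have "space M \<inter> H = H" unfolding H_def by (rule Int_absorb1) blast
  ultimately have H: "H \<in> events" using sub[of UNIV] by (simp only:) blast
  show ev: "?E \<inter> H \<in> events" using E H by (rule sets.Int)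
  have "prob (?E \<inter> H) = prob (E' \<inter> H)"
  proof (rule finite_measure_eq_AE[OF _ ev sets.Int[OF E'M H]])
    show "AE \<omega> in M. \<omega> \<in> ?E \<inter> H \<longleftrightarrow> \<omega> \<in> E' \<inter> H" using AE1 AE_space by eventually_elim auto
  qed
  also have "\<dots> = prob E' * (\<Prod>j\<in>UNIV. \<Prod>k<m. prob {\<omega>\<in>space M. W (mesh T m (Suc k)) \<omega> $ j - W (mesh T m k) \<omega> $ j \<in> V j k})"
    unfolding H_def using W_indep[where V = V, OF m E' V finite] by blast
  also have "prob E' = prob ?E"
  proof (rule finite_measure_eq_AE[OF _ E'M E])
    show "AE \<omega> in M. \<omega> \<in> E' \<longleftrightarrow> \<omega> \<in> ?E" using AE1 AE_space by eventually_elim auto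
  qed
  finally show "prob (?E \<inter> H) = prob ?E * (\<Prod>j\<in>UNIV. \<Prod>k<m. prob {\<omega>\<in>space M. W (mesh T m (Suc k)) \<omega> $ j - W (mesh T m k) \<omega> $ j \<in> V j k})" .
qed

text \<open>The weights \<open>h j k\<^sup>2 / (2 T / m)\<close> add up to half the quadratic form when \<open>h\<close> is the optimal control.\<close>

lemma dual_control_lower_bound:
  assumes m: "m > 0" and \<rho>: "\<rho> > 0" and \<eta>: "\<eta> > 0"
  shows "\<forall>\<^sub>F n in sequentially. exp (- (quad_riemann T \<sigma> \<theta> m g / 2 + \<eta>) / (\<epsilon> n)\<^sup>2)
    \<le> (\<Prod>j\<in>UNIV. \<Prod>k<m. prob {\<omega>\<in>space M. \<bar>\<epsilon> n * (W (mesh T m (Suc k)) \<omega> $ j - W (mesh T m k) \<omega> $ j) - dual_control T \<sigma> \<theta> m g j k\<bar> < \<rho>})"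
proof -
  \<comment> \<open>The number of increments; the admissible loss \<eta> is shared equally among
    them.\<close>
  define N where "N = real CARD('d) * real m"
  have N: "N > 0" using m by (simp add: N_def)
  let ?h = "\<lambda>j k. dual_control T \<sigma> \<theta> m g j k"
  let ?P = "\<lambda>n j k. prob {\<omega>\<in>space M. \<bar>\<epsilon> n * (W (mesh T m (Suc k)) \<omega> $ j - W (mesh T m k) \<omega> $ j) - ?h j k\<bar> < \<rho>}"
  let ?q = "\<lambda>j k. (?h j k)\<^sup>2 / (2 * (T / real m)) + \<eta> / N"
  have "\<forall>\<^sub>F n in sequentially. exp (- ?q j k / (\<epsilon> n)\<^sup>2) \<le> ?P n j k" if k: "k < m" for j k
  proof (rule normal_small_ball)
    have "distributed M lborel (\<lambda>\<omega>. X (Inr j) (mesh T m (Suc k)) \<omega> - X (Inr j) (mesh T m k) \<omega>) (normal_density 0 (sqrt (mesh T m (Suc k) - mesh T m k)))"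
      by (rule increment_distributed) (use k mesh_range[of k m] mesh_range[of "Suc k" m] mesh_less[OF T m, of k] in auto)
    then show "distributed M lborel (\<lambda>\<omega>. W (mesh T m (Suc k)) \<omega> $ j - W (mesh T m k) \<omega> $ j) (normal_density 0 (sqrt (T / real m)))"
      unfolding joint_increment mesh_diff .
  qed (use T m \<rho> \<eta> N in auto)
  then have "\<forall>\<^sub>F n in sequentially. \<forall>j\<in>UNIV. \<forall>k\<in>{..<m}. exp (- ?q j k / (\<epsilon> n)\<^sup>2) \<le> ?P n j k"
    by (intro eventually_ball_finite ballI) auto
  then show ?thesis
  proof eventually_elim
    case (elim n)
    have half: "(?h j k)\<^sup>2 / (2 * (T / real m)) = (dual_coeff \<sigma> \<theta> (g (mesh T m k)) j)\<^sup>2 * (T / real m) / 2" for j k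
    proof -
      have "T / real m \<noteq> 0" using T m by simp
      then show ?thesis unfolding dual_control_def power_mult_distrib by (simp only: power2_eq_square) (simp add: divide_simps)
    qed
    have "(\<Sum>j\<in>UNIV. \<Sum>k<m. ?q j k) = quad_riemann T \<sigma> \<theta> m g / 2 + (\<Sum>j\<in>(UNIV::'d set). \<Sum>k<m. \<eta> / N)"
      unfolding half quad_riemann_def sum.distrib sum_divide_distrib by simp
    also have "(\<Sum>j\<in>(UNIV::'d set). \<Sum>k<m. \<eta> / N) = \<eta>" using N m by (simp add: N_def)
    finally have tot: "(\<Sum>j\<in>UNIV. \<Sum>k<m. ?q j k) = quad_riemann T \<sigma> \<theta> m g / 2 + \<eta>" .
    have "exp (- (quad_riemann T \<sigma> \<theta> m g / 2 + \<eta>) / (\<epsilon> n)\<^sup>2) = (\<Prod>j\<in>UNIV. \<Prod>k<m. exp (- ?q j k / (\<epsilon> n)\<^sup>2))"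
    proof -
      have "- (\<Sum>j\<in>UNIV. \<Sum>k<m. ?q j k) / (\<epsilon> n)\<^sup>2 = (\<Sum>j\<in>UNIV. \<Sum>k<m. - ?q j k / (\<epsilon> n)\<^sup>2)"
        by (simp only: sum_negf[symmetric] sum_divide_distrib)
      then show ?thesis unfolding tot by (simp only: exp_sum finite finite_lessThan)
    qed
    also have "\<dots> \<le> (\<Prod>j\<in>UNIV. \<Prod>k<m. ?P n j k)"
      using elim by (intro prod_mono conjI prod_nonneg) auto
    finally show ?case .
  qed
qed

text \<open>\<open>Z n\<close> is near z once the path pair lies in a tube around a nearly optimal
  (f, hat f), the scaled Wiener increments follow the control, and the freezing error is small. The
  first two events are independent; the failure of the third is exponentially less likely than the
  two together, so it can be subtracted.\<close>

lemma ball_lower_bound: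
  assumes c: "I_T T \<mu> \<sigma> \<sigma>' K z < ereal c" and r: "r > 0"
  shows "\<forall>\<^sub>F n in sequentially. exp (- c / (\<epsilon> n)\<^sup>2) \<le> prob {\<omega>\<in>space M. dist (Z n \<omega>) z < r}"
proof -
  have T0: "0 \<le> T" using T by simp
  obtain f where f: "f \<in> cameron_martin T" and J: "(let v = z - Phi T \<sigma>' f (hat T K f) T - M_vec T \<mu> (hat T K f)
      in ereal (1/2 * cm_norm_sq T f + 1/2 * (v \<bullet> (matrix_inv (A_mat T \<sigma> (hat T K f)) *v v)))) < ereal c"
    using c unfolding I_T_def INF_less_iff by blast
  define g where "g = hat T K f"
  define v where "v = z - Phi T \<sigma>' f g T - M_vec T \<mu> g"
  define \<theta> where "\<theta> = matrix_inv (A_mat T \<sigma> g) *v v"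
  define Q where "Q = 1/2 * (v \<bullet> \<theta>)"
  define c0 where "c0 = 1/2 * cm_norm_sq T f"
  have "c0 + Q < c" using J by (simp add: Let_def Q_def c0_def \<theta>_def v_def g_def)
  \<comment> \<open>The tube costs c0 + \<eta> and the control Q + 2\<eta>, together c - 2\<eta>.
    The remaining 2\<eta> absorb a factor 2, which leaves exp(-c/\<epsilon>^2) after the freezing
    error is subtracted.\<close>
  define \<eta> where "\<eta> = (c - c0 - Q) / 5"
  have \<eta>: "\<eta> > 0" using \<open>c0 + Q < c\<close> by (simp add: \<eta>_def)
  have fm: "f \<in> mspace (C0_space T)" by (rule cameron_martin_mspace[OF f])
  have gm: "g \<in> mspace (C0_space T)" unfolding g_def by (rule volterra_hat_mspace) (use f T volterra in auto)
  note lim = rate_limits[OF f gm]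
  have A\<theta>: "A_mat T \<sigma> g *v \<theta> = v" unfolding \<theta>_def by (rule lim(5))
  define F where "F m f' g' w = M_riemann T \<mu> m g' + Phi_riemann T \<sigma>' m f' g' + W_riemann T \<sigma> m g' (\<lambda>j k. w (j, k))"
    for m f' g' and w :: "'d \<times> nat \<Rightarrow> real"
  define h where "h m = (\<lambda>(j, k). dual_control T \<sigma> \<theta> m g j k)" for m
  have "(\<lambda>m. F m f g (h m)) \<longlonglongrightarrow> M_vec T \<mu> g + Phi T \<sigma>' f g T + A_mat T \<sigma> g *v \<theta>"
    unfolding F_def h_def prod.case by (intro tendsto_add lim)
  also have "M_vec T \<mu> g + Phi T \<sigma>' f g T + A_mat T \<sigma> g *v \<theta> = z" unfolding A\<theta> by (simp add: v_def)
  finally have F_lim: "(\<lambda>m. F m f g (h m)) \<longlonglongrightarrow> z" .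
  have ev1: "\<forall>\<^sub>F m in sequentially. dist (F m f g (h m)) z < r / 4" by (rule tendstoD[OF F_lim]) (use r in simp)
  have "(\<lambda>m. quad_riemann T \<sigma> \<theta> m g / 2) \<longlonglongrightarrow> \<theta> \<bullet> (A_mat T \<sigma> g *v \<theta>) / 2" by (intro tendsto_divide lim tendsto_const) auto
  also have "\<theta> \<bullet> (A_mat T \<sigma> g *v \<theta>) / 2 = Q" unfolding A\<theta> by (simp add: Q_def inner_commute)
  finally have ev2: "\<forall>\<^sub>F m in sequentially. quad_riemann T \<sigma> \<theta> m g / 2 < Q + \<eta>" using \<eta> by (intro order_tendstoD) auto
  obtain m1 where m1: "\<And>m. m \<ge> m1 \<Longrightarrow> dist (F m f g (h m)) z < r / 4 \<and> quad_riemann T \<sigma> \<theta> m g / 2 < Q + \<eta>"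
    using eventually_conj[OF ev1 ev2] unfolding eventually_sequentially by blast
  have r2: "r / 2 > 0" using r by simp
  \<comment> \<open>Any exponent above c would serve for the freezing error. The radius is split as
    r/2 for this error, r/4 for the width of the tube and r/4 for the Riemann sums at the
    centre.\<close>
  obtain m0 where m0: "m0 > 0" "\<And>m. m \<ge> m0 \<Longrightarrow> exp_small (\<lambda>n. {\<omega>. r / 2 \<le> norm (Z n \<omega> - Z_riemann n m \<omega>)}) (c + 1)"
    using exponential_approximation[OF r2, of "c + 1"] by blast
  define m where "m = max m0 m1"
  have m: "m > 0" "m \<ge> m0" "m \<ge> m1" using m0(1) by (auto simp: m_def)
  have "\<exists>\<rho>>0. \<forall>f' g' w'. (\<forall>t\<in>{0..T}. norm (f' t - f t) \<le> \<rho> \<and> norm (g' t - g t) \<le> \<rho>) \<longrightarrow> (\<forall>j\<in>UNIV \<times> {..<m}. \<bar>w' j - h m j\<bar> \<le> \<rho>) \<longrightarrow>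
      dist (F m f' g' w') (F m f g (h m)) < r / 4"
  proof (rule tube_continuity[where F = "F m"])
    fix fn gn :: "nat \<Rightarrow> real \<Rightarrow> real^'p" and wn :: "nat \<Rightarrow> 'd \<times> nat \<Rightarrow> real"
    assume fn: "\<And>t. t \<in> {0..T} \<Longrightarrow> (\<lambda>n. fn n t) \<longlonglongrightarrow> f t" and gn: "\<And>t. t \<in> {0..T} \<Longrightarrow> (\<lambda>n. gn n t) \<longlonglongrightarrow> g t"
      and wn: "\<And>j. j \<in> UNIV \<times> {..<m} \<Longrightarrow> (\<lambda>n. wn n j) \<longlonglongrightarrow> h m j"
    show "(\<lambda>n. F m (fn n) (gn n) (wn n)) \<longlonglongrightarrow> F m f g (h m)"
      unfolding F_def
      by (intro tendsto_add M_riemann_limit[OF mesh_range gn mu_continuous] Phi_riemann_limit[OF mesh_range gn sigma'_continuous fn]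
          W_riemann_limit[OF mesh_range gn sigma_continuous] wn) auto
  qed (use r in simp)
  then obtain \<rho> where \<rho>: "\<rho> > 0" and near: "\<And>f' g' w'. (\<forall>t\<in>{0..T}. norm (f' t - f t) \<le> \<rho> \<and> norm (g' t - g t) \<le> \<rho>) \<Longrightarrow>
      (\<forall>j\<in>UNIV \<times> {..<m}. \<bar>w' j - h m j\<bar> \<le> \<rho>) \<Longrightarrow> dist (F m f' g' w') (F m f g (h m)) < r / 4"
    by blast
  define E where "E n = {\<omega>\<in>space M. path_pair n \<omega> \<in> tube T f g \<rho>}" for n
  define V where "V n j k = {x. \<bar>\<epsilon> n * x - dual_control T \<sigma> \<theta> m g j k\<bar> < \<rho>}" for n j k
  define H where "H n = {\<omega>\<in>space M. \<forall>j\<in>UNIV. \<forall>k<m. W (mesh T m (Suc k)) \<omega> $ j - W (mesh T m k) \<omega> $ j \<in> V n j k}" for n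
  have V: "V n j k \<in> sets borel" for n j k unfolding V_def by measurable
  have EH: "E n \<inter> H n \<in> events"
    "prob (E n \<inter> H n) = prob (E n) * (\<Prod>j\<in>UNIV. \<Prod>k<m. prob {\<omega>\<in>space M. W (mesh T m (Suc k)) \<omega> $ j - W (mesh T m k) \<omega> $ j \<in> V n j k})" for n
    unfolding E_def H_def by (rule tube_W_increments_indep[OF fm gm m(1) V])+
  have IE: "I_B_hatB T K (f, g) < ereal (c0 + \<eta>)" using f \<eta> by (simp add: I_B_hatB_def g_def c0_def)
  \<comment> \<open>The lower bound is available for open sets. The closed tube E n contains the
    open one, and it is the closed one whose independence from the increments of \<open>W\<close> is
    established.\<close>
  have E_low: "\<forall>\<^sub>F n in sequentially. exp (- (c0 + \<eta>) / (\<epsilon> n)\<^sup>2) \<le> prob {\<omega>\<in>space M. path_pair n \<omega> \<in> open_tube T f g \<rho>}"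
    by (rule LDP_lower[OF LDP_path openin_open_tube[OF T0 fm gm] center_in_open_tube[OF T0 fm gm \<rho>] IE])
  define Bad where "Bad n = {\<omega>\<in>space M. r / 2 \<le> norm (Z n \<omega> - Z_riemann n m \<omega>)}" for n
  have Zr: "Z_riemann n m \<in> borel_measurable M" for n
  proof -
    have 1: "(\<lambda>\<omega>. \<mu> (Bh n (mesh T m k) \<omega>) $ i) \<in> borel_measurable M" if "k < m" for k i
      by (rule measurable_compose[OF Bh_measurable borel_measurable_continuous_onI[OF mu_continuous]]) (use that mesh_range[of k m] in simp)
    have "(\<lambda>\<omega>. Z_riemann n m \<omega> $ i) \<in> borel_measurable M" for i
      unfolding Z_riemann_component
      by (intro borel_measurable_add borel_measurable_sum borel_measurable_times borel_measurable_const 1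
          riemann_ito_measurable sigma_continuous sigma'_continuous) auto
    then show ?thesis by (simp add: borel_measurable_vec_iff)
  qed
  have Bad: "Bad n \<in> events" for n
    unfolding Bad_def using Zr[of n] Z_measurable[of n] by measurable
  have ball_event: "{\<omega>\<in>space M. dist (Z n \<omega>) z < r} \<in> events" for n
  proof -
    have [measurable]: "Z n \<in> borel_measurable M" by (rule Z_measurable)
    show ?thesis by measurable
  qed
  have sBad: "exp_small Bad (c + 1)"
    by (rule exp_small_mono[OF m0(2)[OF m(2)]]) (auto simp: Bad_def)
  have "c < c + 1" by simp
  note Bad_up = exp_smallD[OF sBad this Bad]
  have sub: "E n \<inter> H n \<subseteq> Bad n \<union> {\<omega>\<in>space M. dist (Z n \<omega>) z < r}" for n
  proof
    fix \<omega> assume "\<omega> \<in> E n \<inter> H n"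
    then have \<omega>: "\<omega> \<in> space M" and tb: "path_pair n \<omega> \<in> tube T f g \<rho>"
      and inc: "\<And>j k. k < m \<Longrightarrow> \<bar>W_increments n m \<omega> j k - dual_control T \<sigma> \<theta> m g j k\<bar> < \<rho>"
      by (auto simp: E_def H_def V_def W_increments_def)
    have "dist (F m (\<lambda>t. \<epsilon> n *\<^sub>R B t \<omega>) (\<lambda>t. Bh n t \<omega>) (\<lambda>(j, k). W_increments n m \<omega> j k)) (F m f g (h m)) < r / 4"
      using mem_tube_path_pair[OF tb] inc by (intro near) (auto simp: h_def less_imp_le)
    moreover have "F m (\<lambda>t. \<epsilon> n *\<^sub>R B t \<omega>) (\<lambda>t. Bh n t \<omega>) (\<lambda>(j, k). W_increments n m \<omega> j k) = Z_riemann n m \<omega>"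
      by (simp add: F_def Z_riemann_def)
    ultimately have 1: "dist (Z_riemann n m \<omega>) (F m f g (h m)) < r / 4" by simp
    have 2: "dist (F m f g (h m)) z < r / 4" using m1[OF m(3)] by blast
    show "\<omega> \<in> Bad n \<union> {\<omega>\<in>space M. dist (Z n \<omega>) z < r}"
    proof (cases "r / 2 \<le> dist (Z n \<omega>) (Z_riemann n m \<omega>)")
      case True
      then show ?thesis using \<omega> by (simp add: Bad_def dist_norm)
    next
      case False
      have "dist (Z n \<omega>) z \<le> dist (Z n \<omega>) (Z_riemann n m \<omega>) + dist (Z_riemann n m \<omega>) (F m f g (h m)) + dist (F m f g (h m)) z"
        using dist_triangle[of "Z n \<omega>" z "Z_riemann n m \<omega>"] dist_triangle[of "Z_riemann n m \<omega>" z "F m f g (h m)"] by linarith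
      then have "dist (Z n \<omega>) z < r" using 1 2 False r by linarith
      then show ?thesis using \<omega> by simp
    qed
  qed
  have "c - 2 * \<eta> < c" using \<eta> by simp
  note absorb = eventually_absorb_const[OF this, of 2]
  show ?thesis
    using E_low dual_control_lower_bound[OF m(1) \<rho> \<eta>, of \<theta> g] Bad_up absorb
  proof eventually_elim
    case (elim n)
    have "prob {\<omega>\<in>space M. path_pair n \<omega> \<in> open_tube T f g \<rho>} \<le> prob (E n)"
      using open_tube_subset[OF T0 fm gm, of \<rho>]
      by (intro finite_measure_mono) (auto simp: E_def intro: tube_event[OF fm gm])
    then have 1: "exp (- (c0 + \<eta>) / (\<epsilon> n)\<^sup>2) \<le> prob (E n)" using elim(1) by linarith
    have 2: "exp (- (Q + 2 * \<eta>) / (\<epsilon> n)\<^sup>2) \<le> exp (- (quad_riemann T \<sigma> \<theta> m g / 2 + \<eta>) / (\<epsilon> n)\<^sup>2)"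
      using m1[OF m(3)] unfolding exp_le_cancel_iff by (intro divide_right_mono) auto
    have "exp (- (c - 2 * \<eta>) / (\<epsilon> n)\<^sup>2) = exp (- (c0 + \<eta>) / (\<epsilon> n)\<^sup>2) * exp (- (Q + 2 * \<eta>) / (\<epsilon> n)\<^sup>2)"
    proof -
      have "- (c - 2 * \<eta>) = - (c0 + \<eta>) + - (Q + 2 * \<eta>)" by (simp add: \<eta>_def field_simps)
      then show ?thesis unfolding exp_add[symmetric] add_divide_distrib[symmetric] by (simp only:)
    qed
    also have "\<dots> \<le> prob (E n \<inter> H n)"
      unfolding EH(2) V_def mem_Collect_eq by (rule mult_mono[OF 1 order_trans[OF 2 elim(2)]]) auto
    also have "\<dots> \<le> prob (Bad n \<union> {\<omega>\<in>space M. dist (Z n \<omega>) z < r})"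
      by (intro finite_measure_mono[OF sub] sets.Un Bad ball_event)
    also have "\<dots> \<le> prob (Bad n) + prob {\<omega>\<in>space M. dist (Z n \<omega>) z < r}"
      by (intro measure_Un_le Bad ball_event)
    finally show ?case using elim(3,4) by linarith
  qed
qed

lemma I_T_nonneg: "0 \<le> I_T T \<mu> \<sigma> \<sigma>' K z"
  unfolding I_T_def Let_def
proof (rule INF_greatest)
  fix f :: "real \<Rightarrow> real^'p" assume f: "f \<in> cameron_martin T"
  have "hat T K f \<in> mspace (C0_space T)" by (rule volterra_hat_mspace) (use f T volterra in auto)
  note lim = rate_limits[OF f this]
  have "0 \<le> cm_norm_sq T f"
    unfolding cm_norm_sq_def set_lebesgue_integral_def by (rule Bochner_Integration.integral_nonneg) auto
  then show "0 \<le> ereal (1/2 * cm_norm_sq T f + 1/2 * ((z - Phi T \<sigma>' f (hat T K f) T - M_vec T \<mu> (hat T K f)) \<bullet>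
      (matrix_inv (A_mat T \<sigma> (hat T K f)) *v (z - Phi T \<sigma>' f (hat T K f) T - M_vec T \<mu> (hat T K f)))))"
    using lim(6)[of "z - Phi T \<sigma>' f (hat T K f) T - M_vec T \<mu> (hat T K f)"] unfolding zero_ereal_def ereal_less_eq(3) by linarith
qed

theorem LDP_Z:
  "satisfies_LDP M euclidean (\<lambda>n. 1 / (\<epsilon> n)\<^sup>2) (I_T T \<mu> \<sigma> \<sigma>' K) Z \<and> good_rate_function euclidean (I_T T \<mu> \<sigma> \<sigma>' K)"
  by (rule LDP_euclidean_local[OF Z_measurable I_T_nonneg ball_upper_bound ball_lower_bound exponential_tightness])

end

lemma locally_omega_continuous_imp_continuous:
  fixes h :: "real^'p \<Rightarrow> real"
  assumes w: "modulus_of_continuity w" and h: "locally_omega_continuous w h"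
  shows "continuous_on UNIV h"
  unfolding continuous_on_iff
proof (intro ballI allI impI)
  fix x :: "real^'p" and e :: real assume e: "e > 0"
  obtain L where L: "L > 0" "\<And>x' y. norm x' \<le> norm x + 1 \<Longrightarrow> norm y \<le> norm x + 1 \<Longrightarrow> \<bar>h x' - h y\<bar> \<le> L * w (norm (x' - y))"
    using h unfolding locally_omega_continuous_def by (metis add_nonneg_pos norm_ge_zero zero_less_one)
  have "(w \<longlongrightarrow> 0) (at_right 0)" using w by (simp add: modulus_of_continuity_def)
  then have "\<forall>\<^sub>F s in at_right 0. w s < e / L" using e L(1) by (intro order_tendstoD) auto
  then obtain d where d: "d > 0" "\<And>s. 0 < s \<Longrightarrow> s < d \<Longrightarrow> w s < e / L"
    unfolding eventually_at_right_field by auto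
  have w0: "w 0 = 0" using w by (simp add: modulus_of_continuity_def)
  show "\<exists>d>0. \<forall>x'\<in>UNIV. dist x' x < d \<longrightarrow> dist (h x') (h x) < e"
  proof (intro exI[of _ "min d 1"] conjI ballI impI)
    fix x' assume x': "dist x' x < min d 1"
    \<comment> \<open>The limit from the right at 0 says nothing about distance 0 itself; there
      \<open>w 0 = 0\<close> is used.\<close>
    have ws: "w (norm (x' - x)) < e / L"
    proof (cases "x' = x")
      case False
      then show ?thesis using x' by (intro d(2)) (auto simp: dist_norm)
    qed (use w0 e L in simp)
    have "norm x' \<le> norm x + 1" using x' norm_triangle_sub[of x' x] by (simp add: dist_norm)
    then have "\<bar>h x' - h x\<bar> \<le> L * w (norm (x' - x))" by (rule L(2)) simp
    also have "\<dots> < L * (e / L)" using ws L(1) by (rule mult_strict_left_mono)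
    finally show "dist (h x') (h x) < e" using L(1) by (simp add: dist_real_def)
  qed (use d in simp)
qed

theorem corollary4p20:
  fixes M :: "'w measure" and T :: real and \<epsilon> :: "nat \<Rightarrow> real"
    and B :: "real \<Rightarrow> 'w \<Rightarrow> real^'p" and W :: "real \<Rightarrow> 'w \<Rightarrow> real^'d"
    and Bh :: "nat \<Rightarrow> real \<Rightarrow> 'w \<Rightarrow> real^'p"
    and Kn :: "nat \<Rightarrow> 'p \<Rightarrow> real \<Rightarrow> real \<Rightarrow> real" and K :: "'p \<Rightarrow> real \<Rightarrow> real \<Rightarrow> real"
    and \<mu> :: "real^'p \<Rightarrow> real^'d" and \<sigma> :: "real^'p \<Rightarrow> real^'d^'d" and \<sigma>' :: "real^'p \<Rightarrow> real^'p^'d"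
    and w :: "real \<Rightarrow> real" and \<alpha> M1 M2 :: real
    and JB :: "nat \<Rightarrow> 'd \<Rightarrow> 'p \<Rightarrow> real \<Rightarrow> 'w \<Rightarrow> real" and JW :: "nat \<Rightarrow> 'd \<Rightarrow> 'd \<Rightarrow> real \<Rightarrow> 'w \<Rightarrow> real"
    and Z :: "nat \<Rightarrow> real \<Rightarrow> 'w \<Rightarrow> real^'d"
  assumes M: "prob_space M" and T: "T > 0"
    and eps_pos: "\<And>n. \<epsilon> n > 0" and eps_lim: "\<epsilon> \<longlonglongrightarrow> 0"
    and BM_B: "brownian_motion M T B" and BM_W: "brownian_motion M T W"
    and indep: "independent_processes M T B W"
    and volterra_n: "\<And>n l. volterra_kernel T (Kn n l)" and volterra: "\<And>l. volterra_kernel T (K l)"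
    and kernel_lim: "\<And>l t s. t \<in> {0..T} \<Longrightarrow> s \<in> {0..T} \<Longrightarrow> (\<lambda>n. Kn n l t s / \<epsilon> n) \<longlonglongrightarrow> K l t s"
    and Bh_continuous: "\<And>n \<omega>. \<omega> \<in> space M \<Longrightarrow> continuous_on {0..T} (\<lambda>t. Bh n t \<omega>)"
    and Bh_eq: "\<And>n l t. t \<in> {0..T} \<Longrightarrow>
           has_ito_integral M (driving_filtration M B W) (\<lambda>s \<omega>. B s \<omega> $ l) T (\<lambda>s _. Kn n l t s) (\<lambda>\<omega>. Bh n t \<omega> $ l)"
    and LDP_B: "satisfies_LDP M (prod_topology (mtopology_of (C0_space T)) (mtopology_of (C0_space T)))
           (\<lambda>n. 1 / (\<epsilon> n)\<^sup>2) (I_B_hatB T K)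
           (\<lambda>n \<omega>. (trajectory T (\<lambda>t \<omega>. \<epsilon> n *\<^sub>R B t \<omega>) \<omega>, trajectory T (Bh n) \<omega>))"
    and good_B: "good_rate_function (prod_topology (mtopology_of (C0_space T)) (mtopology_of (C0_space T)))
           (I_B_hatB T K)"
    and mu_continuous: "\<And>i. continuous_on UNIV (\<lambda>y. \<mu> y $ i)" and sigma_continuous: "\<And>i j. continuous_on UNIV (\<lambda>y. \<sigma> y $ i $ j)"
    and nondegenerate: "\<And>y. det (diffusion_matrix \<sigma> y) \<noteq> 0"
    and modulus: "modulus_of_continuity w" and sigma'_continuous: "\<And>i l. locally_omega_continuous w (\<lambda>y. \<sigma>' y $ i $ l)"
    and "\<alpha> > 0" and "M1 > 0" and "M2 > 0"
    and growth: "\<And>x i j l. \<bar>\<sigma>' x $ i $ l\<bar> + \<bar>\<sigma> x $ i $ j\<bar> + \<bar>\<mu> x $ i\<bar> \<le> M1 + M2 * norm x powr \<alpha>"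
    and JB: "\<And>n i l t. t \<in> {0..T} \<Longrightarrow>
           has_ito_integral M (driving_filtration M B W) (\<lambda>s \<omega>. B s \<omega> $ l) t (\<lambda>s \<omega>. \<sigma>' (Bh n s \<omega>) $ i $ l) (JB n i l t)"
    and JW: "\<And>n i j t. t \<in> {0..T} \<Longrightarrow>
           has_ito_integral M (driving_filtration M B W) (\<lambda>s \<omega>. W s \<omega> $ j) t (\<lambda>s \<omega>. \<sigma> (Bh n s \<omega>) $ i $ j) (JW n i j t)"
    and Z_measurable: "\<And>n t. t \<in> {0..T} \<Longrightarrow> Z n t \<in> borel_measurable M"
    and Z_eq: "\<And>n i t. t \<in> {0..T} \<Longrightarrow> AE \<omega> in M. Z n t \<omega> $ i =
           (LINT s:{0..t}|lborel. \<mu> (Bh n s \<omega>) $ i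
               - 1/2 * (\<epsilon> n)\<^sup>2 * (\<Sum>j\<in>UNIV. (\<sigma> (Bh n s \<omega>) $ i $ j)\<^sup>2)
               - 1/2 * (\<epsilon> n)\<^sup>2 * (\<Sum>l\<in>UNIV. (\<sigma>' (Bh n s \<omega>) $ i $ l)\<^sup>2))
           + \<epsilon> n * (\<Sum>l\<in>UNIV. JB n i l t \<omega>) + \<epsilon> n * (\<Sum>j\<in>UNIV. JW n i j t \<omega>)"
  shows "satisfies_LDP M euclidean (\<lambda>n. 1 / (\<epsilon> n)\<^sup>2) (I_T T \<mu> \<sigma> \<sigma>' K) (\<lambda>n. Z n T)
       \<and> good_rate_function euclidean (I_T T \<mu> \<sigma> \<sigma>' K)"
proof -
  have T_mem: "T \<in> {0..T}" using T by simp
  interpret log_price M T \<epsilon> B W Bh Kn K \<mu> \<sigma> \<sigma>' "\<lambda>n i l. JB n i l T" "\<lambda>n i j. JW n i j T" "\<lambda>n. Z n T"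
  proof (intro log_price.intro volterra_model.intro log_price_axioms.intro)
    show "continuous_on UNIV (\<lambda>y. \<sigma>' y $ i $ l)" for i l
      by (rule locally_omega_continuous_imp_continuous[OF modulus sigma'_continuous])
    show "satisfies_LDP M (C0_prod T) (\<lambda>n. 1 / (\<epsilon> n)\<^sup>2) (I_B_hatB T K)
           (\<lambda>n \<omega>. (trajectory T (\<lambda>t \<omega>. \<epsilon> n *\<^sub>R B t \<omega>) \<omega>, trajectory T (Bh n) \<omega>))" by (rule LDP_B)
    show "good_rate_function (C0_prod T) (I_B_hatB T K)" by (rule good_B)
    show "Z n T \<in> borel_measurable M" for n by (rule Z_measurable[OF T_mem])
    show "has_ito_integral M (driving_filtration M B W) (\<lambda>s \<omega>. B s \<omega> $ l) T (\<lambda>s \<omega>. \<sigma>' (Bh n s \<omega>) $ i $ l) (JB n i l T)" for n i l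
      by (rule JB[OF T_mem])
    show "has_ito_integral M (driving_filtration M B W) (\<lambda>s \<omega>. W s \<omega> $ j) T (\<lambda>s \<omega>. \<sigma> (Bh n s \<omega>) $ i $ j) (JW n i j T)" for n i j
      by (rule JW[OF T_mem])
    show "AE \<omega> in M. Z n T \<omega> $ i =
           (LINT s:{0..T}|lborel. \<mu> (Bh n s \<omega>) $ i
               - 1/2 * (\<epsilon> n)\<^sup>2 * (\<Sum>j\<in>UNIV. (\<sigma> (Bh n s \<omega>) $ i $ j)\<^sup>2)
               - 1/2 * (\<epsilon> n)\<^sup>2 * (\<Sum>l\<in>UNIV. (\<sigma>' (Bh n s \<omega>) $ i $ l)\<^sup>2))
           + \<epsilon> n * (\<Sum>l\<in>UNIV. JB n i l T \<omega>) + \<epsilon> n * (\<Sum>j\<in>UNIV. JW n i j T \<omega>)" for n i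
      by (rule Z_eq[OF T_mem])
  qed (fact M T eps_pos eps_lim BM_B BM_W indep volterra_n volterra Bh_continuous Bh_eq mu_continuous sigma_continuous nondegenerate)+
  show ?thesis by (rule LDP_Z)
qed

end
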